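(* Let $\mathcal{N}$ be a non-degenerate nilpotent Lie group of step two. Then for every $\phi\in L^2(\mathcal{N})$, $$\sum_{m=0}^\infty\mathbb{P}_m\phi=\phi\qquad\text{in }L^2(\mathcal{N}).$$
   Context: Let $n,r\ge1$ and let $B=(B^1,\dots,B^r):\mathbb{R}^{2n}\times\mathbb{R}^{2n}\to\mathbb{R}^r$ be a skew-symmetric bilinear map, $B^\beta(\mathbf{x},\mathbf{y})=\sum_{k,l}B^\beta_{kl}x_ky_l$. The nilpotent Lie group of step two $\mathcal{N}$ is $\mathbb{R}^{2n}\times\mathbb{R}^r$ with product $(\mathbf{x},\mathbf{t})\cdot(\mathbf{y},\mathbf{s})=(\mathbf{x}+\mathbf{y},\mathbf{t}+\mathbf{s}+2B(\mathbf{x},\mathbf{y}))$ and Haar measure the Lebesgue measure. For $\tau\in\mathbb{R}^r$ let $B^\tau=\sum_\beta\tau_\beta B^\beta$ (a skew-symmetric $2n\times2n$ matrix). $\mathcal{N}$ is non-degenerate if $B^\tau$ is invertible for every $\tau\ne0$. $\mathcal{S}(\mathcal{N})$ is the Schwartz space on $\mathbb{R}^{2n+r}$. For $\tau\ne0$ let $\pm i\mu_1(\tau),\dots,\pm i\mu_n(\tau)$, $\mu_1(\tau)\ge\dots\ge\mu_n(\tau)>0$, be the eigenvalues of $B^\tau$, and choose an orthonormal basis $v_1^\tau,\dots,v_{2n}^\tau$ of $\mathbb{R}^{2n}$ (depending only on $\tau/|\tau|$) such that $O(\tau)=(v_1^\tau,\dots,v_{2n}^\tau)$ satisfies $O(\tau)^tB^\tau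 O(\tau)=$ block diagonal matrix with blocks $\begin{pmatrix}0&-\mu_j(\tau)\\ \mu_j(\tau)&0\end{pmatrix}$. Write $\mathbf{y}=\sum_k y_k^\tau v_k^\tau$ and $\mathbf{y}_j^\tau=(y_{2j-1}^\tau,y_{2j}^\tau)$. With $L_k^{(p)}$ the generalized Laguerre polynomials, for $\mathbf{k}\in\mathbb{Z}_{\ge0}^n$ put $$\widetilde{\mathscr L}_{\mathbf{k}}^{(\mathbf{0})}(\mathbf{y},\tau)=\prod_{j=1}^n\frac{2\mu_j(\tau)}{\pi}L_{k_j}^{(0)}\big(2\mu_j(\tau)|\mathbf{y}_j^\tau|^2\big)e^{-\mu_j(\tau)|\mathbf{y}_j^\tau|^2},\qquad Q_m(\mathbf{y},\tau)=\sum_{|\mathbf{k}|=m}\widetilde{\mathscr L}_{\mathbf{k}}^{(\mathbf{0})}(\mathbf{y},\tau).$$ The distribution $\mathscr{P}_m$ is $\langle\mathscr{P}_m,\phi\rangle=(2\pi)^{-r}\int_{\mathbb{R}^{2n+r}}Q_m(\mathbf{y},\tau)\widetilde\phi(\mathbf{y},-\tau)\,d\mathbf{y}\,d\tau$ for $\phi\in\mathcal{S}(\mathcal{N})$, where $\widetilde\phi(\mathbf{y},\tau)=\int_{\mathbb{R}^r}e^{-i\tau\cdot\mathbf{t}}\phi(\mathbf{y},\mathbf{t})\,d\mathbf{t}$. The spectral projection operator is $(\mathbb{P}_m\phi)(\mathbf{g}):=\phi*\mathscr{P}_m(\mathbf{g}):=\langle\mathscr{P}_m,\phi_{\mathbf{g}}\rangle$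 with $\phi_{\mathbf{g}}(\mathbf{g}')=\phi(\mathbf{g}\cdot\mathbf{g}'^{-1})$, for $\phi\in\mathcal{S}(\mathcal{N})$; on $L^2(\mathcal{N})$, $\mathbb{P}_m$ denotes its bounded extension by density. *)

theory Defs
  imports "HOL-Analysis.Analysis"
begin

section \<open>Nilpotent Lie groups of step two\<close>

text \<open>
  The group is carried by \<^typ>\<open>(real^'d) \<times> (real^'r)\<close>, where the cardinality of \<^typ>\<open>'d\<close> is
  required to be \<open>2 * n\<close> in the theorem. The component maps of \<open>B\<close> are
  \<open>\<lambda>x y. B x y $ \<beta>\<close>.
\<close>

definition skew_bilinear :: "(real^'d \<Rightarrow> real^'d \<Rightarrow> real^'r) \<Rightarrow> bool" where
  "skew_bilinear B \<longleftrightarrow> bilinear B \<and> (\<forall>x y. B x y = - B y x)"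

definition group_mult ::
  "(real^'d \<Rightarrow> real^'d \<Rightarrow> real^'r) \<Rightarrow> (real^'d) \<times> (real^'r) \<Rightarrow> (real^'d) \<times> (real^'r) \<Rightarrow> (real^'d) \<times> (real^'r)" where
  "group_mult B g h =
     (fst g + fst h, snd g + snd h + 2 *\<^sub>R B (fst g) (fst h))"

text \<open>As \<open>B x x = 0\<close>, the inverse of \<open>(x, t)\<close> for this product is \<open>(-x, -t)\<close>.\<close>

definition group_inv :: "(real^'d) \<times> (real^'r) \<Rightarrow> (real^'d) \<times> (real^'r)" where
  "group_inv g = (- fst g, - snd g)"

lemma group_mult_inv:
  assumes "skew_bilinear B"
  shows "group_mult B g (group_inv g) = 0" "group_mult B (group_inv g) g = 0"
proof -
  have B: "bilinear B" and skew: "B x x = - B x x" for x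
    using assms unfolding skew_bilinear_def by blast+
  have "2 *\<^sub>R B x x = 0" for x
    unfolding scaleR_2 using skew[of x] by (metis add.right_inverse)
  then have "B x x = 0" for x by simp
  then show "group_mult B g (group_inv g) = 0" "group_mult B (group_inv g) g = 0"
    by (simp_all add: group_mult_def group_inv_def zero_prod_def
        bilinear_lneg[OF B] bilinear_rneg[OF B])
qed

text \<open>The matrix with entries \<open>\<Sum>\<beta>. \<tau>\<^sub>\<beta> B\<^sup>\<beta>\<^sub>k\<^sub>l\<close>, where \<open>B\<^sup>\<beta>\<^sub>k\<^sub>l\<close> is \<open>B\<^sup>\<beta>\<close> at the standard basis vectors \<open>k\<close> and \<open>l\<close>.\<close>

definition B_matrix :: "(real^'d \<Rightarrow> real^'d \<Rightarrow> real^'r) \<Rightarrow> real^'r \<Rightarrow> real^'d^'d" where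
  "B_matrix B \<tau> = (\<chi> k l. \<Sum>\<beta>\<in>UNIV. \<tau> $ \<beta> * B (axis k 1) (axis l 1) $ \<beta>)"

definition nondegenerate :: "(real^'d \<Rightarrow> real^'d \<Rightarrow> real^'r) \<Rightarrow> bool" where
  "nondegenerate B \<longleftrightarrow> (\<forall>\<tau>. \<tau> \<noteq> 0 \<longrightarrow> invertible (B_matrix B \<tau>))"


section \<open>Eigenvalues and adapted orthonormal bases\<close>

text \<open>
  Entry \<open>(k, l)\<close>, with \<open>k, l \<in> {1..2 * n}\<close>, of the block diagonal matrix whose \<open>j\<close>-th block has rows
  \<open>(0, -\<mu>\<^sub>j)\<close> and \<open>(\<mu>\<^sub>j, 0)\<close>.
\<close>

definition block_entry :: "(nat \<Rightarrow> real) \<Rightarrow> nat \<Rightarrow> nat \<Rightarrow> real" where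
  "block_entry \<mu> k l =
     (if odd k \<and> l = k + 1 then - \<mu> ((k + 1) div 2)
      else if even k \<and> k = l + 1 then \<mu> (k div 2)
      else 0)"

text \<open>
  \<open>\<mu> \<tau> j\<close> (\<open>1 \<le> j \<le> n\<close>) and \<open>v \<tau> k\<close> (\<open>1 \<le> k \<le> 2 * n\<close>) are an admissible choice of the numbers
  \<open>\<mu>\<^sub>j(\<tau>)\<close> and of the basis vectors \<open>v\<^sub>k\<^sup>\<tau>\<close>. That \<open>\<plusminus>i\<mu>\<^sub>j(\<tau>)\<close> are the eigenvalues, listed with
  multiplicity, is expressed by the factorisation of the characteristic polynomial over the complex
  numbers. The entry \<open>(k, l)\<close> of \<open>O(\<tau>)\<^sup>t B\<^sup>\<tau> O(\<tau>)\<close> is the inner product of \<open>v\<^sub>k\<^sup>\<tau>\<close> with \<open>B\<^sup>\<tau> v\<^sub>l\<^sup>\<tau>\<close>.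
  The values at \<open>\<tau> = 0\<close> are unconstrained.
\<close>

definition spectral_frame ::
  "nat \<Rightarrow> (real^'d \<Rightarrow> real^'d \<Rightarrow> real^'r) \<Rightarrow> (real^'r \<Rightarrow> nat \<Rightarrow> real) \<Rightarrow> (real^'r \<Rightarrow> nat \<Rightarrow> real^'d) \<Rightarrow> bool" where
  "spectral_frame n B \<mu> v \<longleftrightarrow>
     (\<forall>\<tau>. \<tau> \<noteq> 0 \<longrightarrow>
        (\<forall>i j. 1 \<le> i \<and> i \<le> j \<and> j \<le> n \<longrightarrow> \<mu> \<tau> j \<le> \<mu> \<tau> i) \<and>
        (\<forall>j\<in>{1..n}. 0 < \<mu> \<tau> j) \<and>
        (\<forall>z. det (mat z - (\<chi> k l. complex_of_real (B_matrix B \<tau> $ k $ l)))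
              = (\<Prod>j=1..n. (z - \<i> * complex_of_real (\<mu> \<tau> j)) * (z + \<i> * complex_of_real (\<mu> \<tau> j)))) \<and>
        (\<forall>k\<in>{1..2*n}. \<forall>l\<in>{1..2*n}. v \<tau> k \<bullet> v \<tau> l = (if k = l then 1 else 0)) \<and>
        (\<forall>k\<in>{1..2*n}. \<forall>l\<in>{1..2*n}. v \<tau> k \<bullet> (B_matrix B \<tau> *v v \<tau> l) = block_entry (\<mu> \<tau>) k l) \<and>
        (\<forall>c>0. \<forall>k\<in>{1..2*n}. v (c *\<^sub>R \<tau>) k = v \<tau> k))"


section \<open>Laguerre functions and the kernels $Q_m$\<close>

definition gen_laguerre :: "nat \<Rightarrow> real \<Rightarrow> real \<Rightarrow> real" where
  "gen_laguerre k p x =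
     (\<Sum>i\<le>k. (-1) ^ i * ((real k + p) gchoose (k - i)) * x ^ i / fact i)"

text \<open>
  The squared length of the pair of coordinates with numbers \<open>2 * j - 1\<close> and \<open>2 * j\<close>; the coordinates
  of \<open>y\<close> in an orthonormal basis are its inner products with the basis vectors.
\<close>

definition block_norm_sq :: "(nat \<Rightarrow> real^'d) \<Rightarrow> nat \<Rightarrow> real^'d \<Rightarrow> real" where
  "block_norm_sq v j y = (y \<bullet> v (2 * j - 1))\<^sup>2 + (y \<bullet> v (2 * j))\<^sup>2"

definition laguerre_kernel ::
  "nat \<Rightarrow> (real^'r \<Rightarrow> nat \<Rightarrow> real) \<Rightarrow> (real^'r \<Rightarrow> nat \<Rightarrow> real^'d) \<Rightarrow> (nat \<Rightarrow> nat) \<Rightarrow> real^'d \<Rightarrow> real^'r \<Rightarrow> real" where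
  "laguerre_kernel n \<mu> v k y \<tau> =
     (\<Prod>j=1..n. 2 * \<mu> \<tau> j / pi
        * gen_laguerre (k j) 0 (2 * \<mu> \<tau> j * block_norm_sq (v \<tau>) j y)
        * exp (- \<mu> \<tau> j * block_norm_sq (v \<tau>) j y))"

definition Q_kernel ::
  "nat \<Rightarrow> (real^'r \<Rightarrow> nat \<Rightarrow> real) \<Rightarrow> (real^'r \<Rightarrow> nat \<Rightarrow> real^'d) \<Rightarrow> nat \<Rightarrow> real^'d \<Rightarrow> real^'r \<Rightarrow> real" where
  "Q_kernel n \<mu> v m y \<tau> =
     (\<Sum>k\<in>{k \<in> {1..n} \<rightarrow>\<^sub>E (UNIV :: nat set). (\<Sum>j=1..n. k j) = m}. laguerre_kernel n \<mu> v k y \<tau>)"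


section \<open>Schwartz functions and square integrable functions\<close>

definition partial_deriv ::
  "'a::euclidean_space \<Rightarrow> ('a \<Rightarrow> complex) \<Rightarrow> 'a \<Rightarrow> complex" where
  "partial_deriv b f = (\<lambda>x. frechet_derivative f (at x) b)"

text \<open>
  Every iterated partial derivative along coordinate directions is (totally) differentiable, and
  decays faster than any power of the norm.
\<close>

definition schwartz :: "('a::euclidean_space \<Rightarrow> complex) \<Rightarrow> bool" where
  "schwartz f \<longleftrightarrow>
     (\<forall>bs. set bs \<subseteq> Basis \<longrightarrow>
        (\<forall>x. foldr partial_deriv bs f differentiable (at x)) \<and>
        (\<forall>k. bounded (range (\<lambda>x. norm x ^ k *\<^sub>R foldr partial_deriv bs f x))))"

text \<open>Elements of \<open>L\<^sup>2\<close> are represented by functions; equality in \<open>L\<^sup>2\<close> is equality almost everywhere.\<close>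

definition L2 :: "('a::euclidean_space \<Rightarrow> complex) set" where
  "L2 = {f \<in> borel_measurable lebesgue. integrable lebesgue (\<lambda>x. (norm (f x))\<^sup>2)}"

definition L2_norm :: "('a::euclidean_space \<Rightarrow> complex) \<Rightarrow> real" where
  "L2_norm f = sqrt (LINT x|lebesgue. (norm (f x))\<^sup>2)"

text \<open>Membership in \<^const>\<open>L2\<close> is required because \<^const>\<open>L2_norm\<close> is \<open>0\<close> on non-integrable arguments.\<close>

definition L2_tendsto :: "(nat \<Rightarrow> 'a::euclidean_space \<Rightarrow> complex) \<Rightarrow> ('a \<Rightarrow> complex) \<Rightarrow> bool" where
  "L2_tendsto F f \<longleftrightarrow>
     (\<forall>N. F N \<in> L2) \<and> f \<in> L2 \<and> (\<lambda>N. L2_norm (\<lambda>x. F N x - f x)) \<longlonglongrightarrow> 0"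

text \<open>
  \<open>T\<close> is a bounded linear operator on \<open>L\<^sup>2\<close> that agrees with \<open>P\<close> on Schwartz functions. Such a \<open>T\<close> is
  unique up to equality almost everywhere, Schwartz functions being dense.
\<close>

definition bounded_L2_extension ::
  "(('a::euclidean_space \<Rightarrow> complex) \<Rightarrow> 'a \<Rightarrow> complex) \<Rightarrow> (('a \<Rightarrow> complex) \<Rightarrow> 'a \<Rightarrow> complex) \<Rightarrow> bool" where
  "bounded_L2_extension P T \<longleftrightarrow>
     (\<forall>f\<in>L2. T f \<in> L2) \<and>
     (\<forall>f\<in>L2. \<forall>g\<in>L2. \<forall>a b.
        AE x in lebesgue. T (\<lambda>x. a * f x + b * g x) x = a * T f x + b * T g x) \<and>
     (\<exists>C. \<forall>f\<in>L2. L2_norm (T f) \<le> C * L2_norm f) \<and>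
     (\<forall>f. schwartz f \<longrightarrow> (AE x in lebesgue. T f x = P f x))"


section \<open>The spectral projections\<close>

definition fourier_centre :: "((real^'d) \<times> (real^'r) \<Rightarrow> complex) \<Rightarrow> real^'d \<Rightarrow> real^'r \<Rightarrow> complex" where
  "fourier_centre \<phi> y \<tau> =
     (LINT t|lebesgue. exp (- \<i> * complex_of_real (\<tau> \<bullet> t)) * \<phi> (y, t))"

definition P_distribution ::
  "nat \<Rightarrow> (real^'r \<Rightarrow> nat \<Rightarrow> real) \<Rightarrow> (real^'r \<Rightarrow> nat \<Rightarrow> real^'d) \<Rightarrow> nat \<Rightarrow> ((real^'d) \<times> (real^'r) \<Rightarrow> complex) \<Rightarrow> complex" where
  "P_distribution n \<mu> v m \<phi> =
     complex_of_real (1 / (2 * pi) ^ CARD('r)) *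
     (LINT p|lebesgue. complex_of_real (Q_kernel n \<mu> v m (fst p) (snd p)) * fourier_centre \<phi> (fst p) (- snd p))"

definition schwartz_projection ::
  "nat \<Rightarrow> (real^'d \<Rightarrow> real^'d \<Rightarrow> real^'r) \<Rightarrow> (real^'r \<Rightarrow> nat \<Rightarrow> real) \<Rightarrow> (real^'r \<Rightarrow> nat \<Rightarrow> real^'d) \<Rightarrow> nat \<Rightarrow>
   ((real^'d) \<times> (real^'r) \<Rightarrow> complex) \<Rightarrow> (real^'d) \<times> (real^'r) \<Rightarrow> complex" where
  "schwartz_projection n B \<mu> v m \<phi> g =
     P_distribution n \<mu> v m (\<lambda>h. \<phi> (group_mult B g (group_inv h)))"

definition spectral_projection ::
  "nat \<Rightarrow> (real^'d \<Rightarrow> real^'d \<Rightarrow> real^'r) \<Rightarrow> (real^'r \<Rightarrow> nat \<Rightarrow> real) \<Rightarrow> (real^'r \<Rightarrow> nat \<Rightarrow> real^'d) \<Rightarrow> nat \<Rightarrow>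
   ((real^'d) \<times> (real^'r) \<Rightarrow> complex) \<Rightarrow> (real^'d) \<times> (real^'r) \<Rightarrow> complex" where
  "spectral_projection n B \<mu> v m = (SOME T. bounded_L2_extension (schwartz_projection n B \<mu> v m) T)"

end

theory Submission
  imports Defs "HOL-Probability.Probability"
begin

text \<open>
  Let \<open>f(x, \<tau>)\<close> be the partial Fourier transform of a Schwartz function \<open>\<phi>\<close> in the central variable.
  On the fibre over \<open>\<tau> \<noteq> 0\<close> the operator \<open>P\<^sub>m\<close> is twisted convolution with \<open>Q\<^sub>m(\<cdot>, \<tau>)\<close>. The generating
  function of the Laguerre polynomials shows that \<open>\<Sum>m. r\<^sup>m Q\<^sub>m\<close> is a Gaussian, and Mehler's formula says
  that these Gaussians multiply like their parameters \<open>r\<close>; comparing coefficients, the \<open>Q\<^sub>m\<close> are mutually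
  orthogonal reproducing kernels. Bessel's inequality and Abel summation (\<open>r \<rightarrow> 1\<close>) then give
  \<open>\<Sum>m. P\<^sub>m f = f\<close> on every fibre, with all partial sums bounded by the norm of \<open>f\<close>. Plancherel's theorem
  in \<open>\<tau>\<close> and dominated convergence carry this over to Schwartz functions on the group, and the uniform
  bound together with the density of the Schwartz functions extends it to \<open>L\<^sup>2\<close>. Since the frame
  \<open>v \<tau>\<close> is an arbitrary choice, the measurability of \<open>Q\<^sub>m\<close> in \<open>\<tau>\<close> comes from its continuity: it depends on
  the frame only through \<open>\<langle>y, |B\<^sup>\<tau>| y\<rangle>\<close> and the determinant of \<open>B\<^sup>\<tau>\<close>.
\<close>

section \<open>Gaussian integrals\<close>

text \<open>The products of the \<open>Q m\<close> have to be won from Gaussians before any good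
  bound on Laguerre functions is at hand. Exchanging the series with an integral needs a majorant,
  and taking absolute values inside the Laguerre polynomials costs a factor
  \<open>exp (2 * q * r / (1 - r))\<close> against the decay \<open>exp (- q)\<close>. At
  \<open>r = 1 / 5\<close> the cost is exactly half of the decay, which is where this constant comes
  from; an interval of parameters, however short, suffices to compare coefficients. Once the
  \<open>Q m\<close> are known to be reproducing kernels, each is largest at the origin, and this
  upgrades the majorant to all \<open>r < 1\<close>, as Abel summation requires. The crude majorant
  also bounds the \<open>L1\<close> norm of \<open>Q m\<close> by \<open>5 ^ m * 5 ^ n\<close>,
  independently of the frequency. Together with the decay of the partial Fourier transform this
  makes the integral over \<open>y\<close> and \<open>\<tau>\<close> absolutely convergent. Since
  \<open>spectral_projection\<close> is picked by \<open>SOME\<close>, a bounded extension must be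
  shown to exist before anything can be said about it; the fibre estimate for a single
  \<open>m\<close> provides the bound on Schwartz functions from which it is built.\<close>

lemma lborel_affine_integral:
  fixes f :: "'a::euclidean_space \<Rightarrow> 'b::{banach, second_countable_topology}"
  assumes "f \<in> borel_measurable borel" and "c \<noteq> 0"
  shows lborel_integrable_affine_iff:
      "integrable lborel (\<lambda>x. f (t + c *\<^sub>R x)) \<longleftrightarrow> integrable lborel f"
    and lborel_integral_affine:
      "(LINT x|lborel. f (t + c *\<^sub>R x)) = (LINT x|lborel. f x) /\<^sub>R \<bar>c\<bar> ^ DIM('a)"
proof -
  have T: "(\<lambda>x::'a. t + c *\<^sub>R x) \<in> measurable lborel borel" by measurable
  have eq: "lborel = density (distr lborel borel (\<lambda>x::'a. t + c *\<^sub>R x))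
      (\<lambda>_. ennreal (\<bar>c\<bar> ^ DIM('a)))"
    using lborel_affine[OF \<open>c \<noteq> 0\<close>, of t] by simp
  have *: "integrable lborel f \<longleftrightarrow> integrable (distr lborel borel (\<lambda>x::'a. t + c *\<^sub>R x))
      (\<lambda>x. (\<bar>c\<bar> ^ DIM('a)) *\<^sub>R f x)"
    by (subst eq, subst integrable_density) (use assms in auto)
  also have "\<dots> \<longleftrightarrow> integrable (distr lborel borel (\<lambda>x::'a. t + c *\<^sub>R x)) f"
    using assms(2) integrable_scaleR_right[of "1 / \<bar>c\<bar> ^ DIM('a)"
        "distr lborel borel (\<lambda>x::'a. t + c *\<^sub>R x)"
      "\<lambda>x. (\<bar>c\<bar> ^ DIM('a)) *\<^sub>R f x"] by auto
  also have "\<dots> \<longleftrightarrow> integrable lborel (\<lambda>x. f (t + c *\<^sub>R x))"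
    using assms by (subst integrable_distr_eq[OF T]) auto
  finally show "integrable lborel (\<lambda>x. f (t + c *\<^sub>R x)) \<longleftrightarrow> integrable lborel f" by simp
  have "(LINT x|lborel. f x) = (LINT x|distr lborel borel (\<lambda>x::'a. t + c *\<^sub>R x). (\<bar>c\<bar> ^ DIM('a))
      *\<^sub>R f x)"
    by (subst eq, subst integral_density) (use assms in auto)
  also have "\<dots> = (\<bar>c\<bar> ^ DIM('a)) *\<^sub>R (LINT x|lborel. f (t + c *\<^sub>R x))"
    using assms by (subst integral_distr[OF T]) auto
  finally show "(LINT x|lborel. f (t + c *\<^sub>R x)) = (LINT x|lborel. f x) /\<^sub>R \<bar>c\<bar> ^ DIM('a)"
    using assms by simp
qed

lemma lborel_integral_shift:
  fixes f :: "'a::euclidean_space \<Rightarrow> 'b::{banach, second_countable_topology}"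
  assumes "f \<in> borel_measurable borel"
  shows "(LINT x|lborel. f (t + x)) = (LINT x|lborel. f x)"
    and "(LINT x|lborel. f (t - x)) = (LINT x|lborel. f x)"
    and "integrable lborel (\<lambda>x. f (t + x)) \<longleftrightarrow> integrable lborel f"
    and "integrable lborel (\<lambda>x. f (t - x)) \<longleftrightarrow> integrable lborel f"
  using lborel_affine_integral[OF assms, of 1 t] lborel_affine_integral[OF assms, of "-1" t]
  by simp_all

text \<open>\<open>lborel\<close> is the image of a product of one-dimensional Lebesgue measures
  under the map from coordinates to vectors, so Fubini's theorem for finite products
  applies.\<close>

lemma lborel_prod_integral:
  fixes u :: "'a::euclidean_space \<Rightarrow> real \<Rightarrow> 'c::{real_normed_field,banach,second_countable_topology}"
  assumes u: "\<And>b. b \<in> Basis \<Longrightarrow> integrable lborel (u b)"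
  shows integrable_lborel_prod: "integrable lborel (\<lambda>x::'a. \<Prod>b\<in>Basis. u b (x \<bullet> b))"
    and integral_lborel_prod:
      "(LINT x|lborel. (\<Prod>b\<in>Basis. u b (x \<bullet> b))) = (\<Prod>b\<in>Basis. LINT s|lborel. u b s)"
proof -
  interpret product_sigma_finite "\<lambda>b::'a. lborel::real measure" by standard
  let ?T = "\<lambda>f. \<Sum>b\<in>Basis. f b *\<^sub>R (b::'a)"
  have T: "?T \<in> measurable (\<Pi>\<^sub>M b\<in>Basis. lborel) borel" by measurable
  have um: "u b \<in> borel_measurable borel" if "b \<in> Basis" for b
    using u[OF that] by (auto dest: borel_measurable_integrable)
  have meas: "(\<lambda>x::'a. \<Prod>b\<in>Basis. u b (x \<bullet> b)) \<in> borel_measurable borel"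
    by (intro borel_measurable_prod measurable_compose[OF _ um]) auto
  have coord: "(\<Prod>b\<in>Basis. u b (?T f \<bullet> b)) = (\<Prod>b\<in>Basis. u b (f b))" for f
    by (intro prod.cong refl) (simp add: inner_sum_left inner_Basis if_distrib cong: if_cong)
  show "integrable lborel (\<lambda>x::'a. \<Prod>b\<in>Basis. u b (x \<bullet> b))"
    unfolding lborel_eq[where 'a='a]
    by (subst integrable_distr_eq[OF T meas], subst coord)
        (intro product_integrable_prod finite_Basis u)
  show "(LINT x|lborel. (\<Prod>b\<in>Basis. u b (x \<bullet> b))) = (\<Prod>b\<in>Basis. LINT s|lborel. u b s)"
    unfolding lborel_eq[where 'a='a]
    by (subst integral_distr[OF T meas], subst coord) (intro product_integral_prod finite_Basis u)
qed

lemma has_bochner_integral_gaussian_real: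
  fixes a b :: real
  assumes a: "a > 0"
  shows "has_bochner_integral lborel (\<lambda>s. exp (- a * s\<^sup>2) *\<^sub>R iexp (b * s))
     (complex_of_real (sqrt (pi / a) * exp (- b\<^sup>2 / (4 * a))))"
proof -
  \<comment> \<open>This scaling turns \<open>- a * (c * x)\<^sup>2\<close> into
    \<open>- x\<^sup>2 / 2\<close>, so the integral becomes the characteristic function of the
    standard normal distribution.\<close>
  define c where "c = 1 / sqrt (2 * a)"
  have c: "c > 0" "c\<^sup>2 = 1 / (2 * a)" using a by (auto simp: c_def power_divide)
  have norm: "has_bochner_integral lborel (\<lambda>x. std_normal_density x *\<^sub>R iexp (t * x))
      (complex_of_real (exp (- (t^2) / 2)))" for t
  proof -
    have int: "integrable std_normal_distribution (\<lambda>x. iexp (t * x))"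
    proof -
      interpret real_distribution std_normal_distribution by (rule real_dist_normal_dist)
      show ?thesis using integrable_iexp[of "\<lambda>x. of_real (t * x)"] by simp
    qed
    have "char std_normal_distribution t = (LINT x|lborel. std_normal_density x *\<^sub>R iexp (t * x))"
      unfolding char_def by (subst integral_density) auto
    moreover have "integrable lborel (\<lambda>x. std_normal_density x *\<^sub>R iexp (t * x))"
      using int by (subst (asm) integrable_density) auto
    ultimately show ?thesis
      unfolding has_bochner_integral_iff by (simp add: char_std_normal_distribution)
  qed
  have "has_bochner_integral lborel (\<lambda>x. exp (- a * (0 + c * x)\<^sup>2) *\<^sub>R iexp (b * (0 + c * x)))
        ((complex_of_real (sqrt (pi / a) * exp (- b\<^sup>2 / (4 * a)))) /\<^sub>R \<bar>c\<bar>)"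
  proof -
    have e: "- a * (0 + c * x)\<^sup>2 = - x\<^sup>2 / 2" for x using c a by (simp add: power_mult_distrib)
    have "has_bochner_integral lborel (\<lambda>x. sqrt (2 * pi)
        *\<^sub>R (std_normal_density x *\<^sub>R iexp ((b * c) * x)))
        (sqrt (2 * pi) *\<^sub>R complex_of_real (exp (- ((b * c)^2) / 2)))"
      by (intro has_bochner_integral_scaleR_right norm)
    moreover have "sqrt (2 * pi) *\<^sub>R complex_of_real (exp (- ((b * c)^2) / 2))
       = ((complex_of_real (sqrt (pi / a) * exp (- b\<^sup>2 / (4 * a)))) /\<^sub>R \<bar>c\<bar>)"
    proof -
      have "- ((b * c)^2) / 2 = - b\<^sup>2 / (4 * a)" using c by (simp add: power_mult_distrib)
      moreover have "sqrt (2 * pi) = sqrt (pi / a) / \<bar>c\<bar>"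
        using a by (simp add: c_def real_sqrt_divide real_sqrt_mult)
      ultimately show ?thesis by (simp add: scaleR_conv_of_real field_simps)
    qed
    moreover have "(\<lambda>x. sqrt (2 * pi) *\<^sub>R (std_normal_density x *\<^sub>R iexp ((b * c) * x)))
      = (\<lambda>x. exp (- a * (0 + c * x)\<^sup>2) *\<^sub>R iexp (b * (0 + c * x)))"
      unfolding e by (simp add: std_normal_density_def mult_ac)
    ultimately show ?thesis by simp
  qed
  then show ?thesis
    using c by (subst lborel_has_bochner_integral_real_affine_iff[of c _ _ 0]) auto
qed

lemma has_bochner_integral_gaussian:
  fixes w :: "'a::euclidean_space"
  assumes a: "a > 0"
  shows "has_bochner_integral lborel (\<lambda>x. exp (- a * (norm x)\<^sup>2) *\<^sub>R iexp (w \<bullet> x))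
     (complex_of_real (sqrt (pi / a) ^ DIM('a) * exp (- (norm w)\<^sup>2 / (4 * a))))"
proof -
  have g: "has_bochner_integral lborel (\<lambda>s. exp (- a * s\<^sup>2) *\<^sub>R iexp ((w \<bullet> b) * s))
     (complex_of_real (sqrt (pi / a) * exp (- (w \<bullet> b)\<^sup>2 / (4 * a))))" for b
    by (rule has_bochner_integral_gaussian_real[OF a])
  have nx: "(norm x)\<^sup>2 = (\<Sum>b\<in>Basis. (x \<bullet> b)\<^sup>2)" for x :: 'a
    by (subst power2_norm_eq_inner, subst euclidean_inner) (simp add: power2_eq_square)
  have e1: "(\<Prod>b\<in>Basis. exp (c * (x \<bullet> b)\<^sup>2)) = exp (c * (norm x)\<^sup>2)" for c and x :: 'a
    unfolding nx sum_distrib_left by (rule exp_sum[symmetric]) simp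
  have e2: "(\<Prod>b\<in>Basis. iexp ((w \<bullet> b) * (x \<bullet> b))) = iexp (w \<bullet> x)" for x
    unfolding euclidean_inner[of w x] of_real_sum sum_distrib_left by (rule exp_sum[symmetric]) simp
  have eq: "(\<Prod>b\<in>Basis. exp (- a * (x \<bullet> b)\<^sup>2) *\<^sub>R iexp ((w \<bullet> b) * (x \<bullet> b)))
      = exp (- a * (norm x)\<^sup>2) *\<^sub>R iexp (w \<bullet> x)" for x
    unfolding e1[of "- a" x, symmetric] e2[symmetric]
        by (simp add: scaleR_conv_of_real prod.distrib)
  have "(\<Prod>b\<in>Basis. complex_of_real (sqrt (pi / a) * exp (- (w \<bullet> b)\<^sup>2 / (4 * a))))
     = complex_of_real (sqrt (pi / a) ^ DIM('a) * exp (- (norm w)\<^sup>2 / (4 * a)))"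
    using e1[of "- 1 / (4 * a)" w] by (simp add: prod.distrib flip: of_real_prod)
  with integrable_lborel_prod[of "\<lambda>b s. exp (- a * s\<^sup>2) *\<^sub>R iexp ((w \<bullet> b) * s)"]
    integral_lborel_prod[of "\<lambda>b s. exp (- a * s\<^sup>2) *\<^sub>R iexp ((w \<bullet> b) * s)"] g
  show ?thesis unfolding has_bochner_integral_iff eq by simp
qed

section \<open>Invariance of Lebesgue measure under isometries; coordinates in an orthonormal
  frame\<close>

lemma lborel_nn_integral_shift:
  fixes f :: "'a::euclidean_space \<Rightarrow> ennreal"
  assumes [measurable]: "f \<in> borel_measurable borel"
  shows "(\<integral>\<^sup>+x. f (t + x) \<partial>lborel) = (\<integral>\<^sup>+x. f x \<partial>lborel)"
    and "(\<integral>\<^sup>+x. f (t - x) \<partial>lborel) = (\<integral>\<^sup>+x. f x \<partial>lborel)"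
proof -
  have "(\<integral>\<^sup>+x. f x \<partial>lborel) = (\<integral>\<^sup>+x. f x \<partial>distr lborel borel (\<lambda>x::'a. t + c *\<^sub>R x))" if "\<bar>c\<bar> = 1"
      for c :: real
    by (subst lborel_affine[of c t]) (use that in \<open>auto simp: density_1\<close>)
  then have "(\<integral>\<^sup>+x. f x \<partial>lborel) = (\<integral>\<^sup>+x. f (t + c *\<^sub>R x) \<partial>lborel)" if "\<bar>c\<bar> = 1" for c :: real
    using that by (simp add: nn_integral_distr)
  from this[of 1] this[of "-1"]
  show "(\<integral>\<^sup>+x. f (t + x) \<partial>lborel) = (\<integral>\<^sup>+x. f x \<partial>lborel)"
    and "(\<integral>\<^sup>+x. f (t - x) \<partial>lborel) = (\<integral>\<^sup>+x. f x \<partial>lborel)" by simp_all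
qed

text \<open>
  Uniqueness of Haar measure: integrate \<open>f x * g (x + T y)\<close> over both
  variables, in either order, with the \<open>T\<close>-invariant function \<open>f x = exp (- \<bar>x\<bar>\<^sup>2)\<close>.
\<close>

lemma lborel_distr_orthogonal:
  fixes T :: "'a::euclidean_space \<Rightarrow> 'a"
  assumes T: "orthogonal_transformation T"
  shows "distr lborel borel T = lborel"
proof (rule measure_eqI)
  have lin: "linear T" using T by (rule orthogonal_transformation_linear)
  have Tm [measurable]: "T \<in> borel_measurable borel"
    using lin by (intro borel_measurable_continuous_onI linear_continuous_on)
        (simp add: linear_linear)
  \<comment> \<open>Moving \<open>T\<close> across the norm,
    \<open>norm (x - T y) = norm (S x - y)\<close>, is where orthogonality enters; a translation
    then removes \<open>S x\<close>.\<close>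
  define S where "S = inv T"
  have TS: "T (S x) = x" for x
    unfolding S_def by (rule surj_f_inv_f[OF orthogonal_transformation_surj[OF T]])
  have T_shift: "x + T y = T (S x + y)" "norm (x - T y) = norm (S x - y)" for x y
    using linear_add[OF lin] linear_diff[OF lin] orthogonal_transformation_norm[OF T]
    by (metis TS)+
  fix A assume "A \<in> sets (distr lborel borel T)"
  then have [measurable]: "A \<in> sets borel" by simp
  define f where "f x = ennreal (exp (- (norm (x::'a))\<^sup>2))" for x
  define g :: "'a \<Rightarrow> ennreal" where "g x = indicator A x" for x
  have [measurable]: "f \<in> borel_measurable borel" "g \<in> borel_measurable borel"
    unfolding f_def g_def by auto
  have "has_bochner_integral lborel (\<lambda>x::'a. exp (- 1 * (norm x)\<^sup>2) *\<^sub>R iexp (0 \<bullet> x))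
     (complex_of_real (sqrt (pi / 1) ^ DIM('a) * exp (- (norm (0::'a))\<^sup>2 / (4 * 1))))"
    by (rule has_bochner_integral_gaussian) simp
  from has_bochner_integral_bounded_linear[OF bounded_linear_Re this]
  have "has_bochner_integral lborel (\<lambda>x::'a. exp (- (norm x)\<^sup>2)) (sqrt pi ^ DIM('a))" by simp
  then have f_int: "(\<integral>\<^sup>+x. f x \<partial>lborel) = ennreal (sqrt pi ^ DIM('a))"
    unfolding f_def by (subst nn_integral_eq_integral) (auto simp: has_bochner_integral_iff)
  \<comment> \<open>The integral of \<open>f\<close> is to be cancelled in the end, so it must be
    neither zero nor infinite.\<close>
  have "sqrt pi ^ DIM('a) > 0" by simp
  then have f_ne: "(\<integral>\<^sup>+x. f x \<partial>lborel) \<noteq> 0" "(\<integral>\<^sup>+x. f x \<partial>lborel) \<noteq> \<top>"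
    unfolding f_int by (metis ennreal_eq_0_iff not_le, simp)
  have "(\<integral>\<^sup>+x. f x \<partial>lborel) * (\<integral>\<^sup>+y. g (T y) \<partial>lborel)
      = (\<integral>\<^sup>+x. f x * (\<integral>\<^sup>+y. g (x + T y) \<partial>lborel) \<partial>lborel)"
    unfolding T_shift using lborel_nn_integral_shift(1)[of "\<lambda>y. g (T y)"]
    by (simp add: nn_integral_multc)
  also have "\<dots> = (\<integral>\<^sup>+x. (\<integral>\<^sup>+y. f x * g (x + T y) \<partial>lborel) \<partial>lborel)"
    by (simp add: nn_integral_cmult)
  also have "\<dots> = (\<integral>\<^sup>+y. (\<integral>\<^sup>+x. f x * g (x + T y) \<partial>lborel) \<partial>lborel)"
    by (rule lborel_pair.Fubini') measurable
  also have "\<dots> = (\<integral>\<^sup>+y. (\<integral>\<^sup>+x. f (x - T y) * g x \<partial>lborel) \<partial>lborel)"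
    using lborel_nn_integral_shift(1)[of "\<lambda>x. f (x - T y) * g x" "T y" for y]
        by (simp add: add.commute)
  also have "\<dots> = (\<integral>\<^sup>+x. (\<integral>\<^sup>+y. f (x - T y) * g x \<partial>lborel) \<partial>lborel)"
    by (rule lborel_pair.Fubini') measurable
  also have "\<dots> = (\<integral>\<^sup>+x. (\<integral>\<^sup>+y. f (S x - y) \<partial>lborel) * g x \<partial>lborel)"
    by (simp add: nn_integral_multc f_def T_shift)
  also have "\<dots> = (\<integral>\<^sup>+x. f x \<partial>lborel) * (\<integral>\<^sup>+x. g x \<partial>lborel)"
    by (simp add: lborel_nn_integral_shift(2) nn_integral_cmult)
  finally have "(\<integral>\<^sup>+y. g (T y) \<partial>lborel) = (\<integral>\<^sup>+x. g x \<partial>lborel)"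
    by (simp add: ennreal_mult_cancel_left f_ne)
  moreover have "(\<integral>\<^sup>+y. g (T y) \<partial>lborel) = (\<integral>\<^sup>+y. g y \<partial>distr lborel borel T)"
    by (simp add: nn_integral_distr)
  ultimately show "emeasure (distr lborel borel T) A = emeasure lborel A"
    by (simp add: g_def nn_integral_indicator)
qed simp

text \<open>The family is indexed, not a set, because the frame comes with numbered vectors.
  Orthonormality makes the indexing injective and the vectors independent; the cardinality then
  makes them span.\<close>

lemma orthonormal_expansion:
  fixes v :: "'i \<Rightarrow> 'a::euclidean_space"
  assumes I: "finite I" "card I = DIM('a)"
    and on: "\<And>k l. k \<in> I \<Longrightarrow> l \<in> I \<Longrightarrow> v k \<bullet> v l = (if k = l then 1 else 0)"
  shows "(\<Sum>k\<in>I. (x \<bullet> v k) *\<^sub>R v k) = x"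
proof -
  have inj: "inj_on v I"
    using on by (intro inj_onI) (metis zero_neq_one)
  have orth: "pairwise orthogonal (v ` I)"
    using on by (auto simp: pairwise_def orthogonal_def)
  have n1: "\<And>i. i \<in> v ` I \<Longrightarrow> norm i = 1"
    using on by (auto simp: norm_eq_1)
  have "0 \<notin> v ` I" using n1 by force
  then have "independent (v ` I)" by (rule pairwise_orthogonal_independent[OF orth])
  then have "x \<in> span (v ` I)"
    using card_eq_dim[of "v ` I" UNIV] I card_image[OF inj] by (auto simp: dim_UNIV)
  then have "(\<Sum>i\<in>v ` I. (x \<bullet> i) *\<^sub>R i) = x"
    using orthonormal_basis_expand[OF orth n1] I by auto
  then show ?thesis by (simp add: sum.reindex[OF inj])
qed

lemma orthonormal_parseval:
  fixes v :: "'i \<Rightarrow> 'a::euclidean_space"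
  assumes I: "finite I" "card I = DIM('a)"
    and on: "\<And>k l. k \<in> I \<Longrightarrow> l \<in> I \<Longrightarrow> v k \<bullet> v l = (if k = l then 1 else 0)"
  shows "x \<bullet> y = (\<Sum>k\<in>I. (x \<bullet> v k) * (y \<bullet> v k))"
proof -
  have "x \<bullet> y = x \<bullet> (\<Sum>k\<in>I. (y \<bullet> v k) *\<^sub>R v k)"
    by (subst orthonormal_expansion[OF assms]) auto
  then show ?thesis by (simp add: inner_sum_right mult_ac)
qed

text \<open>A bijection between the index set and \<open>Basis\<close> gives the orthogonal map
  \<open>T\<close> that sends coordinates along \<open>v\<close> to standard coordinates. Invariance
  of the measure under \<open>T\<close> reduces the claim to the product formula in standard
  coordinates.\<close>

lemma orthonormal_prod_integral:
  fixes v :: "'i \<Rightarrow> 'a::euclidean_space" and u ::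
      "'i \<Rightarrow> real \<Rightarrow> 'c::{real_normed_field,banach,second_countable_topology}"
  assumes I: "finite I" "card I = DIM('a)"
    and on: "\<And>k l. k \<in> I \<Longrightarrow> l \<in> I \<Longrightarrow> v k \<bullet> v l = (if k = l then 1 else 0)"
    and u: "\<And>k. k \<in> I \<Longrightarrow> integrable lborel (u k)"
  shows integrable_orthonormal_prod: "integrable lborel (\<lambda>x. \<Prod>k\<in>I. u k (x \<bullet> v k))"
    and integral_orthonormal_prod: "(LINT x|lborel. (\<Prod>k\<in>I. u k (x \<bullet> v k)))
        = (\<Prod>k\<in>I. LINT s|lborel. u k s)"
proof -
  obtain \<sigma> where \<sigma>: "bij_betw \<sigma> (Basis :: ('a) set) I"
    using finite_same_card_bij[OF finite_Basis I(1)] I(2) by auto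
  define T where "T x = (\<Sum>b\<in>Basis. (x \<bullet> v (\<sigma> b)) *\<^sub>R (b::'a))" for x
  have Tb: "T x \<bullet> b = x \<bullet> v (\<sigma> b)" if "b \<in> Basis" for x b
    using that by (simp add: T_def inner_sum_left inner_Basis if_distrib cong: if_cong)
  have "linear T"
    by (intro linearI) (simp_all add: T_def inner_add_left scaleR_add_left sum.distrib
        scaleR_sum_right)
  moreover have "T x \<bullet> T y = x \<bullet> y" for x y
  proof -
    have "T x \<bullet> T y = (\<Sum>b\<in>Basis. (x \<bullet> v (\<sigma> b)) * (y \<bullet> v (\<sigma> b)))"
      by (subst euclidean_inner) (simp add: Tb)
    also have "\<dots> = (\<Sum>k\<in>I. (x \<bullet> v k) * (y \<bullet> v k))"
      by (rule sum.reindex_bij_betw[OF \<sigma>])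
    finally show ?thesis using orthonormal_parseval[OF I on, of x y] by (simp only:)
  qed
  ultimately have T: "orthogonal_transformation T"
    by (simp add: orthogonal_transformation_def)
  have Tm: "T \<in> measurable lborel borel"
    using linear_continuous_on[OF linear_linear[THEN iffD2, OF \<open>linear T\<close>]]
    by (auto intro: borel_measurable_continuous_onI)
  let ?F = "\<lambda>y. \<Prod>b\<in>Basis. u (\<sigma> b) (y \<bullet> b)"
  have F: "?F (T x) = (\<Prod>k\<in>I. u k (x \<bullet> v k))" for x
    using prod.reindex_bij_betw[OF \<sigma>, of "\<lambda>k. u k (x \<bullet> v k)"] by (simp add: Tb)
  have u\<sigma>: "integrable lborel (u (\<sigma> b))" if "b \<in> Basis" for b
    using u \<sigma> that by (auto simp: bij_betw_def)
  have iF: "integrable lborel ?F" by (rule integrable_lborel_prod[of "\<lambda>b. u (\<sigma> b)", OF u\<sigma>])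
  then have mF: "?F \<in> borel_measurable borel" by (auto dest: borel_measurable_integrable)
  have D: "distr lborel borel T = lborel" by (rule lborel_distr_orthogonal[OF T])
  have "integrable (distr lborel borel T) ?F" using iF by (simp add: D)
  then show "integrable lborel (\<lambda>x. \<Prod>k\<in>I. u k (x \<bullet> v k))"
    by (subst (asm) integrable_distr_eq[OF Tm mF]) (simp only: F)
  have "(LINT y|distr lborel borel T. ?F y) = (LINT x|lborel. (\<Prod>k\<in>I. u k (x \<bullet> v k)))"
    by (subst integral_distr[OF Tm mF]) (simp only: F)
  moreover have "(LINT y|lborel. ?F y) = (\<Prod>k\<in>I. LINT s|lborel. u k s)"
    using integral_lborel_prod[of "\<lambda>b. u (\<sigma> b)", OF u\<sigma>]
        prod.reindex_bij_betw[OF \<sigma>, of "\<lambda>k. LINT s|lborel. u k s"] by simp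
  ultimately show "(LINT x|lborel. (\<Prod>k\<in>I. u k (x \<bullet> v k))) = (\<Prod>k\<in>I. LINT s|lborel. u k s)"
    by (simp add: D)
qed

section \<open>An integrable weight\<close>

text \<open>The universal majorant of the development. It is integrable, at most 1, and
  multiplicative under \<open>Pair\<close>, so a single bound on a function of two variables splits
  into bounds for each of them.\<close>

definition weight :: "'a::euclidean_space \<Rightarrow> real" where
  "weight x = (\<Prod>b\<in>Basis. 1 / (1 + (x \<bullet> b)\<^sup>2))"

lemma weight_pos [simp]: "weight x > 0"
  unfolding weight_def by (intro prod_pos) (auto intro!: divide_pos_pos add_pos_nonneg)

lemma weight_nonneg [simp]: "weight x \<ge> 0"
  using weight_pos[of x] by linarith

lemma weight_le_1: "weight x \<le> 1"
  unfolding weight_def by (intro prod_le_1) (auto simp: divide_le_eq_1 add_pos_nonneg)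

lemma continuous_on_weight [continuous_intros]:
  "continuous_on S g \<Longrightarrow> continuous_on S (\<lambda>x. weight (g x))"
  unfolding weight_def
  by (intro continuous_intros) (auto simp: add_nonneg_eq_0_iff)

lemma borel_measurable_weight [measurable]: "weight \<in> borel_measurable borel"
  by (intro borel_measurable_continuous_onI continuous_intros)

lemma integrable_weight: "integrable lborel (weight :: 'a::euclidean_space \<Rightarrow> real)"
proof -
  have "integrable lborel (\<lambda>x::real. 1 / (1 + x\<^sup>2))"
    using integrable_inverse_1_plus_square by (simp add: set_integrable_def inverse_eq_divide)
  then show ?thesis
    unfolding weight_def by (intro integrable_lborel_prod)
qed

lemma weight_Pair: "weight (x, t) = weight x * weight t"
proof -
  have "(\<lambda>u. (u, 0)) ` (Basis :: 'a set) \<inter> Pair 0 ` (Basis :: 'b set) = {}"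
    using nonzero_Basis by auto
  then show ?thesis
    unfolding weight_def Basis_prod_def
    by (subst prod.union_disjoint) (simp_all add: prod.reindex inj_on_def)
qed

section \<open>Fourier inversion and Plancherel's theorem\<close>

text \<open>The sign is that of the inverse transform, because the main use is the return from the
  frequency to the central variable; \<open>partial_fourier\<close> carries the opposite
  sign.\<close>

definition fourier_int :: "('a::euclidean_space \<Rightarrow> complex) \<Rightarrow> 'a \<Rightarrow> complex" where
  "fourier_int h s = (LINT t|lborel. iexp (s \<bullet> t) * h t)"

lemma norm_iexp_mult [simp]: "norm (iexp x * z) = norm z"
  by (simp add: norm_mult)

lemma borel_measurable_cnj [measurable]: "cnj \<in> borel_measurable borel"
  by (intro borel_measurable_continuous_onI continuous_intros)

lemma integrable_iexp_mult:
  fixes h :: "'a::euclidean_space \<Rightarrow> complex"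
  assumes "integrable lborel h" "g \<in> borel_measurable borel"
  shows "integrable lborel (\<lambda>t. iexp (g t) * h t)"
  using assms by (auto intro: Bochner_Integration.integrable_bound)

lemma borel_measurable_fourier_int:
  assumes "h \<in> borel_measurable borel"
  shows "fourier_int h \<in> borel_measurable borel"
  unfolding fourier_int_def using assms by measurable

lemma norm_fourier_int_le:
  fixes h :: "'a::euclidean_space \<Rightarrow> complex"
  assumes "integrable lborel h"
  shows "norm (fourier_int h s) \<le> (LINT t|lborel. norm (h t))"
proof -
  have "norm (fourier_int h s) \<le> (LINT t|lborel. norm (iexp (s \<bullet> t) * h t))"
    unfolding fourier_int_def by (rule integral_norm_bound)
  then show ?thesis by simp
qed

lemma integrable_gaussian:
  assumes "a > 0"
  shows "integrable lborel (\<lambda>x::'a::euclidean_space. exp (- a * (norm x)\<^sup>2))"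
    and "(LINT x::'a::euclidean_space|lborel. exp (- a * (norm x)\<^sup>2)) = sqrt (pi / a) ^ DIM('a)"
proof -
  have "has_bochner_integral lborel (\<lambda>x::'a. exp (- a * (norm x)\<^sup>2)) (sqrt (pi / a) ^ DIM('a))"
    using has_bochner_integral_bounded_linear[OF bounded_linear_Re
        has_bochner_integral_gaussian[OF assms, of 0]]
    by simp
  then show "integrable lborel (\<lambda>x::'a. exp (- a * (norm x)\<^sup>2))"
    and "(LINT x::'a|lborel. exp (- a * (norm x)\<^sup>2)) = sqrt (pi / a) ^ DIM('a)"
    by (auto simp: has_bochner_integral_iff)
qed

section \<open>Gaussian regularisation, Fourier inversion and Plancherel's theorem\<close>

text \<open>An unnormalised heat average. The scale \<open>d\<close> sits in the argument of
  \<open>h\<close>, so the Gaussian itself is a fixed majorant as \<open>d\<close> tends to 0. The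
  literal factor \<open>- 1\<close> matches the general exponent \<open>- a\<close> of the Gaussian
  integrals.\<close>

definition gauss_mean :: "real \<Rightarrow> ('a::euclidean_space \<Rightarrow> complex) \<Rightarrow> 'a \<Rightarrow> complex" where
  "gauss_mean d h x = (LINT u|lborel. exp (- 1 * (norm u)\<^sup>2) *\<^sub>R h (x + d *\<^sub>R u))"

lemma norm_gauss_mean_le:
  fixes h :: "'a::euclidean_space \<Rightarrow> complex"
  assumes C: "\<And>x. norm (h x) \<le> C"
  shows "norm (gauss_mean d h x) \<le> C * sqrt pi ^ DIM('a)"
proof -
  have "norm (gauss_mean d h x) \<le> (LINT u::'a|lborel. C * exp (- 1 * (norm u)\<^sup>2))"
    unfolding gauss_mean_def
    by (rule order_trans[OF integral_norm_bound], rule integral_mono')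
       (use C C[THEN order_trans[OF norm_ge_zero]] integrable_gaussian(1)[of 1, where 'a='a]
           in \<open>auto simp: mult.commute intro!: mult_left_mono\<close>)
  then show ?thesis using integrable_gaussian[of 1, where 'a='a] by simp
qed

lemma gauss_mean_tendsto:
  fixes h :: "'a::euclidean_space \<Rightarrow> complex"
  assumes [measurable]: "h \<in> borel_measurable borel" and C: "\<And>x. norm (h x) \<le> C"
    and cont: "isCont h x" and d: "d \<longlonglongrightarrow> 0"
  shows "(\<lambda>n. gauss_mean (d n) h x) \<longlonglongrightarrow> complex_of_real (sqrt pi ^ DIM('a)) * h x"
proof -
  have "(\<lambda>n. gauss_mean (d n) h x) \<longlonglongrightarrow> (LINT u::'a|lborel. exp (- 1 * (norm u)\<^sup>2) *\<^sub>R h x)"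
    unfolding gauss_mean_def
  proof (rule integral_dominated_convergence[where w="\<lambda>u. C * exp (- 1 * (norm u)\<^sup>2)"])
    have "(\<lambda>n. x + d n *\<^sub>R u) \<longlonglongrightarrow> x" for u
      using tendsto_add[OF tendsto_const[of x] tendsto_scaleR[OF d tendsto_const[of u]]] by simp
    then show "AE u in lborel. (\<lambda>n. exp (- 1 * (norm u)\<^sup>2) *\<^sub>R h (x + d n *\<^sub>R u))
        \<longlonglongrightarrow> exp (- 1 * (norm u)\<^sup>2) *\<^sub>R h x"
      by (intro AE_I2 tendsto_scaleR tendsto_const isCont_tendsto_compose[OF cont]) 
    show "integrable lborel (\<lambda>u::'a. C * exp (- 1 * (norm u)\<^sup>2))"
      using integrable_gaussian(1)[of 1, where 'a='a] by simp
  qed (use C in \<open>auto simp: mult.commute intro!: mult_left_mono\<close>)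
  also have "(LINT u::'a|lborel. exp (- 1 * (norm u)\<^sup>2) *\<^sub>R h x)
      = complex_of_real (sqrt pi ^ DIM('a)) * h x"
    using integrable_gaussian[of 1, where 'a='a] by (simp add: scaleR_conv_of_real)
  finally show ?thesis .
qed

text \<open>The damping factor makes the double integral absolutely convergent; after the exchange
  the integral over \<open>s\<close> is the Fourier transform of a Gaussian, again a Gaussian,
  centred at \<open>x\<close>.\<close>

lemma regularised_inversion:
  fixes h :: "'a::euclidean_space \<Rightarrow> complex"
  assumes h: "integrable lborel h" and e: "e > 0"
  shows "(LINT s|lborel. exp (- e * (norm s)\<^sup>2) *\<^sub>R (iexp (- (s \<bullet> x)) * fourier_int h s))
    = complex_of_real ((2 * sqrt pi) ^ DIM('a)) * gauss_mean (2 * sqrt e) h x"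
proof -
  have [measurable]: "h \<in> borel_measurable borel" using h
      by (auto dest: borel_measurable_integrable)
  have "(LINT s|lborel. exp (- e * (norm s)\<^sup>2) *\<^sub>R (iexp (- (s \<bullet> x)) * fourier_int h s))
     = (LINT s|lborel. (LINT t|lborel. exp (- e * (norm s)\<^sup>2)
         *\<^sub>R (iexp (- (s \<bullet> x)) * (iexp (s \<bullet> t) * h t))))"
    unfolding fourier_int_def by simp
  also have "\<dots> = (LINT t|lborel. (LINT s|lborel. exp (- e * (norm s)\<^sup>2)
      *\<^sub>R (iexp (- (s \<bullet> x)) * (iexp (s \<bullet> t) * h t))))"
  proof (rule lborel_pair.Fubini_integral)
    have "integrable (lborel \<Otimes>\<^sub>M lborel) (\<lambda>(t, s). exp (- e * (norm (s::'a))\<^sup>2) *\<^sub>R h t)"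
    proof (rule lborel_pair.Fubini_integrable)
      show "AE t in lborel. integrable lborel
          (\<lambda>s. case (t, s) of (t, s) \<Rightarrow> exp (- e * (norm (s::'a))\<^sup>2) *\<^sub>R h t)"
        using integrable_gaussian(1)[OF e, where 'a='a] by simp
      show "integrable lborel (\<lambda>t. LINT s|lborel. norm
          (case (t, s) of (t, s) \<Rightarrow> exp (- e * (norm (s::'a))\<^sup>2) *\<^sub>R h t))"
        using integrable_gaussian(1)[OF e, where 'a='a] h by simp
    qed measurable
    then show "integrable (lborel \<Otimes>\<^sub>M lborel)
        (\<lambda>(t, s). exp (- e * (norm s)\<^sup>2) *\<^sub>R (iexp (- (s \<bullet> x)) * (iexp (s \<bullet> t) * h t)))"
      by (rule Bochner_Integration.integrable_bound)
          (auto simp: case_prod_beta simp del: of_real_minus)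
  qed
  also have "\<dots> = (LINT t|lborel. complex_of_real
      (sqrt (pi / e) ^ DIM('a) * exp (- (norm (t - x))\<^sup>2 / (4 * e))) * h t)"
  proof (intro Bochner_Integration.integral_cong refl)
    fix t
    have eq: "exp (- e * (norm s)\<^sup>2) *\<^sub>R (iexp (- (s \<bullet> x)) * (iexp (s \<bullet> t) * h t))
        = (exp (- e * (norm s)\<^sup>2) *\<^sub>R iexp ((t - x) \<bullet> s)) * h t" for s
      by (simp add: inner_diff_left inner_commute exp_diff exp_minus divide_inverse algebra_simps)
    show "(LINT s|lborel. exp (- e * (norm s)\<^sup>2) *\<^sub>R (iexp (- (s \<bullet> x)) * (iexp (s \<bullet> t) * h t)))
        = complex_of_real (sqrt (pi / e) ^ DIM('a) * exp (- (norm (t - x))\<^sup>2 / (4 * e))) * h t"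
      unfolding eq using has_bochner_integral_gaussian[OF e, of "t - x"]
      by (simp only: has_bochner_integral_iff integral_mult_left_zero)
  qed
  also have "\<dots> = complex_of_real ((2 * sqrt pi) ^ DIM('a)) * gauss_mean (2 * sqrt e) h x"
  proof -
    \<comment> \<open>The inner integral is proportional to
      \<open>exp (- (norm (t - x))\<^sup>2 / (4 * e))\<close>; substituting
      \<open>t = x + c *\<^sub>R u\<close> removes \<open>e\<close> from the exponent.\<close>
    define c where "c = 2 * sqrt e"
    have c: "c > 0" "c * sqrt (pi / e) = 2 * sqrt pi" "c\<^sup>2 = 4 * e"
      using e by (simp_all add: c_def real_sqrt_divide power_mult_distrib)
    have n: "- (norm (x + c *\<^sub>R u - x))\<^sup>2 / (4 * e) = - 1 * (norm u)\<^sup>2" for u :: 'a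
      using e c by (simp add: power_mult_distrib)
    define f where "f t = complex_of_real (sqrt (pi / e) ^ DIM('a) * exp
        (- (norm (t - x))\<^sup>2 / (4 * e))) * h t" for t
    have [measurable]: "f \<in> borel_measurable borel" unfolding f_def by measurable
    have "(LINT t|lborel. f t) = c ^ DIM('a) *\<^sub>R (LINT u|lborel. f (x + c *\<^sub>R u))"
      using lborel_integral_affine[of f c x] c by simp
    also have "\<dots> = c ^ DIM('a) *\<^sub>R (complex_of_real (sqrt (pi / e) ^ DIM('a)) * gauss_mean c h x)"
      unfolding f_def n gauss_mean_def by (simp add: scaleR_conv_of_real mult.assoc)
    also have "\<dots> = complex_of_real (c ^ DIM('a) * sqrt (pi / e) ^ DIM('a)) * gauss_mean c h x"
      by (simp add: scaleR_conv_of_real)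
    also have "c ^ DIM('a) * sqrt (pi / e) ^ DIM('a) = (2 * sqrt pi) ^ DIM('a)"
      unfolding c(2)[symmetric] by (simp add: power_mult_distrib)
    finally show ?thesis unfolding f_def c_def .
  qed
  finally show ?thesis .
qed

lemma two_sqrt_pi_power: "(2 * sqrt pi) ^ N * sqrt pi ^ N = (2 * pi) ^ N"
  by (subst power_mult_distrib[symmetric]) (simp only: mult.assoc real_sqrt_mult_self
      abs_of_pos[OF pi_gt_zero])

lemma inverse_nat_tendsto:
  "(\<lambda>n. inverse (real (Suc n))) \<longlonglongrightarrow> 0" "(\<lambda>n. 2 * sqrt (inverse (real (Suc n)))) \<longlonglongrightarrow> 0"
proof -
  show *: "(\<lambda>n. inverse (real (Suc n))) \<longlonglongrightarrow> 0" by (rule LIMSEQ_inverse_real_of_nat)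
  show "(\<lambda>n. 2 * sqrt (inverse (real (Suc n)))) \<longlonglongrightarrow> 0"
    using tendsto_mult[OF tendsto_const[of 2] tendsto_real_sqrt[OF *]] by simp
qed

text \<open>The damping is removed along \<open>e = 1 / (n + 1)\<close>. On the left the
  integrability of the transform allows dominated convergence; on the right the Gaussian means
  converge because \<open>h\<close> is continuous at \<open>x\<close>.\<close>

lemma fourier_inversion:
  fixes h :: "'a::euclidean_space \<Rightarrow> complex"
  assumes h: "integrable lborel h" and C: "\<And>x. norm (h x) \<le> C"
    and cont: "isCont h x" and fh: "integrable lborel (fourier_int h)"
  shows "(LINT s|lborel. iexp (- (s \<bullet> x)) * fourier_int h s)
      = complex_of_real ((2 * pi) ^ DIM('a)) * h x"
proof (rule LIMSEQ_unique)
  have [measurable]: "h \<in> borel_measurable borel" using h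
      by (auto dest: borel_measurable_integrable)
  have [measurable]: "fourier_int h \<in> borel_measurable borel"
      by (rule borel_measurable_fourier_int) simp
  let ?e = "\<lambda>n. inverse (real (Suc n))"
  let ?F = "\<lambda>n. LINT s|lborel. exp (- ?e n * (norm s)\<^sup>2) *\<^sub>R (iexp (- (s \<bullet> x)) * fourier_int h s)"
  show "?F \<longlonglongrightarrow> (LINT s|lborel. iexp (- (s \<bullet> x)) * fourier_int h s)"
  proof (rule integral_dominated_convergence[where w="\<lambda>s. norm (fourier_int h s)"])
    have "(\<lambda>n. exp (- ?e n * (norm s)\<^sup>2)) \<longlonglongrightarrow> exp (- 0 * (norm s)\<^sup>2)" for s :: 'a
      by (intro tendsto_intros inverse_nat_tendsto)
    then show "AE s in lborel. (\<lambda>n. exp (- ?e n * (norm s)\<^sup>2) *\<^sub>R (iexp (- (s \<bullet> x)) * fourier_int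
        h s)) \<longlonglongrightarrow> iexp (- (s \<bullet> x)) * fourier_int h s"
      using tendsto_scaleR[OF _ tendsto_const] by (intro AE_I2) fastforce
    show "AE s in lborel. norm (exp (- ?e n * (norm s)\<^sup>2) *\<^sub>R (iexp (- (s \<bullet> x)) * fourier_int h
        s)) \<le> norm (fourier_int h s)" for n
      by (intro AE_I2) (auto simp: mult_left_le_one_le simp del: of_real_minus)
  qed (use fh in auto)
  have "?F = (\<lambda>n. complex_of_real ((2 * sqrt pi) ^ DIM('a)) * gauss_mean (2 * sqrt (?e n)) h x)"
    by (intro ext regularised_inversion[OF h]) simp
  moreover have "\<dots> \<longlonglongrightarrow> complex_of_real ((2 * sqrt pi) ^ DIM('a))
      * (complex_of_real (sqrt pi ^ DIM('a)) * h x)"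
    by (intro tendsto_mult tendsto_const gauss_mean_tendsto[OF _ C cont] inverse_nat_tendsto) simp
  ultimately show "?F \<longlonglongrightarrow> complex_of_real ((2 * pi) ^ DIM('a)) * h x"
    by (simp only: mult.assoc[symmetric] of_real_mult[symmetric] two_sqrt_pi_power)
qed

text \<open>Continuity is asked almost everywhere because the functions of the frequency to which
  this is applied are known to be continuous only away from 0. The damped squared norm of the
  transform is, by Fubini's theorem, the pairing of \<open>h\<close> with its own Gaussian means,
  and the damping is then removed.\<close>

lemma plancherel:
  fixes h :: "'a::euclidean_space \<Rightarrow> complex"
  assumes h: "integrable lborel h" and C: "\<And>x. norm (h x) \<le> C"
      and cont: "AE x in lborel. isCont h x"
  shows "(\<integral>\<^sup>+s. ennreal ((norm (fourier_int h s))\<^sup>2) \<partial>lborel)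
      = ennreal ((2 * pi) ^ DIM('a)) * (\<integral>\<^sup>+x. ennreal ((norm (h x))\<^sup>2) \<partial>lborel)"
proof -
  have [measurable]: "h \<in> borel_measurable borel" using h
      by (auto dest: borel_measurable_integrable)
  have [measurable]: "fourier_int h \<in> borel_measurable borel"
      by (rule borel_measurable_fourier_int) simp
  have C0: "C \<ge> 0" using C[of 0] norm_ge_zero order_trans by blast
  let ?e = "\<lambda>n. inverse (real (Suc n))"
  let ?g = "\<lambda>n. LINT s|lborel. exp (- ?e n * (norm s)\<^sup>2) * (norm (fourier_int h s))\<^sup>2"
  define K where "K = (LINT t|lborel. norm (h t))"
  have K: "norm (fourier_int h s) \<le> K" for s unfolding K_def by (rule norm_fourier_int_le[OF h])
  have K0: "K \<ge> 0" using K[of 0] norm_ge_zero order_trans by blast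
  have g_int: "integrable lborel (\<lambda>s. exp (- ?e n * (norm s)\<^sup>2) * (norm (fourier_int h s))\<^sup>2)" for n
    by (rule Bochner_Integration.integrable_bound[of _ "\<lambda>s. K\<^sup>2 * exp (- ?e n * (norm s)\<^sup>2)"])
       (use K integrable_gaussian(1)[of "?e n", where 'a='a] in \<open>auto simp: mult.commute
           intro!: mult_left_mono power_mono\<close>)
  have h2: "integrable lborel (\<lambda>x. (norm (h x))\<^sup>2)"
    by (rule Bochner_Integration.integrable_bound[of _ "\<lambda>x. C * norm (h x)"])
       (use C C0 h in \<open>auto simp: power2_eq_square intro!: mult_mono\<close>)
  have id: "complex_of_real (?g n) = complex_of_real ((2 * sqrt pi) ^ DIM('a))
      * (LINT x|lborel. cnj (h x) * gauss_mean (2 * sqrt (?e n)) h x)" for n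
  proof -
    have ft_cnj: "cnj (fourier_int h s) = (LINT x|lborel. iexp (- (s \<bullet> x)) * cnj (h x))" for s
    proof -
      have "cnj (fourier_int h s) = (LINT x|lborel. cnj (iexp (s \<bullet> x) * h x))"
        unfolding fourier_int_def by (rule Bochner_Integration.integral_cnj[symmetric])
      then show ?thesis by (simp add: exp_cnj)
    qed
    have "complex_of_real (?g n) = (LINT s|lborel. complex_of_real
        (exp (- ?e n * (norm s)\<^sup>2) * (norm (fourier_int h s))\<^sup>2))"
      by (rule integral_complex_of_real[symmetric])
    also have "\<dots> = (LINT s|lborel. (LINT x|lborel. exp (- ?e n * (norm s)\<^sup>2)
        *\<^sub>R (fourier_int h s * (iexp (- (s \<bullet> x)) * cnj (h x)))))"
    proof (intro Bochner_Integration.integral_cong refl)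
      fix s
      have "complex_of_real (exp (- ?e n * (norm s)\<^sup>2) * (norm (fourier_int h s))\<^sup>2)
        = exp (- ?e n * (norm s)\<^sup>2) *\<^sub>R (fourier_int h s * cnj (fourier_int h s))"
        by (simp only: complex_norm_square of_real_mult scaleR_conv_of_real)
      also have "\<dots> = (LINT x|lborel. exp (- ?e n * (norm s)\<^sup>2)
          *\<^sub>R (fourier_int h s * (iexp (- (s \<bullet> x)) * cnj (h x))))"
        unfolding ft_cnj by simp
      finally show "complex_of_real (exp (- ?e n * (norm s)\<^sup>2) * (norm (fourier_int h s))\<^sup>2)
        = (LINT x|lborel. exp (- ?e n * (norm s)\<^sup>2)
            *\<^sub>R (fourier_int h s * (iexp (- (s \<bullet> x)) * cnj (h x))))" .
    qed
    also have "\<dots> = (LINT x|lborel. (LINT s|lborel. exp (- ?e n * (norm s)\<^sup>2)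
        *\<^sub>R (fourier_int h s * (iexp (- (s \<bullet> x)) * cnj (h x)))))"
    proof (rule lborel_pair.Fubini_integral)
      have "integrable (lborel \<Otimes>\<^sub>M lborel) (\<lambda>(x, s). (K * exp (- ?e n * (norm (s::'a))\<^sup>2)) *\<^sub>R h x)"
      proof (rule lborel_pair.Fubini_integrable)
        show "AE x in lborel. integrable lborel
            (\<lambda>s. case (x, s) of (x, s) \<Rightarrow> (K * exp (- ?e n * (norm (s::'a))\<^sup>2)) *\<^sub>R h x)"
          using integrable_gaussian(1)[of "?e n", where 'a='a] by simp
        show "integrable lborel (\<lambda>x. LINT s|lborel. norm
            (case (x, s) of (x, s) \<Rightarrow> (K * exp (- ?e n * (norm (s::'a))\<^sup>2)) *\<^sub>R h x))"
          using integrable_gaussian(1)[of "?e n", where 'a='a] h by (simp add: abs_mult)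
      qed measurable
      then show "integrable (lborel \<Otimes>\<^sub>M lborel) (\<lambda>(x, s). exp (- ?e n * (norm s)\<^sup>2)
          *\<^sub>R (fourier_int h s * (iexp (- (s \<bullet> x)) * cnj (h x))))"
      proof (rule Bochner_Integration.integrable_bound)
        have "norm (h x) * (norm (fourier_int h s) * exp (- ?e n * (norm s)\<^sup>2))
            \<le> norm (h x) * (K * exp (- ?e n * (norm s)\<^sup>2))" for x s
          by (intro mult_left_mono mult_right_mono K) auto
        then show "AE p in lborel \<Otimes>\<^sub>M lborel. norm (case p of (x, s) \<Rightarrow> exp (- ?e n * (norm s)\<^sup>2)
            *\<^sub>R (fourier_int h s * (iexp (- (s \<bullet> x)) * cnj (h x))))
          \<le> norm (case p of (x, s) \<Rightarrow> (K * exp (- ?e n * (norm s)\<^sup>2)) *\<^sub>R h x)"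
          using K0 by (intro AE_I2) (simp add: case_prod_beta norm_mult abs_mult mult_ac
              del: of_real_minus)
      qed measurable
    qed
    also have "\<dots> = (LINT x|lborel. cnj (h x) * (LINT s|lborel. exp (- ?e n * (norm s)\<^sup>2)
        *\<^sub>R (iexp (- (s \<bullet> x)) * fourier_int h s)))"
      unfolding integral_mult_right_zero[symmetric]
      by (intro Bochner_Integration.integral_cong refl) (simp add: mult_ac)
    also have "\<dots> = (LINT x|lborel. cnj (h x) * (complex_of_real ((2 * sqrt pi) ^ DIM('a))
        * gauss_mean (2 * sqrt (?e n)) h x))"
      by (subst regularised_inversion[OF h]) simp_all
    also have "\<dots> = complex_of_real ((2 * sqrt pi) ^ DIM('a))
        * (LINT x|lborel. cnj (h x) * gauss_mean (2 * sqrt (?e n)) h x)"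
      unfolding integral_mult_right_zero[symmetric]
      by (intro Bochner_Integration.integral_cong refl) (simp add: mult_ac)
    finally show ?thesis .
  qed
  have "(\<lambda>n. complex_of_real (?g n)) \<longlonglongrightarrow> complex_of_real ((2 * sqrt pi) ^ DIM('a))
      * (LINT x|lborel. cnj (h x) * (complex_of_real (sqrt pi ^ DIM('a)) * h x))"
    unfolding id
  proof (intro tendsto_mult tendsto_const integral_dominated_convergence[where
      w="\<lambda>x. (C * sqrt pi ^ DIM('a)) * norm (h x)"])
    show "(\<lambda>x. cnj (h x) * gauss_mean (2 * sqrt (?e n)) h x) \<in> borel_measurable lborel" for n
      unfolding gauss_mean_def by measurable
    show "AE x in lborel. (\<lambda>n. cnj (h x) * gauss_mean (2 * sqrt (?e n)) h x)
        \<longlonglongrightarrow> cnj (h x) * (complex_of_real (sqrt pi ^ DIM('a)) * h x)"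
      using cont by eventually_elim
        (intro tendsto_mult tendsto_const gauss_mean_tendsto[OF _ C] inverse_nat_tendsto; simp)
    show "AE x in lborel. norm (cnj (h x) * gauss_mean (2 * sqrt (?e n)) h x)
        \<le> C * sqrt pi ^ DIM('a) * norm (h x)" for n
      using norm_gauss_mean_le[of h, OF C] by (intro AE_I2) (auto simp: norm_mult mult.commute
          intro!: mult_left_mono)
  qed (use h in auto)
  also have "complex_of_real ((2 * sqrt pi) ^ DIM('a))
      * (LINT x|lborel. cnj (h x) * (complex_of_real (sqrt pi ^ DIM('a)) * h x))
     = complex_of_real ((2 * pi) ^ DIM('a) * (LINT x|lborel. (norm (h x))\<^sup>2))"
  proof -
    have "(LINT x|lborel. cnj (h x) * (complex_of_real (sqrt pi ^ DIM('a)) * h x))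
      = (LINT x|lborel. complex_of_real (sqrt pi ^ DIM('a) * (norm (h x))\<^sup>2))"
      by (intro Bochner_Integration.integral_cong refl)
        (simp only: of_real_mult complex_norm_square mult_ac)
    also have "\<dots> = complex_of_real (sqrt pi ^ DIM('a) * (LINT x|lborel. (norm (h x))\<^sup>2))"
      by (simp only: integral_complex_of_real integral_mult_right_zero)
    finally show ?thesis
      by (simp only: mult.assoc[symmetric] of_real_mult[symmetric] two_sqrt_pi_power)
  qed
  finally have lim: "?g \<longlonglongrightarrow> (2 * pi) ^ DIM('a) * (LINT x|lborel. (norm (h x))\<^sup>2)"
    unfolding tendsto_of_real_iff .
  have g_nn: "(\<integral>\<^sup>+s. ennreal (exp (- ?e n * (norm s)\<^sup>2) * (norm (fourier_int h s))\<^sup>2) \<partial>lborel)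
      = ennreal (?g n)" for n
    by (rule nn_integral_eq_integral[OF g_int]) simp
  \<comment> \<open>Square integrability of the transform is part of the conclusion, so on this side
    the limit is taken by monotone convergence in \<open>ennreal\<close>.\<close>
  have "(\<lambda>n. \<integral>\<^sup>+s. ennreal (exp (- ?e n * (norm s)\<^sup>2) * (norm (fourier_int h s))\<^sup>2) \<partial>lborel)
     \<longlonglongrightarrow> (\<integral>\<^sup>+s. ennreal ((norm (fourier_int h s))\<^sup>2) \<partial>lborel)"
  proof (rule nn_integral_LIMSEQ)
    show "incseq (\<lambda>n s. ennreal (exp (- ?e n * (norm s)\<^sup>2) * (norm (fourier_int h s))\<^sup>2))"
      by (intro monoI le_funI ennreal_leI mult_right_mono)
         (auto intro!: mult_right_mono simp: field_simps)
    show "(\<lambda>n. ennreal (exp (- ?e n * (norm s)\<^sup>2) * (norm (fourier_int h s))\<^sup>2))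
        \<longlonglongrightarrow> ennreal ((norm (fourier_int h s))\<^sup>2)" for s
    proof -
      have "(\<lambda>n. exp (- ?e n * (norm s)\<^sup>2) * (norm (fourier_int h s))\<^sup>2)
          \<longlonglongrightarrow> exp (- 0 * (norm s)\<^sup>2) * (norm (fourier_int h s))\<^sup>2"
        by (intro tendsto_intros inverse_nat_tendsto)
      then show ?thesis by (intro tendsto_ennrealI) simp
    qed
  qed measurable
  moreover have "(\<lambda>n. \<integral>\<^sup>+s. ennreal (exp (- ?e n * (norm s)\<^sup>2) * (norm (fourier_int h s))\<^sup>2)
      \<partial>lborel)
     \<longlonglongrightarrow> ennreal ((2 * pi) ^ DIM('a) * (LINT x|lborel. (norm (h x))\<^sup>2))"
    unfolding g_nn by (rule tendsto_ennrealI[OF lim])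
  ultimately have "(\<integral>\<^sup>+s. ennreal ((norm (fourier_int h s))\<^sup>2) \<partial>lborel)
      = ennreal ((2 * pi) ^ DIM('a) * (LINT x|lborel. (norm (h x))\<^sup>2))"
    by (rule LIMSEQ_unique)
  then show ?thesis
    by (simp add: ennreal_mult nn_integral_eq_integral[OF h2])
qed

section \<open>The space of square integrable functions\<close>

lemma L2I:
  assumes "f \<in> borel_measurable lebesgue" "(\<integral>\<^sup>+x. ennreal ((norm (f x))\<^sup>2) \<partial>lebesgue) < \<infinity>"
  shows "f \<in> L2"
  using assms by (auto simp: L2_def integrable_iff_bounded)

lemma L2_measurable: "f \<in> L2 \<Longrightarrow> f \<in> borel_measurable lebesgue"
  and L2_integrable: "f \<in> L2 \<Longrightarrow> integrable lebesgue (\<lambda>x. (norm (f x))\<^sup>2)"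
  by (auto simp: L2_def)

lemma L2_norm_nonneg [simp]: "L2_norm f \<ge> 0"
  by (simp add: L2_norm_def)

lemma L2_norm_power2: "(L2_norm f)\<^sup>2 = (LINT x|lebesgue. (norm (f x))\<^sup>2)"
  by (simp add: L2_norm_def)

lemma nn_integral_L2:
  "f \<in> L2 \<Longrightarrow> (\<integral>\<^sup>+x. ennreal ((norm (f x))\<^sup>2) \<partial>lebesgue) = ennreal ((L2_norm f)\<^sup>2)"
  unfolding L2_norm_power2 by (intro nn_integral_eq_integral) (auto simp: L2_def)

lemma L2_norm_le_iff:
  assumes "f \<in> L2" "c \<ge> 0"
  shows "L2_norm f \<le> c \<longleftrightarrow> (\<integral>\<^sup>+x. ennreal ((norm (f x))\<^sup>2) \<partial>lebesgue) \<le> ennreal (c\<^sup>2)"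
  unfolding nn_integral_L2[OF assms(1)] using assms(2)
  by (simp add: ennreal_le_iff abs_le_square_iff[symmetric])

lemma L2_norm_le:
  assumes "f \<in> borel_measurable lebesgue" "c \<ge> 0" "(\<integral>\<^sup>+x. ennreal ((norm (f x))\<^sup>2) \<partial>lebesgue)
      \<le> ennreal (c\<^sup>2)"
  shows "f \<in> L2" "L2_norm f \<le> c"
proof -
  show "f \<in> L2" using assms by (intro L2I) (auto simp: order_le_less_trans)
  with assms show "L2_norm f \<le> c" by (simp add: L2_norm_le_iff)
qed

lemma L2_AE_eq:
  assumes "f \<in> L2" "g \<in> borel_measurable lebesgue" "AE x in lebesgue. f x = g x"
  shows "g \<in> L2" "L2_norm g = L2_norm f"
proof -
  note [measurable] = assms(2) L2_measurable[OF assms(1)]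
  have "AE x in lebesgue. (norm (f x))\<^sup>2 = (norm (g x))\<^sup>2"
    using assms(3) by eventually_elim simp
  then show "g \<in> L2" "L2_norm g = L2_norm f"
    using assms integrable_cong_AE[of "\<lambda>x. (norm (f x))\<^sup>2" lebesgue "\<lambda>x. (norm (g x))\<^sup>2"]
      integral_cong_AE[of "\<lambda>x. (norm (f x))\<^sup>2" lebesgue "\<lambda>x. (norm (g x))\<^sup>2"]
    by (auto simp: L2_def L2_norm_def)
qed

lemma L2_norm_eq_0:
  assumes "f \<in> L2" "L2_norm f = 0"
  shows "AE x in lebesgue. f x = 0"
proof -
  have "(LINT x|lebesgue. (norm (f x))\<^sup>2) = 0" using assms by (simp add: L2_norm_def)
  then have "AE x in lebesgue. (norm (f x))\<^sup>2 = 0"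
    using integral_nonneg_eq_0_iff_AE[OF L2_integrable[OF assms(1)]] by simp
  then show ?thesis by eventually_elim simp
qed

lemma L2_mult:
  assumes "f \<in> L2"
  shows "(\<lambda>x. c * f x) \<in> L2" "L2_norm (\<lambda>x. c * f x) = norm c * L2_norm f"
proof -
  note [measurable] = L2_measurable[OF assms]
  have i: "integrable lebesgue (\<lambda>x. (norm c)\<^sup>2 * (norm (f x))\<^sup>2)"
    using L2_integrable[OF assms] by simp
  then show "(\<lambda>x. c * f x) \<in> L2" by (simp add: L2_def norm_mult power_mult_distrib)
  show "L2_norm (\<lambda>x. c * f x) = norm c * L2_norm f"
    by (simp add: L2_norm_def norm_mult power_mult_distrib real_sqrt_mult)
qed

text \<open>The step from a pointwise quadratic bound with a free parameter to Minkowski's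
  inequality. The best choice is \<open>t = b / a\<close>; adding \<open>e\<close> to both numbers
  avoids a division by zero, and \<open>e\<close> then tends to 0.\<close>

lemma le_square_sum:
  fixes X a b :: real
  assumes X: "\<And>t. t > 0 \<Longrightarrow> X \<le> (1 + t) * a\<^sup>2 + (1 + 1 / t) * b\<^sup>2" and ab: "a \<ge> 0" "b \<ge> 0"
  shows "X \<le> (a + b)\<^sup>2"
proof -
  have "X \<le> (a + b + 2 * e)\<^sup>2" if "e > 0" for e
  proof -
    have p: "a + e > 0" "b + e > 0" using ab that by auto
    have "X \<le> (1 + (b + e) / (a + e)) * a\<^sup>2 + (1 + 1 / ((b + e) / (a + e))) * b\<^sup>2"
      by (rule X) (use p in simp)
    also have "\<dots> \<le> (1 + (b + e) / (a + e)) * (a + e)\<^sup>2 + (1 + 1 / ((b + e) / (a + e))) * (b + e)\<^sup>2"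
      using p ab that by (intro add_mono mult_left_mono power_mono) auto
    also have "\<dots> = (a + b + 2 * e)\<^sup>2"
      using p by (simp add: divide_simps power2_eq_square) algebra
    finally show ?thesis .
  qed
  then have "eventually (\<lambda>e. X \<le> (a + b + 2 * e)\<^sup>2) (at_right 0)"
    by (auto simp: eventually_at_right_field intro: exI[of _ 1])
  moreover have "((\<lambda>e. (a + b + 2 * e)\<^sup>2) \<longlongrightarrow> (a + b + 2 * 0)\<^sup>2) (at_right 0)"
    by (intro tendsto_intros)
  ultimately have "X \<le> (a + b + 2 * 0)\<^sup>2"
    using tendsto_lowerbound[of "\<lambda>e. (a + b + 2 * e)\<^sup>2"] by (metis trivial_limit_at_right_real)
  then show ?thesis by simp
qed

lemma norm_add_square_le:
  fixes y z :: complex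
  assumes t: "t > 0"
  shows "(norm (y + z))\<^sup>2 \<le> (1 + t) * (norm y)\<^sup>2 + (1 + 1 / t) * (norm z)\<^sup>2"
proof -
  have "(norm (y + z))\<^sup>2 \<le> (norm y + norm z)\<^sup>2" by (intro power_mono norm_triangle_ineq) simp
  also have "\<dots> \<le> (1 + t) * (norm y)\<^sup>2 + (1 + 1 / t) * (norm z)\<^sup>2"
  proof -
    have "0 \<le> (t * norm y - norm z)\<^sup>2 / t" using t by simp
    also have "\<dots> = (1 + t) * (norm y)\<^sup>2 + (1 + 1 / t) * (norm z)\<^sup>2 - (norm y + norm z)\<^sup>2"
      using t by (simp add: divide_simps power2_eq_square) algebra
    finally show ?thesis by simp
  qed
  finally show ?thesis .
qed

lemma L2_add:
  assumes "f \<in> L2" "g \<in> L2"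
  shows "(\<lambda>x. f x + g x) \<in> L2" "L2_norm (\<lambda>x. f x + g x) \<le> L2_norm f + L2_norm g"
proof -
  note [measurable] = assms[THEN L2_measurable]
  have i: "integrable lebesgue (\<lambda>x. (1 + t) * (norm (f x))\<^sup>2 + (1 + 1 / t) * (norm (g x))\<^sup>2)" for t
    using assms[THEN L2_integrable] by simp
  have "integrable lebesgue (\<lambda>x. (norm (f x + g x))\<^sup>2)"
    by (rule Bochner_Integration.integrable_bound[OF i[of 1]])
      (use norm_add_square_le[of 1] in \<open>auto simp: abs_of_nonneg\<close>)
  then show L: "(\<lambda>x. f x + g x) \<in> L2" by (simp add: L2_def)
  have "(L2_norm (\<lambda>x. f x + g x))\<^sup>2 \<le> (L2_norm f + L2_norm g)\<^sup>2"
  proof (rule le_square_sum)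
    fix t :: real assume t: "t > 0"
    have "(L2_norm (\<lambda>x. f x + g x))\<^sup>2 \<le> (LINT x|lebesgue. (1 + t) * (norm (f x))\<^sup>2 + (1 + 1 / t)
        * (norm (g x))\<^sup>2)"
      unfolding L2_norm_power2
      by (rule integral_mono[OF L2_integrable[OF L] i]) (rule norm_add_square_le[OF t])
    also have "\<dots> = (1 + t) * (L2_norm f)\<^sup>2 + (1 + 1 / t) * (L2_norm g)\<^sup>2"
      unfolding L2_norm_power2 using assms[THEN L2_integrable]
          by (subst Bochner_Integration.integral_add) simp_all
    finally show "(L2_norm (\<lambda>x. f x + g x))\<^sup>2
        \<le> (1 + t) * (L2_norm f)\<^sup>2 + (1 + 1 / t) * (L2_norm g)\<^sup>2" .
  qed simp_all
  then show "L2_norm (\<lambda>x. f x + g x) \<le> L2_norm f + L2_norm g"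
    by (rule power2_le_imp_le) simp
qed

lemma L2_lincomb:
  assumes "f \<in> L2" "g \<in> L2"
  shows "(\<lambda>x. a * f x + b * g x) \<in> L2"
  using assms by (intro L2_add L2_mult)

lemma L2_diff:
  assumes "f \<in> L2" "g \<in> L2"
  shows "(\<lambda>x. f x - g x) \<in> L2" "L2_norm (\<lambda>x. f x - g x) \<le> L2_norm f + L2_norm g"
  using L2_add[OF assms(1) L2_mult(1)[OF assms(2), of "-1"]] L2_mult(2)[OF assms(2), of "-1"]
      by simp_all

lemma L2_norm_minus_commute: "L2_norm (\<lambda>x. f x - g x) = L2_norm (\<lambda>x. g x - f x)"
  by (simp add: L2_norm_def norm_minus_commute)

lemma L2_triangle:
  assumes "f \<in> L2" "g \<in> L2" "h \<in> L2"
  shows "L2_norm (\<lambda>x. f x - h x) \<le> L2_norm (\<lambda>x. f x - g x) + L2_norm (\<lambda>x. g x - h x)"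
  using L2_add(2)[OF L2_diff(1)[OF assms(1,2)] L2_diff(1)[OF assms(2,3)]] by simp

lemma L2_norm_le_diff:
  assumes "f \<in> L2" "g \<in> L2"
  shows "L2_norm f \<le> L2_norm g + L2_norm (\<lambda>x. f x - g x)"
  using L2_add(2)[OF assms(2) L2_diff(1)[OF assms]] by simp

lemma L2_zero: "(\<lambda>x. 0) \<in> L2" "L2_norm (\<lambda>x. 0) = 0"
  by (simp_all add: L2_def L2_norm_def)

lemma L2_sum:
  assumes "finite I" "\<And>i. i \<in> I \<Longrightarrow> f i \<in> L2"
  shows "(\<lambda>x. \<Sum>i\<in>I. f i x) \<in> L2" "L2_norm (\<lambda>x. \<Sum>i\<in>I. f i x) \<le> (\<Sum>i\<in>I. L2_norm (f i))"
proof -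
  have "(\<lambda>x. \<Sum>i\<in>I. f i x) \<in> L2 \<and> L2_norm (\<lambda>x. \<Sum>i\<in>I. f i x) \<le> (\<Sum>i\<in>I. L2_norm (f i))"
    using assms
  proof (induction rule: finite_induct)
    case (insert i I)
    then have "f i \<in> L2" "(\<lambda>x. \<Sum>i\<in>I. f i x) \<in> L2" "L2_norm (\<lambda>x. \<Sum>i\<in>I. f i x)
        \<le> (\<Sum>i\<in>I. L2_norm (f i))" by auto
    from L2_add[OF this(1,2)] this(3) insert(1,2) show ?case by simp
  qed (simp add: L2_zero)
  then show "(\<lambda>x. \<Sum>i\<in>I. f i x) \<in> L2" "L2_norm (\<lambda>x. \<Sum>i\<in>I. f i x) \<le> (\<Sum>i\<in>I. L2_norm (f i))" by auto
qed

section \<open>Completeness, extension by density, convergence on a dense subspace\<close>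

text \<open>The Riesz-Fischer argument for fast sequences. The squared increments have integrals of
  order \<open>(1 / 4) ^ k\<close>, so the sum of \<open>2 ^ k * D k\<close> is still integrable.
  Where it is finite, the increments are at most a constant times \<open>(1 / sqrt 2) ^ k\<close>,
  which gives pointwise convergence.\<close>

lemma L2_complete:
  assumes F: "\<And>k. F k \<in> L2" and c: "\<And>k. L2_norm (\<lambda>x. F (Suc k) x - F k x) \<le> c * (1 / 2) ^ k"
  shows "\<exists>f\<in>L2. (\<lambda>k. L2_norm (\<lambda>x. F k x - f x)) \<longlonglongrightarrow> 0"
proof -
  note [measurable] = F[THEN L2_measurable]
  have c0: "c \<ge> 0" using order_trans[OF L2_norm_nonneg c[of 0]] by simp
  define D where "D k x = (norm (F (Suc k) x - F k x))\<^sup>2" for k x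
  have D[measurable]: "D k \<in> borel_measurable lebesgue" for k unfolding D_def by measurable
  have "(\<integral>\<^sup>+x. (\<Sum>k. ennreal (2 ^ k * D k x)) \<partial>lebesgue)
      = (\<Sum>k. \<integral>\<^sup>+x. ennreal (2 ^ k * D k x) \<partial>lebesgue)"
    by (rule nn_integral_suminf) simp
  also have "\<dots> \<le> (\<Sum>k. ennreal (c\<^sup>2 * (1 / 2) ^ k))"
  proof (intro suminf_le allI)
    fix k
    have "(\<integral>\<^sup>+x. ennreal (2 ^ k * D k x) \<partial>lebesgue)
        = ennreal (2 ^ k) * (\<integral>\<^sup>+x. ennreal (D k x) \<partial>lebesgue)"
      by (simp add: ennreal_mult D_def nn_integral_cmult)
    also have "\<dots> = ennreal (2 ^ k * (L2_norm (\<lambda>x. F (Suc k) x - F k x))\<^sup>2)"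
      unfolding D_def by (subst nn_integral_L2) (auto intro: L2_diff F simp: ennreal_mult)
    also have "2 ^ k * (L2_norm (\<lambda>x. F (Suc k) x - F k x))\<^sup>2 \<le> 2 ^ k * (c * (1 / 2) ^ k)\<^sup>2"
      by (intro mult_left_mono power_mono c) auto
    also have "\<dots> = c\<^sup>2 * (1 / 2) ^ k"
      by (simp add: power_mult_distrib power2_eq_square power_divide)
    finally show "(\<integral>\<^sup>+x. ennreal (2 ^ k * D k x) \<partial>lebesgue) \<le> ennreal (c\<^sup>2 * (1 / 2) ^ k)"
      by (simp add: ennreal_leI)
  qed auto
  also have "\<dots> < \<infinity>"
    by (subst suminf_ennreal2) (auto intro!: summable_mult summable_geometric)
  finally have "AE x in lebesgue. (\<Sum>k. ennreal (2 ^ k * D k x)) \<noteq> \<infinity>"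
    by (intro nn_integral_PInf_AE) auto
  then have conv: "AE x in lebesgue. convergent (\<lambda>k. F k x)"
  proof eventually_elim
    case (elim x)
    have "summable (\<lambda>k. 2 ^ k * D k x)"
      by (rule summable_suminf_not_top) (use elim in \<open>auto simp: D_def\<close>)
    then have "(\<lambda>k. 2 ^ k * D k x) \<longlonglongrightarrow> 0" by (rule summable_LIMSEQ_zero)
    then obtain M where M: "\<And>k. norm (2 ^ k * D k x) \<le> M"
      using convergent_imp_Bseq[of "\<lambda>k. 2 ^ k * D k x"] by (auto simp: convergent_def Bseq_def)
    have "norm (F (Suc k) x - F k x) \<le> sqrt M * (1 / sqrt 2) ^ k" for k
    proof -
      have "(norm (F (Suc k) x - F k x))\<^sup>2 \<le> M * (1 / 2) ^ k"
        using M[of k] by (simp add: D_def field_simps power_divide)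
      then have "norm (F (Suc k) x - F k x) \<le> sqrt (M * (1 / 2) ^ k)"
        by (rule real_le_rsqrt)
      then show ?thesis by (simp add: real_sqrt_mult real_sqrt_power real_sqrt_divide)
    qed
    note step = this
    have "norm (1 / sqrt 2) < (1::real)" by (simp add: real_sqrt_gt_1_iff)
    then have "summable (\<lambda>k. sqrt M * (1 / sqrt 2) ^ k)" by (intro summable_mult summable_geometric)
    then have "summable (\<lambda>k. F (Suc k) x - F k x)"
      by (rule summable_comparison_test'[where N=0]) (rule step)
    then have "convergent (\<lambda>n. F 0 x + (\<Sum>k<n. F (Suc k) x - F k x))"
      by (intro convergent_add convergent_const) (simp add: summable_iff_convergent)
    then show ?case by (simp add: sum_lessThan_telescope[of "\<lambda>k. F k x"])
  qed
  define f where "f x = lim (\<lambda>k. F k x)" for x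
  have [measurable]: "f \<in> borel_measurable lebesgue"
    unfolding f_def by (rule borel_measurable_lim_metric) simp
  have lim: "AE x in lebesgue. (\<lambda>k. F k x) \<longlonglongrightarrow> f x"
    using conv by eventually_elim (simp add: f_def convergent_LIMSEQ_iff)
  \<comment> \<open>The subtracted term makes the induction close; later only the first term is
    kept.\<close>
  have tail: "L2_norm (\<lambda>x. F (k + j) x - F k x) \<le> 2 * c * (1 / 2) ^ k - 2 * c * (1 / 2) ^ (k + j)"
      for k j
  proof (induction j)
    case (Suc j)
    have "L2_norm (\<lambda>x. F (k + Suc j) x - F k x) \<le> L2_norm (\<lambda>x. F (Suc (k + j)) x - F (k + j) x) +
        L2_norm (\<lambda>x. F (k + j) x - F k x)"
      using L2_triangle[OF F F F] by simp
    also have "\<dots> \<le> c * (1 / 2) ^ (k + j) + (2 * c * (1 / 2) ^ k - 2 * c * (1 / 2) ^ (k + j))"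
      by (intro add_mono c Suc.IH)
    finally show ?case by simp
  qed (simp add: L2_zero)
  \<comment> \<open>Fatou's lemma, applied for fixed \<open>k\<close> as \<open>j\<close> grows,
    turns pointwise convergence into convergence in norm with a rate.\<close>
  have bound: "(\<integral>\<^sup>+x. ennreal ((norm (F k x - f x))\<^sup>2) \<partial>lebesgue)
      \<le> ennreal ((2 * c * (1 / 2) ^ k)\<^sup>2)" for k
  proof -
    have "(\<integral>\<^sup>+x. ennreal ((norm (F k x - f x))\<^sup>2) \<partial>lebesgue)
        = (\<integral>\<^sup>+x. liminf (\<lambda>j. ennreal ((norm (F (k + j) x - F k x))\<^sup>2)) \<partial>lebesgue)"
    proof (intro nn_integral_cong_AE)
      show "AE x in lebesgue. ennreal ((norm (F k x - f x))\<^sup>2)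
          = liminf (\<lambda>j. ennreal ((norm (F (k + j) x - F k x))\<^sup>2))"
        using lim
      proof eventually_elim
        case (elim x)
        have "(\<lambda>j. F (k + j) x) \<longlonglongrightarrow> f x" using LIMSEQ_ignore_initial_segment[OF elim, of k]
            by (simp add: add.commute)
        then have "(\<lambda>j. ennreal ((norm (F (k + j) x - F k x))\<^sup>2))
            \<longlonglongrightarrow> ennreal ((norm (f x - F k x))\<^sup>2)"
          by (intro tendsto_intros tendsto_ennrealI)
        from lim_imp_Liminf[OF trivial_limit_sequentially this] show ?case
          by (simp only: norm_minus_commute[of "f x" "F k x"])
      qed
    qed
    also have "\<dots> \<le> liminf (\<lambda>j. \<integral>\<^sup>+x. ennreal ((norm (F (k + j) x - F k x))\<^sup>2) \<partial>lebesgue)"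
      by (rule nn_integral_liminf) measurable
    also have "\<dots> \<le> liminf (\<lambda>j. ennreal ((2 * c * (1 / 2) ^ k)\<^sup>2))"
    proof (intro Liminf_mono always_eventually allI)
      fix j
      have "L2_norm (\<lambda>x. F (k + j) x - F k x) \<le> 2 * c * (1 / 2) ^ k"
      proof -
        have "0 \<le> 2 * c * (1 / 2) ^ (k + j)" using c0 by simp
        then show ?thesis using tail[of k j] by linarith
      qed
      then show "(\<integral>\<^sup>+x. ennreal ((norm (F (k + j) x - F k x))\<^sup>2) \<partial>lebesgue)
          \<le> ennreal ((2 * c * (1 / 2) ^ k)\<^sup>2)"
        using c0 L2_norm_le_iff[OF L2_diff(1)[OF F F]] by auto
    qed
    also have "\<dots> = ennreal ((2 * c * (1 / 2) ^ k)\<^sup>2)" by (simp add: Liminf_const)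
    finally show ?thesis .
  qed
  have diff: "(\<lambda>x. F k x - f x) \<in> L2" "L2_norm (\<lambda>x. F k x - f x) \<le> 2 * c * (1 / 2) ^ k" for k
    using L2_norm_le[OF _ _ bound[of k]] c0 by auto
  have "f \<in> L2" using L2_diff(1)[OF F[of 0] diff(1)[of 0]] by simp
  moreover have "(\<lambda>k. L2_norm (\<lambda>x. F k x - f x)) \<longlonglongrightarrow> 0"
  proof (rule tendsto_sandwich[OF _ _ tendsto_const])
    have "(\<lambda>k. 2 * c * (1 / 2) ^ k) \<longlonglongrightarrow> 2 * c * 0"
      by (intro tendsto_intros LIMSEQ_power_zero) simp
    then show "(\<lambda>k. 2 * c * (1 / 2) ^ k) \<longlonglongrightarrow> 0" by simp
  qed (auto simp: diff)
  ultimately show ?thesis by blast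
qed

text \<open>The conclusion spells out \<open>bounded_L2_extension\<close> with a general dense
  subspace \<open>S\<close>. \<open>T f\<close> is the limit of \<open>P\<close> along chosen
  approximations of \<open>f\<close>, with errors below \<open>(1 / 2) ^ k\<close> so that the limit
  exists by \<open>L2_complete\<close>. Linearity can only hold almost everywhere, as functions
  stand for their classes.\<close>

lemma L2_extension:
  fixes P :: "('a::euclidean_space \<Rightarrow> complex) \<Rightarrow> 'a \<Rightarrow> complex"
  assumes SL2: "S \<subseteq> L2"
    and lin: "\<And>f g a b. f \<in> S \<Longrightarrow> g \<in> S \<Longrightarrow> (\<lambda>x. a * f x + b * g x) \<in> S"
    and dense: "\<And>f e. f \<in> L2 \<Longrightarrow> e > 0 \<Longrightarrow> \<exists>g\<in>S. L2_norm (\<lambda>x. f x - g x) < e"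
    and PL2: "\<And>f. f \<in> S \<Longrightarrow> P f \<in> L2"
    and Plin: "\<And>f g a b. f \<in> S \<Longrightarrow> g \<in> S \<Longrightarrow> AE x in lebesgue. P (\<lambda>x. a * f x + b * g x) x
        = a * P f x + b * P g x"
    and Pbound: "\<And>f. f \<in> S \<Longrightarrow> L2_norm (P f) \<le> C * L2_norm f" and C0: "C \<ge> 0"
  shows "\<exists>T. (\<forall>f\<in>L2. T f \<in> L2) \<and>
     (\<forall>f\<in>L2. \<forall>g\<in>L2. \<forall>a b. AE x in lebesgue. T (\<lambda>x. a * f x + b * g x) x = a * T f x + b * T g x) \<and>
     (\<exists>C. \<forall>f\<in>L2. L2_norm (T f) \<le> C * L2_norm f) \<and>
     (\<forall>f\<in>S. AE x in lebesgue. T f x = P f x)"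
proof -
  note SD = subsetD[OF SL2]
  have Pdiff: "L2_norm (\<lambda>x. P f x - P g x) \<le> C * L2_norm (\<lambda>x. f x - g x)" if "f \<in> S" "g \<in> S" for f g
  proof -
    have S: "(\<lambda>x. 1 * f x + (-1) * g x) \<in> S" using lin that by blast
    have "AE x in lebesgue. P (\<lambda>x. 1 * f x + (-1) * g x) x = 1 * P f x + (-1) * P g x"
      using Plin that by blast
    from L2_AE_eq(2)[OF PL2[OF S] L2_measurable[OF L2_lincomb] this]
    have "L2_norm (\<lambda>x. 1 * P f x + (-1) * P g x) = L2_norm (P (\<lambda>x. 1 * f x + (-1) * g x))"
      using PL2 that by blast
    with Pbound[OF S] show ?thesis by simp
  qed
  have "\<exists>g. \<forall>k. g k \<in> S \<and> L2_norm (\<lambda>x. f x - g k x) < (1 / 2) ^ k" if "f \<in> L2" for f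
    using dense[OF that, of "(1 / 2) ^ k" for k] by (intro choice allI) (auto simp: Bex_def)
  then obtain G where G: "\<And>f k. f \<in> L2 \<Longrightarrow> G f k \<in> S" "\<And>f k. f \<in> L2 \<Longrightarrow> L2_norm (\<lambda>x. f x - G f k x)
      < (1 / 2) ^ k"
    by metis
  have half: "(\<lambda>k. (1 / 2 :: real) ^ k) \<longlonglongrightarrow> 0" by (rule LIMSEQ_power_zero) simp
  have Glim: "(\<lambda>k. L2_norm (\<lambda>x. f x - G f k x)) \<longlonglongrightarrow> 0" if "f \<in> L2" for f
    by (rule tendsto_sandwich[OF _ _ tendsto_const half])
      (auto intro!: always_eventually less_imp_le[OF G(2)] that)
  have "\<exists>h\<in>L2. (\<lambda>k. L2_norm (\<lambda>x. P (G f k) x - h x)) \<longlonglongrightarrow> 0" if f: "f \<in> L2" for f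
  proof (rule L2_complete)
    show "P (G f k) \<in> L2" for k using G f PL2 by blast
    fix k
    have "L2_norm (\<lambda>x. P (G f (Suc k)) x - P (G f k) x) \<le> C * L2_norm (\<lambda>x. G f (Suc k) x - G f k x)"
      by (intro Pdiff G f)
    also have "L2_norm (\<lambda>x. G f (Suc k) x - G f k x)
        \<le> L2_norm (\<lambda>x. G f (Suc k) x - f x) + L2_norm (\<lambda>x. f x - G f k x)"
      by (intro L2_triangle SD G f)
    also have "\<dots> \<le> (1 / 2) ^ Suc k + (1 / 2) ^ k"
      using G(2)[OF f, of "Suc k"] G(2)[OF f, of k] by (subst L2_norm_minus_commute) simp
    finally have "L2_norm (\<lambda>x. P (G f (Suc k)) x - P (G f k) x)
        \<le> C * ((1 / 2) ^ Suc k + (1 / 2) ^ k)"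
      using C0 by (simp add: mult_left_mono)
    also have "\<dots> \<le> (2 * C) * (1 / 2) ^ k" using C0 by (simp add: field_simps)
    finally show "L2_norm (\<lambda>x. P (G f (Suc k)) x - P (G f k) x) \<le> (2 * C) * (1 / 2) ^ k" .
  qed
  then obtain T where T: "\<And>f. f \<in> L2 \<Longrightarrow> T f \<in> L2" "\<And>f. f \<in> L2
      \<Longrightarrow> (\<lambda>k. L2_norm (\<lambda>x. P (G f k) x - T f x)) \<longlonglongrightarrow> 0"
    by metis
  \<comment> \<open>The limit is independent of the approximating sequence. Linearity can then be
    tested along linear combinations of the chosen sequences, and agreement with \<open>P\<close> on
    \<open>S\<close> along a constant sequence.\<close>
  have key: "(\<lambda>k. L2_norm (\<lambda>x. P (h k) x - T f x)) \<longlonglongrightarrow> 0"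
    if f: "f \<in> L2" and h: "\<And>k. h k \<in> S" "(\<lambda>k. L2_norm (\<lambda>x. f x - h k x)) \<longlonglongrightarrow> 0" for f h
  proof (rule tendsto_sandwich[OF _ _ tendsto_const])
    show "(\<lambda>k. C * (L2_norm (\<lambda>x. f x - h k x) + L2_norm (\<lambda>x. f x - G f k x)) + L2_norm
        (\<lambda>x. P (G f k) x - T f x)) \<longlonglongrightarrow> 0"
      using tendsto_add[OF tendsto_mult[OF tendsto_const[of C] tendsto_add[OF h(2) Glim[OF f]]]
          T(2)[OF f]] by simp
    have "L2_norm (\<lambda>x. P (h k) x - T f x) \<le> C * (L2_norm (\<lambda>x. f x - h k x) + L2_norm
        (\<lambda>x. f x - G f k x)) + L2_norm (\<lambda>x. P (G f k) x - T f x)" for k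
    proof -
      have "L2_norm (\<lambda>x. P (h k) x - T f x) \<le> L2_norm (\<lambda>x. P (h k) x - P (G f k) x) + L2_norm
          (\<lambda>x. P (G f k) x - T f x)"
        by (intro L2_triangle PL2 G f h T)
      moreover have "L2_norm (\<lambda>x. P (h k) x - P (G f k) x) \<le> C * L2_norm (\<lambda>x. h k x - G f k x)"
        by (intro Pdiff G f h)
      moreover have le: "L2_norm (\<lambda>x. h k x - G f k x)
          \<le> L2_norm (\<lambda>x. h k x - f x) + L2_norm (\<lambda>x. f x - G f k x)"
        by (intro L2_triangle SD G f h)
      ultimately show ?thesis
        using mult_left_mono[OF le C0] unfolding L2_norm_minus_commute[of "h k" f] by linarith
    qed
    then show "\<forall>\<^sub>F k in sequentially. L2_norm (\<lambda>x. P (h k) x - T f x)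
        \<le> C * (L2_norm (\<lambda>x. f x - h k x) + L2_norm (\<lambda>x. f x - G f k x)) + L2_norm
        (\<lambda>x. P (G f k) x - T f x)"
      by simp
  qed simp
  have unique: "AE x in lebesgue. u x = w x"
    if "u \<in> L2" "w \<in> L2" "\<And>k. H k \<in> L2" "(\<lambda>k. L2_norm (\<lambda>x. H k x - u x))
        \<longlonglongrightarrow> 0" "(\<lambda>k. L2_norm (\<lambda>x. H k x - w x)) \<longlonglongrightarrow> 0" for u w :: "'a \<Rightarrow> complex" and H
  proof -
    have "L2_norm (\<lambda>x. u x - w x) \<le> L2_norm (\<lambda>x. H k x - u x) + L2_norm (\<lambda>x. H k x - w x)" for k
      using L2_triangle[OF that(1) that(3) that(2), of k] by (simp add: L2_norm_minus_commute)
    moreover have "(\<lambda>k. L2_norm (\<lambda>x. H k x - u x) + L2_norm (\<lambda>x. H k x - w x)) \<longlonglongrightarrow> 0"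
      using tendsto_add[OF that(4,5)] by simp
    ultimately have "L2_norm (\<lambda>x. u x - w x) \<le> 0"
      by (intro LIMSEQ_le_const) auto
    then have "L2_norm (\<lambda>x. u x - w x) = 0" by (simp add: order_antisym)
    from L2_norm_eq_0[OF L2_diff(1)[OF that(1,2)] this] show ?thesis by simp
  qed
  have "AE x in lebesgue. T (\<lambda>x. a * f x + b * g x) x = a * T f x + b * T g x"
      if fg: "f \<in> L2" "g \<in> L2" for f g a b
  proof (rule unique[of "T (\<lambda>x. a * f x + b * g x)" "\<lambda>x. a * T f x + b * T g x"
      "\<lambda>k. P (\<lambda>x. a * G f k x + b * G g k x)"])
    let ?h = "\<lambda>k x. a * G f k x + b * G g k x"
    have hS: "?h k \<in> S" for k by (intro lin G fg)
    show "P (?h k) \<in> L2" for k by (rule PL2[OF hS])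
    have tri: "L2_norm (\<lambda>x. (a * u x + b * w x) - (a * u' x + b * w' x))
        \<le> norm a * L2_norm (\<lambda>x. u x - u' x) + norm b * L2_norm (\<lambda>x. w x - w' x)"
      if "u \<in> L2" "w \<in> L2" "u' \<in> L2" "w' \<in> L2" for u w u' w' :: "'a \<Rightarrow> complex"
    proof -
      have "(\<lambda>x. (a * u x + b * w x) - (a * u' x + b * w' x))
          = (\<lambda>x. a * (u x - u' x) + b * (w x - w' x))"
        by (simp add: algebra_simps)
      then show ?thesis
        using L2_add(2)[OF L2_mult(1)[OF L2_diff(1)[OF that(1,3)], of a]
            L2_mult(1)[OF L2_diff(1)[OF that(2,4)], of b]]
        by (simp add: L2_mult(2)[OF L2_diff(1)[OF that(1,3)]]
            L2_mult(2)[OF L2_diff(1)[OF that(2,4)]])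
    qed
    show "(\<lambda>k. L2_norm (\<lambda>x. P (?h k) x - T (\<lambda>x. a * f x + b * g x) x)) \<longlonglongrightarrow> 0"
    proof (rule key[OF L2_lincomb[OF fg] hS])
      show "(\<lambda>k. L2_norm (\<lambda>x. a * f x + b * g x - ?h k x)) \<longlonglongrightarrow> 0"
      proof (rule tendsto_sandwich[OF _ _ tendsto_const])
        show "(\<lambda>k. norm a * L2_norm (\<lambda>x. f x - G f k x) + norm b * L2_norm (\<lambda>x. g x - G g k x)) \<longlonglongrightarrow> 0"
          using tendsto_add[OF tendsto_mult[OF tendsto_const[of "norm a"] Glim[OF fg(1)]]
              tendsto_mult[OF tendsto_const[of "norm b"] Glim[OF fg(2)]]] by simp
      qed (auto intro!: always_eventually tri SD G fg)
    qed
    show "(\<lambda>k. L2_norm (\<lambda>x. P (?h k) x - (a * T f x + b * T g x))) \<longlonglongrightarrow> 0"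
    proof (rule tendsto_sandwich[OF _ _ tendsto_const])
      show "(\<lambda>k. norm a * L2_norm (\<lambda>x. P (G f k) x - T f x) + norm b * L2_norm
          (\<lambda>x. P (G g k) x - T g x)) \<longlonglongrightarrow> 0"
        using tendsto_add[OF tendsto_mult[OF tendsto_const[of "norm a"] T(2)[OF fg(1)]]
            tendsto_mult[OF tendsto_const[of "norm b"] T(2)[OF fg(2)]]] by simp
      have "L2_norm (\<lambda>x. P (?h k) x - (a * T f x + b * T g x))
          \<le> norm a * L2_norm (\<lambda>x. P (G f k) x - T f x) + norm b * L2_norm
          (\<lambda>x. P (G g k) x - T g x)" for k
      proof -
        have L: "(\<lambda>x. P (?h k) x - (a * T f x + b * T g x))
            \<in> L2" "(\<lambda>x. (a * P (G f k) x + b * P (G g k) x) - (a * T f x + b * T g x)) \<in> L2"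
          by (intro L2_diff L2_lincomb PL2 hS T G fg)+
        have "AE x in lebesgue. P (?h k) x - (a * T f x + b * T g x)
            = (a * P (G f k) x + b * P (G g k) x) - (a * T f x + b * T g x)"
          using Plin[OF G(1)[OF fg(1), of k] G(1)[OF fg(2), of k], of a b] by eventually_elim simp
        from L2_AE_eq(2)[OF L(1) L2_measurable[OF L(2)] this] show ?thesis
          using tri[OF PL2[OF G(1)[OF fg(1), of k]] PL2[OF G(1)[OF fg(2), of k]] T(1)[OF fg(1)]
              T(1)[OF fg(2)]] by simp
      qed
      then show "\<forall>\<^sub>F k in sequentially. L2_norm (\<lambda>x. P (?h k) x - (a * T f x + b * T g x))
          \<le> norm a * L2_norm (\<lambda>x. P (G f k) x - T f x) + norm b * L2_norm (\<lambda>x. P (G g k) x - T g x)"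
        by simp
    qed simp
  qed (intro T L2_lincomb fg)+
  moreover have "L2_norm (T f) \<le> C * L2_norm f" if f: "f \<in> L2" for f
  proof (rule LIMSEQ_le_const)
    show "(\<lambda>k. L2_norm (\<lambda>x. P (G f k) x - T f x) + C * (L2_norm f + L2_norm (\<lambda>x. f x - G f k x)))
        \<longlonglongrightarrow> C * L2_norm f"
      using tendsto_add[OF T(2)[OF f] tendsto_mult[OF tendsto_const[of C]
          tendsto_add[OF tendsto_const[of "L2_norm f"] Glim[OF f]]]] by simp
    have "L2_norm (T f) \<le> L2_norm (\<lambda>x. P (G f k) x - T f x) + C
        * (L2_norm f + L2_norm (\<lambda>x. f x - G f k x))" for k
    proof -
      have "L2_norm (T f) \<le> L2_norm (P (G f k)) + L2_norm (\<lambda>x. T f x - P (G f k) x)"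
        by (intro L2_norm_le_diff T PL2 G f)
      moreover have "L2_norm (P (G f k)) \<le> C * L2_norm (G f k)" by (intro Pbound G f)
      moreover have le: "L2_norm (G f k) \<le> L2_norm f + L2_norm (\<lambda>x. G f k x - f x)"
        by (intro L2_norm_le_diff SD G f)
      ultimately show ?thesis
        using mult_left_mono[OF le C0]
        unfolding L2_norm_minus_commute[of "G f k" f] L2_norm_minus_commute[of "T f" "P (G f k)"]
            by linarith
    qed
    then show "\<exists>N. \<forall>k\<ge>N. L2_norm (T f) \<le> L2_norm (\<lambda>x. P (G f k) x - T f x) + C
        * (L2_norm f + L2_norm (\<lambda>x. f x - G f k x))"
      by blast
  qed
  moreover have "AE x in lebesgue. T f x = P f x" if f: "f \<in> S" for f
  proof (rule unique[of _ _ "\<lambda>_. P f"])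
    show "(\<lambda>k. L2_norm (\<lambda>x. P f x - T f x)) \<longlonglongrightarrow> 0"
      by (rule key[OF SD[OF f] f]) (simp add: L2_zero)
  qed (use f SD PL2 T in \<open>auto simp: L2_zero\<close>)
  ultimately show ?thesis using T(1) by blast
qed

text \<open>The contraction property of the partial sums passes from \<open>S\<close> to all of
  \<open>L2\<close>, and a three-epsilon argument finishes. The bounds \<open>Tbound\<close> may
  depend on \<open>m\<close>; they serve to carry the contraction property over for each fixed
  \<open>M\<close>, with \<open>1 + C\<close> collecting the errors of replacing \<open>f\<close> by
  \<open>g\<close> on both sides.\<close>

lemma L2_partial_sums_converge:
  fixes T :: "nat \<Rightarrow> ('a::euclidean_space \<Rightarrow> complex) \<Rightarrow> 'a \<Rightarrow> complex"
  assumes SL2: "S \<subseteq> L2"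
    and dense: "\<And>f e. f \<in> L2 \<Longrightarrow> e > 0 \<Longrightarrow> \<exists>g\<in>S. L2_norm (\<lambda>x. f x - g x) < e"
    and T: "\<And>m f. f \<in> L2 \<Longrightarrow> T m f \<in> L2"
    and Tlin: "\<And>m f g a b. f \<in> L2 \<Longrightarrow> g \<in> L2 \<Longrightarrow> AE x in lebesgue. T m (\<lambda>x. a * f x + b * g x) x
        = a * T m f x + b * T m g x"
    and Tbound: "\<And>m. \<exists>C. \<forall>f\<in>L2. L2_norm (T m f) \<le> C * L2_norm f"
    and contr: "\<And>M f. f \<in> S \<Longrightarrow> L2_norm (\<lambda>x. \<Sum>m<M. T m f x) \<le> L2_norm f"
    and conv: "\<And>f. f \<in> S \<Longrightarrow> (\<lambda>M. L2_norm (\<lambda>x. (\<Sum>m<M. T m f x) - f x)) \<longlonglongrightarrow> 0"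
    and f: "f \<in> L2"
  shows "(\<lambda>M. L2_norm (\<lambda>x. (\<Sum>m<M. T m f x) - f x)) \<longlonglongrightarrow> 0"
proof -
  note SD = subsetD[OF SL2]
  define U where "U M f x = (\<Sum>m<M. T m f x)" for M f x
  have U: "U M f \<in> L2" if "f \<in> L2" for M f
    using L2_sum(1)[of "{..<M}" "\<lambda>m. T m f"] T that by (auto simp: U_def[abs_def])
  have Udiff: "L2_norm (\<lambda>x. U M f x - U M g x) = L2_norm (U M (\<lambda>x. f x - g x))"
      if "f \<in> L2" "g \<in> L2" for M f g
  proof -
    have "AE x in lebesgue. \<forall>m. T m (\<lambda>x. 1 * f x + (-1) * g x) x = 1 * T m f x + (-1) * T m g x"
      using Tlin that by (subst AE_all_countable) blast
    then have "AE x in lebesgue. U M (\<lambda>x. f x - g x) x = U M f x - U M g x"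
      by eventually_elim (simp add: U_def sum_subtractf)
    from L2_AE_eq(2)[OF U[OF L2_diff(1)[OF that]]
        L2_measurable[OF L2_diff(1)[OF U[OF that(1)] U[OF that(2)]]] this]
    show ?thesis .
  qed
  have Ubound: "\<exists>C\<ge>0. \<forall>f\<in>L2. L2_norm (U M f) \<le> C * L2_norm f" for M
  proof -
    from Tbound obtain C where C: "\<And>m f. f \<in> L2 \<Longrightarrow> L2_norm (T m f) \<le> C m * L2_norm f" by metis
    have "L2_norm (U M f) \<le> (\<Sum>m<M. \<bar>C m\<bar>) * L2_norm f" if "f \<in> L2" for f
    proof -
      have "L2_norm (U M f) \<le> (\<Sum>m<M. L2_norm (T m f))"
        using L2_sum(2)[of "{..<M}" "\<lambda>m. T m f"] T that by (auto simp: U_def[abs_def])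
      also have "\<dots> \<le> (\<Sum>m<M. \<bar>C m\<bar> * L2_norm f)"
        by (intro sum_mono order_trans[OF C[OF that]] mult_right_mono) auto
      finally show ?thesis by (simp add: sum_distrib_right)
    qed
    then show ?thesis by (intro exI[of _ "\<Sum>m<M. \<bar>C m\<bar>"]) (auto intro: sum_nonneg)
  qed
  have contr': "L2_norm (U M f) \<le> L2_norm f" if f: "f \<in> L2" for M f
  proof (rule field_le_epsilon)
    fix e :: real assume e: "e > 0"
    obtain C where C: "C \<ge> 0" "\<And>f. f \<in> L2 \<Longrightarrow> L2_norm (U M f) \<le> C * L2_norm f" using Ubound by blast
    obtain g where g: "g \<in> S" "L2_norm (\<lambda>x. f x - g x) < e / (1 + C)"
      using dense[OF f, of "e / (1 + C)"] e C by auto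
    have "L2_norm (U M f) \<le> L2_norm (U M g) + L2_norm (\<lambda>x. U M f x - U M g x)"
      by (intro L2_norm_le_diff U SD f g)
    also have "L2_norm (\<lambda>x. U M f x - U M g x) \<le> C * L2_norm (\<lambda>x. f x - g x)"
      unfolding Udiff[OF f SD[OF g(1)]] by (rule C(2)[OF L2_diff(1)[OF f SD[OF g(1)]]])
    also have "L2_norm (U M g) \<le> L2_norm g" using contr[OF g(1)] by (simp add: U_def[abs_def])
    also have "L2_norm g \<le> L2_norm f + L2_norm (\<lambda>x. f x - g x)"
      using L2_norm_le_diff[OF SD[OF g(1)] f] L2_norm_minus_commute[of g f] by simp
    finally have "L2_norm (U M f) \<le> L2_norm f + (1 + C) * L2_norm (\<lambda>x. f x - g x)"
      by (simp add: algebra_simps)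
    also have "(1 + C) * L2_norm (\<lambda>x. f x - g x) \<le> e"
      using g(2) C by (simp add: field_simps)
    finally show "L2_norm (U M f) \<le> L2_norm f + e" by simp
  qed
  have "(\<lambda>M. L2_norm (\<lambda>x. U M f x - f x)) \<longlonglongrightarrow> 0"
  proof (rule LIMSEQ_I)
    fix e :: real assume e: "e > 0"
    obtain g where g: "g \<in> S" "L2_norm (\<lambda>x. f x - g x) < e / 3"
      using dense[OF f, of "e / 3"] e by auto
    obtain N where N: "\<And>M. M \<ge> N \<Longrightarrow> L2_norm (\<lambda>x. U M g x - g x) < e / 3"
      using LIMSEQ_D[OF conv[OF g(1)], of "e / 3"] e by (auto simp: U_def)
    have "L2_norm (\<lambda>x. U M f x - f x) < e" if "M \<ge> N" for M
    proof -
      have "L2_norm (\<lambda>x. U M f x - f x) \<le> L2_norm (\<lambda>x. U M f x - U M g x) + L2_norm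
          (\<lambda>x. U M g x - f x)"
        by (intro L2_triangle U SD f g)
      moreover have "L2_norm (\<lambda>x. U M g x - f x)
          \<le> L2_norm (\<lambda>x. U M g x - g x) + L2_norm (\<lambda>x. g x - f x)"
        by (intro L2_triangle U SD f g)
      moreover have "L2_norm (\<lambda>x. U M f x - U M g x) \<le> L2_norm (\<lambda>x. f x - g x)"
        unfolding Udiff[OF f SD[OF g(1)]] by (rule contr'[OF L2_diff(1)[OF f SD[OF g(1)]]])
      ultimately show ?thesis using N[OF that] g(2) L2_norm_minus_commute[of g f] by linarith
    qed
    then show "\<exists>N. \<forall>M\<ge>N. norm (L2_norm (\<lambda>x. U M f x - f x) - 0) < e" by auto
  qed
  then show ?thesis by (simp add: U_def)
qed

section \<open>Schwartz functions\<close>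

lemma schwartz_differentiable:
  assumes "schwartz f"
  shows "f differentiable (at x)"
  using assms[unfolded schwartz_def, rule_format, of "[]"] by simp

lemma schwartz_continuous:
  assumes "schwartz f"
  shows "continuous_on UNIV f"
  using schwartz_differentiable[OF assms] differentiable_imp_continuous_within
  by (force simp: continuous_on_eq_continuous_within)

lemma schwartz_partial_deriv:
  assumes "schwartz f" "b \<in> Basis"
  shows "schwartz (partial_deriv b f)"
  unfolding schwartz_def
proof (intro allI impI)
  fix bs :: "'a list" assume "set bs \<subseteq> Basis"
  then have "set (bs @ [b]) \<subseteq> Basis" using assms by auto
  from assms(1)[unfolded schwartz_def, rule_format, OF this]
  show "(\<forall>x. foldr partial_deriv bs (partial_deriv b f) differentiable at x) \<and>
    (\<forall>k. bounded (range (\<lambda>x. norm x ^ k *\<^sub>R foldr partial_deriv bs (partial_deriv b f) x)))"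
    by simp
qed

lemma schwartz_foldr_partial_deriv:
  "schwartz f \<Longrightarrow> set bs \<subseteq> Basis \<Longrightarrow> schwartz (foldr partial_deriv bs f)"
  by (induction bs) (auto intro: schwartz_partial_deriv)

lemma partial_deriv_lincomb:
  fixes f g :: "'a::euclidean_space \<Rightarrow> complex"
  assumes "\<And>x. f differentiable (at x)" "\<And>x. g differentiable (at x)"
  shows "partial_deriv c (\<lambda>x. a * f x + b * g x)
      = (\<lambda>x. a * partial_deriv c f x + b * partial_deriv c g x)"
proof
  fix x
  have "((\<lambda>x. a * f x + b * g x) has_derivative
      (\<lambda>y. a * frechet_derivative f (at x) y + b * frechet_derivative g (at x) y)) (at x)"
    using assms[of x, unfolded frechet_derivative_works] by (auto intro!: derivative_intros)
  from frechet_derivative_at[OF this]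
  show "partial_deriv c (\<lambda>x. a * f x + b * g x) x = a * partial_deriv c f x + b * partial_deriv c
      g x"
    by (simp add: partial_deriv_def fun_eq_iff)
qed

lemma schwartz_lincomb:
  assumes f: "schwartz f" and g: "schwartz g"
  shows "schwartz (\<lambda>x. a * f x + b * g x)"
proof -
  have eq: "foldr partial_deriv bs (\<lambda>x. a * f x + b * g x)
      = (\<lambda>x. a * foldr partial_deriv bs f x + b * foldr partial_deriv bs g x)"
    if "set bs \<subseteq> Basis" for bs
    using that
  proof (induction bs)
    case (Cons c bs)
    then show ?case
      using schwartz_differentiable[OF schwartz_foldr_partial_deriv[OF f, of bs]]
        schwartz_differentiable[OF schwartz_foldr_partial_deriv[OF g, of bs]]
      by (simp add: partial_deriv_lincomb)
  qed simp
  show ?thesis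
    unfolding schwartz_def
  proof (intro allI impI conjI)
    fix bs :: "'a list" and x k assume bs: "set bs \<subseteq> Basis"
    show "foldr partial_deriv bs (\<lambda>x. a * f x + b * g x) differentiable at x"
      unfolding eq[OF bs]
      using schwartz_differentiable[OF schwartz_foldr_partial_deriv[OF f bs]]
        schwartz_differentiable[OF schwartz_foldr_partial_deriv[OF g bs]]
      by (intro derivative_intros)
    have "\<exists>C. \<forall>x. norm (norm x ^ k *\<^sub>R foldr partial_deriv bs h x) \<le> C" if "schwartz h" for h
    proof -
      have "bounded (range (\<lambda>x. norm x ^ k *\<^sub>R foldr partial_deriv bs h x))"
        using that bs unfolding schwartz_def by blast
      then show ?thesis unfolding bounded_iff by blast
    qed
    from this[OF f] this[OF g] obtain C D where C:
        "\<And>x. norm (norm x ^ k *\<^sub>R foldr partial_deriv bs f x) \<le> C"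
      and D: "\<And>x. norm (norm x ^ k *\<^sub>R foldr partial_deriv bs g x) \<le> D"
      by blast
    show "bounded (range (\<lambda>x. norm x ^ k *\<^sub>R foldr partial_deriv bs (\<lambda>x. a * f x + b * g x) x))"
      unfolding eq[OF bs] bounded_iff
    proof (intro exI ballI, elim imageE, hypsubst)
      fix x
      have "norm x ^ k *\<^sub>R (a * foldr partial_deriv bs f x + b * foldr partial_deriv bs g x)
        = a * (norm x ^ k *\<^sub>R foldr partial_deriv bs f x) + b
            * (norm x ^ k *\<^sub>R foldr partial_deriv bs g x)"
        by (simp add: scaleR_right_distrib)
      also have "norm \<dots> \<le> norm a * C + norm b * D"
        by (rule norm_triangle_le) (use C D in \<open>auto simp only: norm_mult
            intro!: add_mono mult_left_mono norm_ge_zero\<close>)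
      finally show "norm (norm x ^ k *\<^sub>R (a * foldr partial_deriv bs f x + b * foldr partial_deriv
          bs g x)) \<le> norm a * C + norm b * D" .
    qed
  qed
qed

text \<open>\<open>1 / weight x\<close> is at most \<open>(1 + (norm x)\<^sup>2) ^ DIM('a)\<close>;
  the binomial theorem reduces this to the decay bounds for even powers of the norm.\<close>

lemma schwartz_weight_bound:
  fixes f :: "'a::euclidean_space \<Rightarrow> complex"
  assumes "schwartz f"
  shows "\<exists>C\<ge>0. \<forall>x. norm (f x) \<le> C * weight x"
proof -
  have "\<exists>B. \<forall>x. norm x ^ k * norm (f x) \<le> B" for k
    using assms[unfolded schwartz_def, rule_format, of "[]"] unfolding bounded_iff by auto
  then obtain B where B: "\<And>k x. norm x ^ k * norm (f x) \<le> B k" by metis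
  let ?N = "DIM('a)"
  let ?C = "\<Sum>k\<le>?N. real (?N choose k) * B (2 * k)"
  have "norm (f x) \<le> ?C * weight x" for x
  proof -
    have "1 / weight x = (\<Prod>b\<in>Basis. 1 + (x \<bullet> b)\<^sup>2)"
      by (simp add: weight_def prod_dividef)
    also have "\<dots> \<le> (\<Prod>b\<in>(Basis :: 'a set). 1 + (norm x)\<^sup>2)"
      by (intro prod_mono) (auto simp: add_nonneg_nonneg abs_le_square_iff[symmetric] Basis_le_norm)
    also have "\<dots> = (\<Sum>k\<le>?N. real (?N choose k) * norm x ^ (2 * k))"
      using binomial_ring[of "(norm x)\<^sup>2" 1 ?N] by (simp add: add.commute power_mult)
    finally have w: "1 / weight x \<le> (\<Sum>k\<le>?N. real (?N choose k) * norm x ^ (2 * k))" .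
    have "(1 / weight x) * norm (f x) \<le> (\<Sum>k\<le>?N. real (?N choose k) * norm x ^ (2 * k)) * norm (f x)"
      by (intro mult_right_mono w) simp
    also have "\<dots> = (\<Sum>k\<le>?N. real (?N choose k) * (norm x ^ (2 * k) * norm (f x)))"
      by (simp add: sum_distrib_right mult.assoc)
    also have "\<dots> \<le> ?C" by (intro sum_mono mult_left_mono B) simp
    finally show ?thesis by (simp add: field_simps)
  qed
  moreover from this[of 0] have "?C \<ge> 0"
    using weight_pos[of "0::'a"] norm_ge_zero[of "f 0"] by (smt (verit) mult_neg_pos)
  ultimately show ?thesis by blast
qed

lemma schwartz_borel_measurable: "schwartz f \<Longrightarrow> f \<in> borel_measurable borel"
  by (intro borel_measurable_continuous_onI schwartz_continuous)

lemma schwartz_L2: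
  fixes f :: "'a::euclidean_space \<Rightarrow> complex"
  assumes "schwartz f"
  shows "f \<in> L2"
proof -
  note [measurable] = schwartz_borel_measurable[OF assms]
  obtain C where C: "C \<ge> 0" "\<And>x. norm (f x) \<le> C * weight x" using schwartz_weight_bound[OF assms]
      by blast
  have "integrable lborel (\<lambda>x. (norm (f x))\<^sup>2)"
  proof (rule Bochner_Integration.integrable_bound)
    show "integrable lborel (\<lambda>x::'a. C\<^sup>2 * weight x)" using integrable_weight[where 'a='a] by simp
    have "(norm (f x))\<^sup>2 \<le> C\<^sup>2 * weight x" for x
    proof -
      have "(norm (f x))\<^sup>2 \<le> (C * weight x)\<^sup>2" by (intro power_mono C) simp
      also have "\<dots> \<le> C\<^sup>2 * weight x"
        unfolding power_mult_distrib using weight_le_1[of x] mult_left_le[of "weight x" "weight x"]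
        by (intro mult_left_mono) (auto simp: power2_eq_square)
      finally show ?thesis .
    qed
    then show "AE x in lborel. norm ((norm (f x))\<^sup>2) \<le> norm (C\<^sup>2 * weight x)" by simp
  qed measurable
  then show ?thesis by (simp add: L2_def integrable_completion measurable_completion)
qed

section \<open>Density of the Schwartz functions\<close>

text \<open>
  Differences of two shifted logistic functions approximate the indicator of an interval. The
  class of all \<open>p (\<sigma> a) - p (\<sigma> b)\<close> with a polynomial \<open>p\<close> is closed under differentiation because
  \<open>\<sigma>' = k \<sigma> (1 - \<sigma>)\<close>.
\<close>

definition logistic :: "real \<Rightarrow> real" where
  "logistic s = 1 / (1 + exp (- s))"

lemma logistic_bounds: "0 < logistic s" "logistic s < 1" "logistic s \<le> exp s" "1 - logistic s
    \<le> exp (- s)"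
proof -
  have e: "1 + exp (- s) > 0" by (simp add: add_pos_pos)
  show "0 < logistic s" "logistic s < 1" using e by (auto simp: logistic_def divide_simps)
  show "logistic s \<le> exp s" using e by (simp add: logistic_def divide_simps exp_minus)
  have "1 - logistic s = exp (- s) * logistic s" using e by (simp add: logistic_def divide_simps)
  also have "\<dots> \<le> exp (- s)" using \<open>logistic s < 1\<close> by simp
  finally show "1 - logistic s \<le> exp (- s)" .
qed

lemma has_field_derivative_logistic:
  "(logistic has_field_derivative logistic s * (1 - logistic s)) (at s)"
proof -
  have "1 + exp (- s) \<noteq> 0" using add_pos_pos[OF zero_less_one exp_gt_zero, of "- s"] by linarith
  then show ?thesis
    unfolding logistic_def[abs_def]
    by (auto intro!: derivative_eq_intros simp: divide_simps power2_eq_square)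
qed

definition bump :: "real poly \<Rightarrow> real \<Rightarrow> real \<Rightarrow> real \<Rightarrow> real \<Rightarrow> real" where
  "bump p k a b s = poly p (logistic (k * (s - a))) - poly p (logistic (k * (s - b)))"

text \<open>\<open>[:0, 1, -1:]\<close> is the polynomial \<open>x * (1 - x)\<close>, which
  expresses the derivative of the logistic function through its value.\<close>

definition bump_deriv :: "real \<Rightarrow> real poly \<Rightarrow> real poly" where
  "bump_deriv k p = smult k (pderiv p * [:0, 1, -1:])"

lemma has_field_derivative_bump:
  "(bump p k a b has_field_derivative bump (bump_deriv k p) k a b s) (at s)"
  unfolding bump_def[abs_def] bump_deriv_def
  by (auto intro!: derivative_eq_intros DERIV_chain2[OF poly_DERIV]
      DERIV_chain2[OF has_field_derivative_logistic]
      simp: algebra_simps)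

text \<open>Towards either end both shifted logistic functions approach the same limit, 0 or 1, at
  rate \<open>exp (- k * |s|)\<close>. A polynomial is Lipschitz on \<open>{0..1}\<close>, so the
  difference inherits the rate, whatever \<open>p\<close> is.\<close>

lemma bump_bound:
  assumes k: "k > 0"
  shows "\<exists>L\<ge>0. \<forall>s. \<bar>bump p k a b s\<bar> \<le> L * exp (- (k * \<bar>s\<bar>))"
proof -
  have "compact (poly (pderiv p) ` {0..1})"
    by (intro compact_continuous_image continuous_intros) simp
  then have "bounded (poly (pderiv p) ` {0..1})" by (rule compact_imp_bounded)
  then obtain M where M: "\<And>x. x \<in> {0..1} \<Longrightarrow> \<bar>poly (pderiv p) x\<bar> \<le> M"
    unfolding bounded_iff by (auto simp del: atLeastAtMost_iff)
  have lip: "\<bar>poly p x - poly p y\<bar> \<le> M * \<bar>x - y\<bar>" if "x \<in> {0..1}" "y \<in> {0..1}" for x y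
  proof -
    have "\<exists>z\<in>{0..1}. poly p x - poly p y = (x - y) * poly (pderiv p) z"
      by (rule poly_MVT') (use that in auto)
    then obtain z where z: "z \<in> {0..1}" "poly p x - poly p y = (x - y) * poly (pderiv p) z" by blast
    show ?thesis unfolding z(2) abs_mult using M[OF z(1)]
        by (subst mult.commute) (intro mult_right_mono, auto)
  qed
  have M0: "M \<ge> 0" using M[of 0] by simp
  define c where "c = \<bar>a\<bar> + \<bar>b\<bar>"
  have dec: "\<bar>logistic (k * (s - a)) - logistic (k * (s - b))\<bar> \<le> exp (k * c) * exp (- (k * \<bar>s\<bar>))"
      for s
  proof (cases "s \<ge> 0")
    case True
    have *: "1 - logistic (k * (s - d)) \<le> exp (k * c) * exp (- (k * \<bar>s\<bar>))" if "\<bar>d\<bar> \<le> c" for d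
    proof -
      have "k * d \<le> k * c" using that k by (intro mult_left_mono) auto
      then have "exp (- (k * (s - d))) \<le> exp (k * c - k * s)" by (simp add: algebra_simps)
      then show ?thesis using logistic_bounds(4)[of "k * (s - d)"] True
          by (simp add: exp_diff exp_minus divide_inverse)
    qed
    from *[of a] *[of b] logistic_bounds(2)[of "k * (s - a)"] logistic_bounds(2)[of "k * (s - b)"]
    show ?thesis by (auto simp: c_def abs_le_iff)
  next
    case False
    have *: "logistic (k * (s - d)) \<le> exp (k * c) * exp (- (k * \<bar>s\<bar>))" if "\<bar>d\<bar> \<le> c" for d
    proof -
      have "k * (- d) \<le> k * c" using that k by (intro mult_left_mono) auto
      then have "exp (k * (s - d)) \<le> exp (k * c + k * s)" by (simp add: algebra_simps)
      then show ?thesis using logistic_bounds(3)[of "k * (s - d)"] False by (simp add: exp_add)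
    qed
    from *[of a] *[of b] logistic_bounds(1)[of "k * (s - a)"] logistic_bounds(1)[of "k * (s - b)"]
    show ?thesis by (auto simp: c_def abs_le_iff)
  qed
  have "\<bar>bump p k a b s\<bar> \<le> (M * exp (k * c)) * exp (- (k * \<bar>s\<bar>))" for s
  proof -
    have "\<bar>bump p k a b s\<bar> \<le> M * \<bar>logistic (k * (s - a)) - logistic (k * (s - b))\<bar>"
      unfolding bump_def by (rule lip) (auto intro!: less_imp_le logistic_bounds)
    also have "\<dots> \<le> M * (exp (k * c) * exp (- (k * \<bar>s\<bar>)))" by (intro mult_left_mono dec M0)
    finally show ?thesis by (simp add: mult_ac)
  qed
  then show ?thesis using M0 by (intro exI[of _ "M * exp (k * c)"]) auto
qed

lemma bump_rapid:
  assumes k: "k > 0"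
  shows "\<exists>L. \<forall>s. (1 + \<bar>s\<bar>) ^ m * \<bar>bump p k a b s\<bar> \<le> L"
proof -
  obtain L where L: "L \<ge> 0" "\<And>s. \<bar>bump p k a b s\<bar> \<le> L * exp (- (k * \<bar>s\<bar>))"
    using bump_bound[OF k] by blast
  \<comment> \<open>Chosen so that the \<open>m\<close>-th power of \<open>exp (d * |s|)\<close>
    stays below \<open>exp (k * |s|)\<close>; \<open>Suc m\<close> keeps the quotient meaningful for
    \<open>m = 0\<close>.\<close>
  define d where "d = k / real (Suc m)"
  define C where "C = max 1 (1 / d)"
  have d: "d > 0" "real m * d \<le> k" using k by (auto simp: d_def field_simps)
  have C: "C \<ge> 1" "C * d \<ge> 1" using d by (auto simp: C_def max_def field_simps)
  have le: "(1 + \<bar>s\<bar>) ^ m \<le> C ^ m * exp (k * \<bar>s\<bar>)" for s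
  proof -
    have "1 + \<bar>s\<bar> \<le> C * 1 + (C * d) * \<bar>s\<bar>"
      using C mult_right_mono[OF C(2), of "\<bar>s\<bar>"] by simp
    also have "\<dots> = C * (1 + d * \<bar>s\<bar>)" by (simp add: algebra_simps)
    also have "\<dots> \<le> C * exp (d * \<bar>s\<bar>)" using C by (intro mult_left_mono exp_ge_add_one_self) auto
    finally have "(1 + \<bar>s\<bar>) ^ m \<le> (C * exp (d * \<bar>s\<bar>)) ^ m" by (intro power_mono) auto
    also have "\<dots> = C ^ m * exp ((real m * d) * \<bar>s\<bar>)"
      by (simp add: power_mult_distrib exp_of_nat_mult[symmetric] mult.assoc)
    also have "\<dots> \<le> C ^ m * exp (k * \<bar>s\<bar>)"
      using C d by (intro mult_left_mono) (auto intro!: mult_right_mono)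
    finally show ?thesis .
  qed
  have "(1 + \<bar>s\<bar>) ^ m * \<bar>bump p k a b s\<bar> \<le> C ^ m * L" for s
  proof -
    have "(1 + \<bar>s\<bar>) ^ m * \<bar>bump p k a b s\<bar> \<le> (C ^ m * exp (k * \<bar>s\<bar>)) * (L * exp (- (k * \<bar>s\<bar>)))"
      using C by (intro mult_mono le L) auto
    also have "\<dots> = C ^ m * L" by (simp add: exp_minus)
    finally show ?thesis .
  qed
  then show ?thesis by blast
qed

text \<open>Each coordinate carries its own polynomial, so that a partial derivative changes one
  polynomial and stays in the family. One decay bound, uniform in form, then covers all iterated
  derivatives.\<close>

definition tensor_bump :: "('a::euclidean_space \<Rightarrow> real poly) \<Rightarrow> real \<Rightarrow> 'a \<Rightarrow> 'a \<Rightarrow> 'a \<Rightarrow> complex" where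
  "tensor_bump p k l u x = complex_of_real (\<Prod>b\<in>Basis. bump (p b) k (l \<bullet> b) (u \<bullet> b) (x \<bullet> b))"

lemma has_derivative_tensor_bump:
  "(tensor_bump p k l u has_derivative
     (\<lambda>y. complex_of_real (\<Sum>i\<in>Basis. (bump (bump_deriv k (p i)) k (l \<bullet> i) (u \<bullet> i) (x \<bullet> i) * (y \<bullet> i))
        * (\<Prod>j\<in>Basis - {i}. bump (p j) k (l \<bullet> j) (u \<bullet> j) (x \<bullet> j))))) (at x)"
  unfolding tensor_bump_def[abs_def]
  by (intro has_derivative_of_real has_derivative_prod
      has_field_derivative_bump[unfolded has_field_derivative_def, THEN
          has_derivative_compose[rotated]]
      has_derivative_inner_left has_derivative_ident)

lemma partial_deriv_tensor_bump:
  assumes c: "c \<in> Basis"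
  shows "partial_deriv c (tensor_bump p k l u) = tensor_bump (p(c := bump_deriv k (p c))) k l u"
proof
  fix x
  let ?g = "\<lambda>i. bump (bump_deriv k (p i)) k (l \<bullet> i) (u \<bullet> i) (x \<bullet> i)"
  let ?r = "\<lambda>i. \<Prod>j\<in>Basis - {i}. bump (p j) k (l \<bullet> j) (u \<bullet> j) (x \<bullet> j)"
  have "partial_deriv c (tensor_bump p k l u) x
      = complex_of_real (\<Sum>i\<in>Basis. (?g i * (c \<bullet> i)) * ?r i)"
    unfolding partial_deriv_def by (simp add: frechet_derivative_at[OF has_derivative_tensor_bump,
        symmetric])
  also have "(\<Sum>i\<in>Basis. (?g i * (c \<bullet> i)) * ?r i) = (\<Sum>i\<in>Basis. if i = c then ?g i * ?r i else 0)"
    using c by (intro sum.cong) (auto simp: inner_Basis)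
  also have "\<dots> = ?g c * ?r c" using c by simp
  also have "?r c = (\<Prod>j\<in>Basis - {c}. bump ((p(c := bump_deriv k (p c))) j) k (l \<bullet> j) (u \<bullet> j)
      (x \<bullet> j))"
    by (intro prod.cong) auto
  finally show "partial_deriv c (tensor_bump p k l u) x
      = tensor_bump (p(c := bump_deriv k (p c))) k l u x"
    unfolding tensor_bump_def using c by (subst prod.remove[OF finite_Basis c]) simp
qed

text \<open>Serves to bound the norm by a product over coordinates, so that a power of the norm can
  be distributed over the factors of a \<open>tensor_bump\<close>.\<close>

lemma sum_le_prod_one_plus:
  fixes a :: "'i \<Rightarrow> real"
  assumes "\<And>i. i \<in> I \<Longrightarrow> a i \<ge> 0"
  shows "1 + sum a I \<le> (\<Prod>i\<in>I. 1 + a i)"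
  using assms
proof (induction I rule: infinite_finite_induct)
  case (insert x F)
  have "1 + sum a (insert x F) \<le> (1 + a x) * (1 + sum a F)"
    using insert sum_nonneg[of F a] by (simp add: algebra_simps)
  also have "\<dots> \<le> (1 + a x) * (\<Prod>i\<in>F. 1 + a i)"
    using insert by (intro mult_left_mono insert.IH) auto
  finally show ?case using insert by simp
qed auto

lemma schwartz_tensor_bump:
  fixes p :: "'a::euclidean_space \<Rightarrow> real poly"
  assumes k: "k > 0"
  shows "schwartz (tensor_bump p k l u)"
proof -
  have ex: "\<exists>p'. foldr partial_deriv bs (tensor_bump p k l u) = tensor_bump p' k l u"
    if "set bs \<subseteq> Basis" for bs
    using that
  proof (induction bs)
    case (Cons c bs)
    then show ?case using partial_deriv_tensor_bump[of c] by force
  qed auto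
  have bdd: "bounded (range (\<lambda>x. norm x ^ m *\<^sub>R tensor_bump p k l u x))" for p :: "'a \<Rightarrow> real poly"
      and m
  proof -
    have "\<exists>L. \<forall>b s. (1 + \<bar>s\<bar>) ^ m * \<bar>bump (p b) k (l \<bullet> b) (u \<bullet> b) s\<bar> \<le> L b"
      by (rule choice) (intro allI bump_rapid[OF k])
    then obtain L where L: "\<And>b s. (1 + \<bar>s\<bar>) ^ m * \<bar>bump (p b) k (l \<bullet> b) (u \<bullet> b) s\<bar> \<le> L b" by blast
    have "norm (norm x ^ m *\<^sub>R tensor_bump p k l u x) \<le> (\<Prod>b\<in>Basis. L b)" for x
    proof -
      have "norm x \<le> (\<Sum>b\<in>Basis. \<bar>x \<bullet> b\<bar>)" by (rule norm_le_l1)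
      also have "\<dots> \<le> (\<Prod>b\<in>Basis. 1 + \<bar>x \<bullet> b\<bar>)"
        using sum_le_prod_one_plus[of Basis "\<lambda>b. \<bar>x \<bullet> b\<bar>"] by simp
      finally have "norm x ^ m \<le> (\<Prod>b\<in>Basis. 1 + \<bar>x \<bullet> b\<bar>) ^ m" by (intro power_mono) auto
      then have "norm x ^ m * (\<Prod>b\<in>Basis. \<bar>bump (p b) k (l \<bullet> b) (u \<bullet> b) (x \<bullet> b)\<bar>)
        \<le> (\<Prod>b\<in>Basis. 1 + \<bar>x \<bullet> b\<bar>) ^ m * (\<Prod>b\<in>Basis. \<bar>bump (p b) k (l \<bullet> b) (u \<bullet> b) (x \<bullet> b)\<bar>)"
        by (intro mult_right_mono prod_nonneg) auto
      also have "\<dots> = (\<Prod>b\<in>Basis. (1 + \<bar>x \<bullet> b\<bar>) ^ m * \<bar>bump (p b) k (l \<bullet> b) (u \<bullet> b) (x \<bullet> b)\<bar>)"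
        by (simp add: prod.distrib prod_power_distrib)
      also have "\<dots> \<le> (\<Prod>b\<in>Basis. L b)" by (intro prod_mono conjI L) simp
      finally show ?thesis by (simp add: tensor_bump_def abs_prod flip: of_real_prod)
    qed
    then show ?thesis unfolding bounded_iff by blast
  qed
  show ?thesis
    unfolding schwartz_def
  proof (intro allI impI conjI)
    fix bs :: "'a list" and x m assume "set bs \<subseteq> Basis"
    then obtain p' where p': "foldr partial_deriv bs (tensor_bump p k l u) = tensor_bump p' k l u"
        using ex by blast
    show "foldr partial_deriv bs (tensor_bump p k l u) differentiable at x"
      unfolding p' differentiable_def using has_derivative_tensor_bump by blast
    show "bounded (range (\<lambda>x. norm x ^ m *\<^sub>R foldr partial_deriv bs (tensor_bump p k l u) x))"
      unfolding p' by (rule bdd)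
  qed
qed

section \<open>The closure of the Schwartz space in the square integrable functions\<close>

lemma L2_dominated_convergence:
  assumes meas: "\<And>n. F n \<in> borel_measurable lebesgue" "f \<in> borel_measurable lebesgue"
    and lim: "AE x in lebesgue. (\<lambda>n. F n x) \<longlonglongrightarrow> f x"
    and w: "integrable lebesgue (\<lambda>x. (w x)\<^sup>2)" and bound: "\<And>n. AE x in lebesgue. norm (F n x) \<le> w x"
  shows "f \<in> L2" "\<And>n. F n \<in> L2" "(\<lambda>n. L2_norm (\<lambda>x. f x - F n x)) \<longlonglongrightarrow> 0"
proof -
  note [measurable] = meas
  have L: "h \<in> L2" if [measurable]: "h \<in> borel_measurable lebesgue"
      and "AE x in lebesgue. norm (h x) \<le> w x" for h
  proof -
    have "integrable lebesgue (\<lambda>x. (norm (h x))\<^sup>2)"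
    proof (rule Bochner_Integration.integrable_bound[OF w])
      show "AE x in lebesgue. norm ((norm (h x))\<^sup>2) \<le> norm ((w x)\<^sup>2)"
        using that(2) by eventually_elim (simp add: power_mono)
    qed measurable
    then show ?thesis by (simp add: L2_def)
  qed
  have fb: "AE x in lebesgue. norm (f x) \<le> w x"
  proof -
    have "AE x in lebesgue. \<forall>n. norm (F n x) \<le> w x" using bound by (simp add: AE_all_countable)
    then show ?thesis using lim
    proof eventually_elim
      case (elim x)
      from tendsto_upperbound[OF tendsto_norm[OF elim(2)]] elim(1) show ?case by auto
    qed
  qed
  show "f \<in> L2" "F n \<in> L2" for n by (intro L meas fb bound)+
  have "(\<lambda>n. LINT x|lebesgue. (norm (f x - F n x))\<^sup>2) \<longlonglongrightarrow> (LINT (x::'a)|lebesgue. 0)"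
  proof (rule integral_dominated_convergence[where w="\<lambda>x. 4 * (w x)\<^sup>2"])
    show "AE x in lebesgue. (\<lambda>n. (norm (f x - F n x))\<^sup>2) \<longlonglongrightarrow> 0"
      using lim
    proof eventually_elim
      case (elim x)
      have "(\<lambda>n. (norm (f x - F n x))\<^sup>2) \<longlonglongrightarrow> (norm (f x - f x))\<^sup>2" by (intro tendsto_intros elim)
      then show ?case by simp
    qed
    show "AE x in lebesgue. norm ((norm (f x - F n x))\<^sup>2) \<le> 4 * (w x)\<^sup>2" for n
      using fb bound[of n]
    proof eventually_elim
      case (elim x)
      then have "norm (f x - F n x) \<le> 2 * w x" using norm_triangle_ineq4[of "f x" "F n x"]
          by linarith
      from power_mono[OF this, of 2] show ?case by (simp add: power_mult_distrib)
    qed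
  qed (use w in auto)
  from tendsto_real_sqrt[OF this] show "(\<lambda>n. L2_norm (\<lambda>x. f x - F n x)) \<longlonglongrightarrow> 0"
    by (simp add: L2_norm_def)
qed

text \<open>Its stability under linear combinations and dominated limits is what a monotone class
  argument needs to pass from boxes to arbitrary sets.\<close>

definition schwartz_closure :: "('a::euclidean_space \<Rightarrow> complex) set" where
  "schwartz_closure = {f \<in> L2. \<forall>e>0. \<exists>g. schwartz g \<and> L2_norm (\<lambda>x. f x - g x) < e}"

lemma schwartz_closure_limit:
  assumes f: "f \<in> L2" and F: "\<And>n::nat. F n \<in> schwartz_closure"
    and lim: "(\<lambda>n. L2_norm (\<lambda>x. f x - F n x)) \<longlonglongrightarrow> 0"
  shows "f \<in> schwartz_closure"
  unfolding schwartz_closure_def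
proof (intro CollectI conjI f allI impI)
  fix e :: real assume "e > 0"
  then obtain n where n: "L2_norm (\<lambda>x. f x - F n x) < e / 2"
    using LIMSEQ_D[OF lim, of "e / 2"] by auto
  obtain g where g: "schwartz g" "L2_norm (\<lambda>x. F n x - g x) < e / 2"
    using F[of n] \<open>e > 0\<close> unfolding schwartz_closure_def by (auto dest: spec[of _ "e / 2"])
  have "L2_norm (\<lambda>x. f x - g x) \<le> L2_norm (\<lambda>x. f x - F n x) + L2_norm (\<lambda>x. F n x - g x)"
    using F[of n] by (intro L2_triangle f schwartz_L2[OF g(1)]) (auto simp: schwartz_closure_def)
  then show "\<exists>g. schwartz g \<and> L2_norm (\<lambda>x. f x - g x) < e" using g n by (intro exI[of _ g]) auto
qed

lemma schwartz_in_closure: "schwartz f \<Longrightarrow> f \<in> schwartz_closure"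
  unfolding schwartz_closure_def by (auto intro!: schwartz_L2 exI[of _ f] simp: L2_zero)

lemma schwartz_closure_dominated:
  assumes "\<And>n. F n \<in> schwartz_closure" "f \<in> borel_measurable lebesgue"
    and "AE x in lebesgue. (\<lambda>n. F n x) \<longlonglongrightarrow> f x"
    and "integrable lebesgue (\<lambda>x. (w x)\<^sup>2)" "\<And>n. AE x in lebesgue. norm (F n x) \<le> w x"
  shows "f \<in> schwartz_closure"
proof -
  have "F n \<in> borel_measurable lebesgue" for n
    using assms(1)[of n] by (auto simp: schwartz_closure_def L2_def)
  note dom = L2_dominated_convergence[OF this assms(2-5)]
  show ?thesis by (rule schwartz_closure_limit[OF dom(1) assms(1) dom(3)])
qed

lemma schwartz_closure_lincomb:
  assumes f: "f \<in> schwartz_closure" and g: "g \<in> schwartz_closure"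
  shows "(\<lambda>x. a * f x + b * g x) \<in> schwartz_closure"
  unfolding schwartz_closure_def
proof (intro CollectI conjI allI impI)
  have L: "f \<in> L2" "g \<in> L2" using f g by (auto simp: schwartz_closure_def)
  then show "(\<lambda>x. a * f x + b * g x) \<in> L2" by (rule L2_lincomb)
  fix e :: real assume e: "e > 0"
  define d where "d = e / (norm a + norm b + 1)"
  have nn: "norm a + norm b + 1 > 0" by (simp add: add_nonneg_pos)
  have d: "d > 0" "norm a * d + norm b * d < e"
  proof -
    show "d > 0" using e nn by (simp add: d_def)
    then have "norm a * d + norm b * d < (norm a + norm b + 1) * d" by (simp add: algebra_simps)
    also have "\<dots> = e" using nn by (simp add: d_def)
    finally show "norm a * d + norm b * d < e" .
  qed
  obtain f' g' where fg: "schwartz f'" "L2_norm (\<lambda>x. f x - f' x) < d" "schwartz g'"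
      "L2_norm (\<lambda>x. g x - g' x) < d"
    using f g d(1) unfolding schwartz_closure_def by blast
  have Ld: "(\<lambda>x. f x - f' x) \<in> L2" "(\<lambda>x. g x - g' x) \<in> L2"
    using L fg schwartz_L2 by (auto intro: L2_diff)
  have "L2_norm (\<lambda>x. a * (f x - f' x) + b * (g x - g' x))
      \<le> norm a * L2_norm (\<lambda>x. f x - f' x) + norm b * L2_norm (\<lambda>x. g x - g' x)"
    using L2_add(2)[OF L2_mult(1)[OF Ld(1), of a] L2_mult(1)[OF Ld(2), of b]] Ld
        by (simp add: L2_mult)
  also have "\<dots> \<le> norm a * d + norm b * d"
    using fg by (intro add_mono mult_left_mono) auto
  also have "\<dots> < e" by (rule d)
  finally have "L2_norm (\<lambda>x. (a * f x + b * g x) - (a * f' x + b * g' x)) < e"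
    by (simp add: algebra_simps)
  then show "\<exists>h. schwartz h \<and> L2_norm (\<lambda>x. (a * f x + b * g x) - h x) < e"
    using schwartz_lincomb[OF fg(1,3)] by blast
qed

lemma schwartz_closure_sum:
  fixes f :: "'i \<Rightarrow> 'a::euclidean_space \<Rightarrow> complex"
  assumes "finite I" "\<And>i. i \<in> I \<Longrightarrow> f i \<in> schwartz_closure"
  shows "(\<lambda>x. \<Sum>i\<in>I. f i x) \<in> schwartz_closure"
  using assms
proof (induction I rule: finite_induct)
  case empty
  \<comment> \<open>The zero function is obtained as a linear combination with coefficients 0, for
    which any one Schwartz function has to be exhibited.\<close>
  have "schwartz (tensor_bump (\<lambda>_. 0) 1 0 (0::'a))" by (rule schwartz_tensor_bump) simp
  from schwartz_closure_lincomb[OF schwartz_in_closure[OF this] schwartz_in_closure[OF this], of 0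
      0]
  show ?case by simp
next
  case (insert i I)
  then show ?case using schwartz_closure_lincomb[of "f i" "\<lambda>x. \<Sum>i\<in>I. f i x" 1 1] by simp
qed

lemma logistic_tendsto:
  assumes "s \<noteq> 0"
  shows "(\<lambda>n. logistic (real (Suc n) * s)) \<longlonglongrightarrow> (if s > 0 then 1 else 0)"
proof -
  have exp0: "(\<lambda>n. exp (real (Suc n) * r)) \<longlonglongrightarrow> 0" if "r < 0" for r :: real
    unfolding exp_of_nat_mult using that by (intro LIMSEQ_Suc LIMSEQ_power_zero) simp
  show ?thesis
  proof (cases "s > 0")
    case True
    have "(\<lambda>n. 1 / (1 + exp (real (Suc n) * (- s)))) \<longlonglongrightarrow> 1 / (1 + 0)"
      using True by (intro tendsto_intros exp0) auto
    then show ?thesis using True by (simp add: logistic_def)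
  next
    case False
    then have s: "s < 0" using assms by simp
    have "(\<lambda>n. logistic (real (Suc n) * s)) \<longlonglongrightarrow> 0"
      by (rule tendsto_sandwich[OF _ _ tendsto_const exp0[OF s]])
        (simp_all only: logistic_bounds less_imp_le eventually_True)
    then show ?thesis using s by simp
  qed
qed

text \<open>As the slope \<open>Suc n\<close> grows, the product of logistic bumps tends to the
  indicator off the hyperplanes that bound the box, and these are null sets.\<close>

lemma schwartz_closure_box:
  fixes l u :: "'a::euclidean_space"
  shows "indicator (box l u) \<in> (schwartz_closure :: ('a \<Rightarrow> complex) set)"
proof (cases "\<forall>b\<in>Basis. l \<bullet> b < u \<bullet> b")
  case False
  then have "box l u = {}" by (force simp: box_eq_empty)
  then show ?thesis using schwartz_closure_sum[of "{}" "\<lambda>_ (_::'a). 0"]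
      by (simp add: indicator_def[abs_def])
next
  case True
  let ?F = "\<lambda>n. tensor_bump (\<lambda>_. [:0, 1:]) (real (Suc n)) l u"
  define c where "c = norm l + norm u"
  define w where "w x = (\<Prod>b\<in>Basis. 2 * exp c * (1 / (1 + ((x::'a) \<bullet> b)\<^sup>2)))" for x
  show ?thesis
  proof (rule schwartz_closure_dominated)
    show "?F n \<in> schwartz_closure" for n
      by (intro schwartz_in_closure schwartz_tensor_bump) simp
    have "AE x::'a in lebesgue. \<forall>b\<in>Basis. x \<bullet> b \<noteq> l \<bullet> b \<and> x \<bullet> b \<noteq> u \<bullet> b"
    proof (intro AE_finite_allI finite_Basis)
      fix b :: 'a assume b: "b \<in> Basis"
      have "AE x in lebesgue. x \<bullet> b \<noteq> s" for s
        using negligible_standard_hyperplane[OF b, of s]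
        by (intro AE_I'[of "{x. x \<bullet> b = s}"]) (auto simp: negligible_iff_null_sets)
      from this[of "l \<bullet> b"] this[of "u \<bullet> b"]
      show "AE x in lebesgue. x \<bullet> b \<noteq> l \<bullet> b \<and> x \<bullet> b \<noteq> u \<bullet> b" by eventually_elim simp
    qed
    then show "AE x in lebesgue. (\<lambda>n. ?F n x) \<longlonglongrightarrow> indicator (box l u) x"
    proof eventually_elim
      case (elim x)
      have "(\<lambda>n. bump [:0, 1:] (real (Suc n)) (l \<bullet> b) (u \<bullet> b) (x \<bullet> b))
          \<longlonglongrightarrow> (if l \<bullet> b < x \<bullet> b \<and> x \<bullet> b < u \<bullet> b then 1 else 0)"
        if b: "b \<in> Basis" for b
        using tendsto_diff[OF logistic_tendsto[of "x \<bullet> b - l \<bullet> b"]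
            logistic_tendsto[of "x \<bullet> b - u \<bullet> b"]]
          elim True b by (force simp: bump_def intro: tendsto_eq_rhs)
      then have "(\<lambda>n. ?F n x) \<longlonglongrightarrow> complex_of_real (\<Prod>b\<in>Basis. if l \<bullet> b < x \<bullet> b \<and> x \<bullet> b
          < u \<bullet> b then 1 else 0)"
        unfolding tensor_bump_def by (intro tendsto_of_real tendsto_prod)
      also have "(\<Prod>b\<in>Basis. if l \<bullet> b < x \<bullet> b \<and> x \<bullet> b < u \<bullet> b then 1 else (0::real))
          = indicator (box l u) x"
        by (auto simp: indicator_def box_def intro!: prod_zero)
      also have "complex_of_real (indicator (box l u) x) = indicator (box l u) x"
          by (simp add: indicator_def)
      finally show ?case .
    qed
    have w_eq: "w x = (2 * exp c) ^ DIM('a) * weight x" for x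
      by (simp only: w_def weight_def prod.distrib prod_constant power_mult_distrib)
    have "integrable lborel (\<lambda>x. (w x)\<^sup>2)"
    proof (rule Bochner_Integration.integrable_bound)
      show "integrable lborel (\<lambda>x::'a. ((2 * exp c) ^ DIM('a))\<^sup>2 * weight x)"
          using integrable_weight by simp
      show "(\<lambda>x. (w x)\<^sup>2) \<in> borel_measurable lborel" unfolding w_eq by measurable
      show "AE x in lborel. norm ((w x)\<^sup>2) \<le> norm (((2 * exp c) ^ DIM('a))\<^sup>2 * weight x)"
        unfolding w_eq using weight_le_1
        by (intro AE_I2) (auto simp: power_mult_distrib power2_eq_square[of "weight _"]
            intro!: mult_left_mono mult_left_le)
    qed
    then show "integrable lebesgue (\<lambda>x. (w x)\<^sup>2)"
      by (subst integrable_completion) (auto simp: w_eq)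
    \<comment> \<open>The bound must not depend on the slope. Within distance \<open>c\<close> of
      the origin the trivial bound 1 is enough; outside, a larger slope only improves the decay. The
      final form uses \<open>exp |s| \<ge> (1 + s\<^sup>2) / 2\<close>.\<close>
    have dom: "\<bar>bump [:0, 1:] k a b s\<bar> \<le> 2 * exp c * (1 / (1 + s\<^sup>2))"
      if ab: "\<bar>a\<bar> \<le> c" "\<bar>b\<bar> \<le> c" and k: "k \<ge> 1" for a b s k
    proof -
      have le1: "\<bar>bump [:0, 1:] k a b s\<bar> \<le> 1"
        using logistic_bounds(1,2)[of "k * (s - a)"] logistic_bounds(1,2)[of "k * (s - b)"]
            by (auto simp: bump_def abs_le_iff)
      have "\<bar>bump [:0, 1:] k a b s\<bar> \<le> exp (c - \<bar>s\<bar>)"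
      proof (cases "\<bar>s\<bar> \<le> c")
        case True
        then show ?thesis using le1 one_le_exp_iff[of "c - \<bar>s\<bar>"] by linarith
      next
        case False
        show ?thesis
        proof (cases "s \<ge> 0")
          case True
          have *: "1 - logistic (k * (s - d)) \<le> exp (c - \<bar>s\<bar>)" if "\<bar>d\<bar> \<le> c" for d
          proof -
            have "s - c \<le> s - d" "s - c \<ge> 0" using that False True by auto
            then have "1 * (s - c) \<le> k * (s - d)" using k by (intro mult_mono) auto
            then have "exp (- (k * (s - d))) \<le> exp (c - s)" by simp
            then show ?thesis using logistic_bounds(4)[of "k * (s - d)"]
                unfolding abs_of_nonneg[OF True] by linarith
          qed
          from *[OF ab(1)] *[OF ab(2)] logistic_bounds(2)[of "k * (s - a)"]
              logistic_bounds(2)[of "k * (s - b)"]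
          show ?thesis by (auto simp: bump_def abs_le_iff)
        next
          case neg: False
          have *: "logistic (k * (s - d)) \<le> exp (c - \<bar>s\<bar>)" if "\<bar>d\<bar> \<le> c" for d
          proof -
            have "- s - c \<le> - (s - d)" "- s - c \<ge> 0" using that False neg by auto
            then have "1 * (- s - c) \<le> k * (- (s - d))" using k by (intro mult_mono) auto
            then have "exp (k * (s - d)) \<le> exp (c + s)" by (simp add: algebra_simps)
            then show ?thesis using logistic_bounds(3)[of "k * (s - d)"] neg
                by (simp only: abs_of_neg not_le diff_minus_eq_add)
          qed
          from *[OF ab(1)] *[OF ab(2)] logistic_bounds(1)[of "k * (s - a)"]
              logistic_bounds(1)[of "k * (s - b)"]
          show ?thesis by (auto simp: bump_def abs_le_iff)
        qed
      qed
      also have "exp (c - \<bar>s\<bar>) = exp c / exp \<bar>s\<bar>" by (rule exp_diff)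
      also have "\<dots> \<le> exp c / ((1 + s\<^sup>2) / 2)"
        using exp_lower_Taylor_quadratic[of "\<bar>s\<bar>"]
        by (intro divide_left_mono mult_pos_pos) (auto simp: add_pos_nonneg field_simps)
      finally show ?thesis by (simp add: mult.commute)
    qed
    show "AE x in lebesgue. norm (?F n x) \<le> w x" for n
    proof (intro AE_I2)
      fix x :: 'a
      have "\<bar>l \<bullet> b\<bar> \<le> c \<and> \<bar>u \<bullet> b\<bar> \<le> c" if "b \<in> Basis" for b
        using Basis_le_norm[OF that, of l] Basis_le_norm[OF that, of u] norm_ge_zero[of l]
            norm_ge_zero[of u]
        unfolding c_def by linarith
      then show "norm (?F n x) \<le> w x"
        unfolding tensor_bump_def w_def norm_of_real abs_prod
        by (intro prod_mono conjI dom) auto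
    qed
  qed (auto intro!: borel_measurable_indicator)
qed

text \<open>Dynkin's argument: boxes are stable under intersection and generate the Borel sets. A
  Lebesgue set of finite measure is then reached through its Borel part and growing boxes.\<close>

lemma schwartz_closure_indicator:
  fixes A :: "'a::euclidean_space set"
  assumes A: "A \<in> sets lebesgue" "emeasure lebesgue A < \<infinity>"
  shows "indicator A \<in> (schwartz_closure :: ('a \<Rightarrow> complex) set)"
proof -
  have int: "integrable lebesgue (\<lambda>x. (indicator D x :: real)\<^sup>2)"
      if "D \<in> sets lebesgue" "emeasure lebesgue D < \<infinity>" for D :: "'a set"
  proof -
    have "(\<lambda>x. (indicator D x :: real)\<^sup>2) = indicator D" by (auto simp: indicator_def)
    with that show ?thesis by (simp only: integrable_indicator_iff space_completion) simp
  qed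
  \<comment> \<open>Intersecting with a fixed box keeps all measures finite, in particular in the
    complement case of the induction, which subtracts from the indicator of that box.\<close>
  have bounded_case: "indicator (A \<inter> box l u) \<in> (schwartz_closure :: ('a \<Rightarrow> complex) set)"
      if "A \<in> sets borel" for A :: "'a set" and l u
  proof -
    have gen: "A \<in> sigma_sets UNIV (range (\<lambda>(a, b). box a b))"
      using that unfolding borel_eq_box by (simp add: sets_measure_of)
    have fin: "emeasure lebesgue (box l u) < \<infinity>" using emeasure_lborel_box_finite[of l u] by simp
    have st: "Int_stable (range (\<lambda>(a, b). box a b :: 'a set))"
      by (auto simp: Int_stable_def box_Int_box)
    have "range (\<lambda>(a, b). box a b :: 'a set) \<subseteq> Pow UNIV" by simp
    from st this gen show ?thesis
    proof (induction rule: sigma_sets_induct_disjoint)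
      case (basic A)
      then show ?case using schwartz_closure_box by (auto simp: box_Int_box)
    next
      case empty
      show ?case using schwartz_closure_sum[of "{}" "\<lambda>_ (_::'a). 0"]
          by (simp add: indicator_def[abs_def])
    next
      case (compl A)
      have "indicator ((UNIV - A) \<inter> box l u) = (\<lambda>x. 1 * indicator (box l u) x + (-1) * indicator
          (A \<inter> box l u) x :: complex)"
        by (auto simp: indicator_def)
      then show ?case using schwartz_closure_lincomb[OF schwartz_closure_box compl(2)] by metis
    next
      case (union A)
      have Am: "A i \<in> sets borel" for i
        using union(2) unfolding borel_eq_box by (auto simp: sets_measure_of)
      show ?case
      proof (rule schwartz_closure_dominated)
        show "(\<lambda>x. \<Sum>i<n. indicator (A i \<inter> box l u) x) \<in> (schwartz_closure :: ('a \<Rightarrow> complex) set)"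
            for n
          by (intro schwartz_closure_sum union) auto
        have un: "(\<Sum>i<n. indicator (A i \<inter> box l u) x)
            = (indicator ((\<Union>i<n. A i) \<inter> box l u) x :: complex)" for n x
        proof -
          have "(\<Union>i<n. A i) \<inter> box l u = (\<Union>i<n. A i \<inter> box l u)" by auto
          moreover have "disjoint_family_on (\<lambda>i. A i \<inter> box l u) {..<n}"
            using union(1) by (auto simp: disjoint_family_on_def)
          ultimately show ?thesis by (simp only: indicator_UN_disjoint[OF finite_lessThan])
        qed
        show "AE x in lebesgue. (\<lambda>n. \<Sum>i<n. indicator (A i \<inter> box l u) x)
            \<longlonglongrightarrow> (indicator ((\<Union>i. A i) \<inter> box l u) x :: complex)"
        proof (intro AE_I2)
          fix x
          have "(\<Union>n. (\<Union>i<n. A i) \<inter> box l u) = (\<Union>i. A i) \<inter> box l u" by auto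
          moreover have "incseq (\<lambda>n. (\<Union>i<n. A i) \<inter> box l u)" by (fastforce simp: incseq_def)
          ultimately show "(\<lambda>n. \<Sum>i<n. indicator (A i \<inter> box l u) x)
              \<longlonglongrightarrow> (indicator ((\<Union>i. A i) \<inter> box l u) x :: complex)"
            unfolding un using LIMSEQ_indicator_incseq[of "\<lambda>n. (\<Union>i<n. A i) \<inter> box l u" x] by simp
        qed
        show "integrable lebesgue (\<lambda>x. (indicator (box l u) x :: real)\<^sup>2)" by (intro int fin) auto
        show "AE x in lebesgue. norm (\<Sum>i<n. indicator (A i \<inter> box l u) x :: complex)
            \<le> indicator (box l u) x" for n
          unfolding un by (auto simp: indicator_def)
        show "(indicator ((\<Union>i. A i) \<inter> box l u) :: 'a \<Rightarrow> complex) \<in> borel_measurable lebesgue"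
          using Am by (intro borel_measurable_indicator) auto
      qed
    qed
  qed
  obtain S N N' where S: "A = S \<union> N" "N \<subseteq> N'" "N' \<in> null_sets lborel" "S \<in> sets lborel"
    using A(1) by (rule sets_completionE)
  let ?o = "One :: 'a"
  show ?thesis
  proof (rule schwartz_closure_dominated)
    show "indicator (S \<inter> box (- real n *\<^sub>R ?o) (real n *\<^sub>R ?o))
        \<in> (schwartz_closure :: ('a \<Rightarrow> complex) set)" for n
      using S by (intro bounded_case) auto
    have "AE x in lebesgue. x \<notin> N'" using S(3) by (intro AE_not_in null_sets_completionI)
    then show "AE x in lebesgue. (\<lambda>n. indicator (S \<inter> box (- real n *\<^sub>R ?o) (real n *\<^sub>R ?o)) x)
        \<longlonglongrightarrow> (indicator A x :: complex)"
    proof eventually_elim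
      case (elim x)
      have "(\<Union>n. S \<inter> box (- real n *\<^sub>R ?o) (real n *\<^sub>R ?o)) = S" using UN_box_eq_UNIV[where 'a='a]
          by auto
      moreover have "incseq (\<lambda>n. S \<inter> box (- real n *\<^sub>R ?o) (real n *\<^sub>R ?o))"
        by (auto simp: incseq_def box_def)
      moreover have "indicator A x = (indicator S x :: complex)" using S elim
          by (auto simp: indicator_def)
      ultimately show ?case using LIMSEQ_indicator_incseq[of
          "\<lambda>n. S \<inter> box (- real n *\<^sub>R ?o) (real n *\<^sub>R ?o)" x] by simp
    qed
    show "integrable lebesgue (\<lambda>x. (indicator A x :: real)\<^sup>2)" by (intro int A)
    show "AE x in lebesgue. norm (indicator (S \<inter> box (- real n *\<^sub>R ?o) (real n *\<^sub>R ?o)) x ::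
        complex) \<le> indicator A x" for n
      using S(1) by (auto simp: indicator_def)
  qed (use A in \<open>auto intro: borel_measurable_indicator\<close>)
qed

text \<open>Simple functions dominated by \<open>2 * norm (f x)\<close> converge pointwise to
  \<open>f\<close>, hence in \<open>L2\<close>; each of them is a finite combination of
  indicators.\<close>

lemma schwartz_dense:
  assumes f: "f \<in> L2" and e: "e > 0"
  shows "\<exists>g. schwartz g \<and> L2_norm (\<lambda>x. f x - g x) < e"
proof -
  note [measurable] = L2_measurable[OF f]
  obtain F where F: "\<And>i. simple_function lebesgue (F i)" "\<And>x. (\<lambda>i. F i x) \<longlonglongrightarrow> f x"
    "\<And>i x. dist (F i x) 0 \<le> 2 * dist (f x) 0"
    using borel_measurable_implies_sequence_metric[OF L2_measurable[OF f], of 0] by auto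
  have F_le: "norm (F i x) \<le> 2 * norm (f x)" for i x using F(3)[of i x] by simp
  have w: "integrable lebesgue (\<lambda>x. (2 * norm (f x))\<^sup>2)"
    using L2_integrable[OF f] by (simp add: power_mult_distrib)
  have Fm [measurable]: "F i \<in> borel_measurable lebesgue" for i
    using F(1) by (rule borel_measurable_simple_function)
  have F2: "integrable lebesgue (\<lambda>x. (norm (F i x))\<^sup>2)" for i
    by (rule Bochner_Integration.integrable_bound[OF w]) (use power_mono[OF F_le[of i], of _ 2]
        in \<open>auto intro!: AE_I2\<close>)
  have "F i \<in> schwartz_closure" for i
  proof -
    have fin: "finite (range (F i))" using F(1)[of i] by (auto simp: simple_function_def)
    have "F i = (\<lambda>x. \<Sum>y\<in>range (F i) - {0}. y * indicator (F i -` {y}) x)"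
    proof
      fix x
      have "(\<Sum>y\<in>range (F i) - {0}. y * indicator (F i -` {y}) x)
          = (\<Sum>y\<in>range (F i) - {0}. if y = F i x then y else 0)"
        by (intro sum.cong) (auto simp: indicator_def)
      also have "\<dots> = F i x" using fin by (subst sum.delta) auto
      finally show "F i x = (\<Sum>y\<in>range (F i) - {0}. y * indicator (F i -` {y}) x)" by simp
    qed
    also have "\<dots> \<in> schwartz_closure"
    proof (rule schwartz_closure_sum)
      fix y assume y: "y \<in> range (F i) - {0}"
      have s: "F i -` {y} \<in> sets lebesgue" using F(1)[of i] y by (auto simp: simple_function_def)
      \<comment> \<open>Chebyshev's inequality: on this level set \<open>norm (F i x)\<close> equals
        \<open>norm y\<close>, which is positive. The value 0 was left out of the sum for this
        reason.\<close>
      have "emeasure lebesgue (F i -` {y}) < \<infinity>"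
      proof -
        have "integrable lebesgue (\<lambda>x. indicator (F i -` {y}) x :: real)"
        proof (rule Bochner_Integration.integrable_bound)
          show "integrable lebesgue (\<lambda>x. (norm (F i x))\<^sup>2 / (norm y)\<^sup>2)" using F2[of i] by simp
          show "AE x in lebesgue. norm (indicator (F i -` {y}) x :: real)
              \<le> norm ((norm (F i x))\<^sup>2 / (norm y)\<^sup>2)"
            using y by (auto simp: indicator_def)
        qed (use s in auto)
        then show ?thesis using s by (simp add: integrable_indicator_iff)
      qed
      from schwartz_closure_lincomb[OF schwartz_closure_indicator[OF s this]
          schwartz_closure_indicator[OF s this], of y 0]
      show "(\<lambda>x. y * indicator (F i -` {y}) x) \<in> schwartz_closure" by simp
    qed (use fin in auto)
    finally show ?thesis .
  qed
  then have "f \<in> schwartz_closure"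
    by (rule schwartz_closure_dominated[where F=F, OF _ _ _ w]) (use F F_le in auto)
  then show ?thesis using e by (auto simp: schwartz_closure_def)
qed

section \<open>The generating function of the Laguerre polynomials\<close>

text \<open>Only real parameters in an interval to the right of 0 are available, as they are
  parameters of Gaussians. Once the earlier coefficients vanish, the series can be divided by
  \<open>r ^ m\<close>, and letting \<open>r\<close> tend to 0 isolates the coefficient
  \<open>a m\<close>.\<close>

lemma power_series_eq_0:
  fixes a :: "nat \<Rightarrow> complex"
  assumes d: "d > 0" and s: "\<And>r::real. 0 < r \<Longrightarrow> r < d \<Longrightarrow> (\<lambda>m. complex_of_real (r ^ m) * a m) sums 0"
  shows "a m = 0"
proof (induction m rule: less_induct)
  case (less m)
  define b where "b n = a (n + m)" for n
  have b: "(\<lambda>n. b n * complex_of_real r ^ n) sums 0" if r: "0 < r" "r < d" for r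
  proof -
    have "(\<lambda>n. complex_of_real (r ^ (n + m)) * a (n + m)) sums
        (0 - (\<Sum>i<m. complex_of_real (r ^ i) * a i))"
      using sums_split_initial_segment[OF s[OF r], of m] by simp
    also have "(\<Sum>i<m. complex_of_real (r ^ i) * a i) = 0" using less by (intro sum.neutral) auto
    finally have "(\<lambda>n. complex_of_real r ^ m * (b n * complex_of_real r ^ n)) sums 0"
      by (simp add: b_def power_add mult_ac)
    from sums_mult[OF this, of "1 / complex_of_real r ^ m"] show ?thesis using r by simp
  qed
  define f where "f z = (\<Sum>n. b n * z ^ n)" for z
  have "(\<lambda>n. b n * z ^ n) sums f z" if "norm z < d / 2" for z
  proof -
    have "summable (\<lambda>n. b n * complex_of_real (d / 2) ^ n)" using b[of "d / 2"] d
        by (auto simp: sums_iff)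
    moreover have "norm z < norm (complex_of_real (d / 2))" using that d by simp
    ultimately have "summable (\<lambda>n. b n * z ^ n)" by (rule powser_inside)
    then show ?thesis by (simp add: f_def summable_sums)
  qed
  then have "(f \<longlongrightarrow> b 0) (at 0)" using d by (intro powser_limit_0[where s="d / 2"]) auto
  moreover have "filterlim (\<lambda>n. complex_of_real (d / (2 + real n))) (at 0) sequentially"
  proof (rule filterlim_atI)
    have "(\<lambda>n. d / (2 + real n)) \<longlonglongrightarrow> 0" by real_asymp
    from tendsto_of_real[OF this, where 'a=complex]
    show "(\<lambda>n. complex_of_real (d / (2 + real n))) \<longlonglongrightarrow> 0" by (simp only: of_real_0)
    show "\<forall>\<^sub>F n in sequentially. complex_of_real (d / (2 + real n)) \<noteq> 0" using d
        unfolding of_real_eq_0_iff by (intro always_eventually allI) simp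
  qed
  ultimately have "(\<lambda>n. f (complex_of_real (d / (2 + real n)))) \<longlonglongrightarrow> b 0"
    by (rule filterlim_compose)
  moreover have "f (complex_of_real (d / (2 + real n))) = 0" for n
    using b[of "d / (2 + real n)"] d by (simp add: f_def sums_iff field_simps add_pos_nonneg)
  ultimately have "b 0 = 0" by (simp add: LIMSEQ_const_iff)
  then show ?case by (simp add: b_def)
qed

lemma power_series_unique:
  fixes a b :: "nat \<Rightarrow> complex"
  assumes d: "d > 0"
    and a: "\<And>r::real. 0 < r \<Longrightarrow> r < d \<Longrightarrow> (\<lambda>m. complex_of_real (r ^ m) * a m) sums f r"
    and b: "\<And>r::real. 0 < r \<Longrightarrow> r < d \<Longrightarrow> (\<lambda>m. complex_of_real (r ^ m) * b m) sums f r"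
  shows "a m = b m"
proof -
  have "a m - b m = 0"
  proof (rule power_series_eq_0[OF d])
    fix r :: real assume r: "0 < r" "r < d"
    from sums_diff[OF a[OF r] b[OF r]] show "(\<lambda>m. complex_of_real (r ^ m) * (a m - b m)) sums 0"
      by (simp add: algebra_simps)
  qed
  then show ?thesis by simp
qed

text \<open>The binomial series with exponent \<open>- (i + 1)\<close>, shifted by \<open>i\<close>;
  the terms with \<open>k < i\<close> are zero.\<close>

lemma binomial_column_has_sum:
  fixes r :: real
  assumes r: "\<bar>r\<bar> < 1"
  shows "((\<lambda>k. r ^ k * real (k choose i)) has_sum (r ^ i / (1 - r) ^ Suc i)) UNIV"
proof -
  have sums: "(\<lambda>k. s ^ k * real (k choose i)) sums (s ^ i / (1 - s) ^ Suc i)" if s: "\<bar>s\<bar> < 1"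
      for s :: real
  proof -
    have "(\<lambda>n. ((- (real i + 1)) gchoose n) * (- s) ^ n) sums (1 + - s) powr (- (real i + 1))"
      by (rule gen_binomial_real) (use s in simp)
    moreover have "((- (real i + 1)) gchoose n) * (- s) ^ n = s ^ n * real ((n + i) choose i)" for n
    proof -
      have "((- (real i + 1)) gchoose n) = (-1) ^ n * (real (n + i) gchoose n)"
        unfolding gbinomial_minus by (simp add: add_ac)
      also have "real (n + i) gchoose n = real ((n + i) choose i)"
        using binomial_symmetric[of n "n + i"] unfolding binomial_gbinomial[symmetric] by simp
      finally show ?thesis by (simp add: power_minus[of s])
    qed
    moreover have "(1 + - s) powr (- (real i + 1)) = 1 / (1 - s) ^ Suc i"
    proof -
      have "(1 + - s) powr (- (real i + 1)) = (1 - s) powr (- real (Suc i))"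
          by (simp add: add.commute)
      also have "\<dots> = 1 / (1 - s) powr real (Suc i)" by (rule powr_minus_divide)
      also have "(1 - s) powr real (Suc i) = (1 - s) ^ Suc i" by (rule powr_realpow) (use s in simp)
      finally show ?thesis .
    qed
    ultimately have "(\<lambda>n. s ^ i * (s ^ n * real ((n + i) choose i))) sums
        (s ^ i * (1 / (1 - s) ^ Suc i))"
      by (intro sums_mult) simp
    then have "(\<lambda>n. s ^ (n + i) * real ((n + i) choose i)) sums (s ^ i / (1 - s) ^ Suc i)"
      by (simp add: power_add mult_ac)
    moreover have "(\<Sum>k<i. s ^ k * real (k choose i)) = 0" by (intro sum.neutral) auto
    ultimately show ?thesis using sums_iff_shift'[of "\<lambda>k. s ^ k * real (k choose i)" i] by simp
  qed
  show ?thesis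
  proof (rule norm_summable_imp_has_sum)
    show "summable (\<lambda>k. norm (r ^ k * real (k choose i)))"
      using sums[of "\<bar>r\<bar>"] r by (auto simp: sums_iff abs_mult power_abs)
  qed (rule sums[OF r])
qed

lemma exp_has_sum:
  fixes x :: real
  shows "((\<lambda>i. x ^ i / fact i) has_sum exp x) UNIV"
proof (rule norm_summable_imp_has_sum)
  show "(\<lambda>i. x ^ i / fact i) sums exp x"
    using exp_converges[of x] by (simp add: divide_inverse mult.commute)
  show "summable (\<lambda>i. norm (x ^ i / fact i))"
    using exp_converges[of "\<bar>x\<bar>"] by (auto simp: sums_iff divide_inverse mult.commute power_abs
        abs_mult)
qed

lemma gen_laguerre_0:
  "gen_laguerre k 0 x = (\<Sum>i\<le>k. real (k choose i) * ((- x) ^ i / fact i))"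
  unfolding gen_laguerre_def
proof (intro sum.cong refl)
  fix i assume i: "i \<in> {..k}"
  then have "(real k + 0) gchoose (k - i) = real (k choose i)"
    by (simp add: binomial_gbinomial[symmetric] binomial_symmetric[symmetric])
  then show "(-1) ^ i * ((real k + 0) gchoose (k - i)) * x ^ i / fact i
      = real (k choose i) * ((- x) ^ i / fact i)"
    by (simp add: power_minus[of x])
qed

text \<open>The Laguerre polynomials are expanded and the summation over the degree \<open>k\<close>
  is done first: each column is a negative binomial series, and the columns add up to an exponential
  series. The same computation at \<open>|r|\<close> and \<open>|x|\<close> gives the absolute
  summability that permits the exchange.\<close>

lemma laguerre_double_sum:
  fixes r x :: real
  assumes r: "\<bar>r\<bar> < 1"
  defines "a \<equiv> (\<lambda>(k, i). (r ^ k * real (k choose i)) * (x ^ i / fact i))"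
  shows "(\<lambda>p. norm (a p)) summable_on UNIV \<times> UNIV"
    and "(a has_sum (1 / (1 - r) * exp (x * r / (1 - r)))) (UNIV \<times> UNIV)"
proof -
  have inner: "((\<lambda>k. (s ^ k * real (k choose i)) * (y ^ i / fact i)) has_sum
      (1 / (1 - s) * ((y * s / (1 - s)) ^ i / fact i))) UNIV" if "\<bar>s\<bar> < 1" for s y :: real and i
    using has_sum_cmult_left[OF binomial_column_has_sum[OF that, of i], of "y ^ i / fact i"]
    by (simp add: power_divide power_mult_distrib mult_ac)
  have outer: "((\<lambda>i. 1 / (1 - s) * ((y * s / (1 - s)) ^ i / fact i)) has_sum
      (1 / (1 - s) * exp (y * s / (1 - s)))) UNIV" for s y :: real
    by (intro has_sum_cmult_right exp_has_sum)
  let ?b = "\<lambda>(i, k). (\<bar>r\<bar> ^ k * real (k choose i)) * (\<bar>x\<bar> ^ i / fact i)"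
  have "?b summable_on UNIV \<times> UNIV"
  proof (rule summable_on_SigmaI)
    show "(\<lambda>i. 1 / (1 - \<bar>r\<bar>) * ((\<bar>x\<bar> * \<bar>r\<bar> / (1 - \<bar>r\<bar>)) ^ i / fact i)) summable_on UNIV"
      using outer[of "\<bar>r\<bar>" "\<bar>x\<bar>"] by (rule has_sum_imp_summable)
  qed (use inner[of "\<bar>r\<bar>"] r in auto)
  then have b: "(\<lambda>p. norm (case p of (i, k) \<Rightarrow> a (k, i))) summable_on UNIV \<times> UNIV"
    by (simp add: a_def case_prod_unfold abs_mult power_abs)
  then have ab: "(\<lambda>(i, k). norm (a (k, i))) summable_on UNIV \<times> UNIV"
    by (simp add: case_prod_unfold)
  then show "(\<lambda>p. norm (a p)) summable_on UNIV \<times> UNIV"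
    by (subst (asm) summable_on_swap[symmetric]) (simp add: case_prod_unfold)
  have "((\<lambda>(i, k). a (k, i)) has_sum (1 / (1 - r) * exp (x * r / (1 - r)))) (UNIV \<times> UNIV)"
  proof (rule has_sum_SigmaI)
    show "(\<lambda>(i, k). a (k, i)) summable_on UNIV \<times> UNIV" by (rule abs_summable_summable[OF b])
  qed (use inner[OF r] outer in \<open>auto simp: a_def\<close>)
  then show "(a has_sum (1 / (1 - r) * exp (x * r / (1 - r)))) (UNIV \<times> UNIV)"
    by (subst (asm) has_sum_swap[symmetric]) (simp add: case_prod_unfold)
qed

lemma laguerre_has_sum:
  fixes r x :: real
  assumes r: "\<bar>r\<bar> < 1"
  shows "((\<lambda>k. r ^ k * gen_laguerre k 0 x) has_sum (1 / (1 - r) * exp (- x * r / (1 - r)))) UNIV"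
proof -
  have fin: "((\<lambda>i. (r ^ k * real (k choose i)) * ((- x) ^ i / fact i)) has_sum
      (r ^ k * gen_laguerre k 0 x)) UNIV" for k
  proof -
    have "((\<lambda>i. (r ^ k * real (k choose i)) * ((- x) ^ i / fact i)) has_sum
       (\<Sum>i\<le>k. (r ^ k * real (k choose i)) * ((- x) ^ i / fact i))) UNIV"
      by (rule has_sum_finite_neutralI) auto
    then show ?thesis by (simp add: gen_laguerre_0 sum_distrib_left mult.assoc)
  qed
  show ?thesis
    by (rule has_sum_Sigma'[OF laguerre_double_sum(2)[OF r, of "- x"]]) (use fin in simp)
qed

text \<open>At the argument \<open>- |x|\<close> all terms of the Laguerre polynomial are
  nonnegative, so its value there dominates \<open>|gen_laguerre k 0 x|\<close>, and the generating
  function at \<open>- |x|\<close> gives the bound.\<close>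

lemma laguerre_abs_summable:
  fixes r x :: real
  assumes r: "0 \<le> r" "r < 1"
  shows "(\<lambda>k. r ^ k * \<bar>gen_laguerre k 0 x\<bar>) summable_on UNIV"
    and "(\<Sum>\<^sub>\<infinity>k. r ^ k * \<bar>gen_laguerre k 0 x\<bar>) \<le> 1 / (1 - r) * exp (\<bar>x\<bar> * r / (1 - r))"
proof -
  have le: "r ^ k * \<bar>gen_laguerre k 0 x\<bar> \<le> r ^ k * gen_laguerre k 0 (- \<bar>x\<bar>)" for k
  proof -
    have "\<bar>gen_laguerre k 0 x\<bar> \<le> (\<Sum>i\<le>k. \<bar>real (k choose i) * ((- x) ^ i / fact i)\<bar>)"
      unfolding gen_laguerre_0 by (rule sum_abs)
    also have "\<dots> = gen_laguerre k 0 (- \<bar>x\<bar>)"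
      unfolding gen_laguerre_0 by (intro sum.cong refl) (simp add: abs_mult power_abs)
    finally show ?thesis using r by (intro mult_left_mono) auto
  qed
  have s: "((\<lambda>k. r ^ k * gen_laguerre k 0 (- \<bar>x\<bar>)) has_sum
      (1 / (1 - r) * exp (\<bar>x\<bar> * r / (1 - r)))) UNIV"
    using laguerre_has_sum[of r "- \<bar>x\<bar>"] r by simp
  show S: "(\<lambda>k. r ^ k * \<bar>gen_laguerre k 0 x\<bar>) summable_on UNIV"
    by (rule summable_on_comparison_test[OF has_sum_imp_summable[OF s]]) (use le r in auto)
  show "(\<Sum>\<^sub>\<infinity>k. r ^ k * \<bar>gen_laguerre k 0 x\<bar>) \<le> 1 / (1 - r) * exp (\<bar>x\<bar> * r / (1 - r))"
    by (rule has_sum_mono[OF has_sum_infsum[OF S] s]) (rule le)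
qed

section \<open>Sums over multi-indices of fixed degree\<close>

definition compositions :: "nat \<Rightarrow> nat \<Rightarrow> (nat \<Rightarrow> nat) set" where
  "compositions n m = {k \<in> {1..n} \<rightarrow>\<^sub>E UNIV. (\<Sum>j=1..n. k j) = m}"

lemma finite_compositions: "finite (compositions n m)"
proof (rule finite_subset)
  show "compositions n m \<subseteq> {1..n} \<rightarrow>\<^sub>E {..m}"
  proof
    fix k assume k: "k \<in> compositions n m"
    have "k j \<le> (\<Sum>j=1..n. k j)" if "j \<in> {1..n}" for j
      by (rule member_le_sum[OF that]) auto
    with k show "k \<in> {1..n} \<rightarrow>\<^sub>E {..m}"
      unfolding compositions_def by (intro PiE_I) (auto simp: PiE_iff extensional_def)
  qed
qed (auto intro: finite_PiE)

text \<open>The product of absolutely convergent series is a sum over all multi-indices, which is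
  regrouped by total degree. The coefficients \<open>g\<close> are kept general because the lemma is
  applied both to Laguerre values and to their absolute values.\<close>

lemma compositions_has_sum:
  fixes g :: "nat \<Rightarrow> nat \<Rightarrow> real"
  assumes s: "\<And>j. j \<in> {1..n} \<Longrightarrow> ((\<lambda>k. r ^ k * g j k) has_sum S j) UNIV"
    and a: "\<And>j. j \<in> {1..n} \<Longrightarrow> (\<lambda>k. \<bar>r ^ k * g j k\<bar>) summable_on UNIV"
  shows "((\<lambda>m. r ^ m * (\<Sum>k\<in>compositions n m. \<Prod>j=1..n. g j (k j))) has_sum (\<Prod>j=1..n. S j)) UNIV"
proof -
  let ?P = "{1..n} \<rightarrow>\<^sub>E (UNIV :: nat set)"
  let ?f = "\<lambda>k. \<Prod>j=1..n. r ^ k j * g j (k j)"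
  have "Infinite_Set_Sum.abs_summable_on ?f ?P"
    by (rule abs_summable_on_prod_PiE) (use a in \<open>auto simp: abs_summable_equivalent[symmetric]\<close>)
  then have "(\<lambda>k. norm (?f k)) summable_on ?P" unfolding abs_summable_equivalent .
  then have sm: "?f summable_on ?P" by (rule abs_summable_summable)
  have "infsum ?f ?P = (\<Prod>j=1..n. S j)"
    using infsum_prod_PiE_abs[of "{1..n}" "\<lambda>j k. r ^ k * g j k" "\<lambda>_. UNIV"] a
      prod.cong[of "{1..n}" "{1..n}" "\<lambda>j. \<Sum>\<^sub>\<infinity>k. r ^ k * g j k" S, OF refl infsumI[OF s]] by simp
  with has_sum_infsum[OF sm] have hs: "(?f has_sum (\<Prod>j=1..n. S j)) ?P" by (simp only:)
  have "((\<lambda>(m, k). ?f k) has_sum (\<Prod>j=1..n. S j)) (Sigma UNIV (compositions n))"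
  proof -
    let ?h = "\<lambda>k. (\<Sum>j=1..n. k j, k)"
    have img: "Sigma UNIV (compositions n) = ?h ` ?P" by (auto simp: compositions_def image_iff)
    have inj: "inj_on ?h ?P" by (rule inj_onI) simp
    show ?thesis unfolding img has_sum_reindex[OF inj] o_def using hs by (simp only: prod.case)
  qed
  then show ?thesis
  proof (rule has_sum_Sigma')
    fix m
    have "?f k = r ^ m * (\<Prod>j=1..n. g j (k j))" if "k \<in> compositions n m" for k
      using that by (simp add: compositions_def prod.distrib power_sum[symmetric])
    then show "((\<lambda>k. case (m, k) of (m, k) \<Rightarrow> ?f k) has_sum r ^ m
        * (\<Sum>k\<in>compositions n m. \<Prod>j=1..n. g j (k j))) (compositions n m)"
      by (intro has_sum_finiteI finite_compositions) (simp add: sum_distrib_left)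
  qed
qed

definition laguerre_sum :: "nat \<Rightarrow> nat \<Rightarrow> (nat \<Rightarrow> real) \<Rightarrow> real" where
  "laguerre_sum n m x = (\<Sum>k\<in>compositions n m. \<Prod>j=1..n. gen_laguerre (k j) 0 (x j))"

lemma laguerre_sum_sums:
  assumes r: "\<bar>r\<bar> < 1"
  shows "(\<lambda>m. r ^ m * laguerre_sum n m x) sums (exp (- (\<Sum>j=1..n. x j) * r / (1 - r)) / (1 - r) ^ n)"
proof -
  have "((\<lambda>m. r ^ m * laguerre_sum n m x) has_sum
      (\<Prod>j=1..n. 1 / (1 - r) * exp (- x j * r / (1 - r)))) UNIV"
    unfolding laguerre_sum_def
  proof (rule compositions_has_sum)
    show "(\<lambda>k. \<bar>r ^ k * gen_laguerre k 0 (x j)\<bar>) summable_on UNIV" for j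
      using laguerre_abs_summable(1)[of "\<bar>r\<bar>" "x j"] r by (simp add: abs_mult power_abs)
  qed (rule laguerre_has_sum[OF r])
  also have "(\<Prod>j=1..n. 1 / (1 - r) * exp (- x j * r / (1 - r)))
      = exp (- (\<Sum>j=1..n. x j) * r / (1 - r)) / (1 - r) ^ n"
  proof -
    have "(\<Prod>j=1..n. exp (- x j * r / (1 - r))) = exp (\<Sum>j=1..n. - x j * r / (1 - r))"
      by (simp add: exp_sum)
    also have "(\<Sum>j=1..n. - x j * r / (1 - r)) = - (\<Sum>j=1..n. x j) * r / (1 - r)"
      by (simp add: sum_divide_distrib sum_distrib_right sum_negf)
    finally show ?thesis by (simp only: prod.distrib prod_constant card_atLeastAtMost)
        (simp add: power_divide)
  qed
  finally show ?thesis by (rule has_sum_imp_sums)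
qed

text \<open>The sign of the exponent is flipped compared with the generating function. This growth
  is harmless only against the factor \<open>exp (- q)\<close> of the kernels and for small
  \<open>r\<close>.\<close>

lemma laguerre_sum_majorant:
  assumes r: "0 \<le> r" "r < 1" and x: "\<And>j. j \<in> {1..n} \<Longrightarrow> x j \<ge> 0"
  shows "(\<Sum>m<M. r ^ m * \<bar>laguerre_sum n m x\<bar>) \<le> exp ((\<Sum>j=1..n. x j) * r / (1 - r)) / (1 - r) ^ n"
proof -
  define S where "S j = (\<Sum>\<^sub>\<infinity>k. r ^ k * \<bar>gen_laguerre k 0 (x j)\<bar>)" for j
  let ?A = "\<lambda>m. \<Sum>k\<in>compositions n m. \<Prod>j=1..n. \<bar>gen_laguerre (k j) 0 (x j)\<bar>"
  have hs: "((\<lambda>m. r ^ m * ?A m) has_sum (\<Prod>j=1..n. S j)) UNIV"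
    by (rule compositions_has_sum) (use laguerre_abs_summable(1)[OF r] r in \<open>auto
        simp: S_def abs_mult\<close>)
  have A0: "?A m \<ge> 0" for m by (intro sum_nonneg prod_nonneg) auto
  have "\<bar>laguerre_sum n m x\<bar> \<le> ?A m" for m
    unfolding laguerre_sum_def by (rule sum_abs[THEN order_trans]) (simp add: abs_prod)
  then have "(\<Sum>m<M. r ^ m * \<bar>laguerre_sum n m x\<bar>) \<le> (\<Sum>m<M. r ^ m * ?A m)"
    using r by (intro sum_mono mult_left_mono) auto
  also have "\<dots> \<le> (\<Prod>j=1..n. S j)"
    by (rule finite_sum_le_has_sum[OF hs]) (use A0 r in auto)
  also have "\<dots> \<le> (\<Prod>j=1..n. 1 / (1 - r) * exp (x j * r / (1 - r)))"
  proof (intro prod_mono conjI)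
    fix j assume "j \<in> {1..n}"
    then show "S j \<le> 1 / (1 - r) * exp (x j * r / (1 - r))"
      using laguerre_abs_summable(2)[OF r, of "x j"] x by (simp add: S_def)
    show "0 \<le> S j" unfolding S_def using r by (intro infsum_nonneg) auto
  qed
  also have "\<dots> = exp ((\<Sum>j=1..n. x j) * r / (1 - r)) / (1 - r) ^ n"
  proof -
    have "(\<Prod>j=1..n. exp (x j * r / (1 - r))) = exp (\<Sum>j=1..n. x j * r / (1 - r))"
      by (simp add: exp_sum)
    also have "(\<Sum>j=1..n. x j * r / (1 - r)) = (\<Sum>j=1..n. x j) * r / (1 - r)"
      by (simp add: sum_divide_distrib sum_distrib_right)
    finally show ?thesis by (simp only: prod.distrib prod_constant card_atLeastAtMost)
        (simp add: power_divide)
  qed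
  finally show ?thesis .
qed

text \<open>By its generating function, \<^const>\<open>laguerre_sum\<close> only depends on the sum of its arguments.\<close>

definition laguerre_total :: "nat \<Rightarrow> nat \<Rightarrow> real \<Rightarrow> real" where
  "laguerre_total n m X = laguerre_sum n m (\<lambda>_. X / real n)"

lemma laguerre_sum_eq_total:
  assumes n: "n \<ge> 1"
  shows "laguerre_sum n m x = laguerre_total n m (\<Sum>j=1..n. x j)"
proof -
  let ?f = "\<lambda>r. complex_of_real (exp (- (\<Sum>j=1..n. x j) * r / (1 - r)) / (1 - r) ^ n)"
  have "complex_of_real (laguerre_sum n m x) = complex_of_real (laguerre_total n m (\<Sum>j=1..n. x j))"
  proof (rule power_series_unique[where d=1 and f="?f" and m=m
      and a="\<lambda>m. complex_of_real (laguerre_sum n m x)"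
          and b="\<lambda>m. complex_of_real (laguerre_total n m (\<Sum>j=1..n. x j))"])
    fix r :: real assume r: "0 < r" "r < 1"
    then show "(\<lambda>m. complex_of_real (r ^ m) * complex_of_real (laguerre_sum n m x)) sums ?f r"
      unfolding of_real_mult[symmetric] by (intro sums_of_real laguerre_sum_sums) auto
    have "(\<Sum>j=1..n. (\<Sum>j=1..n. x j) / real n) = (\<Sum>j=1..n. x j)" using n by simp
    then show "(\<lambda>m. complex_of_real (r ^ m) * complex_of_real (laguerre_total n m (\<Sum>j=1..n. x j)))
        sums ?f r"
      unfolding of_real_mult[symmetric] laguerre_total_def
      using laguerre_sum_sums[of r n "\<lambda>_. (\<Sum>j=1..n. x j) / real n"] r by (intro sums_of_real) auto
  qed simp
  then show ?thesis by simp
qed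

lemma continuous_on_laguerre_total [continuous_intros]:
  "continuous_on S f \<Longrightarrow> continuous_on S (\<lambda>x. laguerre_total n m (f x))"
  unfolding laguerre_total_def laguerre_sum_def gen_laguerre_def divide_inverse
  by (intro continuous_intros)

lemma Q_kernel_eq_total:
  assumes n: "n \<ge> 1"
  shows "Q_kernel n \<mu> v m y \<tau> = (\<Prod>j=1..n. 2 * \<mu> \<tau> j / pi)
    * laguerre_total n m (2 * (\<Sum>j=1..n. \<mu> \<tau> j * block_norm_sq (v \<tau>) j y))
    * exp (- (\<Sum>j=1..n. \<mu> \<tau> j * block_norm_sq (v \<tau>) j y))"
proof -
  let ?x = "\<lambda>j. 2 * \<mu> \<tau> j * block_norm_sq (v \<tau>) j y"
  have "Q_kernel n \<mu> v m y \<tau> = (\<Prod>j=1..n. 2 * \<mu> \<tau> j / pi) * laguerre_sum n m ?x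
     * (\<Prod>j=1..n. exp (- \<mu> \<tau> j * block_norm_sq (v \<tau>) j y))"
    unfolding Q_kernel_def laguerre_kernel_def laguerre_sum_def compositions_def
    by (simp only: prod.distrib sum_distrib_left sum_distrib_right)
  also have "(\<Prod>j=1..n. exp (- \<mu> \<tau> j * block_norm_sq (v \<tau>) j y))
      = exp (- (\<Sum>j=1..n. \<mu> \<tau> j * block_norm_sq (v \<tau>) j y))"
    by (simp add: exp_sum[symmetric] sum_negf)
  also have "laguerre_sum n m ?x = laguerre_total n m
      (2 * (\<Sum>j=1..n. \<mu> \<tau> j * block_norm_sq (v \<tau>) j y))"
    by (simp add: laguerre_sum_eq_total[OF n] sum_distrib_left mult.assoc)
  finally show ?thesis .
qed

section \<open>Twisted convolution with Laguerre functions\<close>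

lemma prod_pairs:
  fixes g :: "nat \<Rightarrow> 'a::comm_monoid_mult"
  shows "(\<Prod>l=1..2 * n. g l) = (\<Prod>j=1..n. g (2 * j - 1) * g (2 * j))"
  by (induction n) (simp_all add: mult.assoc)

lemma sum_pairs:
  fixes g :: "nat \<Rightarrow> 'a::comm_monoid_add"
  shows "(\<Sum>l=1..2 * n. g l) = (\<Sum>j=1..n. g (2 * j - 1) + g (2 * j))"
  by (induction n) (simp_all add: add.assoc)

text \<open>A class inside \<open>L2\<close> that is stable under twisted convolution with each
  \<open>Q m\<close> and on which all pairings and double integrals converge absolutely, so that
  Fubini's theorem applies directly.\<close>

definition bounded_integrable :: "('a::euclidean_space \<Rightarrow> complex) \<Rightarrow> bool" where
  "bounded_integrable f \<longleftrightarrow> integrable lborel f \<and> (\<exists>C. \<forall>x. norm (f x) \<le> C)"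

lemma bounded_integrable_measurable: "bounded_integrable f \<Longrightarrow> f \<in> borel_measurable borel"
  by (auto simp: bounded_integrable_def dest: borel_measurable_integrable)

lemma bounded_integrable_bound:
  assumes "bounded_integrable f"
  shows "\<exists>C\<ge>0. \<forall>x. norm (f x) \<le> C"
proof -
  obtain C where C: "\<And>x. norm (f x) \<le> C" using assms by (auto simp: bounded_integrable_def)
  from order_trans[OF norm_ge_zero C[of undefined]] C show ?thesis by blast
qed

lemma bounded_integrable_mult:
  assumes f: "bounded_integrable f" and g: "bounded_integrable g"
  shows "integrable lborel (\<lambda>x. cnj (f x) * g x)"
proof -
  note [measurable] = bounded_integrable_measurable[OF f] bounded_integrable_measurable[OF g]
  obtain C where C: "C \<ge> 0" "\<And>x. norm (f x) \<le> C" using bounded_integrable_bound[OF f] by blast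
  show ?thesis
  proof (rule Bochner_Integration.integrable_bound)
    show "integrable lborel (\<lambda>x. C * norm (g x))" using g by (simp add: bounded_integrable_def)
    show "AE x in lborel. norm (cnj (f x) * g x) \<le> norm (C * norm (g x))"
      using C by (intro AE_I2) (auto simp: norm_mult intro!: mult_right_mono)
  qed measurable
qed

lemma bounded_integrable_diff:
  assumes "bounded_integrable f" "bounded_integrable g"
  shows "bounded_integrable (\<lambda>x. f x - g x)"
proof -
  obtain C D where "\<And>x. norm (f x) \<le> C" "\<And>x. norm (g x) \<le> D"
    using assms by (auto simp: bounded_integrable_def)
  then have "norm (f x - g x) \<le> C + D" for x by (meson add_mono norm_triangle_ineq4 order_trans)
  then show ?thesis using assms by (auto simp: bounded_integrable_def)
qed

lemma bounded_integrable_sum: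
  assumes "finite I" "\<And>i. i \<in> I \<Longrightarrow> bounded_integrable (f i)"
  shows "bounded_integrable (\<lambda>x. \<Sum>i\<in>I. f i x)"
proof -
  have "\<exists>C. \<forall>i\<in>I. \<forall>x. norm (f i x) \<le> C i"
    using assms(2) unfolding bounded_integrable_def by (intro bchoice) blast
  then obtain C where C: "\<And>i x. i \<in> I \<Longrightarrow> norm (f i x) \<le> C i" by blast
  then have "norm (\<Sum>i\<in>I. f i x) \<le> (\<Sum>i\<in>I. C i)" for x by (intro sum_norm_le) auto
  moreover have "integrable lborel (\<lambda>x. \<Sum>i\<in>I. f i x)"
    using assms by (intro Bochner_Integration.integrable_sum) (auto simp: bounded_integrable_def)
  ultimately show ?thesis by (auto simp: bounded_integrable_def)
qed

lemma integrable_pair_mult: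
  fixes f g :: "'a::euclidean_space \<Rightarrow> 'b::{real_normed_field, banach, second_countable_topology}"
  assumes f: "integrable lborel f" and g: "integrable lborel g"
  shows "integrable (lborel \<Otimes>\<^sub>M lborel) (\<lambda>(x, y). f x * g y)"
proof -
  note [measurable] = borel_measurable_integrable[OF f] borel_measurable_integrable[OF g]
  show ?thesis
  proof (rule lborel_pair.Fubini_integrable)
    show "integrable lborel (\<lambda>x. LINT y|lborel. norm (case (x, y) of (x, y) \<Rightarrow> f x * g y))"
      using f g by (simp add: norm_mult)
    show "AE x in lborel. integrable lborel (\<lambda>y. case (x, y) of (x, y) \<Rightarrow> f x * g y)"
      using g by simp
  qed measurable
qed

section \<open>One fibre: Gaussian calculus at a fixed nonzero frequency\<close>

text \<open>The frequency is frozen: \<open>b x y\<close> stands for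
  \<open>\<tau> \<bullet> B x y\<close>, and \<open>block\<close> says that its matrix in the frame
  \<open>v\<close> is the block diagonal normal form.\<close>

locale laguerre_fibre =
  fixes n :: nat and \<mu> :: "nat \<Rightarrow> real" and v :: "nat \<Rightarrow> real^'d" and b :: "real^'d \<Rightarrow> real^'d \<Rightarrow> real"
  assumes n: "n \<ge> 1" and dim: "CARD('d) = 2 * n"
    and \<mu>: "\<And>j. j \<in> {1..n} \<Longrightarrow> \<mu> j > 0"
    and orthonormal: "\<And>k l. k \<in> {1..2*n} \<Longrightarrow> l \<in> {1..2*n} \<Longrightarrow> v k \<bullet> v l = (if k = l then 1 else 0)"
    and bilinear: "bilinear b" and skew: "\<And>x y. b x y = - b y x"
    and block: "\<And>k l. k \<in> {1..2*n} \<Longrightarrow> l \<in> {1..2*n} \<Longrightarrow> b (v k) (v l) = block_entry \<mu> k l"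
begin

lemma b_linear:
  "b (x + y) z = b x z + b y z" "b x (y + z) = b x y + b x z"
  "b (x - y) z = b x z - b y z" "b x (y - z) = b x y - b x z"
  "b (c *\<^sub>R x) y = c * b x y" "b x (c *\<^sub>R y) = c * b x y"
  "b 0 x = 0" "b x 0 = 0" "b (- x) y = - b x y" "b x (- y) = - b x y" "b x x = 0"
  using bilinear_ladd[OF bilinear] bilinear_radd[OF bilinear] bilinear_lsub[OF bilinear]
      bilinear_rsub[OF bilinear]
    bilinear_lmul[OF bilinear] bilinear_rmul[OF bilinear] bilinear_lzero[OF bilinear]
        bilinear_rzero[OF bilinear]
    bilinear_lneg[OF bilinear] bilinear_rneg[OF bilinear] skew[of x x] by simp_all

lemma b_continuous [continuous_intros]:
  "continuous_on S f \<Longrightarrow> continuous_on S g \<Longrightarrow> continuous_on S (\<lambda>x. b (f x) (g x))"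
  using bilinear by (simp add: bilinear_conv_bounded_bilinear bounded_bilinear.continuous_on)

lemma b_measurable [measurable (raw)]:
  "f \<in> borel_measurable M \<Longrightarrow> g \<in> borel_measurable M \<Longrightarrow> (\<lambda>x. b (f x) (g x)) \<in> borel_measurable M"
  by (rule borel_measurable_continuous_Pair) (auto intro!: continuous_intros)

definition q :: "real^'d \<Rightarrow> real" where
  "q y = (\<Sum>j=1..n. \<mu> j * block_norm_sq v j y)"

text \<open>The eigenvalue belonging to a single frame vector: \<open>(l + 1) div 2\<close> is the
  number of the pair that contains \<open>l\<close>.\<close>

definition w :: "nat \<Rightarrow> real" where
  "w l = \<mu> ((l + 1) div 2)"

definition vol :: real where
  "vol = (\<Prod>j=1..n. 2 * \<mu> j / pi)"

definition Q :: "nat \<Rightarrow> real^'d \<Rightarrow> real" where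
  "Q m y = vol * laguerre_total n m (2 * q y) * exp (- q y)"

text \<open>Closed form of the generating function of the \<open>Q m\<close> in the parameter
  \<open>r\<close>; as \<open>r\<close> tends to 1 it concentrates at the origin.\<close>

definition G :: "real \<Rightarrow> real^'d \<Rightarrow> real" where
  "G r y = vol / (1 - r) ^ n * exp (- ((1 + r) / (1 - r)) * q y)"

text \<open>Convolution on the group, seen on one fibre: under the Fourier transform in the centre,
  the term \<open>2 *\<^sub>R B\<close> of the product becomes a phase.\<close>

definition twist :: "(real^'d \<Rightarrow> real) \<Rightarrow> (real^'d \<Rightarrow> complex) \<Rightarrow> real^'d \<Rightarrow> complex" where
  "twist g f x = (LINT z|lborel. g (x - z) *\<^sub>R (iexp (2 * b x z) * f z))"

lemma w_pos: "l \<in> {1..2*n} \<Longrightarrow> w l > 0"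
  unfolding w_def by (rule \<mu>) auto

lemma vol_pos: "vol > 0"
  unfolding vol_def using \<mu> by (intro prod_pos) (auto intro!: divide_pos_pos)

lemma prod_\<mu>: "(\<Prod>j=1..n. \<mu> j) > 0" "vol = (2 / pi) ^ n * (\<Prod>j=1..n. \<mu> j)"
proof -
  show "(\<Prod>j=1..n. \<mu> j) > 0" using \<mu> by (intro prod_pos) auto
  have "vol = (\<Prod>j=1..n. (2 / pi) * \<mu> j)" unfolding vol_def by (intro prod.cong) auto
  then show "vol = (2 / pi) ^ n * (\<Prod>j=1..n. \<mu> j)"
      by (simp only: prod.distrib prod_constant card_atLeastAtMost) simp
qed

lemma q_eq: "q y = (\<Sum>l=1..2*n. w l * (y \<bullet> v l)\<^sup>2)"
  unfolding sum_pairs q_def block_norm_sq_def w_def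
  by (intro sum.cong refl) (auto simp: algebra_simps)

lemma q_nonneg [simp]: "q y \<ge> 0"
  unfolding q_eq using w_pos by (intro sum_nonneg mult_nonneg_nonneg) (auto intro: less_imp_le)

lemma q_minus [simp]: "q (- y) = q y"
  by (simp add: q_eq)

lemma q_0 [simp]: "q 0 = 0"
  by (simp add: q_eq)

lemma q_scaleR: "q (c *\<^sub>R y) = c\<^sup>2 * q y"
  by (simp add: q_eq sum_distrib_left power_mult_distrib mult_ac)

lemma q_continuous [continuous_intros]: "continuous_on S f \<Longrightarrow> continuous_on S (\<lambda>x. q (f x))"
  unfolding q_eq by (intro continuous_intros)

lemma q_measurable [measurable]: "q \<in> borel_measurable borel"
  by (intro borel_measurable_continuous_onI continuous_intros)

lemma Q_continuous [continuous_intros]: "continuous_on S f \<Longrightarrow> continuous_on S (\<lambda>x. Q m (f x))"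
  unfolding Q_def by (intro continuous_intros)

lemma Q_measurable [measurable]: "Q m \<in> borel_measurable borel"
  by (intro borel_measurable_continuous_onI continuous_intros)

lemma G_measurable [measurable]: "G r \<in> borel_measurable borel"
  unfolding G_def[abs_def] by measurable

lemma Q_minus [simp]: "Q m (- y) = Q m y"
  by (simp add: Q_def)

lemma complete_square:
  assumes "\<alpha> > 0" "\<beta> > 0"
  shows "\<alpha> * q (x - z) + \<beta> * q z = (\<alpha> + \<beta>) * q (z - (\<alpha> / (\<alpha> + \<beta>)) *\<^sub>R x) + (\<alpha> * \<beta> / (\<alpha> + \<beta>)) * q x"
proof -
  define t where "t = \<alpha> / (\<alpha> + \<beta>)"
  have t: "(\<alpha> + \<beta>) * t = \<alpha>" "\<alpha> * \<beta> / (\<alpha> + \<beta>) = \<alpha> - (\<alpha> + \<beta>) * t\<^sup>2"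
  proof -
    show 1: "(\<alpha> + \<beta>) * t = \<alpha>" using assms by (simp add: t_def)
    have "(\<alpha> + \<beta>) * t\<^sup>2 = ((\<alpha> + \<beta>) * t) * t" by (simp only: power2_eq_square mult.assoc)
    also have "\<dots> = \<alpha> * t" by (simp only: 1)
    finally have "\<alpha> - (\<alpha> + \<beta>) * t\<^sup>2 = \<alpha> - \<alpha> * t" by simp
    also have "\<dots> = \<alpha> * \<beta> / (\<alpha> + \<beta>)" using assms by (simp add: t_def field_simps)
    finally show "\<alpha> * \<beta> / (\<alpha> + \<beta>) = \<alpha> - (\<alpha> + \<beta>) * t\<^sup>2" ..
  qed
  have "\<alpha> * (X - Z)\<^sup>2 + \<beta> * Z\<^sup>2 = (\<alpha> + \<beta>) * (Z - t * X)\<^sup>2 + (\<alpha> - (\<alpha> + \<beta>) * t\<^sup>2) * X\<^sup>2"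
      for X Z :: real
  proof -
    have "(\<alpha> + \<beta>) * (Z - t * X)\<^sup>2 + (\<alpha> - (\<alpha> + \<beta>) * t\<^sup>2) * X\<^sup>2
        = (\<alpha> + \<beta>) * Z\<^sup>2 - 2 * ((\<alpha> + \<beta>) * t) * X * Z + \<alpha> * X\<^sup>2"
      by (simp add: power2_eq_square algebra_simps)
    then show ?thesis unfolding t(1) by (simp add: power2_eq_square algebra_simps)
  qed
  then have "w l * (\<alpha> * (x \<bullet> v l - z \<bullet> v l)\<^sup>2 + \<beta> * (z \<bullet> v l)\<^sup>2)
      = w l * ((\<alpha> + \<beta>) * (z \<bullet> v l - t * (x \<bullet> v l))\<^sup>2 + (\<alpha> - (\<alpha> + \<beta>) * t\<^sup>2) * (x \<bullet> v l)\<^sup>2)" for l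
    by simp
  then show ?thesis
    unfolding t(2) t_def[symmetric] q_eq sum_distrib_left sum.distrib[symmetric] inner_diff_left
        inner_scaleR_left
    by (intro sum.cong refl) (simp add: algebra_simps)
qed

lemma b_frame:
  assumes j: "j \<in> {1..n}"
  shows "b x (v (2 * j - 1)) = \<mu> j * (x \<bullet> v (2 * j))" "b x (v (2 * j))
      = - \<mu> j * (x \<bullet> v (2 * j - 1))"
proof -
  have ex: "b x y = (\<Sum>k=1..2*n. (x \<bullet> v k) * b (v k) y)" for y
  proof -
    have "b x y = b (\<Sum>k=1..2*n. (x \<bullet> v k) *\<^sub>R v k) y"
      by (subst orthonormal_expansion[OF _ _ orthonormal]) (auto simp: dim)
    also have "\<dots> = (\<Sum>k=1..2*n. b ((x \<bullet> v k) *\<^sub>R v k) y)"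
      by (rule linear_sum[of "\<lambda>x. b x y"]) (use bilinear in \<open>simp add: bilinear_def\<close>)
    finally show ?thesis by (simp add: b_linear)
  qed
  have l: "2 * j - 1 \<in> {1..2*n}" "2 * j \<in> {1..2*n}" using j by auto
  have "b x (v (2 * j - 1)) = (\<Sum>k=1..2*n. if k = 2 * j then \<mu> j * (x \<bullet> v (2 * j)) else 0)"
    unfolding ex
  proof (intro sum.cong refl)
    fix k assume k: "k \<in> {1..2*n}"
    \<comment> \<open>Removes the truncated subtraction in \<open>2 * j - 1\<close> before parities
      are compared.\<close>
    obtain i where "j = Suc i" using j by (cases j) auto
    then have "block_entry \<mu> k (2 * j - 1) = (if k = 2 * j then \<mu> j else 0)"
      by (auto simp: block_entry_def elim!: oddE) presburger
    then show "(x \<bullet> v k) * b (v k) (v (2 * j - 1))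
        = (if k = 2 * j then \<mu> j * (x \<bullet> v (2 * j)) else 0)"
      unfolding block[OF k l(1)] by simp
  qed
  also have "\<dots> = \<mu> j * (x \<bullet> v (2 * j))" using l by (subst sum.delta) auto
  finally show "b x (v (2 * j - 1)) = \<mu> j * (x \<bullet> v (2 * j))" .
  have "b x (v (2 * j)) = (\<Sum>k=1..2*n. if k = 2 * j - 1 then - \<mu> j * (x \<bullet> v (2 * j - 1)) else 0)"
    unfolding ex
  proof (intro sum.cong refl)
    fix k assume k: "k \<in> {1..2*n}"
    have "block_entry \<mu> k (2 * j) = (if k = 2 * j - 1 then - \<mu> j else 0)"
      using j k by (auto simp: block_entry_def elim!: oddE)
    then show "(x \<bullet> v k) * b (v k) (v (2 * j))
        = (if k = 2 * j - 1 then - \<mu> j * (x \<bullet> v (2 * j - 1)) else 0)"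
      unfolding block[OF k l(2)] by simp
  qed
  also have "\<dots> = - \<mu> j * (x \<bullet> v (2 * j - 1))" using l by (subst sum.delta) auto
  finally show "b x (v (2 * j)) = - \<mu> j * (x \<bullet> v (2 * j - 1))" .
qed

text \<open>In frame coordinates the integrand is a product of one-dimensional Gaussians. The form
  \<open>b\<close> exchanges the two coordinates of each plane up to sign with factor
  \<open>\<mu> j\<close>, so \<open>(2 * b x (v l))\<^sup>2 / (4 * \<gamma> * \<mu> j)\<close> is
  again \<open>\<mu> j / \<gamma>\<close> times a squared coordinate. This is why the same form
  \<open>q\<close> reappears in the transform.\<close>

lemma gaussian_integral:
  assumes \<gamma>: "\<gamma> > 0"
  shows "has_bochner_integral lborel (\<lambda>z. exp (- \<gamma> * q z) *\<^sub>R iexp (2 * b x z))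
    (complex_of_real ((pi / \<gamma>) ^ n / (\<Prod>j=1..n. \<mu> j) * exp (- q x / \<gamma>)))"
proof -
  let ?I = "{1..2*n}"
  let ?u = "\<lambda>l s. exp (- (\<gamma> * w l) * s\<^sup>2) *\<^sub>R iexp ((2 * b x (v l)) * s)"
  let ?c = "\<lambda>l. complex_of_real (sqrt (pi / (\<gamma> * w l)) * exp
      (- (2 * b x (v l))\<^sup>2 / (4 * (\<gamma> * w l))))"
  have u: "has_bochner_integral lborel (?u l) (?c l)" if "l \<in> ?I" for l
    by (rule has_bochner_integral_gaussian_real) (use \<gamma> w_pos[OF that] in simp)
  have bz: "2 * b x z = (\<Sum>l\<in>?I. (2 * b x (v l)) * (z \<bullet> v l))" for z
  proof -
    have "b x z = b x (\<Sum>k\<in>?I. (z \<bullet> v k) *\<^sub>R v k)"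
      by (subst orthonormal_expansion[OF _ _ orthonormal]) (auto simp: dim)
    also have "\<dots> = (\<Sum>k\<in>?I. b x ((z \<bullet> v k) *\<^sub>R v k))"
      using bilinear by (simp add: bilinear_def linear_sum)
    finally show ?thesis by (simp add: b_linear sum_distrib_left mult_ac)
  qed
  have prod_u: "(\<Prod>l\<in>?I. ?u l (z \<bullet> v l)) = exp (- \<gamma> * q z) *\<^sub>R iexp (2 * b x z)" for z
  proof -
    have "(\<Prod>l\<in>?I. exp (- (\<gamma> * w l) * (z \<bullet> v l)\<^sup>2)) = exp (- \<gamma> * q z)"
      unfolding q_eq sum_distrib_left by (subst exp_sum) (auto simp: mult.assoc)
    moreover have "(\<Prod>l\<in>?I. iexp ((2 * b x (v l)) * (z \<bullet> v l))) = iexp (2 * b x z)"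
      unfolding bz[of z] of_real_sum sum_distrib_left by (rule exp_sum[symmetric]) simp
    ultimately show ?thesis by (simp only: scaleR_conv_of_real prod.distrib of_real_prod[symmetric])
  qed
  have prod_c: "(\<Prod>l\<in>?I. ?c l) = complex_of_real ((pi / \<gamma>) ^ n / (\<Prod>j=1..n. \<mu> j) * exp (- q x / \<gamma>))"
  proof -
    have "(\<Prod>l\<in>?I. sqrt (pi / (\<gamma> * w l))) = (\<Prod>j=1..n. pi / \<gamma> / \<mu> j)"
      unfolding prod_pairs
    proof (intro prod.cong refl)
      fix j assume j: "j \<in> {1..n}"
      then have "w (2 * j - 1) = \<mu> j" "w (2 * j) = \<mu> j" by (auto simp: w_def)
      then show "sqrt (pi / (\<gamma> * w (2 * j - 1))) * sqrt (pi / (\<gamma> * w (2 * j))) = pi / \<gamma> / \<mu> j"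
        using \<gamma> \<mu>[OF j] by simp
    qed
    also have "\<dots> = (pi / \<gamma>) ^ n / (\<Prod>j=1..n. \<mu> j)"
        by (simp only: prod_dividef prod_constant card_atLeastAtMost) (simp add: power_divide)
    finally have 1: "(\<Prod>l\<in>?I. sqrt (pi / (\<gamma> * w l))) = (pi / \<gamma>) ^ n / (\<Prod>j=1..n. \<mu> j)" .
    have "(\<Sum>l\<in>?I. - (2 * b x (v l))\<^sup>2 / (4 * (\<gamma> * w l)))
        = (\<Sum>j=1..n. - (\<mu> j * block_norm_sq v j x) / \<gamma>)"
      unfolding sum_pairs
    proof (intro sum.cong refl)
      fix j assume j: "j \<in> {1..n}"
      then have "w (2 * j - 1) = \<mu> j" "w (2 * j) = \<mu> j" by (auto simp: w_def)
      note w = this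
      show "- (2 * b x (v (2 * j - 1)))\<^sup>2 / (4 * (\<gamma> * w (2 * j - 1))) + - (2 * b x (v (2 * j)))\<^sup>2
          / (4 * (\<gamma> * w (2 * j)))
        = - (\<mu> j * block_norm_sq v j x) / \<gamma>"
        unfolding w b_frame[OF j] block_norm_sq_def
        using \<gamma> \<mu>[OF j] by (simp add: divide_simps power2_eq_square) (simp add: algebra_simps)
    qed
    also have "\<dots> = - q x / \<gamma>" unfolding q_def by (simp add: sum_divide_distrib sum_negf)
    finally have 2: "(\<Prod>l\<in>?I. exp (- (2 * b x (v l))\<^sup>2 / (4 * (\<gamma> * w l)))) = exp (- q x / \<gamma>)"
      by (subst exp_sum[symmetric]) auto
    show ?thesis by (simp only: of_real_prod[symmetric] prod.distrib 1 2)
  qed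
  have dimI: "card ?I = DIM(real^'d)" by (simp add: dim)
  have ui: "integrable lborel (?u l)" if "l \<in> ?I" for l using u[OF that]
      by (simp add: has_bochner_integral_iff)
  have ug: "(LINT s|lborel. ?u l s) = ?c l" if "l \<in> ?I" for l using u[OF that]
      by (simp add: has_bochner_integral_iff)
  show ?thesis
    unfolding has_bochner_integral_iff prod_u[symmetric] prod_c[symmetric]
    using integrable_orthonormal_prod[OF _ dimI orthonormal ui]
        integral_orthonormal_prod[OF _ dimI orthonormal ui]
      prod.cong[OF refl ug, of ?I] by simp
qed

lemma gaussian_integral_real:
  assumes \<gamma>: "\<gamma> > 0"
  shows "integrable lborel (\<lambda>z. exp (- \<gamma> * q z))"
    and "(LINT z|lborel. exp (- \<gamma> * q z)) = (pi / \<gamma>) ^ n / (\<Prod>j=1..n. \<mu> j)"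
proof -
  have "has_bochner_integral lborel (\<lambda>z. exp (- \<gamma> * q z)) ((pi / \<gamma>) ^ n / (\<Prod>j=1..n. \<mu> j))"
    using has_bochner_integral_bounded_linear[OF bounded_linear_Re gaussian_integral[OF \<gamma>, of 0]]
    by (simp only: Re_complex_of_real b_linear mult_zero_right of_real_0 exp_zero
        scaleR_conv_of_real mult_1_right q_0 minus_zero div_0)
  then show "integrable lborel (\<lambda>z. exp (- \<gamma> * q z))"
    and "(LINT z|lborel. exp (- \<gamma> * q z)) = (pi / \<gamma>) ^ n / (\<Prod>j=1..n. \<mu> j)"
    by (simp_all add: has_bochner_integral_iff)
qed

lemma Q_sums:
  assumes r: "0 \<le> r" "r < 1"
  shows "(\<lambda>m. r ^ m * Q m y) sums G r y"
proof -
  have s: "(\<Sum>j=1..n. 2 * q y / real n) = 2 * q y" using n by simp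
  have "(\<lambda>m. r ^ m * laguerre_total n m (2 * q y)) sums (exp (- (2 * q y) * r / (1 - r)) / (1 - r)
      ^ n)"
    using laguerre_sum_sums[of r n "\<lambda>_. 2 * q y / real n"] r unfolding laguerre_total_def s by simp
  from sums_mult[OF this, of "vol * exp (- q y)"]
  have "(\<lambda>m. r ^ m * Q m y) sums (vol * exp (- q y) * (exp (- (2 * q y) * r / (1 - r)) / (1 - r) ^
      n))"
    by (simp add: Q_def mult_ac)
  moreover have "exp (- q y) * exp (- (2 * q y) * r / (1 - r)) = exp (- ((1 + r) / (1 - r)) * q y)"
    unfolding exp_add[symmetric] using r by (intro arg_cong[where f=exp]) (simp add: field_simps)
  ultimately show ?thesis by (simp add: G_def mult_ac)
qed

text \<open>The prefactor \<open>vol / (1 - r) ^ n\<close> of the majorant at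
  \<open>r = 1 / 5\<close>.\<close>

definition K :: real where
  "K = vol * (5 / 4) ^ n"

lemma K_pos: "K > 0"
  unfolding K_def using vol_pos by simp

text \<open>At \<open>r = 1 / 5\<close> the growth from \<open>laguerre_sum_majorant\<close> is
  \<open>exp (q y / 2)\<close>, which uses up half of \<open>exp (- q y)\<close> and leaves an
  integrable Gaussian.\<close>

lemma Q_majorant: "(\<Sum>m<M. (1 / 5) ^ m * \<bar>Q m y\<bar>) \<le> K * exp (- q y / 2)"
proof -
  have s: "(\<Sum>j=1..n. 2 * q y / real n) = 2 * q y" using n by simp
  have "(\<Sum>m<M. (1 / 5) ^ m * \<bar>Q m y\<bar>) = vol * exp (- q y) * (\<Sum>m<M. (1 / 5) ^ m * \<bar>laguerre_total n
      m (2 * q y)\<bar>)"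
    unfolding sum_distrib_left using vol_pos by (intro sum.cong refl) (simp add: Q_def abs_mult)
  also have "\<dots> \<le> vol * exp (- q y) * (exp (2 * q y * (1 / 5) / (1 - 1 / 5)) / (1 - 1 / 5) ^ n)"
    using laguerre_sum_majorant[of "1 / 5" n "\<lambda>_. 2 * q y / real n" M] vol_pos
    unfolding laguerre_total_def s by (intro mult_left_mono) auto
  also have "\<dots> = K * exp (- q y / 2)"
  proof -
    have "exp (- q y) * exp (2 * q y * (1 / 5) / (1 - 1 / 5)) = exp (- q y / 2)"
      unfolding exp_add[symmetric] by simp
    then show ?thesis by (simp add: K_def power_divide field_simps)
  qed
  finally show ?thesis .
qed

lemma Q_partial_sum_le:
  assumes r: "0 \<le> r" "r \<le> 1 / 5"
  shows "\<bar>\<Sum>m<M. r ^ m * Q m y\<bar> \<le> K * exp (- q y / 2)"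
proof -
  have "\<bar>\<Sum>m<M. r ^ m * Q m y\<bar> \<le> (\<Sum>m<M. \<bar>r ^ m * Q m y\<bar>)" by (rule sum_abs)
  also have "\<dots> \<le> (\<Sum>m<M. (1 / 5) ^ m * \<bar>Q m y\<bar>)"
    using r by (intro sum_mono) (auto simp: abs_mult intro!: mult_right_mono power_mono)
  also have "\<dots> \<le> K * exp (- q y / 2)" by (rule Q_majorant)
  finally show ?thesis .
qed

lemma Q_exp_bound: "\<bar>Q m y\<bar> \<le> 5 ^ m * (K * exp (- q y / 2))"
proof -
  have "(1 / 5) ^ m * \<bar>Q m y\<bar> \<le> (\<Sum>k<Suc m. (1 / 5) ^ k * \<bar>Q k y\<bar>)"
    by (rule member_le_sum) auto
  then have "(1 / 5) ^ m * \<bar>Q m y\<bar> \<le> K * exp (- q y / 2)"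
      using Q_majorant[where M="Suc m" and y=y] by linarith
  then show ?thesis by (simp add: power_divide field_simps)
qed

lemma integrable_exp_half: "integrable lborel (\<lambda>y. exp (- q y / 2))"
  using gaussian_integral_real(1)[of "1 / 2"] by simp

lemma Q_integrable: "integrable lborel (Q m)"
proof (rule Bochner_Integration.integrable_bound)
  show "integrable lborel (\<lambda>y. 5 ^ m * (K * exp (- q y / 2)))" using integrable_exp_half by simp
qed (use Q_exp_bound K_pos in auto)

text \<open>The eigenvalues cancel between \<open>vol\<close> and the Gaussian integral. The
  resulting bound is uniform over all fibres, which is what an integration over the frequency
  needs.\<close>

lemma Q_L1_bound: "(LINT y|lborel. \<bar>Q m y\<bar>) \<le> 5 ^ m * 5 ^ n"
proof -
  have "(LINT y|lborel. \<bar>Q m y\<bar>) \<le> (LINT y|lborel. 5 ^ m * (K * exp (- q y / 2)))"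
    using Q_integrable integrable_exp_half Q_exp_bound by (intro integral_mono) auto
  also have "\<dots> = 5 ^ m * (K * (LINT y|lborel. exp (- q y / 2)))" by simp
  also have "(LINT y|lborel. exp (- q y / 2)) = (2 * pi) ^ n / (\<Prod>j=1..n. \<mu> j)"
    using gaussian_integral_real(2)[of "1 / 2"] by (simp add: mult.commute)
  also have "K * ((2 * pi) ^ n / (\<Prod>j=1..n. \<mu> j)) = 5 ^ n"
  proof -
    have "(2 / pi) ^ n * (5 / 4) ^ n * (2 * pi) ^ n = (5::real) ^ n"
      unfolding power_mult_distrib[symmetric] by simp
    moreover define P where "P = (\<Prod>j=1..n. \<mu> j)"
    moreover have "P > 0" using prod_\<mu>(1) by (simp only: P_def)
    ultimately show ?thesis unfolding K_def prod_\<mu>(2) P_def[symmetric] by (simp add: mult_ac)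
  qed
  finally show ?thesis by simp
qed

lemma Q_bound_nat: "\<bar>Q m y\<bar> \<le> 5 ^ m * K"
proof -
  have "5 ^ m * (K * exp (- q y / 2)) \<le> 5 ^ m * (K * 1)" using K_pos by (intro mult_left_mono) auto
  then show ?thesis using Q_exp_bound[of m y] by (simp only: mult_1_right)
qed

lemma G_integrable:
  assumes "0 \<le> r" "r < 1"
  shows "integrable lborel (G r)"
  unfolding G_def[abs_def] using gaussian_integral_real(1)[of "(1 + r) / (1 - r)"] assms by simp

section \<open>Twisted convolution and the generating function\<close>

text \<open>The form in which the convolution arises from the distribution, with the kernel at an
  unshifted point. It is also the form suited to rescaling the kernel.\<close>

lemma twist_change:
  assumes [measurable]: "g \<in> borel_measurable borel" "f \<in> borel_measurable borel"
  shows "twist g f x = (LINT y|lborel. g y *\<^sub>R (iexp (- (2 * b x y)) * f (x - y)))"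
proof -
  have "twist g f x = (LINT y|lborel. g (x - (x - y)) *\<^sub>R (iexp (2 * b x (x - y)) * f (x - y)))"
    unfolding twist_def by (subst lborel_integral_shift(2)[symmetric, of _ x]) simp_all
  then show ?thesis by (simp add: b_linear)
qed

lemma twist_integrable:
  fixes g :: "real^'d \<Rightarrow> real"
  assumes [measurable]: "g \<in> borel_measurable borel" and C: "\<And>y. \<bar>g y\<bar> \<le> C"
      and f: "integrable lborel f"
  shows "integrable lborel (\<lambda>z. g (x - z) *\<^sub>R (iexp (2 * b x z) * f z))"
proof (rule Bochner_Integration.integrable_bound)
  show "integrable lborel (\<lambda>z. C * norm (f z))" using f by simp
  have [measurable]: "f \<in> borel_measurable borel" using f
      by (auto dest: borel_measurable_integrable)
  show "(\<lambda>z. g (x - z) *\<^sub>R (iexp (2 * b x z) * f z)) \<in> borel_measurable lborel" by measurable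
  show "AE z in lborel. norm (g (x - z) *\<^sub>R (iexp (2 * b x z) * f z)) \<le> norm (C * norm (f z))"
    using C by (intro AE_I2) (auto simp: abs_mult
        intro!: mult_right_mono order_trans[OF C abs_ge_self] simp del: of_real_mult)
qed

lemma twist_measurable [measurable]:
  assumes [measurable]: "g \<in> borel_measurable borel" "f \<in> borel_measurable borel"
  shows "twist g f \<in> borel_measurable borel"
  unfolding twist_def[abs_def] by measurable

lemma norm_twist_le:
  assumes C: "\<And>y. \<bar>g y\<bar> \<le> C" and f: "integrable lborel f"
  shows "norm (twist g f x) \<le> C * (LINT z|lborel. norm (f z))"
proof -
  have C0: "C \<ge> 0" by (rule order_trans[OF abs_ge_zero C])
  have "norm (twist g f x) \<le> (LINT z|lborel. norm (g (x - z) *\<^sub>R (iexp (2 * b x z) * f z)))"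
    unfolding twist_def by (rule integral_norm_bound)
  also have "\<dots> \<le> (LINT z|lborel. C * norm (f z))"
    using f C C0 by (intro integral_mono') (auto intro!: mult_right_mono simp del: of_real_mult)
  finally show ?thesis by simp
qed

lemma twist_partial_sum:
  assumes f: "integrable lborel f"
  shows "(\<Sum>m<M. complex_of_real (r ^ m) * twist (Q m) f x) = twist (\<lambda>y. \<Sum>m<M. r ^ m * Q m y) f x"
proof -
  have "(\<Sum>m<M. complex_of_real (r ^ m) * twist (Q m) f x)
    = (\<Sum>m<M. (LINT z|lborel. complex_of_real (r ^ m) * (Q m (x - z) *\<^sub>R (iexp (2 * b x z) * f z))))"
    by (simp only: twist_def integral_mult_right_zero)
  also have "\<dots> = (LINT z|lborel. (\<Sum>m<M. complex_of_real (r ^ m)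
      * (Q m (x - z) *\<^sub>R (iexp (2 * b x z) * f z))))"
    by (rule Bochner_Integration.integral_sum[symmetric])
      (intro integrable_mult_right twist_integrable[OF _ Q_bound_nat f]; simp)
  finally show ?thesis by (simp add: twist_def scaleR_conv_of_real sum_distrib_left mult_ac)
qed

text \<open>The bound \<open>C\<close> on the partial sums is a hypothesis because it has two
  sources: the constant \<open>K\<close> for \<open>r\<close> below 1/5, and later
  \<open>G r 0\<close> for every \<open>r < 1\<close>.\<close>

lemma twist_sums:
  assumes r: "0 \<le> r" "r < 1" and C: "\<And>M y. \<bar>\<Sum>m<M. r ^ m * Q m y\<bar> \<le> C" and f: "integrable lborel f"
  shows "(\<lambda>m. complex_of_real (r ^ m) * twist (Q m) f x) sums twist (G r) f x"
  unfolding sums_def twist_partial_sum[OF f]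
proof -
  have [measurable]: "f \<in> borel_measurable borel" using f
      by (auto dest: borel_measurable_integrable)
  show "(\<lambda>M. twist (\<lambda>y. \<Sum>m<M. r ^ m * Q m y) f x) \<longlonglongrightarrow> twist (G r) f x"
    unfolding twist_def
  proof (rule integral_dominated_convergence[where w="\<lambda>z. C * norm (f z)"])
    show "AE z in lborel. (\<lambda>M. (\<Sum>m<M. r ^ m * Q m (x - z)) *\<^sub>R (iexp (2 * b x z) * f z))
        \<longlonglongrightarrow> G r (x - z) *\<^sub>R (iexp (2 * b x z) * f z)"
      using Q_sums[OF r, unfolded sums_def] by (intro AE_I2 tendsto_scaleR tendsto_const)
    show "AE z in lborel. norm ((\<Sum>m<M. r ^ m * Q m (x - z)) *\<^sub>R (iexp (2 * b x z) * f z))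
        \<le> C * norm (f z)" for M
      using C by (intro AE_I2) (auto intro!: mult_right_mono simp del: of_real_mult)
  qed (use f in auto)
qed

text \<open>Mehler's formula.\<close>

lemma G_semigroup:
  assumes r: "0 \<le> r" "r < 1" and s: "0 \<le> s" "s < 1"
  shows "twist (G r) (\<lambda>z. complex_of_real (G s z)) x = complex_of_real (G (r * s) x)"
proof -
  define \<alpha> \<beta> where "\<alpha> = (1 + r) / (1 - r)" and "\<beta> = (1 + s) / (1 - s)"
  have pos: "\<alpha> > 0" "\<beta> > 0" "\<alpha> + \<beta> > 0" using r s by (auto simp: \<alpha>_def \<beta>_def add_pos_pos)
  have "r * s \<le> r * 1" using r s by (intro mult_left_mono) auto
  then have rs: "r * s < 1" using r by simp
  \<comment> \<open>The product of the two Gaussians is centred at \<open>t *\<^sub>R x\<close>.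
    Translating there leaves the phase unchanged because \<open>b x x = 0\<close>.\<close>
  define t where "t = \<alpha> / (\<alpha> + \<beta>)"
  define c where "c = vol / (1 - r) ^ n * (vol / (1 - s) ^ n) * exp (- (\<alpha> * \<beta> / (\<alpha> + \<beta>)) * q x)"
  have "twist (G r) (\<lambda>z. complex_of_real (G s z)) x
     = (LINT z|lborel. c *\<^sub>R (exp (- (\<alpha> + \<beta>) * q (z - t *\<^sub>R x)) *\<^sub>R iexp (2 * b x (z - t *\<^sub>R x))))"
    unfolding twist_def
  proof (intro Bochner_Integration.integral_cong refl)
    fix z
    have "exp (- \<alpha> * q (x - z)) * exp (- \<beta> * q z)
        = exp (- (\<alpha> + \<beta>) * q (z - t *\<^sub>R x)) * exp (- (\<alpha> * \<beta> / (\<alpha> + \<beta>)) * q x)"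
      using complete_square[OF pos(1,2), of x z]
          unfolding exp_add[symmetric] t_def[symmetric] mult_minus_left
      by (intro arg_cong[where f=exp]) linarith
    then have "G r (x - z) * G s z = c * exp (- (\<alpha> + \<beta>) * q (z - t *\<^sub>R x))"
      unfolding G_def c_def \<alpha>_def[symmetric] \<beta>_def[symmetric] by (simp add: mult_ac)
    moreover have "a *\<^sub>R (y * complex_of_real d) = (a * d) *\<^sub>R y" for a d :: real and y :: complex
      by (simp add: scaleR_conv_of_real)
    ultimately have "G r (x - z) *\<^sub>R (iexp (2 * b x z) * complex_of_real (G s z))
        = (c * exp (- (\<alpha> + \<beta>) * q (z - t *\<^sub>R x))) *\<^sub>R iexp (2 * b x z)"
      by (simp only:)
    moreover have "b x (z - t *\<^sub>R x) = b x z" by (simp add: b_linear)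
    ultimately show "G r (x - z) *\<^sub>R (iexp (2 * b x z) * complex_of_real (G s z))
      = c *\<^sub>R (exp (- (\<alpha> + \<beta>) * q (z - t *\<^sub>R x)) *\<^sub>R iexp (2 * b x (z - t *\<^sub>R x)))"
      by (simp only: scaleR_scaleR)
  qed
  also have "\<dots> = c *\<^sub>R (LINT z|lborel. exp (- (\<alpha> + \<beta>) * q (z - t *\<^sub>R x)) *\<^sub>R iexp
      (2 * b x (z - t *\<^sub>R x)))"
    by (rule integral_scaleR_right)
  also have "(LINT z|lborel. exp (- (\<alpha> + \<beta>) * q (z - t *\<^sub>R x)) *\<^sub>R iexp (2 * b x (z - t *\<^sub>R x)))
     = (LINT z|lborel. exp (- (\<alpha> + \<beta>) * q z) *\<^sub>R iexp (2 * b x z))"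
    using lborel_integral_shift(1)[of "\<lambda>z. exp (- (\<alpha> + \<beta>) * q z) *\<^sub>R iexp (2 * b x z)" "- t *\<^sub>R x"]
    by (simp add: add.commute)
  also have "\<dots> = complex_of_real ((pi / (\<alpha> + \<beta>)) ^ n / (\<Prod>j=1..n. \<mu> j) * exp (- q x / (\<alpha> + \<beta>)))"
    using gaussian_integral[OF pos(3), of x] by (simp add: has_bochner_integral_iff)
  also have "c *\<^sub>R \<dots> = complex_of_real (c * ((pi / (\<alpha> + \<beta>)) ^ n / (\<Prod>j=1..n. \<mu> j) * exp
      (- q x / (\<alpha> + \<beta>))))"
    by (simp add: scaleR_conv_of_real)
  also have "c * ((pi / (\<alpha> + \<beta>)) ^ n / (\<Prod>j=1..n. \<mu> j) * exp (- q x / (\<alpha> + \<beta>))) = G (r * s) x"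
  proof -
    have cancel: "(1 - r) * \<alpha> = 1 + r" "(1 - s) * \<beta> = 1 + s"
      using r s by (simp_all add: \<alpha>_def \<beta>_def)
    have "(1 - r) * (1 - s) * (\<alpha> + \<beta>) = ((1 - r) * \<alpha>) * (1 - s) + (1 - r) * ((1 - s) * \<beta>)"
      by (simp add: algebra_simps)
    then have ab: "(1 - r) * (1 - s) * (\<alpha> + \<beta>) = 2 * (1 - r * s)"
      unfolding cancel by (simp add: algebra_simps)
    have e: "exp (- (\<alpha> * \<beta> / (\<alpha> + \<beta>)) * q x) * exp (- q x / (\<alpha> + \<beta>))
        = exp (- ((1 + r * s) / (1 - r * s)) * q x)"
    proof -
      have "(\<alpha> * \<beta> + 1) * ((1 - r) * (1 - s)) = ((1 - r) * \<alpha>) * ((1 - s) * \<beta>) + (1 - r) * (1 - s)"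
        by (simp add: algebra_simps)
      then have "(\<alpha> * \<beta> + 1) * ((1 - r) * (1 - s)) = 2 * (1 + r * s)"
        unfolding cancel by (simp add: algebra_simps)
      then have "(\<alpha> * \<beta> + 1) / (\<alpha> + \<beta>) = (2 * (1 + r * s)) / (2 * (1 - r * s))"
        unfolding ab[symmetric] using r s by (simp add: divide_simps)
      also have "\<dots> = (1 + r * s) / (1 - r * s)" by (rule mult_divide_mult_cancel_left) simp
      finally have *: "(\<alpha> * \<beta> + 1) / (\<alpha> + \<beta>) = (1 + r * s) / (1 - r * s)" .
      show ?thesis unfolding exp_add[symmetric] *[symmetric]
        by (intro arg_cong[where f=exp]) (simp add: add_divide_distrib algebra_simps)
    qed
    have k: "vol / (1 - r) ^ n * (vol / (1 - s) ^ n) * ((pi / (\<alpha> + \<beta>)) ^ n / (\<Prod>j=1..n. \<mu> j))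
        = vol / (1 - r * s) ^ n"
    proof -
      have "vol / (1 - r) ^ n * (vol / (1 - s) ^ n) * ((pi / (\<alpha> + \<beta>)) ^ n / (\<Prod>j=1..n. \<mu> j))
        = vol * (vol / (\<Prod>j=1..n. \<mu> j)) * pi ^ n / ((1 - r) * (1 - s) * (\<alpha> + \<beta>)) ^ n"
        by (simp add: power_divide power_mult_distrib)
      also have "vol / (\<Prod>j=1..n. \<mu> j) = (2 / pi) ^ n"
        unfolding prod_\<mu>(2) by (rule nonzero_mult_div_cancel_right[OF
            less_imp_neq[OF prod_\<mu>(1), symmetric]])
      also have "vol * (2 / pi) ^ n * pi ^ n / ((1 - r) * (1 - s) * (\<alpha> + \<beta>)) ^ n
          = vol / (1 - r * s) ^ n"
        unfolding ab power_mult_distrib power_divide by simp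
      finally show ?thesis .
    qed
    have "c * ((pi / (\<alpha> + \<beta>)) ^ n / (\<Prod>j=1..n. \<mu> j) * exp (- q x / (\<alpha> + \<beta>)))
      = (vol / (1 - r) ^ n * (vol / (1 - s) ^ n) * ((pi / (\<alpha> + \<beta>)) ^ n / (\<Prod>j=1..n. \<mu> j)))
        * (exp (- (\<alpha> * \<beta> / (\<alpha> + \<beta>)) * q x) * exp (- q x / (\<alpha> + \<beta>)))"
      unfolding c_def by (simp only: mult_ac)
    then show ?thesis unfolding k e G_def .
  qed
  finally show ?thesis .
qed

text \<open>Coefficients of \<open>r ^ m\<close> in Mehler's formula with \<open>s\<close> fixed.
  The comparison takes place for \<open>r < 1 / 5\<close>, where the crude majorant applies, while
  \<open>s\<close> may be any number in the unit interval.\<close>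

lemma Q_twist_G:
  assumes s: "0 \<le> s" "s < 1"
  shows "twist (Q m) (\<lambda>z. complex_of_real (G s z)) x = complex_of_real (s ^ m * Q m x)"
proof (rule power_series_unique[where d="1 / 5"
    and a="\<lambda>m. twist (Q m) (\<lambda>z. complex_of_real (G s z)) x"
      and b="\<lambda>m. complex_of_real (s ^ m * Q m x)" and f="\<lambda>r. complex_of_real (G (r * s) x)"])
  fix r :: real assume r: "0 < r" "r < 1 / 5"
  have K: "\<bar>\<Sum>m<M. r ^ m * Q m y\<bar> \<le> K" for M y
  proof -
    have "K * exp (- q y / 2) \<le> K * 1" using K_pos by (intro mult_left_mono) auto
    then show ?thesis using Q_partial_sum_le[of r, where M=M and y=y] r by simp
  qed
  have "(\<lambda>m. complex_of_real (r ^ m) * twist (Q m) (\<lambda>z. complex_of_real (G s z)) x) sums twist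
      (G r) (\<lambda>z. complex_of_real (G s z)) x"
    by (rule twist_sums[OF _ _ K]) (use r G_integrable[OF s] in auto)
  then show "(\<lambda>m. complex_of_real (r ^ m) * twist (Q m) (\<lambda>z. complex_of_real (G s z)) x) sums
      complex_of_real (G (r * s) x)"
    using G_semigroup[of r s x] r s by simp
  have "r * s \<le> r * 1" using r s by (intro mult_left_mono) auto
  then have "r * s < 1" using r by linarith
  then have "(\<lambda>m. (r * s) ^ m * Q m x) sums G (r * s) x"
    using r s by (intro Q_sums) auto
  from sums_of_real[OF this, where 'a=complex]
  show "(\<lambda>m. complex_of_real (r ^ m) * complex_of_real (s ^ m * Q m x)) sums complex_of_real
      (G (r * s) x)"
    by (simp add: power_mult_distrib mult.assoc)
qed simp

text \<open>Coefficients of \<open>s ^ k\<close> in \<open>Q_twist_G\<close>: its right-hand side is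
  the single monomial \<open>s ^ m * Q m x\<close>, so every other coefficient vanishes.\<close>

lemma Q_twist_Q:
  "twist (Q m) (\<lambda>z. complex_of_real (Q k z)) x = (if m = k then complex_of_real (Q m x) else 0)"
proof (rule power_series_unique[where d="1 / 5"
    and a="\<lambda>k. twist (Q m) (\<lambda>z. complex_of_real (Q k z)) x"
      and b="\<lambda>k. if m = k then complex_of_real (Q m x) else 0"
          and f="\<lambda>s. complex_of_real (s ^ m * Q m x)"])
  fix s :: real assume s: "0 < s" "s < 1 / 5"
  have "(\<lambda>k. complex_of_real (s ^ k) * (if m = k then complex_of_real (Q m x) else 0))
      = (\<lambda>k. if k = m then complex_of_real (s ^ m * Q m x) else 0)"
    by auto
  then show "(\<lambda>k. complex_of_real (s ^ k) * (if m = k then complex_of_real (Q m x) else 0)) sums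
      complex_of_real (s ^ m * Q m x)"
    using sums_single[of m "\<lambda>_. complex_of_real (s ^ m * Q m x)"] by simp
  have int: "integrable lborel (\<lambda>z. Q m (x - z) *\<^sub>R (iexp (2 * b x z) * complex_of_real (Q k z)))"
      for k
    by (rule twist_integrable[OF _ Q_bound_nat]) (use Q_integrable in auto)
  have "(\<Sum>k<M. complex_of_real (s ^ k) * twist (Q m) (\<lambda>z. complex_of_real (Q k z)) x)
    = (LINT z|lborel. Q m (x - z) *\<^sub>R (iexp (2 * b x z) * complex_of_real (\<Sum>k<M. s ^ k * Q k z)))"
        for M
  proof -
    have "(\<Sum>k<M. complex_of_real (s ^ k) * twist (Q m) (\<lambda>z. complex_of_real (Q k z)) x)
      = (\<Sum>k<M. (LINT z|lborel. complex_of_real (s ^ k)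
          * (Q m (x - z) *\<^sub>R (iexp (2 * b x z) * complex_of_real (Q k z)))))"
      by (simp only: twist_def integral_mult_right_zero)
    also have "\<dots> = (LINT z|lborel. (\<Sum>k<M. complex_of_real (s ^ k)
        * (Q m (x - z) *\<^sub>R (iexp (2 * b x z) * complex_of_real (Q k z)))))"
      by (rule Bochner_Integration.integral_sum[symmetric]) (intro integrable_mult_right int)
    finally show ?thesis by (simp add: sum_distrib_left scaleR_sum_right scaleR_conv_of_real
        mult_ac)
  qed
  moreover have "(\<lambda>M. LINT z|lborel. Q m (x - z) *\<^sub>R (iexp (2 * b x z) * complex_of_real
      (\<Sum>k<M. s ^ k * Q k z)))
      \<longlonglongrightarrow> (LINT z|lborel. Q m (x - z) *\<^sub>R (iexp (2 * b x z) * complex_of_real (G s z)))"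
  \<comment> \<open>One factor is bounded uniformly by \<open>Q_bound_nat\<close>; the partial sums
    of the other are dominated by an integrable Gaussian since \<open>s < 1 / 5\<close>.\<close>
  proof (rule integral_dominated_convergence[where w="\<lambda>z. (5 ^ m * K) * (K * exp (- q z / 2))"])
    show "AE z in lborel. (\<lambda>M. Q m (x - z) *\<^sub>R (iexp (2 * b x z) * complex_of_real
        (\<Sum>k<M. s ^ k * Q k z)))
        \<longlonglongrightarrow> Q m (x - z) *\<^sub>R (iexp (2 * b x z) * complex_of_real (G s z))"
      using Q_sums[of s, unfolded sums_def] s by (intro AE_I2 tendsto_intros) auto
    show "AE z in lborel. norm (Q m (x - z) *\<^sub>R (iexp (2 * b x z) * complex_of_real
        (\<Sum>k<M. s ^ k * Q k z))) \<le> (5 ^ m * K) * (K * exp (- q z / 2))" for M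
    proof (intro AE_I2)
      fix z
      have "\<bar>Q m (x - z)\<bar> * \<bar>\<Sum>k<M. s ^ k * Q k z\<bar> \<le> (5 ^ m * K) * (K * exp (- q z / 2))"
        by (intro mult_mono Q_bound_nat Q_partial_sum_le) (use s K_pos in auto)
      then show "norm (Q m (x - z) *\<^sub>R (iexp (2 * b x z) * complex_of_real (\<Sum>k<M. s ^ k * Q k z)))
          \<le> (5 ^ m * K) * (K * exp (- q z / 2))"
        by (simp del: of_real_mult of_real_sum)
    qed
  qed (use integrable_exp_half in auto)
  ultimately show "(\<lambda>k. complex_of_real (s ^ k) * twist (Q m) (\<lambda>z. complex_of_real (Q k z)) x)
      sums complex_of_real (s ^ m * Q m x)"
    using Q_twist_G[of s m x] s unfolding sums_def twist_def by simp
qed simp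

lemma Q_square_integrable: "integrable lborel (\<lambda>z. (Q m z)\<^sup>2)"
proof (rule Bochner_Integration.integrable_bound)
  show "integrable lborel (\<lambda>z. (5 ^ m * K) * \<bar>Q m z\<bar>)" using Q_integrable by simp
  have "(Q m z)\<^sup>2 \<le> (5 ^ m * K) * \<bar>Q m z\<bar>" for z
  proof -
    have "(Q m z)\<^sup>2 = \<bar>Q m z\<bar> * \<bar>Q m z\<bar>" by (simp add: power2_eq_square)
    then show ?thesis using mult_right_mono[OF Q_bound_nat[of m z], of "\<bar>Q m z\<bar>"]
        by (simp only: abs_ge_zero)
  qed
  then show "AE z in lborel. norm ((Q m z)\<^sup>2) \<le> norm ((5 ^ m * K) * \<bar>Q m z\<bar>)"
    using K_pos by (auto simp: abs_mult)
qed simp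

text \<open>
  \<open>Q m\<close> is a reproducing kernel, so by the inequality \<open>2 |s t| \<le> s\<^sup>2 + t\<^sup>2\<close> it attains its
  maximum at the origin. This replaces the classical bound \<open>|L\<^sub>k x| \<le> exp (x / 2)\<close>.
\<close>

lemma Q_le_Q0: "\<bar>Q m x\<bar> \<le> Q m 0"
proof -
  \<comment> \<open>At the origin the phase is trivial and \<open>Q m\<close> is even, so the
    reproducing property identifies \<open>Q m 0\<close> with the squared norm of
    \<open>Q m\<close>.\<close>
  have "complex_of_real (Q m 0) = twist (Q m) (\<lambda>z. complex_of_real (Q m z)) 0"
      by (simp add: Q_twist_Q)
  also have "\<dots> = (LINT z|lborel. complex_of_real ((Q m z)\<^sup>2))"
    unfolding twist_def by (intro Bochner_Integration.integral_cong refl)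
        (simp add: b_linear scaleR_conv_of_real power2_eq_square)
  also have "\<dots> = complex_of_real (LINT z|lborel. (Q m z)\<^sup>2)" by (rule integral_complex_of_real)
  finally have Q0: "Q m 0 = (LINT z|lborel. (Q m z)\<^sup>2)" by (simp only: of_real_eq_iff)
  have sh: "integrable lborel (\<lambda>z. (Q m (x - z))\<^sup>2)" "(LINT z|lborel. (Q m (x - z))\<^sup>2)
      = (LINT z|lborel. (Q m z)\<^sup>2)"
    using lborel_integral_shift(2,4)[of "\<lambda>z. (Q m z)\<^sup>2" x] Q_square_integrable[of m] by simp_all
  have "\<bar>Q m x\<bar> = norm (twist (Q m) (\<lambda>z. complex_of_real (Q m z)) x)" by (simp add: Q_twist_Q)
  also have "\<dots> \<le> (LINT z|lborel. norm (Q m (x - z) *\<^sub>R (iexp (2 * b x z) * complex_of_real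
      (Q m z))))"
    unfolding twist_def by (rule integral_norm_bound)
  also have "\<dots> \<le> (LINT z|lborel. ((Q m (x - z))\<^sup>2 + (Q m z)\<^sup>2) / 2)"
  proof (rule integral_mono')
    show "integrable lborel (\<lambda>z. ((Q m (x - z))\<^sup>2 + (Q m z)\<^sup>2) / 2)" using sh Q_square_integrable
        by simp
    fix z
    have "\<bar>Q m (x - z)\<bar> * \<bar>Q m z\<bar> \<le> ((Q m (x - z))\<^sup>2 + (Q m z)\<^sup>2) / 2"
      using zero_le_power2[of "\<bar>Q m (x - z)\<bar> - \<bar>Q m z\<bar>"] by (simp add: power2_diff)
    then show "norm (Q m (x - z) *\<^sub>R (iexp (2 * b x z) * complex_of_real (Q m z)))
        \<le> ((Q m (x - z))\<^sup>2 + (Q m z)\<^sup>2) / 2"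
      by (simp del: of_real_mult)
  qed simp
  also have "\<dots> = Q m 0" using sh Q_square_integrable Q0 by simp
  finally show ?thesis .
qed

lemma Q0_nonneg: "Q m 0 \<ge> 0"
  using Q_le_Q0[of m 0] by linarith

text \<open>The series at the origin has nonnegative terms and majorises the series at every point.
  This frees the exchange of sum and integral from the restriction to small
  \<open>r\<close>.\<close>

lemma Q_partial_sum_le_G0:
  assumes r: "0 \<le> r" "r < 1"
  shows "\<bar>\<Sum>m<M. r ^ m * Q m y\<bar> \<le> G r 0"
proof -
  have "\<bar>\<Sum>m<M. r ^ m * Q m y\<bar> \<le> (\<Sum>m<M. \<bar>r ^ m * Q m y\<bar>)" by (rule sum_abs)
  also have "\<dots> \<le> (\<Sum>m<M. r ^ m * Q m 0)"
    using r Q_le_Q0 by (intro sum_mono) (auto simp: abs_mult intro!: mult_left_mono)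
  also have "\<dots> \<le> G r 0"
    using Q_sums[OF r, of 0] Q0_nonneg r sum_le_suminf[of "\<lambda>m. r ^ m * Q m 0" "{..<M}"]
        by (auto simp: sums_iff)
  finally show ?thesis .
qed

section \<open>The operators as mutually orthogonal projections\<close>

lemma bounded_integrable_twist:
  assumes f: "bounded_integrable f"
  shows "bounded_integrable (twist (Q m) f)"
  unfolding bounded_integrable_def
proof (intro conjI exI allI)
  have fi: "integrable lborel f" and [measurable]: "f \<in> borel_measurable borel"
    using f by (auto simp: bounded_integrable_def dest: borel_measurable_integrable)
  show "norm (twist (Q m) f x) \<le> Q m 0 * (LINT z|lborel. norm (f z))" for x
    by (rule norm_twist_le[OF Q_le_Q0 fi])
  have "integrable (lborel \<Otimes>\<^sub>M lborel) (\<lambda>(z, x). Q m (x - z) *\<^sub>R (iexp (2 * b x z) * f z))"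
  proof (rule lborel_pair.Fubini_integrable)
    have sh: "integrable lborel (\<lambda>x. \<bar>Q m (x - z)\<bar>)" "(LINT x|lborel. \<bar>Q m (x - z)\<bar>)
        = (LINT x|lborel. \<bar>Q m x\<bar>)" for z
      using lborel_integral_shift(1,3)[of "\<lambda>x. \<bar>Q m x\<bar>" "- z"] Q_integrable
          by (simp_all add: add.commute)
    show "integrable lborel (\<lambda>z. LINT x|lborel. norm (case (z, x) of (z, x) \<Rightarrow> Q m (x - z)
        *\<^sub>R (iexp (2 * b x z) * f z)))"
      using fi by (simp add: sh del: of_real_mult)
    show "AE z in lborel. integrable lborel (\<lambda>x. case (z, x) of (z, x) \<Rightarrow> Q m (x - z)
        *\<^sub>R (iexp (2 * b x z) * f z))"
    proof (intro AE_I2)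
      fix z
      have "integrable lborel (\<lambda>x. \<bar>Q m (x - z)\<bar> * norm (f z))" using sh by simp
      then have "integrable lborel (\<lambda>x. Q m (x - z) *\<^sub>R (iexp (2 * b x z) * f z))"
        by (rule Bochner_Integration.integrable_bound) (auto simp: abs_mult simp del: of_real_mult)
      then show "integrable lborel (\<lambda>x. case (z, x) of (z, x) \<Rightarrow> Q m (x - z)
          *\<^sub>R (iexp (2 * b x z) * f z))" by simp
    qed
  qed measurable
  from lborel_pair.integrable_snd[OF this]
  show "integrable lborel (twist (Q m) f)" unfolding twist_def[abs_def] .
qed

text \<open>Associativity of twisted convolution reduces the composition of the operators to the
  product of their kernels, which \<open>Q_twist_Q\<close> evaluates.\<close>

lemma twist_twist:
  assumes f: "bounded_integrable f"
  shows "twist (Q m) (twist (Q k) f) x = (if m = k then twist (Q m) f x else 0)"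
proof -
  have fi: "integrable lborel f" and [measurable]: "f \<in> borel_measurable borel"
    using f by (auto simp: bounded_integrable_def dest: borel_measurable_integrable)
  let ?F = "\<lambda>u z. Q m (x - u) *\<^sub>R (iexp (2 * b x u) * (Q k (u - z) *\<^sub>R (iexp (2 * b u z) * f z)))"
  have "twist (Q m) (twist (Q k) f) x = (LINT u|lborel. LINT z|lborel. ?F u z)"
    by (simp only: twist_def integral_scaleR_right integral_mult_right_zero)
  also have "\<dots> = (LINT z|lborel. LINT u|lborel. ?F u z)"
  proof (rule lborel_pair.Fubini_integral)
    have "integrable lborel (\<lambda>u. Q m (x - u))"
      using lborel_integral_shift(4)[of "Q m" x] Q_integrable by simp
    from integrable_pair_mult[OF fi[THEN integrable_norm]
        this[THEN integrable_norm, THEN integrable_mult_right, of "Q k 0"]]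
    have "integrable (lborel \<Otimes>\<^sub>M lborel) (\<lambda>(z, u). norm (f z) * (Q k 0 * norm (Q m (x - u))))" .
    then show "integrable (lborel \<Otimes>\<^sub>M lborel) (\<lambda>(z, u). ?F u z)"
    proof (rule Bochner_Integration.integrable_bound)
      have "\<bar>Q m (x - u)\<bar> * \<bar>Q k (u - z)\<bar> * norm (f z) \<le> norm (f z) * (Q k 0 * \<bar>Q m (x - u)\<bar>)"
          for u z
        using mult_right_mono[OF Q_le_Q0[of k "u - z"], of "norm (f z) * \<bar>Q m (x - u)\<bar>"]
            by (simp add: mult_ac)
      then show "AE p in lborel \<Otimes>\<^sub>M lborel. norm (case p of (z, u) \<Rightarrow> ?F u z)
          \<le> norm (case p of (z, u) \<Rightarrow> norm (f z) * (Q k 0 * norm (Q m (x - u))))"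
        using Q0_nonneg by (intro AE_I2) (auto simp: case_prod_beta abs_mult simp del: of_real_mult)
    qed measurable
  qed
  also have "\<dots> = (LINT z|lborel. twist (Q m) (\<lambda>u. complex_of_real (Q k u)) (x - z)
      * (iexp (2 * b x z) * f z))"
  proof (intro Bochner_Integration.integral_cong refl)
    fix z
    have "(LINT u|lborel. ?F u z) = (LINT u|lborel. ?F (z + u) z)"
      by (rule lborel_integral_shift(1)[symmetric]) simp
    also have "\<dots> = (LINT u|lborel. (Q m (x - z - u) *\<^sub>R (iexp (2 * b (x - z) u) * complex_of_real
        (Q k u))) * (iexp (2 * b x z) * f z))"
    proof (intro Bochner_Integration.integral_cong refl)
      fix u
      \<comment> \<open>The cocycle identity behind associativity: the phases of the two nested
        convolutions regroup into those of the convolution of the kernels followed by the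
        convolution with \<open>f\<close>.\<close>
      have "b x (z + u) + b (z + u) z = b (x - z) u + b x z"
        using skew[of u z] by (simp add: b_linear)
      then have "iexp (2 * b x (z + u)) * iexp (2 * b (z + u) z)
          = iexp (2 * b (x - z) u) * iexp (2 * b x z)"
        unfolding exp_add[symmetric] distrib_left[symmetric] of_real_add[symmetric] by simp
      then have "?F (z + u) z = Q m (x - z - u)
          *\<^sub>R (complex_of_real (Q k u) * (iexp (2 * b (x - z) u) * iexp (2 * b x z)) * f z)"
        by (simp add: scaleR_conv_of_real diff_diff_eq mult_ac del: of_real_mult)
      then show "?F (z + u) z = (Q m (x - z - u) *\<^sub>R (iexp (2 * b (x - z) u) * complex_of_real
          (Q k u))) * (iexp (2 * b x z) * f z)"
        by (simp add: mult_ac del: of_real_mult)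
    qed
    finally show "(LINT u|lborel. ?F u z) = twist (Q m) (\<lambda>u. complex_of_real (Q k u)) (x - z)
        * (iexp (2 * b x z) * f z)"
      by (simp only: twist_def integral_mult_left_zero)
  qed
  also have "\<dots> = (if m = k then twist (Q m) f x else 0)"
    unfolding Q_twist_Q by (auto simp: twist_def scaleR_conv_of_real)
  finally show ?thesis .
qed

text \<open>The integral kernel \<open>Q m (x - z) * exp (2 * \<i> * b x z)\<close> is Hermitian,
  since \<open>Q m\<close> is real and even and \<open>b\<close> is skew.\<close>

lemma twist_self_adjoint:
  assumes f: "bounded_integrable f" and g: "bounded_integrable g"
  shows "(LINT x|lborel. cnj (g x) * twist (Q m) f x)
      = (LINT z|lborel. cnj (twist (Q m) g z) * f z)"
proof -
  have fi: "integrable lborel f" and gi: "integrable lborel g"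
    and [measurable]: "f \<in> borel_measurable borel" "g \<in> borel_measurable borel"
    using f g by (auto simp: bounded_integrable_def dest: borel_measurable_integrable)
  let ?F = "\<lambda>x z. cnj (g x) * (Q m (x - z) *\<^sub>R (iexp (2 * b x z) * f z))"
  have "(LINT x|lborel. cnj (g x) * twist (Q m) f x) = (LINT x|lborel. LINT z|lborel. ?F x z)"
    by (simp only: twist_def integral_mult_right_zero)
  also have "\<dots> = (LINT z|lborel. LINT x|lborel. ?F x z)"
  proof (rule lborel_pair.Fubini_integral)
    from integrable_pair_mult[OF fi[THEN integrable_norm]
        gi[THEN integrable_norm, THEN integrable_mult_right, of "Q m 0"]]
    have "integrable (lborel \<Otimes>\<^sub>M lborel) (\<lambda>(z, x). norm (f z) * (Q m 0 * norm (g x)))" .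
    then show "integrable (lborel \<Otimes>\<^sub>M lborel) (\<lambda>(z, x). ?F x z)"
    proof (rule Bochner_Integration.integrable_bound)
      have "\<bar>Q m (x - z)\<bar> * (norm (g x) * norm (f z)) \<le> norm (f z) * (Q m 0 * norm (g x))" for x z
        using mult_right_mono[OF Q_le_Q0[of m "x - z"], of "norm (f z) * norm (g x)"]
            by (simp add: mult_ac)
      then show "AE p in lborel \<Otimes>\<^sub>M lborel. norm (case p of (z, x) \<Rightarrow> ?F x z)
          \<le> norm (case p of (z, x) \<Rightarrow> norm (f z) * (Q m 0 * norm (g x)))"
        using Q0_nonneg by (intro AE_I2) (auto simp: case_prod_beta norm_mult
            simp del: of_real_mult)
    qed measurable
  qed
  also have "\<dots> = (LINT z|lborel. cnj (twist (Q m) g z) * f z)"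
  proof (intro Bochner_Integration.integral_cong refl)
    fix z
    have "cnj (twist (Q m) g z) = (LINT x|lborel. cnj (Q m (z - x) *\<^sub>R (iexp (2 * b z x) * g x)))"
      unfolding twist_def by (rule Bochner_Integration.integral_cnj[symmetric])
    also have "\<dots> = (LINT x|lborel. Q m (x - z) *\<^sub>R (iexp (2 * b x z) * cnj (g x)))"
    proof (intro Bochner_Integration.integral_cong refl)
      fix x
      have "Q m (z - x) = Q m (x - z)" using Q_minus[of m "x - z"] by simp
      moreover have "cnj (iexp (2 * b z x)) = iexp (2 * b x z)" using skew[of z x]
          by (simp add: exp_cnj)
      ultimately show "cnj (Q m (z - x) *\<^sub>R (iexp (2 * b z x) * g x))
          = Q m (x - z) *\<^sub>R (iexp (2 * b x z) * cnj (g x))"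
        by (simp del: of_real_mult)
    qed
    finally have "cnj (twist (Q m) g z) * f z
        = (LINT x|lborel. (Q m (x - z) *\<^sub>R (iexp (2 * b x z) * cnj (g x))) * f z)"
      by (simp only: integral_mult_left_zero)
    also have "\<dots> = (LINT x|lborel. ?F x z)"
      by (intro Bochner_Integration.integral_cong refl) (simp add: mult_ac)
    finally show "(LINT x|lborel. ?F x z) = cnj (twist (Q m) g z) * f z" by simp
  qed
  finally show ?thesis .
qed

section \<open>The twisted Gaussians as an approximate identity\<close>

lemma vol_gaussian: "vol * (pi ^ n / (\<Prod>j=1..n. \<mu> j)) = 2 ^ n"
proof -
  define P where "P = (\<Prod>j=1..n. \<mu> j)"
  have "P > 0" using prod_\<mu>(1) by (simp only: P_def)
  then show ?thesis unfolding prod_\<mu>(2) P_def[symmetric] by (simp add: power_divide)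
qed

text \<open>Substituting \<open>y = \<delta> *\<^sub>R u\<close> with
  \<open>\<delta>\<^sup>2 = (1 - r) / (1 + r)\<close> makes the Gaussian independent of
  \<open>r\<close> and replaces the singular prefactor \<open>vol / (1 - r) ^ n\<close> by
  \<open>vol / (1 + r) ^ n\<close>. The limit \<open>r\<close> to 1 becomes \<open>\<delta>\<close>
  to 0.\<close>

lemma twist_G_rescaled:
  assumes r: "0 \<le> r" "r < 1" and [measurable]: "f \<in> borel_measurable borel"
  defines "\<delta> \<equiv> sqrt ((1 - r) / (1 + r))"
  shows "twist (G r) f x = (vol / (1 + r) ^ n)
      *\<^sub>R (LINT u|lborel. exp (- 1 * q u) *\<^sub>R (iexp (- (2 * (\<delta> * b x u))) * f (x - \<delta> *\<^sub>R u)))"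
proof -
  define F where "F y = G r y *\<^sub>R (iexp (- (2 * b x y)) * f (x - y))" for y
  have [measurable]: "F \<in> borel_measurable borel" unfolding F_def by measurable
  have d: "\<delta> > 0" "\<delta>\<^sup>2 = (1 - r) / (1 + r)" using r by (auto simp: \<delta>_def)
  have "twist (G r) f x = (LINT y|lborel. F y)" unfolding F_def by (rule twist_change) simp_all
  also have "\<dots> = \<delta> ^ (2 * n) *\<^sub>R (LINT u|lborel. F (0 + \<delta> *\<^sub>R u))"
    using d lborel_integral_affine[of F \<delta> 0] by (simp add: dim)
  also have "(LINT u|lborel. F (0 + \<delta> *\<^sub>R u))
      = (LINT u|lborel. (vol / (1 - r) ^ n) *\<^sub>R (exp (- 1 * q u)
      *\<^sub>R (iexp (- (2 * (\<delta> * b x u))) * f (x - \<delta> *\<^sub>R u))))"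
  proof (intro Bochner_Integration.integral_cong refl)
    fix u
    have "(1 + r) / (1 - r) * \<delta>\<^sup>2 = 1" using r unfolding d(2) by simp
    then have "- ((1 + r) / (1 - r)) * q (\<delta> *\<^sub>R u) = - 1 * q u"
      unfolding q_scaleR mult_minus_left mult.assoc[symmetric] by (simp only:)
    then have "G r (\<delta> *\<^sub>R u) = vol / (1 - r) ^ n * exp (- 1 * q u)" unfolding G_def by (simp only:)
    then show "F (0 + \<delta> *\<^sub>R u) = (vol / (1 - r) ^ n)
        *\<^sub>R (exp (- 1 * q u) *\<^sub>R (iexp (- (2 * (\<delta> * b x u))) * f (x - \<delta> *\<^sub>R u)))"
      unfolding F_def b_linear add_0 by (simp only: scaleR_scaleR)
  qed
  also have "\<delta> ^ (2 * n) *\<^sub>R (LINT u|lborel. (vol / (1 - r) ^ n)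
      *\<^sub>R (exp (- 1 * q u) *\<^sub>R (iexp (- (2 * (\<delta> * b x u))) * f (x - \<delta> *\<^sub>R u))))
     = (\<delta> ^ (2 * n) * (vol / (1 - r) ^ n)) *\<^sub>R (LINT u|lborel. exp (- 1 * q u)
         *\<^sub>R (iexp (- (2 * (\<delta> * b x u))) * f (x - \<delta> *\<^sub>R u)))"
    by (subst integral_scaleR_right) (simp only: scaleR_scaleR)
  also have "\<delta> ^ (2 * n) * (vol / (1 - r) ^ n) = vol / (1 + r) ^ n"
    using r unfolding power_mult d(2) by (simp add: power_divide)
  finally show ?thesis .
qed

text \<open>The bound does not depend on \<open>r\<close> and so dominates the Abel limit. The
  factor \<open>2 ^ n\<close> is the total mass from \<open>vol_gaussian\<close>; the denominator
  \<open>(1 + r) ^ n\<close> is estimated by 1.\<close>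

lemma norm_twist_G_le:
  assumes r: "0 \<le> r" "r < 1" and [measurable]: "f \<in> borel_measurable borel"
      and C: "\<And>x. norm (f x) \<le> C"
  shows "norm (twist (G r) f x) \<le> 2 ^ n * C"
proof -
  define \<delta> where "\<delta> = sqrt ((1 - r) / (1 + r))"
  have C0: "C \<ge> 0" by (rule order_trans[OF norm_ge_zero C])
  have "norm (LINT u|lborel. exp (- 1 * q u) *\<^sub>R (iexp (- (2 * (\<delta> * b x u))) * f (x - \<delta> *\<^sub>R u)))
      \<le> (LINT u|lborel. norm (exp (- 1 * q u) *\<^sub>R (iexp (- (2 * (\<delta> * b x u))) * f (x - \<delta> *\<^sub>R u))))"
    by (rule integral_norm_bound)
  also have "\<dots> \<le> (LINT u|lborel. exp (- 1 * q u) * C)"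
    using gaussian_integral_real(1)[of 1] C C0
    by (intro integral_mono') (auto intro!: mult_left_mono simp del: of_real_mult of_real_minus)
  also have "\<dots> = (pi ^ n / (\<Prod>j=1..n. \<mu> j)) * C"
    using gaussian_integral_real(2)[of 1] by (simp only: integral_mult_left_zero) simp
  finally have le: "norm (LINT u|lborel. exp (- 1 * q u) *\<^sub>R (iexp (- (2 * (\<delta> * b x u))) * f
      (x - \<delta> *\<^sub>R u))) \<le> (pi ^ n / (\<Prod>j=1..n. \<mu> j)) * C" .
  have "norm (twist (G r) f x) = (vol / (1 + r) ^ n) * norm
      (LINT u|lborel. exp (- 1 * q u) *\<^sub>R (iexp (- (2 * (\<delta> * b x u))) * f (x - \<delta> *\<^sub>R u)))"
    using r vol_pos by (simp only: twist_G_rescaled[OF r assms(3)] \<delta>_def[symmetric] norm_scaleR)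
        simp
  also have "\<dots> \<le> vol * ((pi ^ n / (\<Prod>j=1..n. \<mu> j)) * C)"
  proof (rule mult_mono[OF _ le])
    have "1 \<le> (1 + r) ^ n" using r by (intro one_le_power) simp
    then show "vol / (1 + r) ^ n \<le> vol" using vol_pos r by (simp add: divide_le_eq mult_left_mono)
  qed (use vol_pos in auto)
  also have "\<dots> = 2 ^ n * C" using vol_gaussian by (simp only: mult.assoc[symmetric])
  finally show ?thesis .
qed

text \<open>In the limit \<open>r = 1\<close> the denominator \<open>(1 + r) ^ n\<close> is
  \<open>2 ^ n\<close> and cancels the mass from \<open>vol_gaussian\<close>, so the limit is
  \<open>f x\<close> with constant exactly 1.\<close>

lemma twist_G_tendsto:
  assumes [measurable]: "f \<in> borel_measurable borel" and C: "\<And>x. norm (f x) \<le> C"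
      and f: "continuous_on UNIV f"
    and r: "\<And>k. 0 \<le> r k" "\<And>k. r k < 1" "r \<longlonglongrightarrow> 1"
  shows "(\<lambda>k. twist (G (r k)) f x) \<longlonglongrightarrow> f x"
proof -
  define \<delta> where "\<delta> k = sqrt ((1 - r k) / (1 + r k))" for k
  have "\<delta> \<longlonglongrightarrow> sqrt ((1 - 1) / (1 + 1))" unfolding \<delta>_def by (intro tendsto_intros r) simp
  then have d: "\<delta> \<longlonglongrightarrow> 0" by simp
  have "(\<lambda>k. LINT u|lborel. exp (- 1 * q u) *\<^sub>R (iexp (- (2 * (\<delta> k * b x u))) * f (x - \<delta> k *\<^sub>R u)))
     \<longlonglongrightarrow> (LINT u|lborel. exp (- 1 * q u) *\<^sub>R f x)"
  proof (rule integral_dominated_convergence[where w="\<lambda>u. exp (- 1 * q u) * C"])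
    show "AE u in lborel. (\<lambda>k. exp (- 1 * q u) *\<^sub>R (iexp (- (2 * (\<delta> k * b x u))) * f
        (x - \<delta> k *\<^sub>R u))) \<longlonglongrightarrow> exp (- 1 * q u) *\<^sub>R f x"
    proof (intro AE_I2)
      fix u
      have "(\<lambda>k. x - \<delta> k *\<^sub>R u) \<longlonglongrightarrow> x - 0 *\<^sub>R u" by (intro tendsto_intros d)
      then have "(\<lambda>k. f (x - \<delta> k *\<^sub>R u)) \<longlonglongrightarrow> f x"
        using f by (intro continuous_on_tendsto_compose[OF f]) auto
      then have "(\<lambda>k. exp (- 1 * q u) *\<^sub>R (iexp (- (2 * (\<delta> k * b x u))) * f (x - \<delta> k *\<^sub>R u)))
          \<longlonglongrightarrow> exp (- 1 * q u) *\<^sub>R (iexp (- (2 * (0 * b x u))) * f x)"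
        by (intro tendsto_intros d)
      then show "(\<lambda>k. exp (- 1 * q u) *\<^sub>R (iexp (- (2 * (\<delta> k * b x u))) * f (x - \<delta> k *\<^sub>R u)))
          \<longlonglongrightarrow> exp (- 1 * q u) *\<^sub>R f x"
        by simp
    qed
    show "integrable lborel (\<lambda>u. exp (- 1 * q u) * C)"
        by (intro integrable_mult_left gaussian_integral_real(1)) simp
    show "AE u in lborel. norm (exp (- 1 * q u) *\<^sub>R (iexp (- (2 * (\<delta> k * b x u))) * f
        (x - \<delta> k *\<^sub>R u))) \<le> exp (- 1 * q u) * C" for k
      using C by (intro AE_I2) (auto intro!: mult_left_mono simp del: of_real_mult of_real_minus)
  qed measurable
  also have "(LINT u|lborel. exp (- 1 * q u) *\<^sub>R f x) = (pi ^ n / (\<Prod>j=1..n. \<mu> j)) *\<^sub>R f x"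
    using gaussian_integral_real[of 1] by (subst integral_scaleR_left) auto
  finally have "(\<lambda>k. (vol / (1 + r k) ^ n) *\<^sub>R (LINT u|lborel. exp (- 1 * q u)
      *\<^sub>R (iexp (- (2 * (\<delta> k * b x u))) * f (x - \<delta> k *\<^sub>R u))))
     \<longlonglongrightarrow> (vol / (1 + 1) ^ n) *\<^sub>R ((pi ^ n / (\<Prod>j=1..n. \<mu> j)) *\<^sub>R f x)"
    by (intro tendsto_intros r) auto
  moreover have "(vol / (1 + 1) ^ n) *\<^sub>R ((pi ^ n / (\<Prod>j=1..n. \<mu> j)) *\<^sub>R f x) = f x"
  proof -
    have "vol / (1 + 1) ^ n * (pi ^ n / (\<Prod>j=1..n. \<mu> j)) = 2 ^ n / (1 + 1) ^ n"
      unfolding vol_gaussian[symmetric] by simp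
    then show ?thesis unfolding scaleR_scaleR by (simp only:) simp
  qed
  ultimately show ?thesis
    by (simp only: twist_G_rescaled[OF r(1,2) assms(1)] \<delta>_def[symmetric])
qed

section \<open>Energies, Bessel's inequality and completeness\<close>

definition energy :: "nat \<Rightarrow> (real^'d \<Rightarrow> complex) \<Rightarrow> real" where
  "energy m f = (LINT x|lborel. (norm (twist (Q m) f x))\<^sup>2)"

lemma energy_nonneg: "energy m f \<ge> 0"
  by (simp add: energy_def)

lemma integral_norm_square: "complex_of_real (LINT x|lborel. (norm (h x))\<^sup>2)
    = (LINT x|lborel. cnj (h x) * h x)"
proof -
  have "complex_of_real (LINT x|lborel. (norm (h x))\<^sup>2)
      = (LINT x|lborel. complex_of_real ((norm (h x))\<^sup>2))"
    by (rule integral_complex_of_real[symmetric])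
  then show ?thesis by (simp only: complex_norm_square mult.commute)
qed

text \<open>Self-adjointness moves one operator across the pairing, where \<open>twist_twist\<close>
  collapses the composition. Hence the quadratic form of each operator is its energy, as for an
  orthogonal projection.\<close>

lemma twist_orthogonal:
  assumes f: "bounded_integrable f"
  shows "(LINT x|lborel. cnj (twist (Q m) f x) * twist (Q k) f x)
      = (if m = k then complex_of_real (energy m f) else 0)"
    and "(LINT x|lborel. cnj (f x) * twist (Q m) f x) = complex_of_real (energy m f)"
    and "(LINT x|lborel. cnj (twist (Q m) f x) * f x) = complex_of_real (energy m f)"
proof -
  have *: "(LINT x|lborel. cnj (twist (Q m) f x) * twist (Q k) f x)
      = (if m = k then (LINT x|lborel. cnj (f x) * twist (Q m) f x) else 0)" for m k
    unfolding twist_self_adjoint[OF bounded_integrable_twist[OF f] f, symmetric] twist_twist[OF f]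
        by simp
  then show 2: "(LINT x|lborel. cnj (f x) * twist (Q m) f x) = complex_of_real (energy m f)" for m
    using integral_norm_square[of "twist (Q m) f"] by (simp add: energy_def)
  show "(LINT x|lborel. cnj (twist (Q m) f x) * twist (Q k) f x)
      = (if m = k then complex_of_real (energy m f) else 0)"
    unfolding * 2 ..
  show "(LINT x|lborel. cnj (twist (Q m) f x) * f x) = complex_of_real (energy m f)"
    unfolding twist_self_adjoint[OF f f, symmetric] by (rule 2)
qed

text \<open>Pythagoras: all mixed terms are given by \<open>twist_orthogonal\<close>. The second
  identity yields Bessel's inequality and later turns convergence of the energies into convergence
  in norm.\<close>

lemma integral_partial_sum:
  assumes f: "bounded_integrable f"
  shows "(LINT x|lborel. (norm (\<Sum>m<M. twist (Q m) f x))\<^sup>2) = (\<Sum>m<M. energy m f)"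
    and "(LINT x|lborel. (norm ((\<Sum>m<M. twist (Q m) f x) - f x))\<^sup>2)
        = (LINT x|lborel. (norm (f x))\<^sup>2) - (\<Sum>m<M. energy m f)"
proof -
  define S where "S x = (\<Sum>m<M. twist (Q m) f x)" for x
  have tb: "bounded_integrable (twist (Q m) f)" for m by (rule bounded_integrable_twist[OF f])
  have S: "bounded_integrable S" unfolding S_def[abs_def]
      by (rule bounded_integrable_sum) (auto intro: tb)
  have SS: "(LINT x|lborel. cnj (S x) * S x) = complex_of_real (\<Sum>m<M. energy m f)"
  proof -
    have "(LINT x|lborel. cnj (S x) * S x) = (LINT x|lborel.
        (\<Sum>m<M. \<Sum>k<M. cnj (twist (Q m) f x) * twist (Q k) f x))"
      by (simp add: S_def sum_product)
    also have "\<dots> = (\<Sum>m<M. \<Sum>k<M. LINT x|lborel. cnj (twist (Q m) f x) * twist (Q k) f x)"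
      by (subst Bochner_Integration.integral_sum, (intro Bochner_Integration.integrable_sum
          bounded_integrable_mult tb)[1])+
        (simp add: Bochner_Integration.integral_sum bounded_integrable_mult[OF tb tb])
    also have "\<dots> = (\<Sum>m<M. complex_of_real (energy m f))"
      unfolding twist_orthogonal(1)[OF f] by simp
    finally show ?thesis by simp
  qed
  then have "complex_of_real (LINT x|lborel. (norm (S x))\<^sup>2) = complex_of_real (\<Sum>m<M. energy m f)"
    by (simp only: integral_norm_square)
  then show "(LINT x|lborel. (norm (\<Sum>m<M. twist (Q m) f x))\<^sup>2) = (\<Sum>m<M. energy m f)"
    by (simp only: of_real_eq_iff S_def)
  have fS: "(LINT x|lborel. cnj (f x) * S x) = complex_of_real (\<Sum>m<M. energy m f)"
    unfolding S_def sum_distrib_left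
    by (subst Bochner_Integration.integral_sum) (auto intro!: bounded_integrable_mult tb f
        simp: twist_orthogonal(2)[OF f])
  have Sf: "(LINT x|lborel. cnj (S x) * f x) = complex_of_real (\<Sum>m<M. energy m f)"
    unfolding S_def cnj_sum sum_distrib_right
    by (subst Bochner_Integration.integral_sum) (auto intro!: bounded_integrable_mult tb f
        simp: twist_orthogonal(3)[OF f])
  have "complex_of_real (LINT x|lborel. (norm (S x - f x))\<^sup>2)
      = (LINT x|lborel. (cnj (S x) * S x - cnj (S x) * f x) - (cnj (f x) * S x - cnj (f x) * f x))"
    unfolding integral_norm_square by (simp add: algebra_simps)
  also have "\<dots> = ((LINT x|lborel. cnj (S x) * S x) - (LINT x|lborel. cnj (S x) * f x)) -
      ((LINT x|lborel. cnj (f x) * S x) - (LINT x|lborel. cnj (f x) * f x))"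
    by (simp add: bounded_integrable_mult[OF S S] bounded_integrable_mult[OF S f]
        bounded_integrable_mult[OF f S] bounded_integrable_mult[OF f f])
  also have "\<dots> = complex_of_real ((LINT x|lborel. (norm (f x))\<^sup>2) - (\<Sum>m<M. energy m f))"
    unfolding SS Sf fS integral_norm_square[symmetric] by simp
  finally show "(LINT x|lborel. (norm ((\<Sum>m<M. twist (Q m) f x) - f x))\<^sup>2)
      = (LINT x|lborel. (norm (f x))\<^sup>2) - (\<Sum>m<M. energy m f)"
    by (simp only: of_real_eq_iff S_def)
qed

lemma bessel:
  assumes f: "bounded_integrable f"
  shows "(\<Sum>m<M. energy m f) \<le> (LINT x|lborel. (norm (f x))\<^sup>2)"
proof -
  have "0 \<le> (LINT x|lborel. (norm ((\<Sum>m<M. twist (Q m) f x) - f x))\<^sup>2)" by simp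
  then show ?thesis unfolding integral_partial_sum(2)[OF f] by simp
qed

text \<open>Abel summation: the twisted Gaussians tend to the identity as the parameter tends to 1.\<close>

lemma energy_sums:
  assumes f: "bounded_integrable f" and cont: "continuous_on UNIV f"
  shows "(\<lambda>m. energy m f) sums (LINT x|lborel. (norm (f x))\<^sup>2)"
proof -
  let ?N = "LINT x|lborel. (norm (f x))\<^sup>2"
  have fi: "integrable lborel f" and [measurable]: "f \<in> borel_measurable borel"
    using f by (auto simp: bounded_integrable_def dest: borel_measurable_integrable)
  obtain C where C: "C \<ge> 0" "\<And>x. norm (f x) \<le> C" using bounded_integrable_bound[OF f] by blast
  have sm: "summable (\<lambda>m. energy m f)"
    by (rule summableI_nonneg_bounded[OF energy_nonneg bessel[OF f]])
  \<comment> \<open>Pairing \<open>f\<close> with the twisted Gaussian is the Abel mean of the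
    energies, as the next step shows.\<close>
  define A where "A r = (LINT x|lborel. cnj (f x) * twist (G r) f x)" for r
  have A: "(\<lambda>m. complex_of_real (r ^ m * energy m f)) sums A r" if r: "0 \<le> r" "r < 1" for r
  proof -
    have "(\<Sum>m<M. complex_of_real (r ^ m * energy m f))
        = (LINT x|lborel. cnj (f x) * (\<Sum>m<M. complex_of_real (r ^ m) * twist (Q m) f x))" for M
    proof -
      have "(LINT x|lborel. cnj (f x) * (\<Sum>m<M. complex_of_real (r ^ m) * twist (Q m) f x))
        = (LINT x|lborel. (\<Sum>m<M. complex_of_real (r ^ m) * (cnj (f x) * twist (Q m) f x)))"
        by (simp add: sum_distrib_left mult_ac)
      also have "\<dots> = (\<Sum>m<M. LINT x|lborel. complex_of_real (r ^ m) * (cnj (f x) * twist (Q m) f x))"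
        by (rule Bochner_Integration.integral_sum)
          (intro integrable_mult_right bounded_integrable_mult f bounded_integrable_twist)
      also have "\<dots> = (\<Sum>m<M. complex_of_real (r ^ m * energy m f))"
        by (simp only: integral_mult_right_zero twist_orthogonal(2)[OF f] of_real_mult)
      finally show ?thesis by simp
    qed
    moreover have "(\<lambda>M. LINT x|lborel. cnj (f x) * (\<Sum>m<M. complex_of_real (r ^ m) * twist (Q m) f
        x)) \<longlonglongrightarrow> A r"
      unfolding A_def
    proof (rule integral_dominated_convergence[where
        w="\<lambda>x. norm (f x) * (G r 0 * (LINT z|lborel. norm (f z)))"])
      show "AE x in lborel. (\<lambda>M. cnj (f x) * (\<Sum>m<M. complex_of_real (r ^ m) * twist (Q m) f x))
          \<longlonglongrightarrow> cnj (f x) * twist (G r) f x"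
        using twist_sums[OF r Q_partial_sum_le_G0[OF r] fi, unfolded sums_def]
            by (intro AE_I2 tendsto_mult tendsto_const)
      show "AE x in lborel. norm (cnj (f x) * (\<Sum>m<M. complex_of_real (r ^ m) * twist (Q m) f x))
          \<le> norm (f x) * (G r 0 * (LINT z|lborel. norm (f z)))" for M
        unfolding twist_partial_sum[OF fi] norm_mult complex_mod_cnj
        using norm_twist_le[OF Q_partial_sum_le_G0[OF r] fi] by (intro AE_I2 mult_left_mono) auto
    qed (use fi in auto)
    ultimately show ?thesis unfolding sums_def by simp
  qed
  \<comment> \<open>Every Abel mean is at most the full sum of energies. Letting \<open>r\<close>
    tend to 1 then bounds the squared norm of \<open>f\<close> by that sum, which is the converse of
    Bessel's inequality.\<close>
  have A_le: "norm (A r) \<le> (\<Sum>m. energy m f)" if r: "0 \<le> r" "r < 1" for r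
  proof -
    have le: "r ^ m * energy m f \<le> energy m f" for m
      using r energy_nonneg[of m f] by (intro mult_left_le_one_le) (auto simp: power_le_one)
    have "(\<lambda>m. r ^ m * energy m f) sums Re (A r)" using sums_Re[OF A[OF r]] by simp
    moreover have "Im (A r) = 0" using sums_Im[OF A[OF r]] by (simp add: sums_iff)
    ultimately have "A r = complex_of_real (\<Sum>m. r ^ m * energy m f)"
        "summable (\<lambda>m. r ^ m * energy m f)"
      by (auto simp: sums_iff complex_eq_iff)
    moreover have "0 \<le> (\<Sum>m. r ^ m * energy m f)"
      using r energy_nonneg by (intro suminf_nonneg) (use calculation in auto)
    moreover have "(\<Sum>m. r ^ m * energy m f) \<le> (\<Sum>m. energy m f)"
      using le sm calculation by (intro suminf_le) auto
    ultimately show ?thesis by simp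
  qed
  define r where "r k = real k / (real k + 1)" for k
  have r: "0 \<le> r k" "r k < 1" "r \<longlonglongrightarrow> 1" for k
  proof -
    show "0 \<le> r k" "r k < 1" by (auto simp: r_def)
    show "r \<longlonglongrightarrow> 1" unfolding r_def by real_asymp
  qed
  have "(\<lambda>k. A (r k)) \<longlonglongrightarrow> (LINT x|lborel. cnj (f x) * f x)"
    unfolding A_def
  proof (rule integral_dominated_convergence[where w="\<lambda>x. norm (f x) * (2 ^ n * C)"])
    show "AE x in lborel. (\<lambda>k. cnj (f x) * twist (G (r k)) f x) \<longlonglongrightarrow> cnj (f x) * f x"
      by (intro AE_I2 tendsto_mult tendsto_const twist_G_tendsto[OF _ C(2) cont r]) simp
    show "AE x in lborel. norm (cnj (f x) * twist (G (r k)) f x) \<le> norm (f x) * (2 ^ n * C)" for k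
      unfolding norm_mult complex_mod_cnj
      by (intro AE_I2 mult_left_mono norm_twist_G_le r C) auto
  qed (use fi in auto)
  then have "(\<lambda>k. norm (A (r k))) \<longlonglongrightarrow> norm (complex_of_real ?N)"
    unfolding integral_norm_square by (rule tendsto_norm)
  then have "norm (complex_of_real ?N) \<le> (\<Sum>m. energy m f)"
    by (rule LIMSEQ_le_const2) (use A_le r in auto)
  then have "?N \<le> (\<Sum>m. energy m f)" by simp
  moreover have "(\<Sum>m. energy m f) \<le> ?N"
    by (rule suminf_le_const[OF sm bessel[OF f]])
  ultimately show ?thesis using sm by (simp add: sums_iff)
qed

text \<open>All that is exported from a fibre. The third estimate makes the squared norm of the
  fibre of \<open>f\<close> a majorant when the fourth is integrated over the frequency.\<close>

lemma projection_estimates: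
  assumes f: "bounded_integrable f"
  shows "(LINT x|lborel. (norm (twist (Q m) f x))\<^sup>2) \<le> (LINT x|lborel. (norm (f x))\<^sup>2)"
    and "(LINT x|lborel. (norm (\<Sum>m<M. twist (Q m) f x))\<^sup>2) \<le> (LINT x|lborel. (norm (f x))\<^sup>2)"
    and "(LINT x|lborel. (norm ((\<Sum>m<M. twist (Q m) f x) - f x))\<^sup>2)
        \<le> (LINT x|lborel. (norm (f x))\<^sup>2)"
    and "continuous_on UNIV f \<Longrightarrow> (\<lambda>M. LINT x|lborel. (norm ((\<Sum>m<M. twist (Q m) f x) - f x))\<^sup>2) \<longlonglongrightarrow> 0"
proof -
  show "(LINT x|lborel. (norm (\<Sum>m<M. twist (Q m) f x))\<^sup>2) \<le> (LINT x|lborel. (norm (f x))\<^sup>2)"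
    unfolding integral_partial_sum(1)[OF f] by (rule bessel[OF f])
  have "energy m f \<le> (\<Sum>k<Suc m. energy k f)" by (rule member_le_sum) (auto simp: energy_nonneg)
  also have "\<dots> \<le> (LINT x|lborel. (norm (f x))\<^sup>2)" by (rule bessel[OF f])
  finally show "(LINT x|lborel. (norm (twist (Q m) f x))\<^sup>2) \<le> (LINT x|lborel. (norm (f x))\<^sup>2)"
    unfolding energy_def .
  show "(LINT x|lborel. (norm ((\<Sum>m<M. twist (Q m) f x) - f x))\<^sup>2) \<le> (LINT x|lborel. (norm (f x))\<^sup>2)"
    unfolding integral_partial_sum(2)[OF f] by (simp add: sum_nonneg energy_nonneg)
  show "(\<lambda>M. LINT x|lborel. (norm ((\<Sum>m<M. twist (Q m) f x) - f x))\<^sup>2) \<longlonglongrightarrow> 0" if "continuous_on UNIV f"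
    unfolding integral_partial_sum(2)[OF f]
    using tendsto_diff[OF tendsto_const[of "LINT x|lborel. (norm (f x))\<^sup>2"]
        energy_sums[OF f that, unfolded sums_def]] by simp
qed

end

section \<open>The partial Fourier transform of a Schwartz function\<close>

definition partial_fourier :: "('a::euclidean_space \<times> 'b::euclidean_space \<Rightarrow> complex) \<Rightarrow> 'a \<Rightarrow> 'b \<Rightarrow>
    complex" where
  "partial_fourier f y s = (LINT t|lborel. iexp (- (s \<bullet> t)) * f (y, t))"

lemma partial_fourier_eq: "partial_fourier f y s = fourier_int (\<lambda>t. f (y, t)) (- s)"
  by (simp add: partial_fourier_def fourier_int_def)

text \<open>Difference quotients are bounded by a derivative at a point shifted by at most 1, so
  their majorant must tolerate such a shift. The constant comes from
  \<open>t\<^sup>2 \<le> 2 * (t + s)\<^sup>2 + 2 * s\<^sup>2\<close>.\<close>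

lemma weight_shift_le:
  assumes b: "b \<in> Basis" and s: "\<bar>s\<bar> \<le> 1"
  shows "weight (t + s *\<^sub>R b) \<le> 3 * weight t"
proof -
  let ?g = "\<lambda>t c. 1 / (1 + (t \<bullet> c)\<^sup>2)"
  have split: "weight u = ?g u b * (\<Prod>c\<in>Basis - {b}. ?g u c)" for u
    unfolding weight_def by (rule prod.remove[OF finite_Basis b])
  have rest: "(\<Prod>c\<in>Basis - {b}. ?g (t + s *\<^sub>R b) c) = (\<Prod>c\<in>Basis - {b}. ?g t c)"
    using b by (intro prod.cong refl) (auto simp: inner_add_left inner_Basis)
  have "?g (t + s *\<^sub>R b) b \<le> 3 * ?g t b"
  proof -
    have "(t \<bullet> b)\<^sup>2 \<le> 2 * (t \<bullet> b + s)\<^sup>2 + 2 * s\<^sup>2"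
      using zero_le_power2[of "t \<bullet> b + 2 * s"] by (simp add: power2_eq_square algebra_simps)
    moreover have "s\<^sup>2 \<le> 1" using s by (simp add: abs_square_le_1)
    ultimately have "1 + (t \<bullet> b)\<^sup>2 \<le> 1 + (2 * (t \<bullet> b + s)\<^sup>2 + 2 * 1)" by auto
    also have "\<dots> \<le> 3 * (1 + (t \<bullet> b + s)\<^sup>2)" by simp
    finally have "1 + (t \<bullet> b)\<^sup>2 \<le> 3 * (1 + (t \<bullet> b + s)\<^sup>2)" .
    then show ?thesis using b by (simp add: inner_add_left divide_simps add_pos_nonneg
        add_nonneg_eq_0_iff)
  qed
  then show ?thesis unfolding split[of "t + s *\<^sub>R b"] split[of t] rest
    using mult_right_mono[of "?g (t + s *\<^sub>R b) b" "3 * ?g t b" "\<Prod>c\<in>Basis - {b}. ?g t c"]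
        by (simp add: prod_nonneg)
qed

lemma has_vector_derivative_quotient:
  assumes "(g has_vector_derivative D) (at 0)"
  shows "((\<lambda>u. (g u - g 0) /\<^sub>R u) \<longlongrightarrow> D) (at 0)"
proof -
  have "((\<lambda>u. (1 / norm (u - 0)) *\<^sub>R (g u - (g 0 + (u - 0) *\<^sub>R D))) \<longlongrightarrow> 0) (at 0)"
    using assms unfolding has_vector_derivative_def has_derivative_at2 by blast
  then have "((\<lambda>u. norm ((1 / norm (u - 0)) *\<^sub>R (g u - (g 0 + (u - 0) *\<^sub>R D)))) \<longlongrightarrow> 0) (at 0)"
    by (simp only: tendsto_norm_zero)
  moreover have "norm ((1 / norm (u - 0)) *\<^sub>R (g u - (g 0 + (u - 0) *\<^sub>R D)))
      = norm ((g u - g 0) /\<^sub>R u - D)" if "u \<noteq> 0" for u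
  proof -
    have "(g u - g 0) /\<^sub>R u - D = (1 / u) *\<^sub>R (g u - (g 0 + u *\<^sub>R D))"
      using that by (simp add: scaleR_diff_right scaleR_add_right divide_inverse)
    then show ?thesis by simp
  qed
  then have "\<forall>\<^sub>F u in at 0. norm ((1 / norm (u - 0)) *\<^sub>R (g u - (g 0 + (u - 0) *\<^sub>R D)))
      = norm ((g u - g 0) /\<^sub>R u - D)"
    by (auto simp: eventually_at_filter)
  ultimately have "((\<lambda>u. norm ((g u - g 0) /\<^sub>R u - D)) \<longlongrightarrow> 0) (at 0)"
    by (rule Lim_transform_eventually)
  then show ?thesis unfolding tendsto_norm_zero_iff LIM_zero_iff .
qed

context
  fixes f :: "'a::euclidean_space \<times> 'b::euclidean_space \<Rightarrow> complex"
  assumes f: "schwartz f"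
begin

declare schwartz_borel_measurable[OF f, measurable]

lemma schwartz_slice_bound: "\<exists>C\<ge>0. \<forall>y t. norm (f (y, t)) \<le> C * (weight y * weight t)"
  using schwartz_weight_bound[OF f] by (simp add: weight_Pair)

lemma schwartz_slice_continuous: "continuous_on UNIV (\<lambda>t. f (y, t))"
  by (rule continuous_on_compose2[OF schwartz_continuous[OF f]
      continuous_on_Pair[OF continuous_on_const continuous_on_id] subset_UNIV])

lemma schwartz_slice_integrable: "integrable lborel (\<lambda>t. f (y, t))"
proof -
  obtain C where C: "C \<ge> 0" "\<And>y t. norm (f (y, t)) \<le> C * (weight y * weight t)"
      using schwartz_slice_bound by blast
  show ?thesis
  proof (rule Bochner_Integration.integrable_bound)
    show "integrable lborel (\<lambda>t::'b. C * (weight y * weight t))"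
        using integrable_weight[where 'a='b] by simp
  qed (use C in auto)
qed

lemma partial_fourier_integrable: "integrable lborel (\<lambda>t. iexp (- (s \<bullet> t)) * f (y, t))"
  by (rule integrable_iexp_mult[OF schwartz_slice_integrable]) simp

lemma partial_fourier_weight_bound: "\<exists>C\<ge>0. \<forall>y s. norm (partial_fourier f y s) \<le> C * weight y"
proof -
  obtain C where C: "C \<ge> 0" "\<And>y t. norm (f (y, t)) \<le> C * (weight y * weight t)"
      using schwartz_slice_bound by blast
  have "norm (partial_fourier f y s) \<le> (C * (LINT t::'b|lborel. weight t)) * weight y" for y s
  proof -
    have "norm (partial_fourier f y s) \<le> (LINT t|lborel. norm (f (y, t)))"
      unfolding partial_fourier_eq by (rule norm_fourier_int_le[OF schwartz_slice_integrable])
    also have "\<dots> \<le> (LINT t::'b|lborel. C * (weight y * weight t))"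
      using C integrable_weight[where 'a='b] by (intro integral_mono') auto
    finally show ?thesis by (simp add: mult_ac)
  qed
  moreover have "C * (LINT t::'b|lborel. weight t) \<ge> 0" using C
      by (intro mult_nonneg_nonneg integral_nonneg_AE) auto
  ultimately show ?thesis by blast
qed

lemma partial_fourier_continuous: "continuous_on UNIV (\<lambda>p. partial_fourier f (fst p) (snd p))"
proof -
  obtain C where C: "C \<ge> 0" "\<And>y t. norm (f (y, t)) \<le> C * (weight y * weight t)"
      using schwartz_slice_bound by blast
  have "(\<lambda>n. partial_fourier f (fst (p n)) (snd (p n))) \<longlonglongrightarrow> partial_fourier f (fst q) (snd q)"
      if p: "p \<longlonglongrightarrow> q" for p :: "nat \<Rightarrow> 'a \<times> 'b" and q
    unfolding partial_fourier_def
  proof (rule integral_dominated_convergence[where w="\<lambda>t. C * weight t"])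
    show "integrable lborel (\<lambda>t::'b. C * weight t)" using integrable_weight[where 'a='b] by simp
    show "AE t in lborel. (\<lambda>n. iexp (- (snd (p n) \<bullet> t)) * f (fst (p n), t))
        \<longlonglongrightarrow> iexp (- (snd q \<bullet> t)) * f (fst q, t)"
    proof (intro AE_I2)
      fix t
      have "(\<lambda>n. f (fst (p n), t)) \<longlonglongrightarrow> f (fst q, t)"
        by (rule continuous_on_tendsto_compose[OF schwartz_continuous[OF f]])
            (auto intro!: tendsto_intros p)
      then show "(\<lambda>n. iexp (- (snd (p n) \<bullet> t)) * f (fst (p n), t))
          \<longlonglongrightarrow> iexp (- (snd q \<bullet> t)) * f (fst q, t)"
        by (intro tendsto_intros p)
    qed
    show "AE t in lborel. norm (iexp (- (snd (p n) \<bullet> t)) * f (fst (p n), t)) \<le> C * weight t" for n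
    proof (intro AE_I2)
      fix t :: 'b
      have "weight (fst (p n)) * weight t \<le> 1 * weight t"
          by (intro mult_right_mono weight_le_1) simp
      then have "C * (weight (fst (p n)) * weight t) \<le> C * weight t" using C
          by (intro mult_left_mono) auto
      then show "norm (iexp (- (snd (p n) \<bullet> t)) * f (fst (p n), t)) \<le> C * weight t"
        using C(2)[of "fst (p n)" t] by (simp add: norm_mult del: of_real_minus)
    qed
  qed measurable
  then show ?thesis by (auto simp: continuous_on_sequentially o_def)
qed

lemma partial_fourier_measurable [measurable]: "(\<lambda>p. partial_fourier f (fst p) (snd p))
    \<in> borel_measurable borel"
  by (rule borel_measurable_continuous_onI[OF partial_fourier_continuous])

text \<open>
  Integration by parts, obtained by differentiating the translation invariance of the integral.
\<close>

lemma partial_fourier_partial_deriv: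
  assumes b: "b \<in> Basis"
  shows "partial_fourier (partial_deriv (0, b) f) y s
      = \<i> * complex_of_real (s \<bullet> b) * partial_fourier f y s"
proof -
  have B: "(0, b) \<in> (Basis :: ('a \<times> 'b) set)" using b by (simp add: Basis_prod_def)
  have fd: "schwartz (partial_deriv (0, b) f)" by (rule schwartz_partial_deriv[OF f B])
  note [measurable] = schwartz_borel_measurable[OF fd]
  obtain C where C: "C \<ge> 0" "\<And>p. norm (partial_deriv (0, b) f p) \<le> C * weight p"
      using schwartz_weight_bound[OF fd] by blast
  define h where "h k = 1 / real (Suc k)" for k
  have h: "0 < h k" "h k \<le> 1" for k by (auto simp: h_def)
  have h0: "h \<longlonglongrightarrow> 0" unfolding h_def by real_asymp
  define g where "g k t = (f (y, t + h k *\<^sub>R b) - f (y, t)) /\<^sub>R h k" for k t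
  have deriv: "((\<lambda>u. f (y, t + u *\<^sub>R b)) has_vector_derivative partial_deriv (0, b) f
      (y, t + u *\<^sub>R b)) (at u)" for t u
  proof -
    have "((\<lambda>u. (y, t + u *\<^sub>R b)) has_derivative (\<lambda>u. u *\<^sub>R (0, b))) (at u)"
      by (auto intro!: derivative_eq_intros)
    moreover have D: "(f has_derivative frechet_derivative f (at (y, t + u *\<^sub>R b)))
        (at (y, t + u *\<^sub>R b))"
      using schwartz_differentiable[OF f] by (simp add: frechet_derivative_works)
    ultimately have "((\<lambda>u. f (y, t + u *\<^sub>R b)) has_derivative
        (\<lambda>u'. frechet_derivative f (at (y, t + u *\<^sub>R b)) (u' *\<^sub>R (0, b)))) (at u)"
      by (rule has_derivative_compose)
    then show ?thesis
      unfolding has_vector_derivative_def partial_deriv_def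
      using linear_cmul[OF has_derivative_linear[OF D], of _ "(0, b)"] by simp
  qed
  have g_lim: "(\<lambda>k. g k t) \<longlonglongrightarrow> partial_deriv (0, b) f (y, t)" for t
  proof -
    have "((\<lambda>u. (f (y, t + u *\<^sub>R b) - f (y, t)) /\<^sub>R u) \<longlongrightarrow> partial_deriv (0, b) f (y, t)) (at 0)"
      using has_vector_derivative_quotient[OF deriv[of t 0]] by simp
    moreover have "filterlim h (at 0) sequentially"
      using h0 h by (intro filterlim_atI) (auto intro!: always_eventually
          simp: less_imp_neq[symmetric])
    ultimately show ?thesis unfolding g_def by (rule filterlim_compose)
  qed
  have g_bound: "norm (g k t) \<le> 3 * C * weight t" for k t
  proof -
    \<comment> \<open>The mean value inequality bounds the difference quotient by the derivative at
      an intermediate point, independently of the step size.\<close>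
    have "\<exists>u\<in>{0<..<h k}. norm (f (y, t + h k *\<^sub>R b) - f (y, t + 0 *\<^sub>R b))
        \<le> norm ((h k - 0) *\<^sub>R partial_deriv (0, b) f (y, t + u *\<^sub>R b))"
    proof (rule mvt_general[where f="\<lambda>u. f (y, t + u *\<^sub>R b)"
        and f'="\<lambda>u d. d *\<^sub>R partial_deriv (0, b) f (y, t + u *\<^sub>R b)"])
      show "continuous_on {0..h k} (\<lambda>u. f (y, t + u *\<^sub>R b))"
        by (rule continuous_on_vector_derivative) (rule has_vector_derivative_at_within[OF deriv])
      show "((\<lambda>u. f (y, t + u *\<^sub>R b)) has_derivative
          (\<lambda>d. d *\<^sub>R partial_deriv (0, b) f (y, t + u *\<^sub>R b))) (at u)" for u
        using deriv[of t u] unfolding has_vector_derivative_def .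
    qed (rule h)
    then obtain u where u: "u \<in> {0<..<h k}" "norm (f (y, t + h k *\<^sub>R b) - f (y, t))
        \<le> h k * norm (partial_deriv (0, b) f (y, t + u *\<^sub>R b))"
      using h[of k] by auto
    have "norm (g k t) = norm (f (y, t + h k *\<^sub>R b) - f (y, t)) / h k"
      unfolding g_def using h[of k] by (simp add: divide_inverse mult.commute)
    also have "\<dots> \<le> norm (partial_deriv (0, b) f (y, t + u *\<^sub>R b))"
      using u(2) h[of k] by (simp add: divide_le_eq mult.commute)
    also have "\<dots> \<le> C * (weight y * weight (t + u *\<^sub>R b))" using C(2)[of "(y, t + u *\<^sub>R b)"]
        by (simp add: weight_Pair)
    also have "\<dots> \<le> C * (1 * (3 * weight t))"
      using C(1) u(1) h[of k] by (intro mult_left_mono mult_mono weight_le_1 weight_shift_le b) auto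
    finally show ?thesis by simp
  qed
  have "(\<lambda>k. LINT t|lborel. iexp (- (s \<bullet> t)) * g k t)
      \<longlonglongrightarrow> partial_fourier (partial_deriv (0, b) f) y s"
    unfolding partial_fourier_def
  proof (rule integral_dominated_convergence[where w="\<lambda>t. 3 * C * weight t"])
    show "integrable lborel (\<lambda>t::'b. 3 * C * weight t)" using integrable_weight[where 'a='b] by simp
    show "AE t in lborel. (\<lambda>k. iexp (- (s \<bullet> t)) * g k t)
        \<longlonglongrightarrow> iexp (- (s \<bullet> t)) * partial_deriv (0, b) f (y, t)"
      by (intro AE_I2 tendsto_mult tendsto_const g_lim)
    show "(\<lambda>t. iexp (- (s \<bullet> t)) * g k t) \<in> borel_measurable lborel" for k unfolding g_def
        by measurable
    show "AE t in lborel. norm (iexp (- (s \<bullet> t)) * g k t) \<le> 3 * C * weight t" for k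
      using g_bound by (simp add: norm_mult del: of_real_minus)
  qed measurable
  moreover have "(LINT t|lborel. iexp (- (s \<bullet> t)) * g k t)
      = ((iexp (h k * (s \<bullet> b)) - 1) /\<^sub>R h k) * partial_fourier f y s" for k
  proof -
    \<comment> \<open>Translating the integration variable turns the shift of \<open>f\<close> into
      a phase; the difference quotient of that phase tends to the factor in the claim.\<close>
    have shift: "(LINT t|lborel. iexp (- (s \<bullet> t)) * f (y, t + h k *\<^sub>R b))
        = iexp (h k * (s \<bullet> b)) * partial_fourier f y s"
    proof -
      have "(LINT t|lborel. iexp (- (s \<bullet> t)) * f (y, t + h k *\<^sub>R b))
          = (LINT t|lborel. iexp (- (s \<bullet> (h k *\<^sub>R b + t) - s \<bullet> (h k *\<^sub>R b))) * f
          (y, h k *\<^sub>R b + t))"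
        by (simp add: inner_add_right add.commute)
      also have "\<dots> = (LINT t|lborel. iexp (- (s \<bullet> t - s \<bullet> (h k *\<^sub>R b))) * f (y, t))"
        by (rule lborel_integral_shift(1)) measurable
      also have "\<dots> = (LINT t|lborel. iexp (h k * (s \<bullet> b)) * (iexp (- (s \<bullet> t)) * f (y, t)))"
        by (intro Bochner_Integration.integral_cong refl)
            (simp add: exp_diff exp_minus divide_inverse right_diff_distrib mult_ac)
      finally show ?thesis unfolding partial_fourier_def by (simp only: integral_mult_right_zero)
    qed
    have int: "integrable lborel (\<lambda>t. iexp (- (s \<bullet> t)) * f (y, t + h k *\<^sub>R b))"
    proof (rule integrable_iexp_mult)
      show "integrable lborel (\<lambda>t. f (y, t + h k *\<^sub>R b))"
        using lborel_integral_shift(3)[of "\<lambda>t. f (y, t)" "h k *\<^sub>R b"] schwartz_slice_integrable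
            by (simp add: add.commute)
    qed simp
    have "(LINT t|lborel. iexp (- (s \<bullet> t)) * g k t)
      = (LINT t|lborel. (iexp (- (s \<bullet> t)) * f (y, t + h k *\<^sub>R b) - iexp (- (s \<bullet> t)) * f (y, t))
          /\<^sub>R h k)"
      unfolding g_def by (intro Bochner_Integration.integral_cong refl) (simp add: algebra_simps)
    also have "\<dots> = ((LINT t|lborel. iexp (- (s \<bullet> t)) * f (y, t + h k *\<^sub>R b)) - partial_fourier f y
        s) /\<^sub>R h k"
      unfolding partial_fourier_def
      by (simp only: integral_scaleR_right Bochner_Integration.integral_diff[OF int
          partial_fourier_integrable])
    finally show ?thesis unfolding shift by (simp add: algebra_simps)
  qed
  moreover have "(\<lambda>k. ((iexp (h k * (s \<bullet> b)) - 1) /\<^sub>R h k) * partial_fourier f y s)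
      \<longlonglongrightarrow> (\<i> * complex_of_real (s \<bullet> b)) * partial_fourier f y s"
  proof (intro tendsto_mult tendsto_const)
    have "((\<lambda>z. exp (\<i> * (z * complex_of_real (s \<bullet> b)))) has_field_derivative \<i> * complex_of_real
        (s \<bullet> b)) (at (complex_of_real 0))"
      by (auto intro!: derivative_eq_intros)
    from has_vector_derivative_quotient[OF has_vector_derivative_real_field[OF this]]
    have "((\<lambda>u. (iexp (u * (s \<bullet> b)) - 1) /\<^sub>R u) \<longlongrightarrow> \<i> * complex_of_real (s \<bullet> b)) (at 0)"
      by simp
    moreover have "filterlim h (at 0) sequentially"
      using h0 h by (intro filterlim_atI) (auto intro!: always_eventually
          simp: less_imp_neq[symmetric])
    ultimately show "(\<lambda>k. (iexp (h k * (s \<bullet> b)) - 1) /\<^sub>R h k) \<longlonglongrightarrow> \<i> * complex_of_real (s \<bullet> b)"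
      by (rule filterlim_compose)
  qed
  ultimately show ?thesis using LIMSEQ_unique by (simp only:)
qed

end

text \<open>Two derivatives in direction \<open>b\<close> multiply the transform by a factor of
  modulus \<open>(s \<bullet> b)\<^sup>2\<close>, so the extra factor
  \<open>1 + (s \<bullet> b)\<^sup>2\<close> splits into the claims for \<open>f\<close> and for its
  second derivative. With all directions used, the product is \<open>1 / weight s\<close>.\<close>

lemma partial_fourier_decay_aux:
  fixes f :: "'a::euclidean_space \<times> 'b::euclidean_space \<Rightarrow> complex"
  assumes "finite I" "I \<subseteq> Basis" "schwartz f"
  shows "\<exists>C\<ge>0. \<forall>y s. (\<Prod>b\<in>I. 1 + (s \<bullet> b)\<^sup>2) * norm (partial_fourier f y s) \<le> C * weight y"
  using assms
proof (induction I arbitrary: f rule: finite_induct)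
  case empty
  then show ?case using partial_fourier_weight_bound by simp
next
  case (insert b I)
  then have b: "b \<in> Basis" "(0, b) \<in> (Basis :: ('a \<times> 'b) set)" by (auto simp: Basis_prod_def)
  let ?D = "partial_deriv (0, b)"
  have Df: "schwartz (?D f)" "schwartz (?D (?D f))" using insert b
      by (auto intro: schwartz_partial_deriv)
  obtain C where C: "C \<ge> 0" "\<And>y s. (\<Prod>b\<in>I. 1 + (s \<bullet> b)\<^sup>2) * norm (partial_fourier f y s)
      \<le> C * weight y"
    using insert.IH[of f] insert.prems by auto
  obtain D where D: "D \<ge> 0" "\<And>y s. (\<Prod>b\<in>I. 1 + (s \<bullet> b)\<^sup>2) * norm (partial_fourier (?D (?D f)) y s)
      \<le> D * weight y"
    using insert.IH[of "?D (?D f)"] insert.prems Df by auto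
  have "(\<Prod>b\<in>insert b I. 1 + (s \<bullet> b)\<^sup>2) * norm (partial_fourier f y s) \<le> (C + D) * weight y" for y s
  proof -
    have "norm (partial_fourier (?D (?D f)) y s) = (s \<bullet> b)\<^sup>2 * norm (partial_fourier f y s)"
      unfolding partial_fourier_partial_deriv[OF Df(1) b(1)]
          partial_fourier_partial_deriv[OF insert.prems(2) b(1)]
      by (simp add: norm_mult power2_eq_square flip: abs_mult)
    then have "(\<Prod>b\<in>insert b I. 1 + (s \<bullet> b)\<^sup>2) * norm (partial_fourier f y s)
      = (\<Prod>b\<in>I. 1 + (s \<bullet> b)\<^sup>2) * norm (partial_fourier f y s) + (\<Prod>b\<in>I. 1 + (s \<bullet> b)\<^sup>2) * norm
          (partial_fourier (?D (?D f)) y s)"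
      using insert(1,2) by (simp add: algebra_simps)
    also have "\<dots> \<le> C * weight y + D * weight y" by (intro add_mono C D)
    finally show ?thesis by (simp add: algebra_simps)
  qed
  then show ?case using C D by (intro exI[of _ "C + D"]) auto
qed

lemma partial_fourier_decay:
  fixes f :: "'a::euclidean_space \<times> 'b::euclidean_space \<Rightarrow> complex"
  assumes "schwartz f"
  shows "\<exists>C\<ge>0. \<forall>y s. norm (partial_fourier f y s) \<le> C * (weight y * weight s)"
proof -
  obtain C where C: "C \<ge> 0" "\<And>y s. (\<Prod>b\<in>(Basis :: 'b set). 1 + (s \<bullet> b)\<^sup>2) * norm
      (partial_fourier f y s) \<le> C * weight y"
    using partial_fourier_decay_aux[OF finite_Basis subset_refl assms] by blast
  have "norm (partial_fourier f y s) \<le> C * (weight y * weight s)" for y s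
  proof -
    have "(\<Prod>b\<in>(Basis :: 'b set). 1 + (s \<bullet> b)\<^sup>2) = 1 / weight s"
        by (simp add: weight_def prod_dividef)
    with C(2)[where y=y and s=s] have "norm (partial_fourier f y s) / weight s \<le> C * weight y"
        by simp
    then show ?thesis using weight_pos[of s] by (simp add: divide_le_eq mult_ac)
  qed
  then show ?thesis using C by blast
qed

lemma partial_fourier_inversion:
  fixes f :: "'a::euclidean_space \<times> 'b::euclidean_space \<Rightarrow> complex"
  assumes f: "schwartz f"
  shows "fourier_int (partial_fourier f y) t = complex_of_real ((2 * pi) ^ DIM('b)) * f (y, t)"
proof -
  obtain C where C: "C \<ge> 0" "\<And>y s. norm (partial_fourier f y s) \<le> C * (weight y * weight s)"
    using partial_fourier_decay[OF f] by blast
  obtain D where D: "D \<ge> 0" "\<And>p. norm (f p) \<le> D * weight p" using schwartz_weight_bound[OF f]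
      by blast
  let ?h = "\<lambda>t. f (y, t)"
  have [measurable]: "f \<in> borel_measurable borel" by (rule schwartz_borel_measurable[OF f])
  have [measurable]: "fourier_int ?h \<in> borel_measurable borel"
    by (rule borel_measurable_fourier_int) measurable
  have eq: "fourier_int ?h s = partial_fourier f y (- s)" for s by (simp add: partial_fourier_eq)
  have int: "integrable lborel (fourier_int ?h)"
  proof (rule Bochner_Integration.integrable_bound)
    show "integrable lborel (\<lambda>s::'b. C * (weight y * weight s))"
        using integrable_weight[where 'a='b] by simp
    have "weight (- s) = weight s" for s :: 'b by (simp add: weight_def)
    then show "AE s in lborel. norm (fourier_int ?h s) \<le> norm (C * (weight y * weight s))"
      using C(1) C(2)[of y "- s" for s] by (simp add: eq abs_mult)
  qed measurable
  have "fourier_int (partial_fourier f y) t = (LINT s|lborel. iexp (s \<bullet> t) * fourier_int ?h (- s))"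
    unfolding fourier_int_def[of "partial_fourier f y"] eq by (simp add: inner_commute)
  also have "\<dots> = (LINT s|lborel. iexp (- ((0 - s) \<bullet> t)) * fourier_int ?h (0 - s))" by simp
  also have "\<dots> = (LINT s|lborel. iexp (- (s \<bullet> t)) * fourier_int ?h s)"
    by (rule lborel_integral_shift(2)) measurable
  also have "\<dots> = complex_of_real ((2 * pi) ^ DIM('b)) * f (y, t)"
  proof (rule fourier_inversion[OF schwartz_slice_integrable[OF f] _ _ int])
    show "norm (f (y, x)) \<le> D" for x
      using D(2)[of "(y, x)"] mult_left_mono[OF weight_le_1[of "(y, x)"] D(1)] by simp
    show "isCont (\<lambda>t. f (y, t)) t"
      using schwartz_slice_continuous[OF f] by (simp add: continuous_on_eq_continuous_at)
  qed
  finally show ?thesis .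
qed

section \<open>Dependence of the kernels on the central frequency\<close>

lemma isCont_approx:
  fixes f :: "'a::t2_space \<Rightarrow> 'b::metric_space"
  assumes "\<And>e. e > 0 \<Longrightarrow> \<exists>g. isCont g a \<and> dist (f a) (g a) < e \<and> (\<forall>\<^sub>F x in nhds a. dist (f x) (g x)
      < e)"
  shows "isCont f a"
  unfolding isCont_def
proof (rule tendstoI)
  fix e :: real assume "e > 0"
  then obtain g where g: "isCont g a" "dist (f a) (g a)
      < e / 3" "\<forall>\<^sub>F x in nhds a. dist (f x) (g x) < e / 3"
    using assms[of "e / 3"] by auto
  have "\<forall>\<^sub>F x in at a. dist (f x) (g x) < e / 3"
    using g(3) by (simp add: eventually_nhds_conv_at)
  moreover have "\<forall>\<^sub>F x in at a. dist (g x) (g a) < e / 3"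
    using tendstoD[OF g(1)[unfolded isCont_def], of "e / 3"] \<open>e > 0\<close> by simp
  ultimately show "\<forall>\<^sub>F x in at a. dist (f x) (f a) < e"
  proof eventually_elim
    case (elim x)
    have "dist (f x) (f a) \<le> dist (f x) (g x) + dist (g x) (f a)" by (rule dist_triangle)
    also have "dist (g x) (f a) \<le> dist (g x) (g a) + dist (g a) (f a)" by (rule dist_triangle)
    finally show ?case using elim g(2) by (simp add: dist_commute)
  qed
qed

section \<open>The group: quadratic form, determinant and kernels as functions of the
  frequency\<close>

locale step_two =
  fixes n :: nat
    and B :: "real^'d \<Rightarrow> real^'d \<Rightarrow> real^'r"
    and \<mu> :: "real^'r \<Rightarrow> nat \<Rightarrow> real"
    and v :: "real^'r \<Rightarrow> nat \<Rightarrow> real^'d"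
  assumes n: "n \<ge> 1" and dim: "CARD('d) = 2 * n"
    and skew_bilinear: "skew_bilinear B" and frame: "spectral_frame n B \<mu> v"
begin

lemma bilinear_B: "bilinear B" and skew_B: "B x y = - B y x"
  using skew_bilinear unfolding skew_bilinear_def by blast+

lemma frame_at:
  assumes "\<tau> \<noteq> 0"
  shows "\<And>j. j \<in> {1..n} \<Longrightarrow> 0 < \<mu> \<tau> j"
    and "\<And>z. det (mat z - (\<chi> k l. complex_of_real (B_matrix B \<tau> $ k $ l)))
              = (\<Prod>j=1..n. (z - \<i> * complex_of_real (\<mu> \<tau> j)) * (z + \<i> * complex_of_real (\<mu> \<tau> j)))"
    and "\<And>k l. k \<in> {1..2*n} \<Longrightarrow> l \<in> {1..2*n} \<Longrightarrow> v \<tau> k \<bullet> v \<tau> l = (if k = l then 1 else 0)"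
    and "\<And>k l. k \<in> {1..2*n} \<Longrightarrow> l \<in> {1..2*n} \<Longrightarrow> v \<tau> k \<bullet> (B_matrix B \<tau> *v v \<tau> l)
        = block_entry (\<mu> \<tau>) k l"
  using frame assms unfolding spectral_frame_def by blast+

text \<open>The action of \<open>B_matrix\<close>, written so that its joint continuity in
  \<open>\<tau>\<close> and \<open>z\<close> is immediate.\<close>

definition A :: "real^'r \<Rightarrow> real^'d \<Rightarrow> real^'d" where
  "A \<tau> z = (\<chi> k. \<tau> \<bullet> B (axis k 1) z)"

lemma B_continuous [continuous_intros]:
  "continuous_on S f \<Longrightarrow> continuous_on S g \<Longrightarrow> continuous_on S (\<lambda>x. B (f x) (g x))"
  using bilinear_B by (simp add: bilinear_conv_bounded_bilinear bounded_bilinear.continuous_on)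

lemma B_measurable [measurable (raw)]:
  "f \<in> borel_measurable M \<Longrightarrow> g \<in> borel_measurable M \<Longrightarrow> (\<lambda>x. B (f x) (g x)) \<in> borel_measurable M"
  by (rule borel_measurable_continuous_Pair) (auto intro!: continuous_intros)

lemma linear_B: "linear (\<lambda>x. B x y)" "linear (B x)"
  using bilinear_B by (simp_all add: bilinear_def)

lemma axis_expansion: "(x :: real^'d) = (\<Sum>k\<in>UNIV. (x $ k) *\<^sub>R axis k 1)"
  by (simp add: vec_eq_iff axis_def if_distrib cong: if_cong)

lemma inner_A: "x \<bullet> A \<tau> z = \<tau> \<bullet> B x z"
proof -
  have "B x z = (\<Sum>k\<in>UNIV. B ((x $ k) *\<^sub>R axis k 1) z)"
    by (subst axis_expansion[of x]) (rule linear_sum[OF linear_B(1)])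
  also have "\<dots> = (\<Sum>k\<in>UNIV. (x $ k) *\<^sub>R B (axis k 1) z)"
    by (intro sum.cong refl linear_cmul[OF linear_B(1)])
  finally show ?thesis by (simp add: A_def inner_vec_def[of x] inner_sum_right)
qed

lemma B_matrix_mult: "B_matrix B \<tau> *v z = A \<tau> z"
proof -
  have "(B_matrix B \<tau> *v z) $ k = \<tau> \<bullet> B (axis k 1) z" for k
  proof -
    have "B (axis k 1) z = (\<Sum>l\<in>UNIV. B (axis k 1) ((z $ l) *\<^sub>R axis l 1))"
      by (subst axis_expansion[of z]) (rule linear_sum[OF linear_B(2)])
    also have "\<dots> = (\<Sum>l\<in>UNIV. (z $ l) *\<^sub>R B (axis k 1) (axis l 1))"
      by (intro sum.cong refl linear_cmul[OF linear_B(2)])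
    finally have "\<tau> \<bullet> B (axis k 1) z = (\<Sum>l\<in>UNIV. (\<tau> \<bullet> B (axis k 1) (axis l 1)) * z $ l)"
      by (simp add: inner_sum_right mult.commute)
    then show ?thesis by (simp add: matrix_vector_mult_def B_matrix_def inner_vec_def)
  qed
  then show ?thesis by (simp add: vec_eq_iff A_def)
qed

lemma fibre:
  assumes "\<tau> \<noteq> 0"
  shows "laguerre_fibre n (\<mu> \<tau>) (v \<tau>) (\<lambda>x y. \<tau> \<bullet> B x y)"
proof
  show "bilinear (\<lambda>x y. \<tau> \<bullet> B x y)"
    unfolding bilinear_def
    using linear_compose[OF linear_B(1) bounded_linear.linear[OF bounded_linear_inner_right]]
      linear_compose[OF linear_B(2) bounded_linear.linear[OF bounded_linear_inner_right]]
          by (auto simp: o_def)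
  show "\<tau> \<bullet> B x y = - (\<tau> \<bullet> B y x)" for x y by (subst skew_B) simp
  show "\<tau> \<bullet> B (v \<tau> k) (v \<tau> l) = block_entry (\<mu> \<tau>) k l" if "k \<in> {1..2*n}" "l \<in> {1..2*n}" for k l
    using frame_at(4)[OF assms that] by (simp add: B_matrix_mult inner_A)
qed (use n dim frame_at[OF assms] in auto)

definition freq :: "real^'r \<Rightarrow> nat \<Rightarrow> real" where
  "freq \<tau> l = \<mu> \<tau> ((l + 1) div 2)"

definition qform :: "real^'d \<Rightarrow> real^'r \<Rightarrow> real" where
  "qform y \<tau> = (\<Sum>j=1..n. \<mu> \<tau> j * block_norm_sq (v \<tau>) j y)"

lemma qform_eq:
  assumes "\<tau> \<noteq> 0"
  shows "qform y \<tau> = (\<Sum>l=1..2*n. freq \<tau> l * (y \<bullet> v \<tau> l)\<^sup>2)"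
proof -
  interpret F: laguerre_fibre n "\<mu> \<tau>" "v \<tau>" "\<lambda>x y. \<tau> \<bullet> B x y" by (rule fibre[OF assms])
  show ?thesis using F.q_eq[of y] unfolding F.q_def F.w_def qform_def freq_def .
qed

lemma card_frame: "finite {1..2*n}" "card {1..2*n} = DIM(real^'d)"
  by (simp_all add: dim)

lemma frame_parseval:
  assumes "\<tau> \<noteq> 0"
  shows "x \<bullet> y = (\<Sum>l=1..2*n. (x \<bullet> v \<tau> l) * (y \<bullet> v \<tau> l))"
  by (rule orthonormal_parseval[OF card_frame frame_at(3)[OF assms]])

text \<open>Each block squares to \<open>- (\<mu> \<tau> j)\<^sup>2\<close> times the identity, so
  minus the square of \<open>A \<tau>\<close> is diagonal in the frame and polynomials in it can be
  evaluated eigenvalue by eigenvalue.\<close>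

lemma A_A_frame:
  assumes \<tau>: "\<tau> \<noteq> 0" and l: "l \<in> {1..2*n}"
  shows "(- A \<tau> (A \<tau> z)) \<bullet> v \<tau> l = (freq \<tau> l)\<^sup>2 * (z \<bullet> v \<tau> l)"
proof -
  interpret F: laguerre_fibre n "\<mu> \<tau>" "v \<tau>" "\<lambda>x y. \<tau> \<bullet> B x y" by (rule fibre[OF \<tau>])
  have A: "A \<tau> x \<bullet> v \<tau> (2 * j - 1) = - \<mu> \<tau> j * (x \<bullet> v \<tau> (2 * j))" "A \<tau> x \<bullet> v \<tau> (2 * j)
      = \<mu> \<tau> j * (x \<bullet> v \<tau> (2 * j - 1))"
    if j: "j \<in> {1..n}" for x j
    using F.b_frame[OF j, of x] F.skew[of x] by (simp_all add: inner_commute[of "A \<tau> x"] inner_A)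
  define j where "j = (l + 1) div 2"
  have j: "j \<in> {1..n}" and "l = 2 * j - 1 \<or> l = 2 * j" using l by (auto simp: j_def)
  then show ?thesis
    using A(1)[OF j, of "A \<tau> z"] A(2)[OF j, of "A \<tau> z"] A[OF j, of z]
    by (auto simp: freq_def j_def[symmetric] power2_eq_square)
qed

lemma iterate_frame:
  assumes \<tau>: "\<tau> \<noteq> 0" and l: "l \<in> {1..2*n}"
  shows "((\<lambda>z. - A \<tau> (A \<tau> z)) ^^ k) y \<bullet> v \<tau> l = ((freq \<tau> l)\<^sup>2) ^ k * (y \<bullet> v \<tau> l)"
proof (induction k)
  case (Suc k)
  have "((\<lambda>z. - A \<tau> (A \<tau> z)) ^^ Suc k) y \<bullet> v \<tau> l
      = (freq \<tau> l)\<^sup>2 * (((\<lambda>z. - A \<tau> (A \<tau> z)) ^^ k) y \<bullet> v \<tau> l)"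
    using A_A_frame[OF \<tau> l, of "((\<lambda>z. - A \<tau> (A \<tau> z)) ^^ k) y"] by simp
  then show ?case unfolding Suc.IH by simp
qed simp

lemma A_continuous: "continuous_on S f \<Longrightarrow> continuous_on S g \<Longrightarrow> continuous_on S (\<lambda>x. A (f x) (g x))"
  unfolding A_def by (intro continuous_intros)

text \<open>The form of a polynomial with coefficients \<open>a\<close>, applied to minus the square
  of \<open>A \<tau>\<close>. The frame does not occur in it, hence its continuity.\<close>

definition poly_form :: "(nat \<Rightarrow> real) \<Rightarrow> nat \<Rightarrow> real^'d \<Rightarrow> real^'r \<Rightarrow> real" where
  "poly_form a m y \<tau> = (\<Sum>k\<le>m. a k * (y \<bullet> ((\<lambda>z. - A \<tau> (A \<tau> z)) ^^ k) y))"

lemma poly_form_continuous: "continuous_on UNIV (\<lambda>p. poly_form a m (fst p) (snd p))"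
proof -
  have "continuous_on UNIV (\<lambda>p. ((\<lambda>z. - A (snd p) (A (snd p) z)) ^^ k) (fst p))" for k
  proof (induction k)
    case (Suc k)
    then have "continuous_on UNIV (\<lambda>p. - A (snd p)
        (A (snd p) (((\<lambda>z. - A (snd p) (A (snd p) z)) ^^ k) (fst p))))"
      by (intro continuous_on_minus A_continuous continuous_on_snd continuous_on_id)
    then show ?case by simp
  qed (simp add: continuous_on_fst continuous_on_id)
  then show ?thesis unfolding poly_form_def
    by (intro continuous_on_sum continuous_on_mult continuous_on_const continuous_on_inner
        continuous_on_fst continuous_on_id)
qed

lemma poly_form_eq:
  assumes \<tau>: "\<tau> \<noteq> 0"
  shows "poly_form a m y \<tau> = (\<Sum>l=1..2*n. (\<Sum>k\<le>m. a k * ((freq \<tau> l)\<^sup>2) ^ k) * (y \<bullet> v \<tau> l)\<^sup>2)"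
proof -
  have p: "y \<bullet> ((\<lambda>z. - A \<tau> (A \<tau> z)) ^^ k) y = (\<Sum>l=1..2*n. (y \<bullet> v \<tau> l)
      * (((\<lambda>z. - A \<tau> (A \<tau> z)) ^^ k) y \<bullet> v \<tau> l))" for k
    by (rule frame_parseval[OF \<tau>])
  have "poly_form a m y \<tau> = (\<Sum>k\<le>m. \<Sum>l=1..2*n. a k * ((freq \<tau> l)\<^sup>2) ^ k * (y \<bullet> v \<tau> l)\<^sup>2)"
    unfolding poly_form_def p sum_distrib_left
    by (intro sum.cong refl) (simp add: iterate_frame[OF \<tau>] power2_eq_square mult_ac)
  also have "\<dots> = (\<Sum>l=1..2*n. \<Sum>k\<le>m. a k * ((freq \<tau> l)\<^sup>2) ^ k * (y \<bullet> v \<tau> l)\<^sup>2)" by (rule sum.swap)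
  finally show ?thesis by (simp add: sum_distrib_right)
qed

text \<open>Confines the squared frequencies over a bounded set of \<open>\<tau>\<close> to a
  compact interval, on which the square root can be approximated by polynomials.\<close>

lemma freq_bound: "\<exists>C>0. \<forall>\<tau> l. \<tau> \<noteq> 0 \<longrightarrow> l \<in> {1..2*n} \<longrightarrow> 0 < freq \<tau> l \<and> freq \<tau> l \<le> C * norm \<tau>"
proof -
  obtain C where C: "C > 0" "\<And>x y. norm (B x y) \<le> C * norm x * norm y"
    using bilinear_bounded_pos[OF bilinear_B] by blast
  have "0 < freq \<tau> l \<and> freq \<tau> l \<le> C * norm \<tau>" if \<tau>: "\<tau> \<noteq> 0" and l: "l \<in> {1..2*n}" for \<tau> l
  proof -
    interpret F: laguerre_fibre n "\<mu> \<tau>" "v \<tau>" "\<lambda>x y. \<tau> \<bullet> B x y" by (rule fibre[OF \<tau>])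
    define j where "j = (l + 1) div 2"
    have j: "j \<in> {1..n}" using l by (auto simp: j_def)
    then have jj: "2 * j - 1 \<in> {1..2*n}" "2 * j \<in> {1..2*n}" by auto
    have nv: "norm (v \<tau> k) = 1" if "k \<in> {1..2*n}" for k using frame_at(3)[OF \<tau> that that]
        by (simp add: norm_eq_1)
    have "\<mu> \<tau> j = \<tau> \<bullet> B (v \<tau> (2 * j)) (v \<tau> (2 * j - 1))"
      using F.b_frame(1)[OF j, of "v \<tau> (2 * j)"] frame_at(3)[OF \<tau> jj(2) jj(2)] by simp
    also have "\<dots> \<le> norm \<tau> * norm (B (v \<tau> (2 * j)) (v \<tau> (2 * j - 1)))" by (rule norm_cauchy_schwarz)
    also have "\<dots> \<le> norm \<tau> * C"
      using C(2)[of "v \<tau> (2 * j)" "v \<tau> (2 * j - 1)"] nv[OF jj(1)] nv[OF jj(2)]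
          by (intro mult_left_mono) auto
    finally show ?thesis using frame_at(1)[OF \<tau> j] by (simp add: freq_def j_def mult.commute)
  qed
  then show ?thesis using C(1) by blast
qed

text \<open>
  On bounded sets of frequencies the quadratic form \<open>\<langle>y, |B\<^sup>\<tau>| y\<rangle>\<close> is a uniform limit of the forms
  \<open>\<langle>y, p (- (B\<^sup>\<tau>)\<^sup>2) y\<rangle>\<close> with polynomials \<open>p\<close> approximating the square root. It is therefore
  continuous in \<open>\<tau>\<close>, although the frame \<open>v \<tau>\<close> need not even be measurable.
\<close>

lemma qform_isCont:
  assumes \<tau>0: "\<tau>0 \<noteq> 0"
  shows "isCont (\<lambda>p. qform (fst p) (snd p)) (y0, \<tau>0)"
proof (rule isCont_approx)
  fix e :: real assume e: "e > 0"
  obtain C where C: "C > 0" "\<And>\<tau> l. \<tau> \<noteq> 0 \<Longrightarrow> l \<in> {1..2*n} \<Longrightarrow> 0 < freq \<tau> l \<and> freq \<tau> l \<le> C * norm \<tau>"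
    using freq_bound by blast
  \<comment> \<open>\<open>R\<close> bounds the squared frequencies and \<open>Y\<close> the squared
    norm of \<open>y\<close> near the given point. The accuracy \<open>e / (2 * Y)\<close> of the
    polynomial then gives an error of at most \<open>e / 2\<close> in the form.\<close>
  define R where "R = (C * (norm \<tau>0 + 1))\<^sup>2"
  define Y where "Y = (norm y0 + 1)\<^sup>2"
  have Y: "Y > 0" unfolding Y_def by (intro zero_less_power add_nonneg_pos) auto
  obtain g where g: "real_polynomial_function g" "\<And>x. x \<in> {0..R} \<Longrightarrow> \<bar>sqrt x - g x\<bar> < e / (2 * Y)"
  proof (rule Stone_Weierstrass_real_polynomial_function[OF compact_Icc])
    show "continuous_on {0..R} sqrt" by (rule continuous_on_real_sqrt[OF continuous_on_id])
    show "0 < e / (2 * Y)" using e Y by simp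
  qed blast
  obtain a m where a: "g = (\<lambda>x. \<Sum>k\<le>m. a k * x ^ k)"
    using g(1) unfolding real_polynomial_function_iff_sum by blast
  have close: "dist (qform y \<tau>) (poly_form a m y \<tau>) < e"
    if \<tau>: "\<tau> \<noteq> 0" "norm \<tau> < norm \<tau>0 + 1" and y: "norm y < norm y0 + 1" for y \<tau>
  proof -
    have le: "\<bar>freq \<tau> l - g ((freq \<tau> l)\<^sup>2)\<bar> \<le> e / (2 * Y)" if l: "l \<in> {1..2*n}" for l
    proof -
      have f: "0 < freq \<tau> l" "freq \<tau> l \<le> C * (norm \<tau>0 + 1)"
        using C(2)[OF \<tau>(1) l] \<tau>(2) C(1) by (auto intro: order_trans mult_left_mono)
      then have "(freq \<tau> l)\<^sup>2 \<in> {0..R}" unfolding R_def by (auto intro: power_mono)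
      from g(2)[OF this] f show ?thesis by simp
    qed
    have "qform y \<tau> - poly_form a m y \<tau> = (\<Sum>l=1..2*n. (freq \<tau> l - g ((freq \<tau> l)\<^sup>2))
        * (y \<bullet> v \<tau> l)\<^sup>2)"
      unfolding qform_eq[OF \<tau>(1)] poly_form_eq[OF \<tau>(1)] a
          by (simp add: sum_subtractf[symmetric] left_diff_distrib)
    then have "\<bar>qform y \<tau> - poly_form a m y \<tau>\<bar>
        \<le> (\<Sum>l=1..2*n. \<bar>(freq \<tau> l - g ((freq \<tau> l)\<^sup>2)) * (y \<bullet> v \<tau> l)\<^sup>2\<bar>)"
      by simp
    also have "\<dots> \<le> (\<Sum>l=1..2*n. e / (2 * Y) * (y \<bullet> v \<tau> l)\<^sup>2)"
      unfolding abs_mult abs_power2 by (intro sum_mono mult_right_mono le) auto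
    also have "\<dots> = e / (2 * Y) * (y \<bullet> y)"
      unfolding sum_distrib_left[symmetric] frame_parseval[OF \<tau>(1), of y y]
          by (simp add: power2_eq_square)
    also have "\<dots> \<le> e / (2 * Y) * Y"
      using y e Y unfolding Y_def by (intro mult_left_mono)
          (auto simp: power2_norm_eq_inner[symmetric] intro!: power_mono)
    also have "\<dots> < e" using e Y by simp
    finally show ?thesis by (simp add: dist_real_def)
  qed
  show "\<exists>g. isCont g (y0, \<tau>0) \<and> dist (qform (fst (y0, \<tau>0)) (snd (y0, \<tau>0))) (g (y0, \<tau>0)) < e \<and>
      (\<forall>\<^sub>F x in nhds (y0, \<tau>0). dist (qform (fst x) (snd x)) (g x) < e)"
  proof (intro exI[of _ "\<lambda>p. poly_form a m (fst p) (snd p)"] conjI)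
    show "isCont (\<lambda>p. poly_form a m (fst p) (snd p)) (y0, \<tau>0)"
      using poly_form_continuous by (simp add: continuous_on_eq_continuous_at)
    show "dist (qform (fst (y0, \<tau>0)) (snd (y0, \<tau>0))) (poly_form a m (fst (y0, \<tau>0)) (snd (y0, \<tau>0)))
        < e"
      using close[OF \<tau>0] by simp
    let ?U = "{y. norm y < norm y0 + 1} \<times> ({\<tau>. norm \<tau> < norm \<tau>0 + 1} \<inter> - {0})"
    have "open ?U" by (intro open_Times open_Int open_Collect_less continuous_intros)
    moreover have "(y0, \<tau>0) \<in> ?U" using \<tau>0 by simp
    ultimately have "\<forall>\<^sub>F x in nhds (y0, \<tau>0). x \<in> ?U" by (rule eventually_nhds_in_open)
    then show "\<forall>\<^sub>F x in nhds (y0, \<tau>0). dist (qform (fst x) (snd x))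
        (poly_form a m (fst x) (snd x)) < e"
      by eventually_elim (auto intro: close)
  qed
qed

text \<open>The characteristic polynomial at 0 is the product of the squares of the
  \<open>\<mu> \<tau> j\<close>. Its square root recovers the product through matrix entries, which
  are continuous in \<open>\<tau>\<close>. The matrix is written \<open>mat 0 - ...\<close> to match
  the polynomial in \<open>spectral_frame\<close>.\<close>

definition volume :: "real^'r \<Rightarrow> real" where
  "volume \<tau> = (2 / pi) ^ n * sqrt (Re (det (mat 0 -
      (\<chi> k l. complex_of_real (B_matrix B \<tau> $ k $ l)))))"

lemma volume_continuous: "continuous_on S volume"
proof -
  have "continuous_on S (\<lambda>\<tau>. B_matrix B \<tau> $ k $ l)" for k l
    unfolding B_matrix_def by (simp add: continuous_intros)
  then show ?thesis
    unfolding volume_def[abs_def] det_def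
    by (simp add: continuous_intros mat_def)
qed

lemma volume_eq:
  assumes "\<tau> \<noteq> 0"
  shows "volume \<tau> = (\<Prod>j=1..n. 2 * \<mu> \<tau> j / pi)"
proof -
  interpret F: laguerre_fibre n "\<mu> \<tau>" "v \<tau>" "\<lambda>x y. \<tau> \<bullet> B x y" by (rule fibre[OF assms])
  have "det (mat 0 - (\<chi> k l. complex_of_real (B_matrix B \<tau> $ k $ l)))
      = complex_of_real ((\<Prod>j=1..n. \<mu> \<tau> j)\<^sup>2)"
    unfolding frame_at(2)[OF assms] by (simp add: prod_power_distrib power2_eq_square
        algebra_simps flip: prod.distrib)
  then have "volume \<tau> = (2 / pi) ^ n * (\<Prod>j=1..n. \<mu> \<tau> j)"
    unfolding volume_def by (simp only: Re_complex_of_real real_sqrt_abs abs_of_pos[OF F.prod_\<mu>(1)])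
  then show ?thesis using F.prod_\<mu>(2) unfolding F.vol_def by (simp only:)
qed

text \<open>Set to 0 at frequency 0, where the frame is unconstrained; the kernel then satisfies its
  bounds at every frequency, and the change concerns a null set.\<close>

definition kernel :: "nat \<Rightarrow> real^'d \<Rightarrow> real^'r \<Rightarrow> real" where
  "kernel m y \<tau> = (if \<tau> = 0 then 0 else Q_kernel n \<mu> v m y \<tau>)"

lemma kernel_fibre:
  assumes "\<tau> \<noteq> 0"
  shows "kernel m y \<tau> = laguerre_fibre.Q n (\<mu> \<tau>) (v \<tau>) m y"
proof -
  interpret F: laguerre_fibre n "\<mu> \<tau>" "v \<tau>" "\<lambda>x y. \<tau> \<bullet> B x y" by (rule fibre[OF assms])
  show ?thesis using assms by (simp add: kernel_def Q_kernel_eq_total[OF n] F.Q_def F.vol_def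
      F.q_def)
qed

lemma kernel_eq:
  assumes "\<tau> \<noteq> 0"
  shows "kernel m y \<tau> = volume \<tau> * laguerre_total n m (2 * qform y \<tau>) * exp (- qform y \<tau>)"
  using assms by (simp add: kernel_def Q_kernel_eq_total[OF n] volume_eq qform_def)

lemma kernel_continuous_on: "continuous_on (UNIV \<times> - {0}) (\<lambda>p. kernel m (fst p) (snd p))"
proof -
  have q: "continuous_on (UNIV \<times> - {0}) (\<lambda>p. qform (fst p) (snd p))"
    using qform_isCont by (intro continuous_at_imp_continuous_on ballI) auto
  have "continuous_on (UNIV \<times> - {0}) (\<lambda>p. volume (snd p) * laguerre_total n m
      (2 * qform (fst p) (snd p)) * exp (- qform (fst p) (snd p)))"
    by (intro continuous_intros q continuous_on_compose2[OF volume_continuous]) auto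
  then show ?thesis
    by (rule continuous_on_eq) (simp add: kernel_eq mem_Times_iff)
qed

lemma open_nonzero: "open ((UNIV :: (real^'d) set) \<times> - {0 :: real^'r})"
  by (intro open_Times) auto

lemma kernel_isCont: "\<tau> \<noteq> 0 \<Longrightarrow> isCont (\<lambda>p. kernel m (fst p) (snd p)) (y, \<tau>)"
  using kernel_continuous_on[of m] open_nonzero by (simp add: continuous_on_eq_continuous_at)

lemma kernel_measurable_pair: "(\<lambda>p. kernel m (fst p) (snd p)) \<in> borel_measurable borel"
proof -
  have "(\<lambda>p. indicator (UNIV \<times> - {0}) p *\<^sub>R kernel m (fst p) (snd p)) \<in> borel_measurable borel"
    by (intro borel_measurable_continuous_on_indicator kernel_continuous_on borel_open open_nonzero)
  also have "(\<lambda>p. indicator (UNIV \<times> - {0}) p *\<^sub>R kernel m (fst p) (snd p))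
      = (\<lambda>p. kernel m (fst p) (snd p))"
    by (auto simp: kernel_def indicator_def)
  finally show ?thesis .
qed

lemma kernel_measurable [measurable (raw)]:
  assumes [measurable]: "f \<in> borel_measurable M" "g \<in> borel_measurable M"
  shows "(\<lambda>x. kernel m (f x) (g x)) \<in> borel_measurable M"
proof -
  have "(\<lambda>x. (f x, g x)) \<in> borel_measurable M" by simp
  from measurable_compose[OF this kernel_measurable_pair] show ?thesis by simp
qed

text \<open>The maximum is at the origin, where the quadratic form vanishes. The bound is continuous
  in \<open>\<tau>\<close>, hence locally uniform.\<close>

lemma kernel_bound: "\<bar>kernel m y \<tau>\<bar> \<le> \<bar>volume \<tau> * laguerre_total n m 0\<bar>"
proof (cases "\<tau> = 0")
  case False
  interpret F: laguerre_fibre n "\<mu> \<tau>" "v \<tau>" "\<lambda>x y. \<tau> \<bullet> B x y" by (rule fibre[OF False])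
  have "\<bar>kernel m y \<tau>\<bar> \<le> kernel m 0 \<tau>" unfolding kernel_fibre[OF False] by (rule F.Q_le_Q0)
  also have "kernel m 0 \<tau> = volume \<tau> * laguerre_total n m 0"
    using F.q_0 unfolding kernel_eq[OF False] qform_def F.q_def by simp
  finally show ?thesis by simp
qed (simp add: kernel_def)

lemma kernel_L1:
  shows "integrable lborel (\<lambda>y. kernel m y \<tau>)" "(LINT y|lborel. \<bar>kernel m y \<tau>\<bar>) \<le> 5 ^ m * 5 ^ n"
proof -
  have "integrable lborel (\<lambda>y. kernel m y \<tau>) \<and> (LINT y|lborel. \<bar>kernel m y \<tau>\<bar>) \<le> 5 ^ m * 5 ^ n"
  proof (cases "\<tau> = 0")
    case False
    interpret F: laguerre_fibre n "\<mu> \<tau>" "v \<tau>" "\<lambda>x y. \<tau> \<bullet> B x y" by (rule fibre[OF False])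
    show ?thesis unfolding kernel_fibre[OF False] using F.Q_integrable F.Q_L1_bound by simp
  qed (simp add: kernel_def)
  then show "integrable lborel (\<lambda>y. kernel m y \<tau>)" "(LINT y|lborel. \<bar>kernel m y \<tau>\<bar>)
      \<le> 5 ^ m * 5 ^ n" by auto
qed

end

section \<open>The spectral projections of Schwartz functions\<close>

lemma tendsto_ennreal_zero:
  assumes "\<And>n. a n \<ge> 0" "(\<lambda>n. ennreal (a n)) \<longlonglongrightarrow> 0"
  shows "a \<longlonglongrightarrow> 0"
  using tendsto_ennreal_iff[of a sequentially 0] assms by simp

lemma borel_measurable_fst:
  "f \<in> borel_measurable M \<Longrightarrow> (\<lambda>x. fst (f x)) \<in> borel_measurable M"
  by (rule measurable_compose[of f _ borel]) (auto intro!: borel_measurable_continuous_onI[OF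
      continuous_on_fst[OF continuous_on_id]])

lemma borel_measurable_snd:
  "f \<in> borel_measurable M \<Longrightarrow> (\<lambda>x. snd (f x)) \<in> borel_measurable M"
  by (rule measurable_compose[of f _ borel]) (auto intro!: borel_measurable_continuous_onI[OF
      continuous_on_snd[OF continuous_on_id]])

context step_two
begin

text \<open>The projection on the fibre over \<open>\<tau>\<close>, in the shape that the
  distribution produces; \<open>twisted_fibre\<close> identifies it with \<open>twist\<close> for
  nonzero frequency.\<close>

definition twisted :: "nat \<Rightarrow> ((real^'d) \<times> (real^'r) \<Rightarrow> complex) \<Rightarrow> real^'d \<Rightarrow> real^'r \<Rightarrow> complex" where
  "twisted m f x \<tau> = (LINT y|lborel. kernel m y \<tau>
      *\<^sub>R (iexp (- (2 * (\<tau> \<bullet> B x y))) * partial_fourier f (x - y) \<tau>))"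

context
  fixes f :: "(real^'d) \<times> (real^'r) \<Rightarrow> complex"
  assumes f: "schwartz f"
begin

declare schwartz_borel_measurable[OF f, measurable]

lemma partial_fourier_measurable_compose [measurable (raw)]:
  assumes [measurable]: "g \<in> borel_measurable M" "h \<in> borel_measurable M"
  shows "(\<lambda>x. partial_fourier f (g x) (h x)) \<in> borel_measurable M"
proof -
  have "(\<lambda>x. (g x, h x)) \<in> borel_measurable M" by simp
  from measurable_compose[OF this partial_fourier_measurable[OF f]] show ?thesis by simp
qed

lemma partial_fourier_slice_continuous: "continuous_on UNIV (\<lambda>x. partial_fourier f x \<tau>)"
  using continuous_on_compose2[OF partial_fourier_continuous[OF f]
      continuous_on_Pair[OF continuous_on_id continuous_on_const] subset_UNIV, of UNIV \<tau>]
  by simp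

lemma partial_fourier_bounded_integrable: "bounded_integrable (\<lambda>x. partial_fourier f x \<tau>)"
proof -
  obtain C where C: "C \<ge> 0" "\<And>y s. norm (partial_fourier f y s) \<le> C * weight y"
      using partial_fourier_weight_bound[OF f] by blast
  have "integrable lborel (\<lambda>x. partial_fourier f x \<tau>)"
  proof (rule Bochner_Integration.integrable_bound)
    show "integrable lborel (\<lambda>y::real^'d. C * weight y)"
        using integrable_weight[where 'a="real^'d"] by simp
  qed (use C in auto)
  moreover have "norm (partial_fourier f x \<tau>) \<le> C" for x
    using C(2)[of x \<tau>] mult_left_mono[OF weight_le_1[of x] C(1)] by simp
  ultimately show ?thesis by (auto simp: bounded_integrable_def)
qed

lemma partial_fourier_central_bound: "\<exists>C\<ge>0. \<forall>y s. norm (partial_fourier f y s) \<le> C * weight s"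
proof -
  obtain C where C: "C \<ge> 0" "\<And>y s. norm (partial_fourier f y s) \<le> C * (weight y * weight s)"
    using partial_fourier_decay[OF f] by blast
  have "norm (partial_fourier f y s) \<le> C * weight s" for y s
  proof -
    have "C * (weight y * weight s) \<le> C * (1 * weight s)"
      using C(1) by (intro mult_left_mono mult_right_mono weight_le_1) auto
    then show ?thesis using C(2)[of y s] by simp
  qed
  then show ?thesis using C(1) by blast
qed

lemma twisted_fibre:
  assumes "\<tau> \<noteq> 0"
  shows "twisted m f x \<tau> = laguerre_fibre.twist (\<lambda>x y. \<tau> \<bullet> B x y)
      (laguerre_fibre.Q n (\<mu> \<tau>) (v \<tau>) m) (\<lambda>x. partial_fourier f x \<tau>) x"
proof -
  interpret F: laguerre_fibre n "\<mu> \<tau>" "v \<tau>" "\<lambda>x y. \<tau> \<bullet> B x y" by (rule fibre[OF assms])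
  show ?thesis unfolding twisted_def kernel_fibre[OF assms]
      by (rule F.twist_change[symmetric]) measurable
qed

lemma twisted_integrand:
  "integrable lborel (\<lambda>y. kernel m y \<tau> *\<^sub>R (iexp (- (2 * (\<tau> \<bullet> B x y))) * partial_fourier f (x - y)
      \<tau>))"
proof -
  obtain C where C: "C \<ge> 0" "\<And>y s. norm (partial_fourier f y s) \<le> C * weight s"
      using partial_fourier_central_bound by blast
  show ?thesis
  proof (rule Bochner_Integration.integrable_bound)
    show "integrable lborel (\<lambda>y. (C * weight \<tau>) * kernel m y \<tau>)" using kernel_L1(1) by simp
    show "AE y in lborel. norm (kernel m y \<tau> *\<^sub>R (iexp (- (2 * (\<tau> \<bullet> B x y))) * partial_fourier f
        (x - y) \<tau>)) \<le> norm ((C * weight \<tau>) * kernel m y \<tau>)"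
    proof (intro AE_I2)
      fix y
      have "\<bar>kernel m y \<tau>\<bar> * norm (partial_fourier f (x - y) \<tau>) \<le> \<bar>kernel m y \<tau>\<bar> * (C * weight \<tau>)"
        by (intro mult_left_mono C) simp
      then show "norm (kernel m y \<tau> *\<^sub>R (iexp (- (2 * (\<tau> \<bullet> B x y))) * partial_fourier f (x - y)
          \<tau>)) \<le> norm ((C * weight \<tau>) * kernel m y \<tau>)"
        using C(1) by (simp add: norm_mult abs_mult mult.commute del: of_real_minus of_real_mult)
    qed
  qed measurable
qed

lemma twisted_norm_integral_le:
  assumes C: "C \<ge> 0" "\<And>y s. norm (partial_fourier f y s) \<le> C * weight s"
  shows "(LINT y|lborel. norm (kernel m y \<tau> *\<^sub>R (iexp (- (2 * (\<tau> \<bullet> B x y))) * partial_fourier f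
      (x - y) \<tau>))) \<le> (5 ^ m * 5 ^ n * C) * weight \<tau>"
proof -
  have "(LINT y|lborel. norm (kernel m y \<tau> *\<^sub>R (iexp (- (2 * (\<tau> \<bullet> B x y))) * partial_fourier f
      (x - y) \<tau>)))
      \<le> (LINT y|lborel. \<bar>kernel m y \<tau>\<bar> * (C * weight \<tau>))"
    using kernel_L1(1)[of m \<tau>] C
    by (intro integral_mono') (auto simp: norm_mult
        intro!: mult_left_mono simp del: of_real_minus of_real_mult)
  also have "\<dots> = (LINT y|lborel. \<bar>kernel m y \<tau>\<bar>) * (C * weight \<tau>)" by simp
  also have "\<dots> \<le> (5 ^ m * 5 ^ n) * (C * weight \<tau>)"
    using C by (intro mult_right_mono kernel_L1(2)) auto
  finally show ?thesis by (simp add: mult.assoc)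
qed

lemma twisted_bound: "\<exists>D\<ge>0. \<forall>x \<tau>. norm (twisted m f x \<tau>) \<le> D * weight \<tau>"
proof -
  obtain C where C: "C \<ge> 0" "\<And>y s. norm (partial_fourier f y s) \<le> C * weight s"
      using partial_fourier_central_bound by blast
  have "norm (twisted m f x \<tau>) \<le> (5 ^ m * 5 ^ n * C) * weight \<tau>" for x \<tau>
    unfolding twisted_def by (rule order_trans[OF integral_norm_bound
        twisted_norm_integral_le[OF C]])
  then show ?thesis using C(1) by (intro exI[of _ "5 ^ m * 5 ^ n * C"]) auto
qed

lemma twisted_measurable [measurable (raw)]:
  assumes [measurable]: "g \<in> borel_measurable M" "h \<in> borel_measurable M"
  shows "(\<lambda>x. twisted m f (g x) (h x)) \<in> borel_measurable M"
  unfolding twisted_def by measurable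

lemma twisted_integrable: "integrable lborel (\<lambda>\<tau>. twisted m f x \<tau>)"
proof -
  obtain D where D: "D \<ge> 0" "\<And>x \<tau>. norm (twisted m f x \<tau>) \<le> D * weight \<tau>" using twisted_bound
      by blast
  show ?thesis
  proof (rule Bochner_Integration.integrable_bound)
    show "integrable lborel (\<lambda>\<tau>::real^'r. D * weight \<tau>)"
        using integrable_weight[where 'a="real^'r"] by simp
  qed (use D in auto)
qed

text \<open>Supplies the continuity that \<open>plancherel\<close> asks for in the frequency
  variable.\<close>

lemma twisted_isCont:
  assumes \<tau>: "\<tau> \<noteq> 0"
  shows "isCont (\<lambda>\<tau>. twisted m f x \<tau>) \<tau>"
  unfolding continuous_at_sequentially o_def
proof (intro allI impI)
  fix s assume s: "s \<longlonglongrightarrow> \<tau>"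
  obtain C where C: "C \<ge> 0" "\<And>y s. norm (partial_fourier f y s) \<le> C * weight y"
      using partial_fourier_weight_bound[OF f] by blast
  have "(\<lambda>k. \<bar>volume (s k) * laguerre_total n m 0\<bar>) \<longlonglongrightarrow> \<bar>volume \<tau> * laguerre_total n m 0\<bar>"
    by (intro tendsto_intros continuous_on_tendsto_compose[OF volume_continuous[of UNIV] s]) auto
  \<comment> \<open>Along a convergent sequence of frequencies the continuous bound of
    \<open>kernel_bound\<close> stays below a constant, which yields a majorant in
    \<open>y\<close>.\<close>
  then obtain V where V: "\<And>k. \<bar>volume (s k) * laguerre_total n m 0\<bar> \<le> V"
    using convergent_imp_Bseq[of "\<lambda>k. \<bar>volume (s k) * laguerre_total n m 0\<bar>"]
        by (auto simp: convergent_def Bseq_def)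
  have V0: "V \<ge> 0" using V[of 0] by linarith
  show "(\<lambda>k. twisted m f x (s k)) \<longlonglongrightarrow> twisted m f x \<tau>"
    unfolding twisted_def
  proof (rule integral_dominated_convergence[where w="\<lambda>y. V * (C * weight (x - y))"])
    have "integrable lborel (\<lambda>y::real^'d. weight (x - y))"
      by (subst lborel_integral_shift(4)) (auto intro: integrable_weight)
    then show "integrable lborel (\<lambda>y. V * (C * weight (x - y)))" by simp
    show "AE y in lborel. (\<lambda>k. kernel m y (s k)
        *\<^sub>R (iexp (- (2 * (s k \<bullet> B x y))) * partial_fourier f (x - y) (s k)))
      \<longlonglongrightarrow> kernel m y \<tau> *\<^sub>R (iexp (- (2 * (\<tau> \<bullet> B x y))) * partial_fourier f (x - y) \<tau>)"
    proof (intro AE_I2 tendsto_scaleR tendsto_mult)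
      fix y :: "real^'d"
      have "(\<lambda>k. (y, s k)) \<longlonglongrightarrow> (y, \<tau>)" by (intro tendsto_intros s)
      from isCont_tendsto_compose[OF kernel_isCont[OF \<tau>, where m=m] this]
      show "(\<lambda>k. kernel m y (s k)) \<longlonglongrightarrow> kernel m y \<tau>" by simp
      show "(\<lambda>k. iexp (- (2 * (s k \<bullet> B x y)))) \<longlonglongrightarrow> iexp (- (2 * (\<tau> \<bullet> B x y)))"
          by (intro tendsto_intros s)
      have "(\<lambda>k. (x - y, s k)) \<longlonglongrightarrow> (x - y, \<tau>)" by (intro tendsto_intros s)
      from continuous_on_tendsto_compose[OF partial_fourier_continuous[OF f] this]
      show "(\<lambda>k. partial_fourier f (x - y) (s k)) \<longlonglongrightarrow> partial_fourier f (x - y) \<tau>" by simp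
    qed
    show "AE y in lborel. norm (kernel m y (s k)
        *\<^sub>R (iexp (- (2 * (s k \<bullet> B x y))) * partial_fourier f (x - y) (s k)))
        \<le> V * (C * weight (x - y))" for k
    proof (intro AE_I2)
      fix y
      have "\<bar>kernel m y (s k)\<bar> * norm (partial_fourier f (x - y) (s k)) \<le> V * (C * weight (x - y))"
        using V0 by (intro mult_mono order_trans[OF kernel_bound V] C) auto
      then show "norm (kernel m y (s k) *\<^sub>R (iexp (- (2 * (s k \<bullet> B x y))) * partial_fourier f
          (x - y) (s k))) \<le> V * (C * weight (x - y))"
        by (simp add: norm_mult del: of_real_minus of_real_mult)
    qed
  qed measurable
qed

text \<open>The product of \<open>(x, t)\<close> with the inverse of \<open>(y, s)\<close> is
  \<open>(x - y, t - s - 2 *\<^sub>R B x y)\<close>. Reflecting the central variable about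
  \<open>t - 2 *\<^sub>R B x y\<close> produces both phases and reverses the frequency, which undoes
  the sign in \<open>- \<tau>\<close>.\<close>

lemma fourier_centre_translate:
  "fourier_centre (\<lambda>h. f (group_mult B (x, t) (group_inv h))) y (- \<tau>)
    = iexp (\<tau> \<bullet> t) * (iexp (- (2 * (\<tau> \<bullet> B x y))) * partial_fourier f (x - y) \<tau>)"
proof -
  have Bm: "B x (- y) = - B x y" using bilinear_rneg[OF bilinear_B] .
  let ?t = "t - 2 *\<^sub>R B x y"
  have "fourier_centre (\<lambda>h. f (group_mult B (x, t) (group_inv h))) y (- \<tau>)
    = (LINT s|lebesgue. iexp (\<tau> \<bullet> s) * f (x - y, ?t - s))"
    unfolding fourier_centre_def group_mult_def group_inv_def by (simp add: Bm algebra_simps)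
  also have "\<dots> = (LINT s|lborel. iexp (\<tau> \<bullet> s) * f (x - y, ?t - s))"
    by (rule integral_completion) measurable
  also have "\<dots> = (LINT s|lborel. iexp (\<tau> \<bullet> (?t - (?t - s))) * f (x - y, ?t - s))" by simp
  also have "\<dots> = (LINT s|lborel. iexp (\<tau> \<bullet> (?t - s)) * f (x - y, s))"
    by (rule lborel_integral_shift(2)) measurable
  also have "\<dots> = (LINT s|lborel. (iexp (\<tau> \<bullet> t) * iexp (- (2 * (\<tau> \<bullet> B x y))))
      * (iexp (- (\<tau> \<bullet> s)) * f (x - y, s)))"
  proof (intro Bochner_Integration.integral_cong refl)
    fix s
    have "\<tau> \<bullet> (?t - s) = \<tau> \<bullet> t + (- (2 * (\<tau> \<bullet> B x y)) + - (\<tau> \<bullet> s))" by (simp add: inner_diff_right)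
    then have "iexp (\<tau> \<bullet> (?t - s)) = iexp (\<tau> \<bullet> t) * (iexp (- (2 * (\<tau> \<bullet> B x y))) * iexp (- (\<tau> \<bullet> s)))"
      unfolding exp_add[symmetric] distrib_left[symmetric] of_real_add[symmetric] by (simp only:)
    then show "iexp (\<tau> \<bullet> (?t - s)) * f (x - y, s)
        = (iexp (\<tau> \<bullet> t) * iexp (- (2 * (\<tau> \<bullet> B x y)))) * (iexp (- (\<tau> \<bullet> s)) * f (x - y, s))"
      by (simp only: mult.assoc)
  qed
  also have "\<dots> = (iexp (\<tau> \<bullet> t) * iexp (- (2 * (\<tau> \<bullet> B x y)))) * partial_fourier f (x - y) \<tau>"
    unfolding partial_fourier_def by (rule integral_mult_right_zero)
  finally show ?thesis by (simp only: mult.assoc)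
qed

end

lemma AE_snd_nonzero: "AE p in (lborel :: ((real^'d) \<times> (real^'r)) measure). snd p \<noteq> 0"
proof -
  obtain k :: 'r where True by simp
  have "((0::real^'d), axis k (1::real)) \<in> Basis" by (simp add: Basis_prod_def)
  from negligible_standard_hyperplane[OF this, of 0]
  have "AE p in (lebesgue :: ((real^'d) \<times> (real^'r)) measure). p \<bullet> (0, axis k 1) \<noteq> 0"
    by (intro AE_I'[of "{p. p \<bullet> (0, axis k 1) = 0}"]) (auto simp: negligible_iff_null_sets)
  then have "AE p in (lebesgue :: ((real^'d) \<times> (real^'r)) measure). snd p \<noteq> 0"
    by eventually_elim (auto simp: inner_prod_def)
  then show ?thesis by (simp only: AE_completion_iff)
qed

text \<open>Over the hyperplane of frequency 0 the kernel is built from arbitrary data, but there it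
  is a fixed continuous function of \<open>y\<close>; elsewhere it agrees with
  \<open>kernel\<close>.\<close>

lemma Q_kernel_measurable: "(\<lambda>p. Q_kernel n \<mu> v m (fst p) (snd p)) \<in> borel_measurable borel"
proof -
  note [measurable (raw)] = borel_measurable_fst borel_measurable_snd
  have "continuous_on UNIV (\<lambda>p::(real^'d) \<times> (real^'r). Q_kernel n \<mu> v m (fst p) 0)"
    unfolding Q_kernel_eq_total[OF n] block_norm_sq_def by (intro continuous_intros)
  then have [measurable]: "(\<lambda>p::(real^'d) \<times> (real^'r). Q_kernel n \<mu> v m (fst p) 0)
      \<in> borel_measurable borel"
    by (rule borel_measurable_continuous_onI)
  have "(\<lambda>p::(real^'d) \<times> (real^'r). if snd p = 0 then Q_kernel n \<mu> v m (fst p) 0 else kernel m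
      (fst p) (snd p)) \<in> borel_measurable borel"
    by measurable
  also have "(\<lambda>p. if snd p = 0 then Q_kernel n \<mu> v m (fst p) 0 else kernel m (fst p) (snd p))
      = (\<lambda>p. Q_kernel n \<mu> v m (fst p) (snd p))"
    by (auto simp: kernel_def)
  finally show ?thesis .
qed

text \<open>Exchanging the integrals over \<open>y\<close> and \<open>\<tau>\<close> shows that the
  projection acts frequency by frequency through \<open>twisted\<close> and then returns to the
  central variable by Fourier inversion. Decay in \<open>\<tau>\<close> and the uniform
  \<open>L1\<close> bound of the kernel justify the exchange.\<close>

lemma schwartz_projection_eq:
  assumes f: "schwartz f"
  shows "schwartz_projection n B \<mu> v m f (x, t)
      = complex_of_real (1 / (2 * pi) ^ CARD('r)) * fourier_int (twisted m f x) t"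
proof -
  note [measurable] = schwartz_borel_measurable[OF f] Q_kernel_measurable
  note [measurable (raw)] = partial_fourier_measurable_compose[OF f] borel_measurable_fst
      borel_measurable_snd
  let ?u = "\<lambda>y \<tau>. iexp (\<tau> \<bullet> t) * (iexp (- (2 * (\<tau> \<bullet> B x y))) * partial_fourier f (x - y) \<tau>)"
  have Fm: "(\<lambda>p. kernel m (fst p) (snd p) *\<^sub>R ?u (fst p) (snd p)) \<in> borel_measurable borel"
      by measurable
  have "(LINT p|lebesgue. complex_of_real (Q_kernel n \<mu> v m (fst p) (snd p)) *
      fourier_centre (\<lambda>h. f (group_mult B (x, t) (group_inv h))) (fst p) (- snd p))
    = (LINT p|lebesgue. complex_of_real (Q_kernel n \<mu> v m (fst p) (snd p)) * ?u (fst p) (snd p))"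
    unfolding fourier_centre_translate[OF f] ..
  also have "\<dots> = (LINT p|lborel. complex_of_real (Q_kernel n \<mu> v m (fst p) (snd p)) * ?u (fst p)
      (snd p))"
    by (rule integral_completion) measurable
  \<comment> \<open>\<open>Q_kernel\<close> and \<open>kernel\<close> differ at most over frequency
    0, a hyperplane-like null set of the product.\<close>
  also have "\<dots> = (LINT p|lborel. kernel m (fst p) (snd p) *\<^sub>R ?u (fst p) (snd p))"
  proof (rule integral_cong_AE)
    show "AE p in lborel. complex_of_real (Q_kernel n \<mu> v m (fst p) (snd p)) * ?u (fst p) (snd p)
        = kernel m (fst p) (snd p) *\<^sub>R ?u (fst p) (snd p)"
      using AE_snd_nonzero by eventually_elim (simp add: kernel_def scaleR_conv_of_real)
  qed measurable
  also have "\<dots> = (LINT p|(lborel \<Otimes>\<^sub>M lborel). (case p of (y, \<tau>) \<Rightarrow> kernel m y \<tau> *\<^sub>R ?u y \<tau>))"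
    unfolding lborel_prod by (simp add: case_prod_beta)
  also have "\<dots> = (LINT \<tau>|lborel. LINT y|lborel. kernel m y \<tau> *\<^sub>R ?u y \<tau>)"
  proof (rule lborel_pair.integral_snd[symmetric])
    obtain C where C: "C \<ge> 0" "\<And>y s. norm (partial_fourier f y s) \<le> C * weight s"
        using partial_fourier_central_bound[OF f] by blast
    have u: "kernel m y \<tau> *\<^sub>R ?u y \<tau> = iexp (\<tau> \<bullet> t)
        * (kernel m y \<tau> *\<^sub>R (iexp (- (2 * (\<tau> \<bullet> B x y))) * partial_fourier f (x - y) \<tau>))" for y \<tau>
      by (simp only: mult_scaleR_right)
    have "integrable (lborel \<Otimes>\<^sub>M lborel) (\<lambda>(\<tau>, y). kernel m y \<tau> *\<^sub>R ?u y \<tau>)"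
    proof (rule lborel_pair.Fubini_integrable)
      show "(\<lambda>(\<tau>, y). kernel m y \<tau> *\<^sub>R ?u y \<tau>) \<in> borel_measurable (lborel \<Otimes>\<^sub>M lborel)" by measurable
      show "AE \<tau> in lborel. integrable lborel (\<lambda>y. case (\<tau>, y) of (\<tau>, y) \<Rightarrow> kernel m y \<tau> *\<^sub>R ?u y \<tau>)"
        unfolding prod.case u by (intro AE_I2 integrable_mult_right twisted_integrand[OF f])
      show "integrable lborel (\<lambda>\<tau>. LINT y|lborel. norm (case (\<tau>, y) of (\<tau>, y) \<Rightarrow> kernel m y \<tau>
          *\<^sub>R ?u y \<tau>))"
      proof (rule Bochner_Integration.integrable_bound)
        show "integrable lborel (\<lambda>\<tau>::real^'r. (5 ^ m * 5 ^ n * C) * weight \<tau>)"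
            using integrable_weight[where 'a="real^'r"] by simp
        have "norm (LINT y|lborel. norm (kernel m y \<tau> *\<^sub>R ?u y \<tau>))
            \<le> norm ((5 ^ m * 5 ^ n * C) * weight \<tau>)" for \<tau>
          unfolding u norm_iexp_mult using twisted_norm_integral_le[OF f C, of m \<tau> x] C(1)
              by (simp del: of_real_minus of_real_mult)
        then show "AE \<tau> in lborel. norm (LINT y|lborel. norm (case (\<tau>, y) of (\<tau>, y) \<Rightarrow> kernel m y \<tau>
            *\<^sub>R ?u y \<tau>)) \<le> norm ((5 ^ m * 5 ^ n * C) * weight \<tau>)"
          by simp
      qed measurable
    qed
    from lborel_pair.integrable_product_swap[OF this]
    show "integrable (lborel \<Otimes>\<^sub>M lborel) (\<lambda>(y, \<tau>). kernel m y \<tau> *\<^sub>R ?u y \<tau>)"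
        by (simp add: case_prod_beta)
  qed
  also have "\<dots> = fourier_int (twisted m f x) t"
    unfolding fourier_int_def twisted_def
  proof (intro Bochner_Integration.integral_cong refl)
    fix \<tau>
    show "(LINT y|lborel. kernel m y \<tau> *\<^sub>R ?u y \<tau>)
        = iexp (t \<bullet> \<tau>) * (LINT y|lborel. kernel m y \<tau>
        *\<^sub>R (iexp (- (2 * (\<tau> \<bullet> B x y))) * partial_fourier f (x - y) \<tau>))"
      unfolding integral_mult_right_zero[symmetric] mult_scaleR_right
          by (simp only: inner_commute[of t \<tau>])
  qed
  finally show ?thesis unfolding schwartz_projection_def P_distribution_def by (simp only:)
qed

lemma schwartz_projection_measurable:
  assumes f: "schwartz f"
  shows "schwartz_projection n B \<mu> v m f \<in> borel_measurable borel"
proof -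
  note [measurable (raw)] = twisted_measurable[OF f] borel_measurable_fst borel_measurable_snd
  have "(\<lambda>p. complex_of_real (1 / (2 * pi) ^ CARD('r))
      * (LINT \<tau>|lborel. iexp (snd p \<bullet> \<tau>) * twisted m f (fst p) \<tau>)) \<in> borel_measurable borel"
    by measurable
  also have "(\<lambda>p. complex_of_real (1 / (2 * pi) ^ CARD('r))
      * (LINT \<tau>|lborel. iexp (snd p \<bullet> \<tau>) * twisted m f (fst p) \<tau>))
      = schwartz_projection n B \<mu> v m f"
    by (auto simp: schwartz_projection_eq[OF f] fourier_int_def)
  finally show ?thesis .
qed

lemma twisted_lincomb:
  assumes f: "schwartz f" and g: "schwartz g"
  shows "twisted m (\<lambda>p. a * f p + b * g p) x \<tau> = a * twisted m f x \<tau> + b * twisted m g x \<tau>"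
proof -
  have pf: "partial_fourier (\<lambda>p. a * f p + b * g p) y \<tau>
      = a * partial_fourier f y \<tau> + b * partial_fourier g y \<tau>" for y
  proof -
    have "partial_fourier (\<lambda>p. a * f p + b * g p) y \<tau>
        = (LINT t|lborel. a * (iexp (- (\<tau> \<bullet> t)) * f (y, t)) + b * (iexp (- (\<tau> \<bullet> t)) * g (y, t)))"
      unfolding partial_fourier_def by (intro Bochner_Integration.integral_cong refl)
          (simp add: algebra_simps)
    then show ?thesis
      unfolding partial_fourier_def
      by (simp only: Bochner_Integration.integral_add[OF
          integrable_mult_right[OF partial_fourier_integrable[OF f]]
          integrable_mult_right[OF partial_fourier_integrable[OF g]]]
          integral_mult_right_zero)
  qed
  let ?I = "\<lambda>f y. kernel m y \<tau> *\<^sub>R (iexp (- (2 * (\<tau> \<bullet> B x y))) * partial_fourier f (x - y) \<tau>)"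
  have "twisted m (\<lambda>p. a * f p + b * g p) x \<tau> = (LINT y|lborel. a * ?I f y + b * ?I g y)"
    unfolding twisted_def pf by (intro Bochner_Integration.integral_cong refl)
        (simp add: algebra_simps)
  then show ?thesis
    unfolding twisted_def
    by (simp only: Bochner_Integration.integral_add[OF
        integrable_mult_right[OF twisted_integrand[OF f]]
        integrable_mult_right[OF twisted_integrand[OF g]]]
        integral_mult_right_zero)
qed

lemma schwartz_projection_lincomb:
  assumes f: "schwartz f" and g: "schwartz g"
  shows "schwartz_projection n B \<mu> v m (\<lambda>p. a * f p + b * g p) p
      = a * schwartz_projection n B \<mu> v m f p + b * schwartz_projection n B \<mu> v m g p"
proof -
  obtain x t where p: "p = (x, t)" by (cases p)
  have int: "integrable lborel (\<lambda>\<tau>. iexp (t \<bullet> \<tau>) * twisted m h x \<tau>)" if "schwartz h" for h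
    by (rule integrable_iexp_mult[OF twisted_integrable[OF that]]) simp
  have "fourier_int (twisted m (\<lambda>p. a * f p + b * g p) x) t
      = (LINT \<tau>|lborel. a * (iexp (t \<bullet> \<tau>) * twisted m f x \<tau>) + b
      * (iexp (t \<bullet> \<tau>) * twisted m g x \<tau>))"
    unfolding fourier_int_def twisted_lincomb[OF f g]
        by (intro Bochner_Integration.integral_cong refl) (simp add: algebra_simps)
  also have "\<dots> = a * fourier_int (twisted m f x) t + b * fourier_int (twisted m g x) t"
    unfolding fourier_int_def
    by (simp only: Bochner_Integration.integral_add[OF integrable_mult_right[OF int[OF f]]
        integrable_mult_right[OF int[OF g]]] integral_mult_right_zero)
  finally show ?thesis
    unfolding p schwartz_projection_eq[OF f] schwartz_projection_eq[OF g]
        schwartz_projection_eq[OF schwartz_lincomb[OF f g]]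
    by (simp add: algebra_simps)
qed

text \<open>General \<open>I\<close> and \<open>c\<close> let one identity serve four purposes: a
  single projection and a partial sum with \<open>c = 0\<close>, the remainder with
  \<open>c = 1\<close>, and the norm of \<open>f\<close> itself with \<open>I\<close> empty and
  \<open>c = 1\<close>.\<close>

lemma plancherel_fibres:
  assumes f: "schwartz f" and I: "finite I"
  shows "(\<integral>\<^sup>+p. ennreal ((norm ((\<Sum>m\<in>I. schwartz_projection n B \<mu> v m f p) - c * f p))\<^sup>2) \<partial>lebesgue)
    = ennreal (1 / (2 * pi) ^ CARD('r)) * (\<integral>\<^sup>+\<tau>.
        (\<integral>\<^sup>+x. ennreal ((norm ((\<Sum>m\<in>I. twisted m f x \<tau>) - c * partial_fourier f x \<tau>))\<^sup>2) \<partial>lborel)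
        \<partial>lborel)"
proof -
  note [measurable] = schwartz_borel_measurable[OF f] schwartz_projection_measurable[OF f]
  note [measurable (raw)] = partial_fourier_measurable_compose[OF f] twisted_measurable[OF f]
  define k where "k = 1 / (2 * pi) ^ CARD('r)"
  have k: "k > 0" "k * (2 * pi) ^ CARD('r) = 1" by (simp_all add: k_def)
  define H where "H x \<tau> = (\<Sum>m\<in>I. twisted m f x \<tau>) - c * partial_fourier f x \<tau>" for x \<tau>
  have Hm [measurable (raw)]: "g \<in> borel_measurable M \<Longrightarrow> h \<in> borel_measurable M
      \<Longrightarrow> (\<lambda>x. H (g x) (h x)) \<in> borel_measurable M" for g h and M :: "'z measure"
    unfolding H_def by (intro borel_measurable_diff borel_measurable_sum borel_measurable_times
        borel_measurable_const partial_fourier_measurable_compose[OF f] twisted_measurable[OF f])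
  have "\<forall>m. \<exists>D\<ge>0. \<forall>x \<tau>. norm (twisted m f x \<tau>) \<le> D * weight \<tau>" using twisted_bound[OF f] by blast
  then obtain D where D: "\<And>m x \<tau>. norm (twisted m f x \<tau>) \<le> D m * weight \<tau>" by metis
  obtain C where C: "C \<ge> 0" "\<And>y s. norm (partial_fourier f y s) \<le> C * weight s"
      using partial_fourier_central_bound[OF f] by blast
  define E where "E = (\<Sum>m\<in>I. D m) + norm c * C"
  have H_le: "norm (H x \<tau>) \<le> E * weight \<tau>" for x \<tau>
  proof -
    have "norm (H x \<tau>) \<le> (\<Sum>m\<in>I. norm (twisted m f x \<tau>)) + norm (c * partial_fourier f x \<tau>)"
      unfolding H_def by (rule norm_triangle_ineq4[THEN order_trans])
          (intro add_right_mono norm_sum)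
    also have "\<dots> \<le> (\<Sum>m\<in>I. D m * weight \<tau>) + norm c * (C * weight \<tau>)"
      unfolding norm_mult by (intro add_mono sum_mono D mult_left_mono C) simp
    also have "\<dots> = E * weight \<tau>" by (simp add: E_def sum_distrib_right distrib_right mult.assoc)
    finally show ?thesis .
  qed
  have pf_int: "integrable lborel (\<lambda>\<tau>. partial_fourier f x \<tau>)" for x
  proof (rule Bochner_Integration.integrable_bound)
    show "integrable lborel (\<lambda>\<tau>::real^'r. C * weight \<tau>)"
        using integrable_weight[where 'a="real^'r"] by simp
  qed (use C in auto)
  have H_int: "integrable lborel (H x)" for x
    unfolding H_def[abs_def] using pf_int twisted_integrable[OF f]
        by (intro Bochner_Integration.integrable_diff Bochner_Integration.integrable_sum
        integrable_mult_right)
  have E0: "E \<ge> 0" using order_trans[OF norm_ge_zero H_le[of 0 0]] weight_pos[of "0::real^'r"]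
      by (simp add: zero_le_mult_iff)
  have H_bdd: "norm (H x \<tau>) \<le> E" for x \<tau> using H_le[of x \<tau>] mult_left_mono[OF weight_le_1[of \<tau>]
      E0] by simp
  \<comment> \<open>Continuity can fail at frequency 0, where the kernel has been set to 0; a single
    point is negligible.\<close>
  have H_cont: "AE \<tau> in lborel. isCont (H x) \<tau>" for x
    using AE_lborel_singleton[of "0::real^'r"]
  proof eventually_elim
    case (elim \<tau>)
    have "continuous_on UNIV (\<lambda>\<tau>. partial_fourier f x \<tau>)"
      using continuous_on_compose2[OF partial_fourier_continuous[OF f]
          continuous_on_Pair[OF continuous_on_const continuous_on_id] subset_UNIV, of UNIV x]
          by simp
    then have "isCont (\<lambda>\<tau>. partial_fourier f x \<tau>) \<tau>" by (simp add: continuous_on_eq_continuous_at)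
    then show ?case unfolding H_def by (intro continuous_intros twisted_isCont[OF f elim])
  qed
  have FH: "(\<Sum>m\<in>I. schwartz_projection n B \<mu> v m f (x, t)) - c * f (x, t)
      = complex_of_real k * fourier_int (H x) t" for x t
  proof -
    have ti: "integrable lborel (\<lambda>\<tau>. iexp (t \<bullet> \<tau>) * twisted m f x \<tau>)" for m
      by (rule integrable_iexp_mult[OF twisted_integrable[OF f]]) simp
    have pi: "integrable lborel (\<lambda>\<tau>. iexp (t \<bullet> \<tau>) * partial_fourier f x \<tau>)"
      by (rule integrable_iexp_mult[OF pf_int]) simp
    have "fourier_int (H x) t = (LINT \<tau>|lborel. (\<Sum>m\<in>I. iexp (t \<bullet> \<tau>) * twisted m f x \<tau>) - c
        * (iexp (t \<bullet> \<tau>) * partial_fourier f x \<tau>))"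
      unfolding fourier_int_def H_def by (intro Bochner_Integration.integral_cong refl)
          (simp add: sum_distrib_left algebra_simps)
    also have "\<dots> = (\<Sum>m\<in>I. fourier_int (twisted m f x) t) - c * fourier_int (partial_fourier f x) t"
      unfolding fourier_int_def
      by (simp only: Bochner_Integration.integral_diff[OF Bochner_Integration.integrable_sum[OF
          ti] integrable_mult_right[OF pi]] Bochner_Integration.integral_sum[OF ti]
          integral_mult_right_zero)
    also have "fourier_int (partial_fourier f x) t
        = complex_of_real ((2 * pi) ^ CARD('r)) * f (x, t)"
      using partial_fourier_inversion[OF f, of x t] by simp
    finally have "complex_of_real k * fourier_int (H x) t
        = (\<Sum>m\<in>I. complex_of_real k * fourier_int (twisted m f x) t) - c
        * (complex_of_real (k * (2 * pi) ^ CARD('r)) * f (x, t))"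
      by (simp only: right_diff_distrib sum_distrib_left of_real_mult mult.assoc mult.left_commute)
    then show ?thesis unfolding k(2) k_def by (simp add: schwartz_projection_eq[OF f])
  qed
  have inner: "(\<integral>\<^sup>+t. ennreal ((norm ((\<Sum>m\<in>I. schwartz_projection n B \<mu> v m f (x, t)) - c * f
      (x, t)))\<^sup>2) \<partial>lborel)
     = ennreal k * (\<integral>\<^sup>+\<tau>. ennreal ((norm (H x \<tau>))\<^sup>2) \<partial>lborel)" for x
  proof -
    have [measurable]: "fourier_int (H x) \<in> borel_measurable borel"
        by (rule borel_measurable_fourier_int) measurable
    have "(\<integral>\<^sup>+t. ennreal ((norm ((\<Sum>m\<in>I. schwartz_projection n B \<mu> v m f (x, t)) - c * f
        (x, t)))\<^sup>2) \<partial>lborel)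
      = (\<integral>\<^sup>+t. ennreal (k\<^sup>2) * ennreal ((norm (fourier_int (H x) t))\<^sup>2) \<partial>lborel)"
      unfolding FH by (simp add: norm_mult power_mult_distrib ennreal_mult)
    also have "\<dots> = ennreal (k\<^sup>2) * (ennreal ((2 * pi) ^ CARD('r))
        * (\<integral>\<^sup>+\<tau>. ennreal ((norm (H x \<tau>))\<^sup>2) \<partial>lborel))"
      using plancherel[OF H_int H_bdd H_cont, of x] by (simp add: nn_integral_cmult)
    also have "\<dots> = ennreal (k * (k * (2 * pi) ^ CARD('r))) * (\<integral>\<^sup>+\<tau>. ennreal ((norm (H x \<tau>))\<^sup>2)
        \<partial>lborel)"
      using k(1) by (simp add: mult.assoc[symmetric] ennreal_mult[symmetric] power2_eq_square)
    finally show ?thesis unfolding k(2) by simp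
  qed
  have "(\<integral>\<^sup>+p. ennreal ((norm ((\<Sum>m\<in>I. schwartz_projection n B \<mu> v m f p) - c * f p))\<^sup>2) \<partial>lebesgue)
    = (\<integral>\<^sup>+p. ennreal ((norm ((\<Sum>m\<in>I. schwartz_projection n B \<mu> v m f p) - c * f p))\<^sup>2)
        \<partial>(lborel \<Otimes>\<^sub>M lborel))"
    unfolding nn_integral_completion lborel_prod ..
  also have "\<dots> = (\<integral>\<^sup>+x. (\<integral>\<^sup>+t. ennreal ((norm ((\<Sum>m\<in>I. schwartz_projection n B \<mu> v m f (x, t)) - c
      * f (x, t)))\<^sup>2) \<partial>lborel) \<partial>lborel)"
    by (rule lborel.nn_integral_fst[symmetric]) (simp add: lborel_prod)
  also have "\<dots> = ennreal k * (\<integral>\<^sup>+x. (\<integral>\<^sup>+\<tau>. ennreal ((norm (H x \<tau>))\<^sup>2) \<partial>lborel) \<partial>lborel)"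
    unfolding inner by (rule nn_integral_cmult) measurable
  also have "(\<integral>\<^sup>+x. (\<integral>\<^sup>+\<tau>. ennreal ((norm (H x \<tau>))\<^sup>2) \<partial>lborel) \<partial>lborel)
      = (\<integral>\<^sup>+\<tau>. (\<integral>\<^sup>+x. ennreal ((norm (H x \<tau>))\<^sup>2) \<partial>lborel) \<partial>lborel)"
    by (rule lborel_pair.Fubini') measurable
  finally show ?thesis unfolding H_def k_def .
qed

end

section \<open>Convergence of the spectral expansion\<close>

lemma tendsto_zero_power2:
  fixes a :: "nat \<Rightarrow> real"
  assumes "(\<lambda>n. (a n)\<^sup>2) \<longlonglongrightarrow> 0" "\<And>n. a n \<ge> 0"
  shows "a \<longlonglongrightarrow> 0"
  using tendsto_real_sqrt[OF assms(1)] assms(2) by simp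

context step_two
begin

text \<open>The defect on one fibre, with the same parameters as \<open>plancherel_fibres\<close>.
  \<open>gap {} 1 f\<close> is the squared norm of the fibre of \<open>f\<close> and serves as the
  common majorant.\<close>

definition gap :: "nat set \<Rightarrow> complex \<Rightarrow> ((real^'d) \<times> (real^'r) \<Rightarrow> complex) \<Rightarrow> real^'r \<Rightarrow> ennreal" where
  "gap I c f \<tau> = (\<integral>\<^sup>+x. ennreal ((norm ((\<Sum>m\<in>I. twisted m f x \<tau>) - c * partial_fourier f x \<tau>))\<^sup>2)
      \<partial>lborel)"

context
  fixes f :: "(real^'d) \<times> (real^'r) \<Rightarrow> complex"
  assumes f: "schwartz f"
begin

lemma gap_measurable: "gap I c f \<in> borel_measurable borel"
proof -
  note [measurable (raw)] = partial_fourier_measurable_compose[OF f] twisted_measurable[OF f]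
  have [measurable (raw)]: "(\<lambda>z. (\<Sum>m\<in>I. twisted m f (g z) (h z)) - c * partial_fourier f (g z)
      (h z)) \<in> borel_measurable M"
    if "g \<in> borel_measurable M" "h \<in> borel_measurable M" for g h and M :: "'z measure"
    by (intro borel_measurable_diff borel_measurable_sum borel_measurable_times
        borel_measurable_const partial_fourier_measurable_compose[OF f] twisted_measurable[OF f]
        that)
  show ?thesis unfolding gap_def[abs_def] by measurable
qed

lemma gap_eq:
  assumes \<tau>: "\<tau> \<noteq> 0" and I: "finite I"
  shows "gap I c f \<tau> = ennreal (LINT x|lborel.
      (norm ((\<Sum>m\<in>I. twisted m f x \<tau>) - c * partial_fourier f x \<tau>))\<^sup>2)"
  unfolding gap_def
proof (rule nn_integral_eq_integral)
  interpret F: laguerre_fibre n "\<mu> \<tau>" "v \<tau>" "\<lambda>x y. \<tau> \<bullet> B x y" by (rule fibre[OF \<tau>])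
  have "bounded_integrable (\<lambda>x. c * partial_fourier f x \<tau>)"
    using partial_fourier_bounded_integrable[OF f, of \<tau>] unfolding bounded_integrable_def
    by (auto simp: norm_mult intro: mult_left_mono[OF _ norm_ge_zero])
  then have "bounded_integrable (\<lambda>x. (\<Sum>m\<in>I. twisted m f x \<tau>) - c * partial_fourier f x \<tau>)"
    unfolding twisted_fibre[OF f \<tau>]
    by (intro bounded_integrable_diff bounded_integrable_sum I F.bounded_integrable_twist
        partial_fourier_bounded_integrable[OF f])
  from integrable_norm[OF bounded_integrable_mult[OF this this]]
  show "integrable lborel (\<lambda>x. (norm ((\<Sum>m\<in>I. twisted m f x \<tau>) - c * partial_fourier f x \<tau>))\<^sup>2)"
    by (simp only: norm_mult complex_mod_cnj power2_eq_square)
qed simp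

lemma gap_estimates:
  assumes \<tau>: "\<tau> \<noteq> 0"
  shows "gap {m} 0 f \<tau> \<le> gap {} 1 f \<tau>"
    and "gap {..<M} 0 f \<tau> \<le> gap {} 1 f \<tau>"
    and "gap {..<M} 1 f \<tau> \<le> gap {} 1 f \<tau>"
    and "(\<lambda>M. gap {..<M} 1 f \<tau>) \<longlonglongrightarrow> 0"
proof -
  interpret F: laguerre_fibre n "\<mu> \<tau>" "v \<tau>" "\<lambda>x y. \<tau> \<bullet> B x y" by (rule fibre[OF \<tau>])
  note est = F.projection_estimates[OF partial_fourier_bounded_integrable[OF f, of \<tau>], folded
      twisted_fibre[OF f \<tau>]]
  note ge = gap_eq[OF \<tau>]
  show "gap {m} 0 f \<tau> \<le> gap {} 1 f \<tau>" "gap {..<M} 0 f \<tau> \<le> gap {} 1 f \<tau>" "gap {..<M} 1 f \<tau>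
      \<le> gap {} 1 f \<tau>"
    using est(1-3) by (simp_all add: ge ennreal_leI)
  show "(\<lambda>M. gap {..<M} 1 f \<tau>) \<longlonglongrightarrow> 0"
    using tendsto_ennrealI[OF est(4)[OF partial_fourier_slice_continuous[OF f]]] by (simp add: ge)
qed

lemma norm_defect:
  assumes "finite I"
  shows "(\<integral>\<^sup>+p. ennreal ((norm ((\<Sum>m\<in>I. schwartz_projection n B \<mu> v m f p) - c * f p))\<^sup>2) \<partial>lebesgue)
    = ennreal (1 / (2 * pi) ^ CARD('r)) * (\<integral>\<^sup>+\<tau>. gap I c f \<tau> \<partial>lborel)"
  using plancherel_fibres[OF f assms] unfolding gap_def .

lemma norm_total: "ennreal (1 / (2 * pi) ^ CARD('r)) * (\<integral>\<^sup>+\<tau>. gap {} 1 f \<tau> \<partial>lborel)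
    = ennreal ((L2_norm f)\<^sup>2)"
  using norm_defect[of "{}" 1] nn_integral_L2[OF schwartz_L2[OF f]] by simp

lemma projection_defect_bound:
  assumes I: "finite I" and le: "\<And>\<tau>. \<tau> \<noteq> 0 \<Longrightarrow> gap I c f \<tau> \<le> gap {} 1 f \<tau>"
  shows "(\<lambda>p. (\<Sum>m\<in>I. schwartz_projection n B \<mu> v m f p) - c * f p) \<in> L2"
    and "L2_norm (\<lambda>p. (\<Sum>m\<in>I. schwartz_projection n B \<mu> v m f p) - c * f p) \<le> L2_norm f"
proof -
  note [measurable] = schwartz_borel_measurable[OF f] schwartz_projection_measurable[OF f]
  have "(\<lambda>p. (\<Sum>m\<in>I. schwartz_projection n B \<mu> v m f p) - c * f p) \<in> borel_measurable borel"
      by measurable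
  then have m: "(\<lambda>p. (\<Sum>m\<in>I. schwartz_projection n B \<mu> v m f p) - c * f p)
      \<in> borel_measurable lebesgue"
    by (simp add: measurable_completion)
  have "(\<integral>\<^sup>+\<tau>. gap I c f \<tau> \<partial>lborel) \<le> (\<integral>\<^sup>+\<tau>. gap {} 1 f \<tau> \<partial>lborel)"
    using AE_lborel_singleton[of "0::real^'r"] by (intro nn_integral_mono_AE) (auto intro: le)
  then have "(\<integral>\<^sup>+p. ennreal ((norm ((\<Sum>m\<in>I. schwartz_projection n B \<mu> v m f p) - c * f p))\<^sup>2)
      \<partial>lebesgue) \<le> ennreal ((L2_norm f)\<^sup>2)"
    unfolding norm_defect[OF I] norm_total[symmetric] by (rule mult_left_mono) simp
  from L2_norm_le[OF m L2_norm_nonneg this]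
  show "(\<lambda>p. (\<Sum>m\<in>I. schwartz_projection n B \<mu> v m f p) - c * f p) \<in> L2"
    and "L2_norm (\<lambda>p. (\<Sum>m\<in>I. schwartz_projection n B \<mu> v m f p) - c * f p) \<le> L2_norm f" by blast+
qed

lemma schwartz_projection_L2: "schwartz_projection n B \<mu> v m f \<in> L2"
  and schwartz_projection_bound: "L2_norm (schwartz_projection n B \<mu> v m f) \<le> L2_norm f"
  using projection_defect_bound[of "{m}" 0] gap_estimates(1) by simp_all

lemma partial_sum_bound: "L2_norm (\<lambda>p. \<Sum>m<M. schwartz_projection n B \<mu> v m f p) \<le> L2_norm f"
  using projection_defect_bound(2)[of "{..<M}" 0] gap_estimates(2) by simp

text \<open>Dominated convergence over the frequency: on each fibre the defect tends to 0 and stays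
  below \<open>gap {} 1 f\<close>, whose integral is finite because \<open>f\<close> is in
  \<open>L2\<close>.\<close>

lemma partial_sum_converges: "(\<lambda>M. L2_norm (\<lambda>p. (\<Sum>m<M. schwartz_projection n B \<mu> v m f p) - f p))
    \<longlonglongrightarrow> 0"
proof -
  let ?k = "ennreal (1 / (2 * pi) ^ CARD('r))"
  note [measurable] = gap_measurable
  have "(\<lambda>M. \<integral>\<^sup>+\<tau>. gap {..<M} 1 f \<tau> \<partial>lborel) \<longlonglongrightarrow> (\<integral>\<^sup>+\<tau>. 0 \<partial>(lborel :: (real^'r) measure))"
  proof (rule nn_integral_dominated_convergence)
    have "(\<integral>\<^sup>+\<tau>. gap {} 1 f \<tau> \<partial>lborel) \<noteq> \<infinity>"
    proof
      assume "(\<integral>\<^sup>+\<tau>. gap {} 1 f \<tau> \<partial>lborel) = \<infinity>"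
      then show False using norm_total by (simp add: ennreal_mult_top)
    qed
    then show "(\<integral>\<^sup>+\<tau>. gap {} 1 f \<tau> \<partial>lborel) < \<infinity>" by (simp add: less_top)
    show "AE \<tau> in lborel. gap {..<M} 1 f \<tau> \<le> gap {} 1 f \<tau>" for M
      using AE_lborel_singleton[of "0::real^'r"] by eventually_elim (rule gap_estimates)
    show "AE \<tau> in lborel. (\<lambda>M. gap {..<M} 1 f \<tau>) \<longlonglongrightarrow> 0"
      using AE_lborel_singleton[of "0::real^'r"] by eventually_elim (rule gap_estimates)
  qed measurable
  then have "(\<lambda>M. ?k * (\<integral>\<^sup>+\<tau>. gap {..<M} 1 f \<tau> \<partial>lborel)) \<longlonglongrightarrow> ?k * 0"
    by (intro tendsto_mult_ennreal) auto
  moreover have "?k * (\<integral>\<^sup>+\<tau>. gap {..<M} 1 f \<tau> \<partial>lborel)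
      = ennreal ((L2_norm (\<lambda>p. (\<Sum>m<M. schwartz_projection n B \<mu> v m f p) - f p))\<^sup>2)" for M
    using nn_integral_L2[OF projection_defect_bound(1)[of "{..<M}" 1]] gap_estimates(3)
        norm_defect[of "{..<M}" 1] by simp
  ultimately have "(\<lambda>M. (L2_norm (\<lambda>p. (\<Sum>m<M. schwartz_projection n B \<mu> v m f p) - f p))\<^sup>2) \<longlonglongrightarrow> 0"
    by (intro tendsto_ennreal_zero) simp_all
  then show ?thesis by (rule tendsto_zero_power2) simp
qed

end

text \<open>Existence of an extension is what gives the choice operator in
  \<open>spectral_projection\<close> its meaning; any extension has the properties used
  afterwards.\<close>

lemma spectral_projection_extension:
  "bounded_L2_extension (schwartz_projection n B \<mu> v m) (spectral_projection n B \<mu> v m)"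
proof -
  have "\<exists>T. bounded_L2_extension (schwartz_projection n B \<mu> v m) T"
    using L2_extension[of "Collect schwartz" "schwartz_projection n B \<mu> v m" 1]
    unfolding bounded_L2_extension_def
    by (simp add: subset_eq schwartz_L2 schwartz_lincomb schwartz_dense schwartz_projection_L2
        schwartz_projection_lincomb schwartz_projection_bound)
  then show ?thesis unfolding spectral_projection_def by (rule someI_ex)
qed

lemma spectral_projection_L2: "f \<in> L2 \<Longrightarrow> spectral_projection n B \<mu> v m f \<in> L2"
  using spectral_projection_extension unfolding bounded_L2_extension_def by blast

lemma spectral_expansion_converges:
  assumes "f \<in> L2"
  shows "(\<lambda>M. L2_norm (\<lambda>p. (\<Sum>m<M. spectral_projection n B \<mu> v m f p) - f p)) \<longlonglongrightarrow> 0"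
proof (rule L2_partial_sums_converge[where S="Collect schwartz"])
  note ext = spectral_projection_extension[unfolded bounded_L2_extension_def]
  show "Collect schwartz \<subseteq> (L2 :: ((real^'d) \<times> (real^'r) \<Rightarrow> complex) set)"
      by (auto intro: schwartz_L2)
  show "\<exists>g\<in>Collect schwartz. L2_norm (\<lambda>x. f x - g x) < e" if "f \<in> L2" "e > 0"
      for f :: "(real^'d) \<times> (real^'r) \<Rightarrow> complex" and e
    using schwartz_dense[OF that] by blast
  show "AE x in lebesgue. spectral_projection n B \<mu> v m (\<lambda>x. a * f x + b * g x) x
      = a * spectral_projection n B \<mu> v m f x + b * spectral_projection n B \<mu> v m g x"
    if "f \<in> L2" "g \<in> L2" for m f g a b using ext that by blast
  show "\<exists>C. \<forall>f\<in>L2. L2_norm (spectral_projection n B \<mu> v m f) \<le> C * L2_norm f" for m using ext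
      by blast
  fix f :: "(real^'d) \<times> (real^'r) \<Rightarrow> complex" assume "f \<in> Collect schwartz"
  then have f: "schwartz f" by simp
  \<comment> \<open>Countably many null sets are merged, so that the two operators can be exchanged
    in all partial sums at once.\<close>
  have "AE p in lebesgue. \<forall>m. spectral_projection n B \<mu> v m f p = schwartz_projection n B \<mu> v m f p"
    using ext f by (simp add: AE_all_countable)
  note ae = this
  have sL2: "(\<lambda>p. \<Sum>m<M. spectral_projection n B \<mu> v m f p) \<in> L2" for M
    by (intro L2_sum spectral_projection_L2 schwartz_L2[OF f]) simp
  have pL2: "(\<lambda>p. \<Sum>m<M. schwartz_projection n B \<mu> v m f p) \<in> L2" for M
    by (intro L2_sum schwartz_projection_L2 f) simp
  have "L2_norm (\<lambda>p. \<Sum>m<M. spectral_projection n B \<mu> v m f p)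
      = L2_norm (\<lambda>p. \<Sum>m<M. schwartz_projection n B \<mu> v m f p)" for M
    by (intro L2_AE_eq(2) pL2 L2_measurable sL2) (use ae in \<open>auto elim: eventually_mono\<close>)
  then show "L2_norm (\<lambda>p. \<Sum>m<M. spectral_projection n B \<mu> v m f p) \<le> L2_norm f" for M
    using partial_sum_bound[OF f] by simp
  have "L2_norm (\<lambda>p. (\<Sum>m<M. spectral_projection n B \<mu> v m f p) - f p)
      = L2_norm (\<lambda>p. (\<Sum>m<M. schwartz_projection n B \<mu> v m f p) - f p)" for M
    by (intro L2_AE_eq(2) L2_diff(1) L2_measurable pL2 sL2 schwartz_L2[OF f])
        (use ae in \<open>auto elim: eventually_mono\<close>)
  then show "(\<lambda>M. L2_norm (\<lambda>p. (\<Sum>m<M. spectral_projection n B \<mu> v m f p) - f p)) \<longlonglongrightarrow> 0"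
    using partial_sum_converges[OF f] by simp
qed (auto intro: spectral_projection_L2 assms)

end

theorem corollary1p1:
  fixes n :: nat
    and B :: "real^'d \<Rightarrow> real^'d \<Rightarrow> real^'r"
    and \<mu> :: "real^'r \<Rightarrow> nat \<Rightarrow> real"
    and v :: "real^'r \<Rightarrow> nat \<Rightarrow> real^'d"
    and \<phi> :: "(real^'d) \<times> (real^'r) \<Rightarrow> complex"
  assumes "n \<ge> 1" and "CARD('d) = 2 * n"
    and "skew_bilinear B" and "nondegenerate B"
    and "spectral_frame n B \<mu> v"
    and "\<phi> \<in> L2"
  shows "L2_tendsto (\<lambda>M g. \<Sum>m<M. spectral_projection n B \<mu> v m \<phi> g) \<phi>"
proof -
  interpret step_two n B \<mu> v by unfold_locales fact+
  show ?thesis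
    unfolding L2_tendsto_def
    using spectral_expansion_converges[OF \<open>\<phi> \<in> L2\<close>] \<open>\<phi> \<in> L2\<close>
        by (auto intro!: L2_sum spectral_projection_L2)
qed

end
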